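(* Let $\mathcal{E}$ be a locally presentable and locally cartesian closed category equipped with a functorial cylinder $I\otimes(-)$ with contractions and connections such that $I\otimes(-)$ has a right adjoint. Let $(\mathsf{C},\mathsf{F_t})$ be a suitable algebraic weak factorization system on $\mathcal{E}$, cofibrantly generated by a small category of maps $u\colon\mathcal{I}\to\mathcal{E}^\to$. Let $\mathcal{I}_\otimes=\mathcal{I}+\mathcal{I}$ with functor $u_\otimes\colon\mathcal{I}_\otimes\to\mathcal{E}^\to$ given by $i\mapsto\delta^0\hat\otimes u_i$ on the first summand and $i\mapsto\delta^1\hat\otimes u_i$ on the second, and let $\mathsf{Fib}=(\mathcal{I}_\otimes)^{\pitchfork}$ be the category of uniform fibrations. Then there are lifts of pushforward functors as follows. (i) For every uniform fibration $p\colon X\to Y$, the functor $p_*\colon\mathcal{E}_{/X}^\to\to\mathcal{E}_{/Y}^\to$ induced by pushforward along $p$ lifts along the forgetful functors to a functor $\widetilde{p_*}\colon\mathsf{Fib}_{/X}\to\mathsf{Fib}_{/Y}$. (ii) For every morphism of uniform fibrations $(s,t)\colon p\to q$, where $p\colon X\to Y$, $q\colon U\to V$, $s\colon X\to U$ and $t\colon Y\to V$, the canonical natural transformation $\psi\colon t^*q_*\to p_*s^*$ lifts to a natural transformation $\widetilde\psi\colon\widetilde{t^*}\circ\widetilde{q_*}\to\widetilde{p_*}\circ\widetilde{s^*}$ of functors $\mathsf{Fib}_{/U}\to\mathsf{Fib}_{/Y}$ (where $\widetilde{p_*},\widetilde{q_*}$ are the lifts of (i)). If $(s,t)\colon p\to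 q$ is a pullback square, then $\widetilde\psi$ is a natural isomorphism.
   Context: A functorial cylinder on $\mathcal{E}$ is an endofunctor $I\otimes(-)$ with natural transformations $\delta^0\otimes(-),\delta^1\otimes(-)\colon \mathrm{Id}\to I\otimes(-)$. It has contractions if there is a natural transformation $\varepsilon\otimes(-)\colon I\otimes(-)\to\mathrm{Id}$ with $(\varepsilon\otimes X)\circ(\delta^k\otimes X)=\mathrm{id}_X$ for $k=0,1$. It then has connections if for $k\in\{0,1\}$ there is a natural $c^k\otimes(-)\colon I\otimes I\otimes(-)\to I\otimes(-)$ such that $(c^k\otimes X)\circ(\delta^k\otimes I\otimes X)=(\delta^k\otimes X)\circ(\varepsilon\otimes X)=(c^k\otimes X)\circ(I\otimes\delta^k\otimes X)$ and $(c^k\otimes X)\circ(\delta^{1-k}\otimes I\otimes X)=\mathrm{id}_{I\otimes X}=(c^k\otimes X)\circ(I\otimes\delta^{1-k}\otimes X)$; here $\delta^k\otimes I\otimes X$ is the component at $I\otimes X$, and $I\otimes\delta^k\otimes X$ is $I\otimes(-)$ applied to the component at $X$. For $i\colon A\to B$ the Leibniz product $\delta^k\hat\otimes i\colon (I\otimes A)+_A B\to I\otimes B$ is the map out of the pushout of $\delta^k\otimes A$ and $i$ induced by $I\otimes i$ and $\delta^k\otimes B$; this is a functor $\mathcal{E}^\to\to\mathcal{E}^\to$. For $u\colon\mathcal{I}\to\mathcal{E}^\to$ with values $u_i\colon A_i\to B_i$, a right $\mathcal{I}$-map is a map $f\colon X\to Y$ with a function $\phi$ assigning to each $i$ and square $(s,t)\colon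 u_i\to f$ a diagonal filler $\phi(i,s,t)\colon B_i\to X$, such that for $\sigma\colon i\to j$ with $u_\sigma=(a,b)$ and $(s,t)\colon u_j\to f$ one has $\phi(j,s,t)\circ b=\phi(i,s\circ a,t\circ b)$; morphisms are squares commuting with fillers. $\mathcal{I}^{\pitchfork}$ is the category of right $\mathcal{I}$-maps over $\mathcal{E}^\to$, and ${}^{\pitchfork}\mathcal{I}$ the dually defined category of left $\mathcal{I}$-maps. An algebraic weak factorization system (awfs) $(\mathsf{L},\mathsf{R})$ is a functorial factorization $f=\mathsf{R}f\circ\mathsf{L}f$ together with a comultiplication $\mathsf{L}\to\mathsf{L}\mathsf{L}$ and a multiplication $\mathsf{R}\mathsf{R}\to\mathsf{R}$ making the copointed endofunctor $\mathsf{L}$ of $\mathcal{E}^\to$ a comonad and the pointed endofunctor $\mathsf{R}$ of $\mathcal{E}^\to$ a monad, such that the canonical $\mathsf{L}\mathsf{R}\to\mathsf{R}\mathsf{L}$ is a distributive law. $\mathsf{L}\text{-}\mathsf{map}$ is the category of coalgebras for the copointed endofunctor $\mathsf{L}$ and $\mathsf{R}\text{-}\mathsf{Map}$ the category of algebras for the monad $\mathsf{R}$; one has $\mathsf{L}\text{-}\mathsf{map}={}^{\pitchfork}(\mathsf{R}\text{-}\mathsf{Map})$. The awfs is cofibrantly generated by $u\colon\mathcal{I}\to\mathcal{E}^\to$, with $\mathcal{I}$ small, if $\mathsf{R}\text{-}\mathsf{Map}\cong\mathcal{I}^{\pitchfork}$ over $\mathcal{E}^\to$. For an awfs $(\mathsf{C},\mathsf{F_t})$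 put $\mathsf{Cof}=\mathsf{C}\text{-}\mathsf{map}$. It is suitable if: (S1) it is cofibrantly generated; (S2) the functor $\mathcal{E}\to\mathcal{E}^\to$, $X\mapsto(0\to X)$, factors through $\mathsf{Cof}\to\mathcal{E}^\to$; (S3) the pullback functor $P\colon\mathcal{E}^\to\times_{\mathcal{E}}\mathcal{E}^\to\to\mathcal{E}^\to$, $(g,h)\mapsto h^*(g)$, on pairs with common codomain lifts to a functor $\mathsf{Cof}\times_{\mathcal{E}}\mathcal{E}^\to\to\mathsf{Cof}$; (S4) for $k\in\{0,1\}$ the functor $\delta^k\hat\otimes(-)$ lifts to a functor $\mathsf{Cof}\to\mathsf{Cof}$. Slices and pushforward: $\mathcal{E}_{/X}^\to$ is the arrow category of the slice $\mathcal{E}_{/X}$. For a category $\mathcal{J}$ over $\mathcal{E}^\to$, $\mathcal{J}_{/X}$ has as objects $j\in\mathcal{J}$ together with maps making the underlying arrow of $j$ an arrow of $\mathcal{E}_{/X}$; it has a forgetful functor to $\mathcal{E}_{/X}^\to$. For $f\colon X\to Y$, $f_!\dashv f^*\dashv f_*$ denote composition, pullback and pushforward between $\mathcal{E}_{/X}$ and $\mathcal{E}_{/Y}$, applied also to arrows. The pullback functor $f^*$ lifts canonically to $\widetilde{f^*}\colon\mathsf{Fib}_{/Y}\to\mathsf{Fib}_{/X}$ (fillers for $f^*g$ over $X$ are transposes, under $f_!\dashv f^*$, of the chosen fillers for $g$). For a square with $q\circ s=t\circ p$, $\psi\colon t^*q_*\to p_*s^*$ is the mate of the canonical natural transformation $s_!p^*\to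 q^*t_!$. *)

theory Defs
  imports "HOL-Library.FuncSet"
begin

unbundle cardinal_syntax

section \<open>Categories, functors, natural transformations\<close>

record ('o, 'm) cat =
  Obj :: "'o set"
  Arr :: "'m set"
  Dom :: "'m \<Rightarrow> 'o"
  Cod :: "'m \<Rightarrow> 'o"
  Id :: "'o \<Rightarrow> 'm"
  Cmp :: "'m \<Rightarrow> 'm \<Rightarrow> 'm" (infixr "\<cdot>\<index>" 70)

definition hom :: "('o, 'm) cat \<Rightarrow> 'o \<Rightarrow> 'o \<Rightarrow> 'm set" where
  "hom C a b = {f \<in> Arr C. Dom C f = a \<and> Cod C f = b}"

locale category =
  fixes C :: "('o, 'm) cat" (structure)
  assumes dom_obj: "f \<in> Arr C \<Longrightarrow> Dom C f \<in> Obj C"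
    and cod_obj: "f \<in> Arr C \<Longrightarrow> Cod C f \<in> Obj C"
    and id_hom: "a \<in> Obj C \<Longrightarrow> Id C a \<in> hom C a a"
    and cmp_hom: "f \<in> hom C a b \<Longrightarrow> g \<in> hom C b c \<Longrightarrow> g \<cdot> f \<in> hom C a c"
    and id_left: "f \<in> hom C a b \<Longrightarrow> Id C b \<cdot> f = f"
    and id_right: "f \<in> hom C a b \<Longrightarrow> f \<cdot> Id C a = f"
    and assoc: "f \<in> hom C a b \<Longrightarrow> g \<in> hom C b c \<Longrightarrow> h \<in> hom C c d \<Longrightarrow> (h \<cdot> g) \<cdot> f = h \<cdot> (g \<cdot> f)"

definition is_iso :: "('o, 'm) cat \<Rightarrow> 'm \<Rightarrow> bool" where
  "is_iso C f \<longleftrightarrow> f \<in> Arr C \<and>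
     (\<exists>g \<in> hom C (Cod C f) (Dom C f). g \<cdot>\<^bsub>C\<^esub> f = Id C (Dom C f) \<and> f \<cdot>\<^bsub>C\<^esub> g = Id C (Cod C f))"

record ('o1, 'm1, 'o2, 'm2) func =
  fob :: "'o1 \<Rightarrow> 'o2"
  far :: "'m1 \<Rightarrow> 'm2"

definition is_functor :: "('o1, 'm1) cat \<Rightarrow> ('o2, 'm2) cat \<Rightarrow> ('o1, 'm1, 'o2, 'm2) func \<Rightarrow> bool" where
  "is_functor A B F \<longleftrightarrow>
     (\<forall>a \<in> Obj A. fob F a \<in> Obj B) \<and>
     (\<forall>f \<in> Arr A. far F f \<in> hom B (fob F (Dom A f)) (fob F (Cod A f))) \<and>
     (\<forall>a \<in> Obj A. far F (Id A a) = Id B (fob F a)) \<and>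
     (\<forall>f \<in> Arr A. \<forall>g \<in> Arr A. Dom A g = Cod A f \<longrightarrow> far F (g \<cdot>\<^bsub>A\<^esub> f) = far F g \<cdot>\<^bsub>B\<^esub> far F f)"

definition id_func :: "('o, 'm, 'o, 'm) func" where
  "id_func = \<lparr>fob = (\<lambda>a. a), far = (\<lambda>f. f)\<rparr>"

definition comp_func ::
  "('o2, 'm2, 'o3, 'm3) func \<Rightarrow> ('o1, 'm1, 'o2, 'm2) func \<Rightarrow> ('o1, 'm1, 'o3, 'm3) func"
  (infixr "\<circ>\<^sub>F" 55) where
  "G \<circ>\<^sub>F F = \<lparr>fob = (\<lambda>a. fob G (fob F a)), far = (\<lambda>f. far G (far F f))\<rparr>"

definition nat_trans :: "('o1, 'm1) cat \<Rightarrow> ('o2, 'm2) cat \<Rightarrow> ('o1, 'm1, 'o2, 'm2) func \<Rightarrow>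
    ('o1, 'm1, 'o2, 'm2) func \<Rightarrow> ('o1 \<Rightarrow> 'm2) \<Rightarrow> bool" where
  "nat_trans A B F G \<tau> \<longleftrightarrow>
     (\<forall>a \<in> Obj A. \<tau> a \<in> hom B (fob F a) (fob G a)) \<and>
     (\<forall>f \<in> Arr A. \<tau> (Cod A f) \<cdot>\<^bsub>B\<^esub> far F f = far G f \<cdot>\<^bsub>B\<^esub> \<tau> (Dom A f))"

definition nat_iso :: "('o1, 'm1) cat \<Rightarrow> ('o2, 'm2) cat \<Rightarrow> ('o1, 'm1, 'o2, 'm2) func \<Rightarrow>
    ('o1, 'm1, 'o2, 'm2) func \<Rightarrow> ('o1 \<Rightarrow> 'm2) \<Rightarrow> bool" where
  "nat_iso A B F G \<tau> \<longleftrightarrow> nat_trans A B F G \<tau> \<and> (\<forall>a \<in> Obj A. is_iso B (\<tau> a))"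

definition eq_func :: "('o1, 'm1) cat \<Rightarrow> ('o1, 'm1, 'o2, 'm2) func \<Rightarrow> ('o1, 'm1, 'o2, 'm2) func \<Rightarrow> bool" where
  "eq_func A F G \<longleftrightarrow> (\<forall>a \<in> Obj A. fob F a = fob G a) \<and> (\<forall>f \<in> Arr A. far F f = far G f)"

text \<open>\<open>F'\<close> from \<open>A'\<close> to \<open>B'\<close> lifts \<open>F\<close> from \<open>A\<close> to \<open>B\<close> along \<open>U\<close> from \<open>A'\<close> to \<open>A\<close> and
  \<open>V\<close> from \<open>B'\<close> to \<open>B\<close>. The square commutes strictly, and only on the carriers of \<open>A'\<close>.\<close>

definition lifts_functor :: "('o3, 'm3) cat \<Rightarrow> ('o4, 'm4) cat \<Rightarrow> ('o3, 'm3, 'o1, 'm1) func \<Rightarrow>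
    ('o4, 'm4, 'o2, 'm2) func \<Rightarrow> ('o1, 'm1, 'o2, 'm2) func \<Rightarrow> ('o3, 'm3, 'o4, 'm4) func \<Rightarrow> bool" where
  "lifts_functor A' B' U V F F' \<longleftrightarrow> is_functor A' B' F' \<and> eq_func A' (V \<circ>\<^sub>F F') (F \<circ>\<^sub>F U)"

definition iso_over :: "('o1, 'm1) cat \<Rightarrow> ('o2, 'm2) cat \<Rightarrow> ('o1, 'm1, 'o3, 'm3) func \<Rightarrow>
    ('o2, 'm2, 'o3, 'm3) func \<Rightarrow> bool" where
  "iso_over A B U V \<longleftrightarrow> (\<exists>F G. is_functor A B F \<and> is_functor B A G \<and>
     eq_func A (G \<circ>\<^sub>F F) id_func \<and> eq_func B (F \<circ>\<^sub>F G) id_func \<and> eq_func A (V \<circ>\<^sub>F F) U)"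

definition sum_cat :: "('o1, 'm1) cat \<Rightarrow> ('o2, 'm2) cat \<Rightarrow> ('o1 + 'o2, 'm1 + 'm2) cat" where
  "sum_cat A B =
     \<lparr>Obj = Obj A <+> Obj B, Arr = Arr A <+> Arr B,
      Dom = map_sum (Dom A) (Dom B), Cod = map_sum (Cod A) (Cod B),
      Id = map_sum (Id A) (Id B),
      Cmp = (\<lambda>g f. case (g, f) of
               (Inl g, Inl f) \<Rightarrow> Inl (g \<cdot>\<^bsub>A\<^esub> f)
             | (Inr g, Inr f) \<Rightarrow> Inr (g \<cdot>\<^bsub>B\<^esub> f)
             | _ \<Rightarrow> undefined)\<rparr>"

definition case_func :: "('o1, 'm1, 'o3, 'm3) func \<Rightarrow> ('o2, 'm2, 'o3, 'm3) func \<Rightarrow>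
    ('o1 + 'o2, 'm1 + 'm2, 'o3, 'm3) func" where
  "case_func F G = \<lparr>fob = case_sum (fob F) (fob G), far = case_sum (far F) (far G)\<rparr>"

definition fibre_prod :: "('o1, 'm1) cat \<Rightarrow> ('o2, 'm2) cat \<Rightarrow> ('o1, 'm1, 'o3, 'm3) func \<Rightarrow>
    ('o2, 'm2, 'o3, 'm3) func \<Rightarrow> ('o1 \<times> 'o2, 'm1 \<times> 'm2) cat" where
  "fibre_prod A B F G =
     \<lparr>Obj = {(a, b). a \<in> Obj A \<and> b \<in> Obj B \<and> fob F a = fob G b},
      Arr = {(f, g). f \<in> Arr A \<and> g \<in> Arr B \<and> far F f = far G g},
      Dom = map_prod (Dom A) (Dom B), Cod = map_prod (Cod A) (Cod B),
      Id = map_prod (Id A) (Id B),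
      Cmp = (\<lambda>(g, g') (f, f'). (g \<cdot>\<^bsub>A\<^esub> f, g' \<cdot>\<^bsub>B\<^esub> f'))\<rparr>"

definition fst_func :: "('o1 \<times> 'o2, 'm1 \<times> 'm2, 'o1, 'm1) func" where
  "fst_func = \<lparr>fob = fst, far = fst\<rparr>"

definition snd_func :: "('o1 \<times> 'o2, 'm1 \<times> 'm2, 'o2, 'm2) func" where
  "snd_func = \<lparr>fob = snd, far = snd\<rparr>"

definition prod_func :: "('o1, 'm1, 'o2, 'm2) func \<Rightarrow> ('o3, 'm3, 'o4, 'm4) func \<Rightarrow>
    ('o1 \<times> 'o3, 'm1 \<times> 'm3, 'o2 \<times> 'o4, 'm2 \<times> 'm4) func" where
  "prod_func F G = \<lparr>fob = map_prod (fob F) (fob G), far = map_prod (far F) (far G)\<rparr>"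


section \<open>Adjunctions and mates\<close>

record ('o1, 'm1, 'o2, 'm2) adj =
  ladj :: "('o1, 'm1, 'o2, 'm2) func"
  radj :: "('o2, 'm2, 'o1, 'm1) func"
  unit :: "'o1 \<Rightarrow> 'm1"
  counit :: "'o2 \<Rightarrow> 'm2"

definition adjunction :: "('o1, 'm1) cat \<Rightarrow> ('o2, 'm2) cat \<Rightarrow> ('o1, 'm1, 'o2, 'm2) adj \<Rightarrow> bool" where
  "adjunction A B \<Lambda> \<longleftrightarrow>
     is_functor A B (ladj \<Lambda>) \<and> is_functor B A (radj \<Lambda>) \<and>
     nat_trans A A id_func (radj \<Lambda> \<circ>\<^sub>F ladj \<Lambda>) (unit \<Lambda>) \<and>
     nat_trans B B (ladj \<Lambda> \<circ>\<^sub>F radj \<Lambda>) id_func (counit \<Lambda>) \<and>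
     (\<forall>a \<in> Obj A. counit \<Lambda> (fob (ladj \<Lambda>) a) \<cdot>\<^bsub>B\<^esub> far (ladj \<Lambda>) (unit \<Lambda> a) = Id B (fob (ladj \<Lambda>) a)) \<and>
     (\<forall>b \<in> Obj B. far (radj \<Lambda>) (counit \<Lambda> b) \<cdot>\<^bsub>A\<^esub> unit \<Lambda> (fob (radj \<Lambda>) b) = Id A (fob (radj \<Lambda>) b))"

text \<open>The transpose \<open>L a \<rightarrow> b\<close> of \<open>h : a \<rightarrow> R b\<close>, and the transpose \<open>a \<rightarrow> R b\<close> of \<open>k : L a \<rightarrow> b\<close>.\<close>

definition ltranspose :: "('o2, 'm2) cat \<Rightarrow> ('o1, 'm1, 'o2, 'm2) adj \<Rightarrow> 'o2 \<Rightarrow> 'm1 \<Rightarrow> 'm2" where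
  "ltranspose B \<Lambda> b h = counit \<Lambda> b \<cdot>\<^bsub>B\<^esub> far (ladj \<Lambda>) h"

definition rtranspose :: "('o1, 'm1) cat \<Rightarrow> ('o1, 'm1, 'o2, 'm2) adj \<Rightarrow> 'o1 \<Rightarrow> 'm2 \<Rightarrow> 'm1" where
  "rtranspose A \<Lambda> a k = far (radj \<Lambda>) k \<cdot>\<^bsub>A\<^esub> unit \<Lambda> a"

text \<open>The composite of an adjunction \<open>\<Lambda>\<close> between \<open>A\<close> and some \<open>B\<close> with an adjunction \<open>\<Lambda>'\<close>
  between \<open>B\<close> and \<open>D\<close>.\<close>

definition comp_adj :: "('o1, 'm1) cat \<Rightarrow> ('o3, 'm3) cat \<Rightarrow> ('o1, 'm1, 'o2, 'm2) adj \<Rightarrow>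
    ('o2, 'm2, 'o3, 'm3) adj \<Rightarrow> ('o1, 'm1, 'o3, 'm3) adj" where
  "comp_adj A D \<Lambda> \<Lambda>' =
     \<lparr>ladj = ladj \<Lambda>' \<circ>\<^sub>F ladj \<Lambda>, radj = radj \<Lambda> \<circ>\<^sub>F radj \<Lambda>',
      unit = (\<lambda>a. far (radj \<Lambda>) (unit \<Lambda>' (fob (ladj \<Lambda>) a)) \<cdot>\<^bsub>A\<^esub> unit \<Lambda> a),
      counit = (\<lambda>d. counit \<Lambda>' d \<cdot>\<^bsub>D\<^esub> far (ladj \<Lambda>') (counit \<Lambda> (fob (radj \<Lambda>') d)))\<rparr>"

text \<open>The mate \<open>R\<^sub>2 \<rightarrow> R\<^sub>1\<close> of a natural transformation \<open>\<tau> : L\<^sub>1 \<rightarrow> L\<^sub>2\<close>, where \<open>\<Lambda>\<^sub>i\<close> is the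
  adjunction of \<open>L\<^sub>i : A \<rightarrow> B\<close> and \<open>R\<^sub>i\<close>.\<close>

definition mate :: "('o1, 'm1) cat \<Rightarrow> ('o1, 'm1, 'o2, 'm2) adj \<Rightarrow> ('o1, 'm1, 'o2, 'm2) adj \<Rightarrow>
    ('o1 \<Rightarrow> 'm2) \<Rightarrow> 'o2 \<Rightarrow> 'm1" where
  "mate A \<Lambda>\<^sub>1 \<Lambda>\<^sub>2 \<tau> b =
     far (radj \<Lambda>\<^sub>1) (counit \<Lambda>\<^sub>2 b) \<cdot>\<^bsub>A\<^esub>
       (far (radj \<Lambda>\<^sub>1) (\<tau> (fob (radj \<Lambda>\<^sub>2) b)) \<cdot>\<^bsub>A\<^esub> unit \<Lambda>\<^sub>1 (fob (radj \<Lambda>\<^sub>2) b))"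


section \<open>Arrow categories and slices\<close>

text \<open>The morphism \<open>(a, b)\<close> from \<open>f\<close> to \<open>g\<close> of the arrow category is \<open>(f, a, b, g)\<close>.\<close>

type_synonym 'm sq = "'m \<times> 'm \<times> 'm \<times> 'm"

definition top_of :: "'m sq \<Rightarrow> 'm" where
  "top_of = (\<lambda>(f, a, b, g). a)"

definition bot_of :: "'m sq \<Rightarrow> 'm" where
  "bot_of = (\<lambda>(f, a, b, g). b)"

definition arrow_cat :: "('o, 'm) cat \<Rightarrow> ('m, 'm sq) cat" where
  "arrow_cat C =
     \<lparr>Obj = Arr C,
      Arr = {(f, a, b, g). f \<in> Arr C \<and> g \<in> Arr C \<and> a \<in> hom C (Dom C f) (Dom C g) \<and>
               b \<in> hom C (Cod C f) (Cod C g) \<and> g \<cdot>\<^bsub>C\<^esub> a = b \<cdot>\<^bsub>C\<^esub> f},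
      Dom = (\<lambda>(f, a, b, g). f), Cod = (\<lambda>(f, a, b, g). g),
      Id = (\<lambda>f. (f, Id C (Dom C f), Id C (Cod C f), f)),
      Cmp = (\<lambda>(g, a', b', h) (f, a, b, g'). (f, a' \<cdot>\<^bsub>C\<^esub> a, b' \<cdot>\<^bsub>C\<^esub> b, h))\<rparr>"

definition arrow_func :: "('o1, 'm1, 'o2, 'm2) func \<Rightarrow> ('m1, 'm1 sq, 'm2, 'm2 sq) func" where
  "arrow_func F = \<lparr>fob = far F, far = (\<lambda>(f, a, b, g). (far F f, far F a, far F b, far F g))\<rparr>"

definition arrow_nat :: "('o1, 'm1) cat \<Rightarrow> ('o1, 'm1, 'o2, 'm2) func \<Rightarrow>
    ('o1, 'm1, 'o2, 'm2) func \<Rightarrow> ('o1 \<Rightarrow> 'm2) \<Rightarrow> 'm1 \<Rightarrow> 'm2 sq" where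
  "arrow_nat A F G \<tau> f = (far F f, \<tau> (Dom A f), \<tau> (Cod A f), far G f)"

definition dom_func :: "('o, 'm) cat \<Rightarrow> ('m, 'm sq, 'o, 'm) func" where
  "dom_func C = \<lparr>fob = Dom C, far = top_of\<rparr>"

definition cod_func :: "('o, 'm) cat \<Rightarrow> ('m, 'm sq, 'o, 'm) func" where
  "cod_func C = \<lparr>fob = Cod C, far = bot_of\<rparr>"

text \<open>The morphism \<open>h\<close> from \<open>f\<close> to \<open>g\<close> of a slice is \<open>(f, h, g)\<close>.\<close>

definition slice :: "('o, 'm) cat \<Rightarrow> 'o \<Rightarrow> ('m, 'm \<times> 'm \<times> 'm) cat" where
  "slice C X =
     \<lparr>Obj = {f \<in> Arr C. Cod C f = X},
      Arr = {(f, h, g). f \<in> Arr C \<and> Cod C f = X \<and> g \<in> Arr C \<and> Cod C g = X \<and>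
               h \<in> hom C (Dom C f) (Dom C g) \<and> g \<cdot>\<^bsub>C\<^esub> h = f},
      Dom = (\<lambda>(f, h, g). f), Cod = (\<lambda>(f, h, g). g),
      Id = (\<lambda>f. (f, Id C (Dom C f), f)),
      Cmp = (\<lambda>(g, k, h) (f, l, g'). (f, k \<cdot>\<^bsub>C\<^esub> l, h))\<rparr>"

definition slice_forget :: "('o, 'm) cat \<Rightarrow> ('m, 'm \<times> 'm \<times> 'm, 'o, 'm) func" where
  "slice_forget C = \<lparr>fob = Dom C, far = (\<lambda>(f, h, g). h)\<rparr>"

text \<open>For \<open>U\<close> from \<open>J\<close> to the arrow category: objects of \<open>J\<close> whose underlying arrow is equipped
  with the structure of an arrow of the slice over \<open>X\<close>, and morphisms of \<open>J\<close> over \<open>X\<close>. The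
  forgetful functor to the arrow category of the slice is \<open>snd_func\<close>.\<close>

definition over_slice :: "('o, 'm) cat \<Rightarrow> ('j, 'k) cat \<Rightarrow> ('j, 'k, 'm, 'm sq) func \<Rightarrow> 'o \<Rightarrow>
    ('j \<times> ('m \<times> 'm \<times> 'm), 'k \<times> ('m \<times> 'm \<times> 'm) sq) cat" where
  "over_slice C J U X =
     fibre_prod J (arrow_cat (slice C X)) U (arrow_func (slice_forget C))"


section \<open>Limits and colimits\<close>

definition initial :: "('o, 'm) cat \<Rightarrow> 'o \<Rightarrow> bool" where
  "initial C z \<longleftrightarrow> z \<in> Obj C \<and> (\<forall>x \<in> Obj C. \<exists>!h. h \<in> hom C z x)"

definition terminal :: "('o, 'm) cat \<Rightarrow> 'o \<Rightarrow> bool" where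
  "terminal C z \<longleftrightarrow> z \<in> Obj C \<and> (\<forall>x \<in> Obj C. \<exists>!h. h \<in> hom C x z)"

definition init_func :: "('o, 'm) cat \<Rightarrow> ('o, 'm, 'm, 'm sq) func" where
  "init_func C = (let z = (SOME z. initial C z); i = (\<lambda>x. THE h. h \<in> hom C z x) in
     \<lparr>fob = i, far = (\<lambda>f. (i (Dom C f), Id C z, f, i (Cod C f)))\<rparr>)"

definition is_pullback :: "('o, 'm) cat \<Rightarrow> 'm \<Rightarrow> 'm \<Rightarrow> 'm \<Rightarrow> 'm \<Rightarrow> bool" where
  "is_pullback C f g p q \<longleftrightarrow>
     f \<in> Arr C \<and> g \<in> Arr C \<and> p \<in> Arr C \<and> q \<in> Arr C \<and>
     Cod C f = Cod C g \<and> Dom C p = Dom C q \<and> Cod C p = Dom C f \<and> Cod C q = Dom C g \<and>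
     f \<cdot>\<^bsub>C\<^esub> p = g \<cdot>\<^bsub>C\<^esub> q \<and>
     (\<forall>x \<in> Obj C. \<forall>a \<in> hom C x (Dom C f). \<forall>b \<in> hom C x (Dom C g). f \<cdot>\<^bsub>C\<^esub> a = g \<cdot>\<^bsub>C\<^esub> b \<longrightarrow>
        (\<exists>!h. h \<in> hom C x (Dom C p) \<and> p \<cdot>\<^bsub>C\<^esub> h = a \<and> q \<cdot>\<^bsub>C\<^esub> h = b))"

definition is_pushout :: "('o, 'm) cat \<Rightarrow> 'm \<Rightarrow> 'm \<Rightarrow> 'm \<Rightarrow> 'm \<Rightarrow> bool" where
  "is_pushout C f g p q \<longleftrightarrow>
     f \<in> Arr C \<and> g \<in> Arr C \<and> p \<in> Arr C \<and> q \<in> Arr C \<and>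
     Dom C f = Dom C g \<and> Cod C p = Cod C q \<and> Dom C p = Cod C f \<and> Dom C q = Cod C g \<and>
     p \<cdot>\<^bsub>C\<^esub> f = q \<cdot>\<^bsub>C\<^esub> g \<and>
     (\<forall>x \<in> Obj C. \<forall>a \<in> hom C (Cod C f) x. \<forall>b \<in> hom C (Cod C g) x. a \<cdot>\<^bsub>C\<^esub> f = b \<cdot>\<^bsub>C\<^esub> g \<longrightarrow>
        (\<exists>!h. h \<in> hom C (Cod C p) x \<and> h \<cdot>\<^bsub>C\<^esub> p = a \<and> h \<cdot>\<^bsub>C\<^esub> q = b))"

text \<open>Pullbacks and pushouts are fixed by Hilbert choice; the following are meaningful only where
  they exist. All functors involving pullbacks are built from this one choice.\<close>

definition pb :: "('o, 'm) cat \<Rightarrow> 'm \<Rightarrow> 'm \<Rightarrow> 'm \<times> 'm" where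
  "pb C f g = (SOME pq. is_pullback C f g (fst pq) (snd pq))"

abbreviation pb1 :: "('o, 'm) cat \<Rightarrow> 'm \<Rightarrow> 'm \<Rightarrow> 'm" where
  "pb1 C f g \<equiv> fst (pb C f g)"

abbreviation pb2 :: "('o, 'm) cat \<Rightarrow> 'm \<Rightarrow> 'm \<Rightarrow> 'm" where
  "pb2 C f g \<equiv> snd (pb C f g)"

definition pb_pair :: "('o, 'm) cat \<Rightarrow> 'm \<Rightarrow> 'm \<Rightarrow> 'm \<Rightarrow> 'm \<Rightarrow> 'm" where
  "pb_pair C f g a b = (THE h. h \<in> hom C (Dom C a) (Dom C (pb1 C f g)) \<and>
     pb1 C f g \<cdot>\<^bsub>C\<^esub> h = a \<and> pb2 C f g \<cdot>\<^bsub>C\<^esub> h = b)"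

definition po :: "('o, 'm) cat \<Rightarrow> 'm \<Rightarrow> 'm \<Rightarrow> 'm \<times> 'm" where
  "po C f g = (SOME pq. is_pushout C f g (fst pq) (snd pq))"

abbreviation po1 :: "('o, 'm) cat \<Rightarrow> 'm \<Rightarrow> 'm \<Rightarrow> 'm" where
  "po1 C f g \<equiv> fst (po C f g)"

abbreviation po2 :: "('o, 'm) cat \<Rightarrow> 'm \<Rightarrow> 'm \<Rightarrow> 'm" where
  "po2 C f g \<equiv> snd (po C f g)"

definition po_copair :: "('o, 'm) cat \<Rightarrow> 'm \<Rightarrow> 'm \<Rightarrow> 'm \<Rightarrow> 'm \<Rightarrow> 'm" where
  "po_copair C f g a b = (THE h. h \<in> hom C (Cod C (po1 C f g)) (Cod C a) \<and>
     h \<cdot>\<^bsub>C\<^esub> po1 C f g = a \<and> h \<cdot>\<^bsub>C\<^esub> po2 C f g = b)"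

definition cocone :: "('j, 'k) cat \<Rightarrow> ('o, 'm) cat \<Rightarrow> ('j, 'k, 'o, 'm) func \<Rightarrow> 'o \<Rightarrow> ('j \<Rightarrow> 'm) \<Rightarrow> bool" where
  "cocone J C D c \<tau> \<longleftrightarrow> c \<in> Obj C \<and> (\<forall>j \<in> Obj J. \<tau> j \<in> hom C (fob D j) c) \<and>
     (\<forall>m \<in> Arr J. \<tau> (Cod J m) \<cdot>\<^bsub>C\<^esub> far D m = \<tau> (Dom J m))"

definition is_colimit :: "('j, 'k) cat \<Rightarrow> ('o, 'm) cat \<Rightarrow> ('j, 'k, 'o, 'm) func \<Rightarrow> 'o \<Rightarrow> ('j \<Rightarrow> 'm) \<Rightarrow> bool" where
  "is_colimit J C D c \<tau> \<longleftrightarrow> cocone J C D c \<tau> \<and>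
     (\<forall>c' \<tau>'. cocone J C D c' \<tau>' \<longrightarrow>
        (\<exists>!h. h \<in> hom C c c' \<and> (\<forall>j \<in> Obj J. h \<cdot>\<^bsub>C\<^esub> \<tau> j = \<tau>' j)))"


section \<open>Local presentability\<close>

text \<open>Smallness is measured by a type \<open>'u\<close>: a set is small if its cardinality is below that of
  \<open>'u\<close>. If \<open>'u\<close> has inaccessible cardinality, this is smallness in the sense of a Grothendieck
  universe; inaccessibility is nowhere assumed. As every small category is isomorphic to one
  whose objects and arrows are elements of \<open>'u\<close>, it suffices to quantify over those.\<close>

definition small :: "'u itself \<Rightarrow> 'a set \<Rightarrow> bool" where
  "small T S \<longleftrightarrow> |S| <o |UNIV :: 'u set|"

definition small_category :: "'u itself \<Rightarrow> ('j, 'k) cat \<Rightarrow> bool" where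
  "small_category T J \<longleftrightarrow> category J \<and> small T (Obj J) \<and> small T (Arr J)"

definition locally_small :: "'u itself \<Rightarrow> ('o, 'm) cat \<Rightarrow> bool" where
  "locally_small T C \<longleftrightarrow> (\<forall>a \<in> Obj C. \<forall>b \<in> Obj C. small T (hom C a b))"

definition cocomplete :: "'u itself \<Rightarrow> ('o, 'm) cat \<Rightarrow> bool" where
  "cocomplete T C \<longleftrightarrow> (\<forall>(J :: ('u, 'u) cat) D. small_category T J \<and> is_functor J C D \<longrightarrow>
     (\<exists>c \<tau>. is_colimit J C D c \<tau>))"

text \<open>Every subdiagram of \<open>J\<close> of size less than \<open>\<kappa>\<close> has a cocone.\<close>

definition filtered_cat :: "'u rel \<Rightarrow> ('j, 'k) cat \<Rightarrow> bool" where
  "filtered_cat \<kappa> J \<longleftrightarrow>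
     (\<forall>S F. S \<subseteq> Obj J \<and> F \<subseteq> Arr J \<and> Dom J ` F \<subseteq> S \<and> Cod J ` F \<subseteq> S \<and> |S| <o \<kappa> \<and> |F| <o \<kappa> \<longrightarrow>
        (\<exists>v \<in> Obj J. \<exists>\<tau>. (\<forall>x \<in> S. \<tau> x \<in> hom J x v) \<and> (\<forall>f \<in> F. \<tau> (Cod J f) \<cdot>\<^bsub>J\<^esub> f = \<tau> (Dom J f))))"

text \<open>The colimit of the sets \<open>hom C k (D j)\<close> is the set of pairs \<open>(j, g)\<close> modulo the
  equivalence relation generated by \<open>(j, g) \<sim> (j', D m \<cdot> g)\<close> for \<open>m : j \<rightarrow> j'\<close>.\<close>

definition hom_colim_rel :: "('j, 'k) cat \<Rightarrow> ('o, 'm) cat \<Rightarrow> ('j, 'k, 'o, 'm) func \<Rightarrow> 'o \<Rightarrow> ('j \<times> 'm) rel" where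
  "hom_colim_rel J C D k =
     (let E = {((Dom J m, g), (Cod J m, far D m \<cdot>\<^bsub>C\<^esub> g)) | m g.
                 m \<in> Arr J \<and> g \<in> hom C k (fob D (Dom J m))} in (E \<union> E\<inverse>)\<^sup>*)"

text \<open>\<open>hom C k\<close> preserves \<open>\<kappa>\<close>-filtered colimits: the comparison map from the colimit of the
  \<open>hom C k (D j)\<close> to \<open>hom C k c\<close> is bijective.\<close>

definition presentable :: "'u rel \<Rightarrow> ('o, 'm) cat \<Rightarrow> 'o \<Rightarrow> bool" where
  "presentable \<kappa> C k \<longleftrightarrow> k \<in> Obj C \<and>
     (\<forall>(J :: ('u, 'u) cat) D c \<tau>.
        small_category TYPE('u) J \<and> filtered_cat \<kappa> J \<and> is_functor J C D \<and> is_colimit J C D c \<tau> \<longrightarrow>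
        (\<forall>f \<in> hom C k c. \<exists>j \<in> Obj J. \<exists>g \<in> hom C k (fob D j). \<tau> j \<cdot>\<^bsub>C\<^esub> g = f) \<and>
        (\<forall>j \<in> Obj J. \<forall>j' \<in> Obj J. \<forall>g \<in> hom C k (fob D j). \<forall>g' \<in> hom C k (fob D j').
           \<tau> j \<cdot>\<^bsub>C\<^esub> g = \<tau> j' \<cdot>\<^bsub>C\<^esub> g' \<longrightarrow> ((j, g), (j', g')) \<in> hom_colim_rel J C D k))"

definition locally_presentable :: "'u itself \<Rightarrow> ('o, 'm) cat \<Rightarrow> bool" where
  "locally_presentable T C \<longleftrightarrow> category C \<and> locally_small T C \<and> cocomplete T C \<and>
     (\<exists>\<kappa> :: 'u rel. Card_order \<kappa> \<and> cinfinite \<kappa> \<and> regularCard \<kappa> \<and> \<kappa> <o |UNIV :: 'u set| \<and>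
       (\<exists>S \<subseteq> Obj C. small T S \<and> (\<forall>k \<in> S. presentable \<kappa> C k) \<and>
         (\<forall>x \<in> Obj C. \<exists>(J :: ('u, 'u) cat) D \<tau>. small_category T J \<and> filtered_cat \<kappa> J \<and>
            is_functor J C D \<and> fob D ` Obj J \<subseteq> S \<and> is_colimit J C D x \<tau>)))"


section \<open>Pullback, composition and pushforward\<close>

text \<open>The functor \<open>(g, h) \<mapsto> h\<^sup>*(g)\<close> on pairs of arrows with common codomain.\<close>

definition pull_bifunc :: "('o, 'm) cat \<Rightarrow> ('m \<times> 'm, 'm sq \<times> 'm sq, 'm, 'm sq) func" where
  "pull_bifunc C =
     \<lparr>fob = (\<lambda>(g, h). pb2 C g h),
      far = (\<lambda>((g, a, c, g'), (h, b, c', h')).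
        (pb2 C g h, pb_pair C g' h' (a \<cdot>\<^bsub>C\<^esub> pb1 C g h) (b \<cdot>\<^bsub>C\<^esub> pb2 C g h), b, pb2 C g' h'))\<rparr>"

definition pull_func :: "('o, 'm) cat \<Rightarrow> 'm \<Rightarrow> ('m, 'm \<times> 'm \<times> 'm, 'm, 'm \<times> 'm \<times> 'm) func" where
  "pull_func C f =
     \<lparr>fob = (\<lambda>g. pb2 C g f),
      far = (\<lambda>(g, h, g'). (pb2 C g f, pb_pair C g' f (h \<cdot>\<^bsub>C\<^esub> pb1 C g f) (pb2 C g f), pb2 C g' f))\<rparr>"

definition post_func :: "('o, 'm) cat \<Rightarrow> 'm \<Rightarrow> ('m, 'm \<times> 'm \<times> 'm, 'm, 'm \<times> 'm \<times> 'm) func" where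
  "post_func C f =
     \<lparr>fob = (\<lambda>x. f \<cdot>\<^bsub>C\<^esub> x), far = (\<lambda>(x, h, x'). (f \<cdot>\<^bsub>C\<^esub> x, h, f \<cdot>\<^bsub>C\<^esub> x'))\<rparr>"

text \<open>The adjunction \<open>f\<^sub>! \<stileturn> f\<^sup>*\<close>.\<close>

definition base_adj :: "('o, 'm) cat \<Rightarrow> 'm \<Rightarrow> ('m, 'm \<times> 'm \<times> 'm, 'm, 'm \<times> 'm \<times> 'm) adj" where
  "base_adj C f =
     \<lparr>ladj = post_func C f, radj = pull_func C f,
      unit = (\<lambda>x. (x, pb_pair C (f \<cdot>\<^bsub>C\<^esub> x) f (Id C (Dom C x)) x, pb2 C (f \<cdot>\<^bsub>C\<^esub> x) f)),
      counit = (\<lambda>y. (f \<cdot>\<^bsub>C\<^esub> pb2 C y f, pb1 C y f, y))\<rparr>"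

definition is_push_adj :: "('o, 'm) cat \<Rightarrow> 'm \<Rightarrow> ('m, 'm \<times> 'm \<times> 'm, 'm, 'm \<times> 'm \<times> 'm) adj \<Rightarrow> bool" where
  "is_push_adj C f \<Lambda> \<longleftrightarrow>
     adjunction (slice C (Cod C f)) (slice C (Dom C f)) \<Lambda> \<and> ladj \<Lambda> = pull_func C f"

definition locally_cartesian_closed :: "('o, 'm) cat \<Rightarrow> bool" where
  "locally_cartesian_closed C \<longleftrightarrow> category C \<and> (\<exists>z. terminal C z) \<and>
     (\<forall>f \<in> Arr C. \<forall>g \<in> Arr C. Cod C f = Cod C g \<longrightarrow> (\<exists>p q. is_pullback C f g p q)) \<and>
     (\<forall>f \<in> Arr C. \<exists>\<Lambda>. is_push_adj C f \<Lambda>)"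

text \<open>The (chosen) adjunction \<open>f\<^sup>* \<stileturn> f\<^sub>*\<close>.\<close>

definition push_adj :: "('o, 'm) cat \<Rightarrow> 'm \<Rightarrow> ('m, 'm \<times> 'm \<times> 'm, 'm, 'm \<times> 'm \<times> 'm) adj" where
  "push_adj C f = (SOME \<Lambda>. is_push_adj C f \<Lambda>)"

definition push_func :: "('o, 'm) cat \<Rightarrow> 'm \<Rightarrow> ('m, 'm \<times> 'm \<times> 'm, 'm, 'm \<times> 'm \<times> 'm) func" where
  "push_func C f = radj (push_adj C f)"

text \<open>For a commutative square \<open>q \<cdot> s = t \<cdot> p\<close>: the canonical transformation
  \<open>s\<^sub>! p\<^sup>* \<rightarrow> q\<^sup>* t\<^sub>!\<close> and its mate \<open>t\<^sup>* q\<^sub>* \<rightarrow> p\<^sub>* s\<^sup>*\<close>.\<close>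

definition exch :: "('o, 'm) cat \<Rightarrow> 'm \<Rightarrow> 'm \<Rightarrow> 'm \<Rightarrow> 'm \<Rightarrow> 'm \<Rightarrow> 'm \<times> 'm \<times> 'm" where
  "exch C p q s t y =
     (s \<cdot>\<^bsub>C\<^esub> pb2 C y p,
      pb_pair C (t \<cdot>\<^bsub>C\<^esub> y) q (pb1 C y p) (s \<cdot>\<^bsub>C\<^esub> pb2 C y p),
      pb2 C (t \<cdot>\<^bsub>C\<^esub> y) q)"

definition exch_mate :: "('o, 'm) cat \<Rightarrow> 'm \<Rightarrow> 'm \<Rightarrow> 'm \<Rightarrow> 'm \<Rightarrow> 'm \<Rightarrow> 'm \<times> 'm \<times> 'm" where
  "exch_mate C p q s t =
     (let A = slice C (Cod C p); B = slice C (Dom C q) in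
      mate A (comp_adj A B (push_adj C p) (base_adj C s))
             (comp_adj A B (base_adj C t) (push_adj C q))
             (exch C p q s t))"

definition exch_mate_arrow :: "('o, 'm) cat \<Rightarrow> 'm \<Rightarrow> 'm \<Rightarrow> 'm \<Rightarrow> 'm \<Rightarrow> 'm \<times> 'm \<times> 'm \<Rightarrow> ('m \<times> 'm \<times> 'm) sq" where
  "exch_mate_arrow C p q s t =
     arrow_nat (slice C (Dom C q)) (pull_func C t \<circ>\<^sub>F push_func C q)
       (push_func C p \<circ>\<^sub>F pull_func C s) (exch_mate C p q s t)"


section \<open>Functorial cylinders\<close>

text \<open>\<open>K\<close> is the functor \<open>I \<otimes> (-)\<close>, and \<open>\<delta> k X\<close>, \<open>\<epsilon> X\<close>, \<open>c k X\<close> are the components at \<open>X\<close>,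
  with \<open>k\<close> restricted to \<open>{0, 1}\<close>.\<close>

definition functorial_cylinder :: "('o, 'm) cat \<Rightarrow> ('o, 'm, 'o, 'm) func \<Rightarrow> (nat \<Rightarrow> 'o \<Rightarrow> 'm) \<Rightarrow> bool" where
  "functorial_cylinder C K \<delta> \<longleftrightarrow>
     is_functor C C K \<and> (\<forall>k \<in> {0, 1}. nat_trans C C id_func K (\<delta> k))"

definition has_contractions :: "('o, 'm) cat \<Rightarrow> ('o, 'm, 'o, 'm) func \<Rightarrow> (nat \<Rightarrow> 'o \<Rightarrow> 'm) \<Rightarrow> ('o \<Rightarrow> 'm) \<Rightarrow> bool" where
  "has_contractions C K \<delta> \<epsilon> \<longleftrightarrow> nat_trans C C K id_func \<epsilon> \<and>
     (\<forall>k \<in> {0, 1}. \<forall>X \<in> Obj C. \<epsilon> X \<cdot>\<^bsub>C\<^esub> \<delta> k X = Id C X)"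

definition has_connections :: "('o, 'm) cat \<Rightarrow> ('o, 'm, 'o, 'm) func \<Rightarrow> (nat \<Rightarrow> 'o \<Rightarrow> 'm) \<Rightarrow> ('o \<Rightarrow> 'm) \<Rightarrow>
    (nat \<Rightarrow> 'o \<Rightarrow> 'm) \<Rightarrow> bool" where
  "has_connections C K \<delta> \<epsilon> c \<longleftrightarrow>
     (\<forall>k \<in> {0, 1}. nat_trans C C (K \<circ>\<^sub>F K) K (c k) \<and>
       (\<forall>X \<in> Obj C.
          c k X \<cdot>\<^bsub>C\<^esub> \<delta> k (fob K X) = \<delta> k X \<cdot>\<^bsub>C\<^esub> \<epsilon> X \<and>
          c k X \<cdot>\<^bsub>C\<^esub> far K (\<delta> k X) = \<delta> k X \<cdot>\<^bsub>C\<^esub> \<epsilon> X \<and>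
          c k X \<cdot>\<^bsub>C\<^esub> \<delta> (1 - k) (fob K X) = Id C (fob K X) \<and>
          c k X \<cdot>\<^bsub>C\<^esub> far K (\<delta> (1 - k) X) = Id C (fob K X)))"

definition has_right_adjoint :: "('o1, 'm1) cat \<Rightarrow> ('o2, 'm2) cat \<Rightarrow> ('o1, 'm1, 'o2, 'm2) func \<Rightarrow> bool" where
  "has_right_adjoint A B F \<longleftrightarrow> (\<exists>\<Lambda>. adjunction A B \<Lambda> \<and> ladj \<Lambda> = F)"

definition leibniz_ob :: "('o, 'm) cat \<Rightarrow> ('o, 'm, 'o, 'm) func \<Rightarrow> ('o \<Rightarrow> 'm) \<Rightarrow> 'm \<Rightarrow> 'm" where
  "leibniz_ob C K d i = po_copair C (d (Dom C i)) i (far K i) (d (Cod C i))"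

text \<open>The functor \<open>d \<otimes> (-)\<close> (Leibniz product) for \<open>d\<close> an endpoint inclusion of the cylinder.\<close>

definition leibniz :: "('o, 'm) cat \<Rightarrow> ('o, 'm, 'o, 'm) func \<Rightarrow> ('o \<Rightarrow> 'm) \<Rightarrow> ('m, 'm sq, 'm, 'm sq) func" where
  "leibniz C K d =
     \<lparr>fob = leibniz_ob C K d,
      far = (\<lambda>(i, a, b, j).
        (leibniz_ob C K d i,
         po_copair C (d (Dom C i)) i
           (po1 C (d (Dom C j)) j \<cdot>\<^bsub>C\<^esub> far K a) (po2 C (d (Dom C j)) j \<cdot>\<^bsub>C\<^esub> b),
         far K b,
         leibniz_ob C K d j))\<rparr>"


section \<open>Right maps\<close>

definition lift_problems :: "('o, 'm) cat \<Rightarrow> ('i, 'j) cat \<Rightarrow> ('i, 'j, 'm, 'm sq) func \<Rightarrow> 'm \<Rightarrow> ('i \<times> 'm \<times> 'm) set" where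
  "lift_problems C I u f = {(i, s, t). i \<in> Obj I \<and> (fob u i, s, t, f) \<in> Arr (arrow_cat C)}"

text \<open>Fillers are \<open>undefined\<close> off the lifting problems, so that equality of right maps is
  equality of their underlying maps and of their fillers.\<close>

definition right_map :: "('o, 'm) cat \<Rightarrow> ('i, 'j) cat \<Rightarrow> ('i, 'j, 'm, 'm sq) func \<Rightarrow>
    'm \<times> ('i \<times> 'm \<times> 'm \<Rightarrow> 'm) \<Rightarrow> bool" where
  "right_map C I u = (\<lambda>(f, \<phi>).
     f \<in> Arr C \<and> \<phi> \<in> extensional (lift_problems C I u f) \<and>
     (\<forall>(i, s, t) \<in> lift_problems C I u f.
        \<phi> (i, s, t) \<in> hom C (Cod C (fob u i)) (Dom C f) \<and>
        \<phi> (i, s, t) \<cdot>\<^bsub>C\<^esub> fob u i = s \<and> f \<cdot>\<^bsub>C\<^esub> \<phi> (i, s, t) = t) \<and>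
     (\<forall>\<sigma> \<in> Arr I. \<forall>s t. (Cod I \<sigma>, s, t) \<in> lift_problems C I u f \<longrightarrow>
        \<phi> (Cod I \<sigma>, s, t) \<cdot>\<^bsub>C\<^esub> bot_of (far u \<sigma>) =
        \<phi> (Dom I \<sigma>, s \<cdot>\<^bsub>C\<^esub> top_of (far u \<sigma>), t \<cdot>\<^bsub>C\<^esub> bot_of (far u \<sigma>))))"

definition right_maps :: "('o, 'm) cat \<Rightarrow> ('i, 'j) cat \<Rightarrow> ('i, 'j, 'm, 'm sq) func \<Rightarrow>
    ('m \<times> ('i \<times> 'm \<times> 'm \<Rightarrow> 'm),
     ('m \<times> ('i \<times> 'm \<times> 'm \<Rightarrow> 'm)) \<times> 'm sq \<times> ('m \<times> ('i \<times> 'm \<times> 'm \<Rightarrow> 'm))) cat" where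
  "right_maps C I u =
     \<lparr>Obj = {x. right_map C I u x},
      Arr = {((f, \<phi>), S, (g, \<psi>)). right_map C I u (f, \<phi>) \<and> right_map C I u (g, \<psi>) \<and>
               S \<in> hom (arrow_cat C) f g \<and>
               (\<forall>(i, s, t) \<in> lift_problems C I u f.
                  top_of S \<cdot>\<^bsub>C\<^esub> \<phi> (i, s, t) = \<psi> (i, top_of S \<cdot>\<^bsub>C\<^esub> s, bot_of S \<cdot>\<^bsub>C\<^esub> t))},
      Dom = (\<lambda>(x, S, y). x), Cod = (\<lambda>(x, S, y). y),
      Id = (\<lambda>x. (x, Id (arrow_cat C) (fst x), x)),
      Cmp = (\<lambda>(y, S', z) (x, S, y'). (x, S' \<cdot>\<^bsub>arrow_cat C\<^esub> S, z))\<rparr>"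

definition forget :: "('x \<times> 's, ('x \<times> 's) \<times> 'f \<times> ('x \<times> 's), 'x, 'f) func" where
  "forget = \<lparr>fob = fst, far = (\<lambda>(x, h, y). h)\<rparr>"

text \<open>The canonical lift of \<open>f\<^sup>*\<close> to right maps. For an arrow \<open>e = (x, g, y)\<close> of the slice over
  \<open>Cod C f\<close> with fillers \<open>\<phi>\<close> for \<open>g\<close>, a lifting problem \<open>(s, t)\<close> against \<open>f\<^sup>* e = (x', g', y')\<close> lives
  over \<open>Dom C f\<close>, with structure map \<open>d = y' \<cdot> t\<close> on the codomain of the left map; it is transposed
  along \<open>f\<^sub>! \<stileturn> f\<^sup>*\<close>, solved by \<open>\<phi>\<close>, and the solution is transposed back.\<close>

definition pull_fillers :: "('o, 'm) cat \<Rightarrow> ('i, 'j) cat \<Rightarrow> ('i, 'j, 'm, 'm sq) func \<Rightarrow> 'm \<Rightarrow>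
    ('i \<times> 'm \<times> 'm \<Rightarrow> 'm) \<Rightarrow> 'm \<times> 'm \<times> 'm \<Rightarrow> ('i \<times> 'm \<times> 'm \<Rightarrow> 'm)" where
  "pull_fillers C I u f \<phi> = (\<lambda>(x, g, y).
     let (x', g', y') = far (pull_func C f) (x, g, y);
         und = far (slice_forget C);
         sharp = (\<lambda>b h. und (ltranspose (slice C (Cod C f)) (base_adj C f) b h));
         flat = (\<lambda>a k. und (rtranspose (slice C (Dom C f)) (base_adj C f) a k))
     in restrict (\<lambda>(i, s, t). let d = y' \<cdot>\<^bsub>C\<^esub> t in
          flat d (f \<cdot>\<^bsub>C\<^esub> d, \<phi> (i, sharp x (x' \<cdot>\<^bsub>C\<^esub> s, s, x'), sharp y (d, t, y')), x))
        (lift_problems C I u g'))"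

definition pull_lift_ob :: "('o, 'm) cat \<Rightarrow> ('i, 'j) cat \<Rightarrow> ('i, 'j, 'm, 'm sq) func \<Rightarrow> 'm \<Rightarrow>
    ('m \<times> ('i \<times> 'm \<times> 'm \<Rightarrow> 'm)) \<times> ('m \<times> 'm \<times> 'm) \<Rightarrow> ('m \<times> ('i \<times> 'm \<times> 'm \<Rightarrow> 'm)) \<times> ('m \<times> 'm \<times> 'm)" where
  "pull_lift_ob C I u f = (\<lambda>((g, \<phi>), e).
     let e' = far (pull_func C f) e
     in ((far (slice_forget C) e', pull_fillers C I u f \<phi> e), e'))"

definition pull_lift :: "('o, 'm) cat \<Rightarrow> ('i, 'j) cat \<Rightarrow> ('i, 'j, 'm, 'm sq) func \<Rightarrow> 'm \<Rightarrow>
    (('m \<times> ('i \<times> 'm \<times> 'm \<Rightarrow> 'm)) \<times> ('m \<times> 'm \<times> 'm),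
     (('m \<times> ('i \<times> 'm \<times> 'm \<Rightarrow> 'm)) \<times> 'm sq \<times> ('m \<times> ('i \<times> 'm \<times> 'm \<Rightarrow> 'm))) \<times> ('m \<times> 'm \<times> 'm) sq,
     ('m \<times> ('i \<times> 'm \<times> 'm \<Rightarrow> 'm)) \<times> ('m \<times> 'm \<times> 'm),
     (('m \<times> ('i \<times> 'm \<times> 'm \<Rightarrow> 'm)) \<times> 'm sq \<times> ('m \<times> ('i \<times> 'm \<times> 'm \<Rightarrow> 'm))) \<times> ('m \<times> 'm \<times> 'm) sq) func" where
  "pull_lift C I u f =
     \<lparr>fob = pull_lift_ob C I u f,
      far = (\<lambda>((v, S, w), (e, a, b, e')).
        let Q = far (arrow_func (pull_func C f)) (e, a, b, e')
        in ((fst (pull_lift_ob C I u f (v, e)),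
             far (arrow_func (slice_forget C)) Q,
             fst (pull_lift_ob C I u f (w, e'))), Q))\<rparr>"


section \<open>Monads, comonads and algebraic weak factorization systems\<close>

definition monad :: "('o, 'm) cat \<Rightarrow> ('o, 'm, 'o, 'm) func \<Rightarrow> ('o \<Rightarrow> 'm) \<Rightarrow> ('o \<Rightarrow> 'm) \<Rightarrow> bool" where
  "monad A T \<eta> \<mu> \<longleftrightarrow> is_functor A A T \<and>
     nat_trans A A id_func T \<eta> \<and> nat_trans A A (T \<circ>\<^sub>F T) T \<mu> \<and>
     (\<forall>x \<in> Obj A.
        \<mu> x \<cdot>\<^bsub>A\<^esub> \<eta> (fob T x) = Id A (fob T x) \<and>
        \<mu> x \<cdot>\<^bsub>A\<^esub> far T (\<eta> x) = Id A (fob T x) \<and>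
        \<mu> x \<cdot>\<^bsub>A\<^esub> \<mu> (fob T x) = \<mu> x \<cdot>\<^bsub>A\<^esub> far T (\<mu> x))"

definition comonad :: "('o, 'm) cat \<Rightarrow> ('o, 'm, 'o, 'm) func \<Rightarrow> ('o \<Rightarrow> 'm) \<Rightarrow> ('o \<Rightarrow> 'm) \<Rightarrow> bool" where
  "comonad A T \<epsilon> \<delta> \<longleftrightarrow> is_functor A A T \<and>
     nat_trans A A T id_func \<epsilon> \<and> nat_trans A A T (T \<circ>\<^sub>F T) \<delta> \<and>
     (\<forall>x \<in> Obj A.
        \<epsilon> (fob T x) \<cdot>\<^bsub>A\<^esub> \<delta> x = Id A (fob T x) \<and>
        far T (\<epsilon> x) \<cdot>\<^bsub>A\<^esub> \<delta> x = Id A (fob T x) \<and>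
        \<delta> (fob T x) \<cdot>\<^bsub>A\<^esub> \<delta> x = far T (\<delta> x) \<cdot>\<^bsub>A\<^esub> \<delta> x)"

text \<open>A distributive law \<open>\<Delta> : L R \<rightarrow> R L\<close> of a comonad \<open>(L, \<epsilon>, \<delta>)\<close> over a monad \<open>(R, \<eta>, \<mu>)\<close>.\<close>

definition distributive_law :: "('o, 'm) cat \<Rightarrow> ('o, 'm, 'o, 'm) func \<Rightarrow> ('o \<Rightarrow> 'm) \<Rightarrow> ('o \<Rightarrow> 'm) \<Rightarrow>
    ('o, 'm, 'o, 'm) func \<Rightarrow> ('o \<Rightarrow> 'm) \<Rightarrow> ('o \<Rightarrow> 'm) \<Rightarrow> ('o \<Rightarrow> 'm) \<Rightarrow> bool" where
  "distributive_law A L \<epsilon> \<delta> R \<eta> \<mu> \<Delta> \<longleftrightarrow> nat_trans A A (L \<circ>\<^sub>F R) (R \<circ>\<^sub>F L) \<Delta> \<and>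
     (\<forall>x \<in> Obj A.
        \<Delta> x \<cdot>\<^bsub>A\<^esub> far L (\<eta> x) = \<eta> (fob L x) \<and>
        \<Delta> x \<cdot>\<^bsub>A\<^esub> far L (\<mu> x) = \<mu> (fob L x) \<cdot>\<^bsub>A\<^esub> (far R (\<Delta> x) \<cdot>\<^bsub>A\<^esub> \<Delta> (fob R x)) \<and>
        far R (\<epsilon> x) \<cdot>\<^bsub>A\<^esub> \<Delta> x = \<epsilon> (fob R x) \<and>
        far R (\<delta> x) \<cdot>\<^bsub>A\<^esub> \<Delta> x = \<Delta> (fob L x) \<cdot>\<^bsub>A\<^esub> (far L (\<Delta> x) \<cdot>\<^bsub>A\<^esub> \<delta> (fob R x)))"

definition copointed_coalgs :: "('o, 'm) cat \<Rightarrow> ('o, 'm, 'o, 'm) func \<Rightarrow> ('o \<Rightarrow> 'm) \<Rightarrow>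
    ('o \<times> 'm, ('o \<times> 'm) \<times> 'm \<times> ('o \<times> 'm)) cat" where
  "copointed_coalgs A T \<epsilon> =
     (let ob = {(x, \<alpha>). x \<in> Obj A \<and> \<alpha> \<in> hom A x (fob T x) \<and> \<epsilon> x \<cdot>\<^bsub>A\<^esub> \<alpha> = Id A x} in
     \<lparr>Obj = ob,
      Arr = {((x, \<alpha>), h, (y, \<beta>)). (x, \<alpha>) \<in> ob \<and> (y, \<beta>) \<in> ob \<and> h \<in> hom A x y \<and>
               \<beta> \<cdot>\<^bsub>A\<^esub> h = far T h \<cdot>\<^bsub>A\<^esub> \<alpha>},
      Dom = (\<lambda>(x, h, y). x), Cod = (\<lambda>(x, h, y). y),
      Id = (\<lambda>x. (x, Id A (fst x), x)),
      Cmp = (\<lambda>(y, h', z) (x, h, y'). (x, h' \<cdot>\<^bsub>A\<^esub> h, z))\<rparr>)"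

definition monad_algs :: "('o, 'm) cat \<Rightarrow> ('o, 'm, 'o, 'm) func \<Rightarrow> ('o \<Rightarrow> 'm) \<Rightarrow> ('o \<Rightarrow> 'm) \<Rightarrow>
    ('o \<times> 'm, ('o \<times> 'm) \<times> 'm \<times> ('o \<times> 'm)) cat" where
  "monad_algs A T \<eta> \<mu> =
     (let ob = {(x, \<alpha>). x \<in> Obj A \<and> \<alpha> \<in> hom A (fob T x) x \<and> \<alpha> \<cdot>\<^bsub>A\<^esub> \<eta> x = Id A x \<and>
                  \<alpha> \<cdot>\<^bsub>A\<^esub> \<mu> x = \<alpha> \<cdot>\<^bsub>A\<^esub> far T \<alpha>} in
     \<lparr>Obj = ob,
      Arr = {((x, \<alpha>), h, (y, \<beta>)). (x, \<alpha>) \<in> ob \<and> (y, \<beta>) \<in> ob \<and> h \<in> hom A x y \<and>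
               h \<cdot>\<^bsub>A\<^esub> \<alpha> = \<beta> \<cdot>\<^bsub>A\<^esub> far T h},
      Dom = (\<lambda>(x, h, y). x), Cod = (\<lambda>(x, h, y). y),
      Id = (\<lambda>x. (x, Id A (fst x), x)),
      Cmp = (\<lambda>(y, h', z) (x, h, y'). (x, h' \<cdot>\<^bsub>A\<^esub> h, z))\<rparr>)"

text \<open>\<open>f\<close> factors through \<open>fob (mid W) f\<close> as \<open>rpart W f \<cdot> lpart W f\<close>; a square \<open>S\<close> from \<open>f\<close> to
  \<open>g\<close> induces the map \<open>far (mid W) S\<close> between the middle objects.\<close>

record ('o, 'm) awfs_data =
  mid :: "('m, 'm sq, 'o, 'm) func"
  lpart :: "'m \<Rightarrow> 'm"
  rpart :: "'m \<Rightarrow> 'm"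
  comult :: "'m \<Rightarrow> 'm sq"
  mult :: "'m \<Rightarrow> 'm sq"

definition functorial_factorization :: "('o, 'm) cat \<Rightarrow> ('o, 'm) awfs_data \<Rightarrow> bool" where
  "functorial_factorization C W \<longleftrightarrow>
     is_functor (arrow_cat C) C (mid W) \<and>
     nat_trans (arrow_cat C) C (dom_func C) (mid W) (lpart W) \<and>
     nat_trans (arrow_cat C) C (mid W) (cod_func C) (rpart W) \<and>
     (\<forall>f \<in> Arr C. rpart W f \<cdot>\<^bsub>C\<^esub> lpart W f = f)"

definition Lfunc :: "('o, 'm) awfs_data \<Rightarrow> ('m, 'm sq, 'm, 'm sq) func" where
  "Lfunc W = \<lparr>fob = lpart W,
     far = (\<lambda>(f, a, b, g). (lpart W f, a, far (mid W) (f, a, b, g), lpart W g))\<rparr>"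

definition Rfunc :: "('o, 'm) awfs_data \<Rightarrow> ('m, 'm sq, 'm, 'm sq) func" where
  "Rfunc W = \<lparr>fob = rpart W,
     far = (\<lambda>(f, a, b, g). (rpart W f, far (mid W) (f, a, b, g), b, rpart W g))\<rparr>"

definition copoint :: "('o, 'm) cat \<Rightarrow> ('o, 'm) awfs_data \<Rightarrow> 'm \<Rightarrow> 'm sq" where
  "copoint C W f = (lpart W f, Id C (Dom C f), rpart W f, f)"

definition point :: "('o, 'm) cat \<Rightarrow> ('o, 'm) awfs_data \<Rightarrow> 'm \<Rightarrow> 'm sq" where
  "point C W f = (f, lpart W f, Id C (Cod C f), rpart W f)"

text \<open>The canonical \<open>L R \<rightarrow> R L\<close>, built from the non-identity components of the comultiplication
  and the multiplication.\<close>

definition canonical_dist :: "('o, 'm) awfs_data \<Rightarrow> 'm \<Rightarrow> 'm sq" where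
  "canonical_dist W f =
     (lpart W (rpart W f), bot_of (comult W f), top_of (mult W f), rpart W (lpart W f))"

definition awfs :: "('o, 'm) cat \<Rightarrow> ('o, 'm) awfs_data \<Rightarrow> bool" where
  "awfs C W \<longleftrightarrow> functorial_factorization C W \<and>
     comonad (arrow_cat C) (Lfunc W) (copoint C W) (comult W) \<and>
     monad (arrow_cat C) (Rfunc W) (point C W) (mult W) \<and>
     distributive_law (arrow_cat C) (Lfunc W) (copoint C W) (comult W)
       (Rfunc W) (point C W) (mult W) (canonical_dist W)"

definition Lmap :: "('o, 'm) cat \<Rightarrow> ('o, 'm) awfs_data \<Rightarrow>
    ('m \<times> 'm sq, ('m \<times> 'm sq) \<times> 'm sq \<times> ('m \<times> 'm sq)) cat" where
  "Lmap C W = copointed_coalgs (arrow_cat C) (Lfunc W) (copoint C W)"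

definition RMap :: "('o, 'm) cat \<Rightarrow> ('o, 'm) awfs_data \<Rightarrow>
    ('m \<times> 'm sq, ('m \<times> 'm sq) \<times> 'm sq \<times> ('m \<times> 'm sq)) cat" where
  "RMap C W = monad_algs (arrow_cat C) (Rfunc W) (point C W) (mult W)"

definition cofibrantly_generated_by :: "'u itself \<Rightarrow> ('o, 'm) cat \<Rightarrow> ('o, 'm) awfs_data \<Rightarrow>
    ('i, 'j) cat \<Rightarrow> ('i, 'j, 'm, 'm sq) func \<Rightarrow> bool" where
  "cofibrantly_generated_by T C W I u \<longleftrightarrow> small_category T I \<and> is_functor I (arrow_cat C) u \<and>
     iso_over (RMap C W) (right_maps C I u) forget forget"

definition suitable :: "'u itself \<Rightarrow> ('o, 'm) cat \<Rightarrow> ('o, 'm, 'o, 'm) func \<Rightarrow> (nat \<Rightarrow> 'o \<Rightarrow> 'm) \<Rightarrow>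
    ('o, 'm) awfs_data \<Rightarrow> bool" where
  "suitable T C K \<delta> W \<longleftrightarrow>
     (\<exists>(I :: ('u, 'u) cat) u. cofibrantly_generated_by T C W I u) \<and>
     (\<exists>F. lifts_functor C (Lmap C W) id_func forget (init_func C) F) \<and>
     (\<exists>P. lifts_functor
            (fibre_prod (Lmap C W) (arrow_cat C) (cod_func C \<circ>\<^sub>F forget) (cod_func C)) (Lmap C W)
            (prod_func forget id_func) forget (pull_bifunc C) P) \<and>
     (\<forall>k \<in> {0, 1}. \<exists>F. lifts_functor (Lmap C W) (Lmap C W) forget forget (leibniz C K (\<delta> k)) F)"


section \<open>Uniform fibrations\<close>

definition tensor_gen :: "('o, 'm) cat \<Rightarrow> ('o, 'm, 'o, 'm) func \<Rightarrow> (nat \<Rightarrow> 'o \<Rightarrow> 'm) \<Rightarrow>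
    ('i, 'j, 'm, 'm sq) func \<Rightarrow> ('i + 'i, 'j + 'j, 'm, 'm sq) func" where
  "tensor_gen C K \<delta> u = case_func (leibniz C K (\<delta> 0) \<circ>\<^sub>F u) (leibniz C K (\<delta> 1) \<circ>\<^sub>F u)"

definition Fib where
  "Fib C K \<delta> I u = right_maps C (sum_cat I I) (tensor_gen C K \<delta> u)"

definition Fib_over where
  "Fib_over C K \<delta> I u X = over_slice C (Fib C K \<delta> I u) forget X"

definition Fib_pull where
  "Fib_pull C K \<delta> I u f = pull_lift C (sum_cat I I) (tensor_gen C K \<delta> u) f"

end

theory Submission
  imports Defs
begin

text \<open>
  A lifting problem of a map \<open>m\<close> against \<open>p\<^sub>* g\<close> is, by transposition along \<open>p\<^sup>* \<stileturn> p\<^sub>*\<close>, a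
  lifting problem of \<open>p\<^sup>* m\<close> against \<open>g\<close>. So \<open>p\<^sub>*\<close> preserves uniform fibrations if the pullback of a
  generator \<open>m\<close>, the Leibniz product of an endpoint \<open>\<delta>\<^sup>k\<close> with some \<open>u\<^sub>i\<close>, along a uniform
  fibration still lifts against uniform fibrations, by a choice of fillers that is natural in all
  data. This is a Frobenius property, and it rests on two facts.

  First, uniform fibrations lift not only against the generators but against the Leibniz product of
  \<open>\<delta>\<^sup>k\<close> with any cofibration (\<open>cof_fill\<close>). Indeed, with \<open>H\<close> the right adjoint of \<open>I \<otimes> (-)\<close>, lifting
  the Leibniz product with \<open>i\<close> against \<open>f : X \<rightarrow> Y\<close> is lifting \<open>i\<close> against the pullback hom
  \<open>H X \<rightarrow> X \<times>\<^sub>Y H Y\<close>. If \<open>f\<close> is a uniform fibration, this is a right \<open>I\<close>-map, hence an algebra of the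
  monad \<open>R\<close>, and algebras lift against coalgebras (\<open>diag\<close>). The maps \<open>u\<^sub>i\<close> themselves are
  coalgebras (\<open>generators_coalgebras\<close>), hence so are the generators and their pullbacks.

  Second, call \<open>m\<close> a strong homotopy equivalence if it has a homotopy inverse, with homotopies on
  domain and codomain that correspond under \<open>m\<close>. A cofibration that is a strong homotopy equivalence
  is a retract of its Leibniz product with \<open>\<delta>\<^sup>k\<close>, so by the first fact it lifts against uniform
  fibrations (\<open>strong_heq_fill\<close>). The generators are strong homotopy equivalences, by means of the
  connections (\<open>strong_heq_LZ\<close>), and pulling back along a uniform fibration \<open>p\<close> preserves them: the
  homotopy on the codomain lifts along \<open>p\<close>, by the first fact for the cofibration \<open>0 \<rightarrow> Z\<close>, and the
  universal property of the pullback gives the rest (\<open>frobenius\<close>).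

  All constructions are natural in the generator, in \<open>g\<close> and in \<open>p\<close> (\<open>frob_left\<close>, \<open>frob_right\<close>).
  Naturality in the generator is uniformity of the fillers of \<open>p\<^sub>* g\<close>; naturality in \<open>g\<close> makes
  \<open>p\<^sub>*\<close> a functor on uniform fibrations; naturality in \<open>p\<close> says that \<open>\<psi> : t\<^sup>* q\<^sub>* \<rightarrow> p\<^sub>* s\<^sup>*\<close> commutes
  with fillers (\<open>push_exch\<close>), because under transposition composing with the mate \<open>\<psi>\<close> is
  precomposing with the transformation \<open>s\<^sub>! p\<^sup>* \<rightarrow> q\<^sup>* t\<^sub>!\<close>. When the square is a pullback the latter is
  invertible, hence so is its mate, and the inverse of a map that commutes with fillers commutes
  with fillers too.
\<close>


section \<open>Composition in categories\<close>

context category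
begin

lemma dom_obj' [simp]: "f \<in> Arr C \<Longrightarrow> Dom C f \<in> Obj C"
  and cod_obj' [simp]: "f \<in> Arr C \<Longrightarrow> Cod C f \<in> Obj C"
  by (simp_all add: dom_obj cod_obj)

lemma id_arr [simp]:
  "a \<in> Obj C \<Longrightarrow> Id C a \<in> Arr C" "a \<in> Obj C \<Longrightarrow> Dom C (Id C a) = a"
  "a \<in> Obj C \<Longrightarrow> Cod C (Id C a) = a"
  using id_hom by (auto simp: hom_def)

lemma cmp_arr [simp]:
  assumes "f \<in> Arr C" "g \<in> Arr C" "Dom C g = Cod C f"
  shows "g \<cdot> f \<in> Arr C" "Dom C (g \<cdot> f) = Dom C f" "Cod C (g \<cdot> f) = Cod C g"
  using cmp_hom[of f "Dom C f" "Cod C f" g "Cod C g"] assms by (auto simp: hom_def)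

lemma cmp_id [simp]:
  "f \<in> Arr C \<Longrightarrow> Cod C f = a \<Longrightarrow> Id C a \<cdot> f = f"
  "f \<in> Arr C \<Longrightarrow> Dom C f = a \<Longrightarrow> f \<cdot> Id C a = f"
  using id_left[of f] id_right[of f] by (auto simp: hom_def)

lemma cmp_assoc [simp]:
  assumes "f \<in> Arr C" "g \<in> Arr C" "h \<in> Arr C" "Dom C g = Cod C f" "Dom C h = Cod C g"
  shows "(h \<cdot> g) \<cdot> f = h \<cdot> (g \<cdot> f)"
  using assoc[of f "Dom C f" "Cod C f" g "Cod C g" h "Cod C h"] assms by (auto simp: hom_def)

text \<open>Composites are kept bracketed to the right, so an equation between composites has to be
  usable in front of a further factor.\<close>

lemma reassoc:
  assumes "g \<cdot> f = k" "f \<in> Arr C" "g \<in> Arr C" "Dom C g = Cod C f" "w \<in> Arr C" "Cod C w = Dom C f"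
  shows "g \<cdot> (f \<cdot> w) = k \<cdot> w"
  using assms by (metis cmp_assoc)

end

lemma functorD:
  assumes "is_functor A B F"
  shows "a \<in> Obj A \<Longrightarrow> fob F a \<in> Obj B"
    and "f \<in> Arr A \<Longrightarrow> far F f \<in> Arr B"
    and "f \<in> Arr A \<Longrightarrow> Dom B (far F f) = fob F (Dom A f)"
    and "f \<in> Arr A \<Longrightarrow> Cod B (far F f) = fob F (Cod A f)"
    and "a \<in> Obj A \<Longrightarrow> far F (Id A a) = Id B (fob F a)"
    and "f \<in> Arr A \<Longrightarrow> g \<in> Arr A \<Longrightarrow> Dom A g = Cod A f \<Longrightarrow>
      far F (g \<cdot>\<^bsub>A\<^esub> f) = far F g \<cdot>\<^bsub>B\<^esub> far F f"
  using assms by (auto simp: is_functor_def hom_def)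

lemma nat_transD:
  assumes "nat_trans A B F G \<tau>"
  shows "a \<in> Obj A \<Longrightarrow> \<tau> a \<in> Arr B"
    and "a \<in> Obj A \<Longrightarrow> Dom B (\<tau> a) = fob F a"
    and "a \<in> Obj A \<Longrightarrow> Cod B (\<tau> a) = fob G a"
    and "f \<in> Arr A \<Longrightarrow> \<tau> (Cod A f) \<cdot>\<^bsub>B\<^esub> far F f = far G f \<cdot>\<^bsub>B\<^esub> \<tau> (Dom A f)"
  using assms by (auto simp: nat_trans_def hom_def)

lemma id_func_simps [simp]: "fob id_func a = a" "far id_func f = f"
  by (simp_all add: id_func_def)

lemma comp_func_simps [simp]:
  "fob (G \<circ>\<^sub>F F) a = fob G (fob F a)" "far (G \<circ>\<^sub>F F) f = far G (far F f)"
  by (simp_all add: comp_func_def)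

lemma is_functor_comp:
  assumes "is_functor A B F" "is_functor B D G"
  shows "is_functor A D (G \<circ>\<^sub>F F)"
  using assms by (auto simp: is_functor_def hom_def)


section \<open>Transposition along adjunctions\<close>

locale adjoint_pair = A: category A + B: category B
  for A :: "('o1, 'm1) cat" and B :: "('o2, 'm2) cat" +
  fixes \<Lambda> :: "('o1, 'm1, 'o2, 'm2) adj"
  assumes adj: "adjunction A B \<Lambda>"
begin

lemma functor_ladj: "is_functor A B (ladj \<Lambda>)"
  and functor_radj: "is_functor B A (radj \<Lambda>)"
  using adj by (auto simp: adjunction_def)

lemmas L [simp] = functorD[OF functor_ladj]
lemmas R [simp] = functorD[OF functor_radj]

lemma unit_nat: "nat_trans A A id_func (radj \<Lambda> \<circ>\<^sub>F ladj \<Lambda>) (unit \<Lambda>)"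
  and counit_nat: "nat_trans B B (ladj \<Lambda> \<circ>\<^sub>F radj \<Lambda>) id_func (counit \<Lambda>)"
  using adj by (auto simp: adjunction_def)

lemmas unit_arr [simp] = nat_transD(1-3)[OF unit_nat, unfolded comp_func_simps id_func_simps]
lemmas counit_arr [simp] = nat_transD(1-3)[OF counit_nat, unfolded comp_func_simps id_func_simps]
lemmas unit_natural = nat_transD(4)[OF unit_nat, unfolded comp_func_simps id_func_simps]
lemmas counit_natural = nat_transD(4)[OF counit_nat, unfolded comp_func_simps id_func_simps]

lemma triangle:
  "a \<in> Obj A \<Longrightarrow> counit \<Lambda> (fob (ladj \<Lambda>) a) \<cdot>\<^bsub>B\<^esub> far (ladj \<Lambda>) (unit \<Lambda> a) = Id B (fob (ladj \<Lambda>) a)"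
  "b \<in> Obj B \<Longrightarrow> far (radj \<Lambda>) (counit \<Lambda> b) \<cdot>\<^bsub>A\<^esub> unit \<Lambda> (fob (radj \<Lambda>) b) = Id A (fob (radj \<Lambda>) b)"
  using adj by (auto simp: adjunction_def)

lemma lt_arr [simp]:
  assumes "h \<in> Arr A" "b \<in> Obj B" "Cod A h = fob (radj \<Lambda>) b"
  shows "ltranspose B \<Lambda> b h \<in> Arr B" "Dom B (ltranspose B \<Lambda> b h) = fob (ladj \<Lambda>) (Dom A h)"
    "Cod B (ltranspose B \<Lambda> b h) = b"
  using assms by (simp_all add: ltranspose_def)

lemma rt_arr [simp]:
  assumes "k \<in> Arr B" "a \<in> Obj A" "Dom B k = fob (ladj \<Lambda>) a"
  shows "rtranspose A \<Lambda> a k \<in> Arr A" "Cod A (rtranspose A \<Lambda> a k) = fob (radj \<Lambda>) (Cod B k)"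
    "Dom A (rtranspose A \<Lambda> a k) = a"
  using assms by (simp_all add: rtranspose_def)

lemma lt_rt [simp]:
  assumes "k \<in> Arr B" "a \<in> Obj A" "Dom B k = fob (ladj \<Lambda>) a" "b = Cod B k"
  shows "ltranspose B \<Lambda> b (rtranspose A \<Lambda> a k) = k"
proof -
  have "counit \<Lambda> (Cod B k) \<cdot>\<^bsub>B\<^esub> far (ladj \<Lambda>) (far (radj \<Lambda>) k) = k \<cdot>\<^bsub>B\<^esub> counit \<Lambda> (fob (ladj \<Lambda>) a)"
    using counit_natural[of k] assms by simp
  from B.reassoc[OF this] show ?thesis
    using assms by (simp add: ltranspose_def rtranspose_def triangle)
qed

lemma rt_lt [simp]:
  assumes "h \<in> Arr A" "b \<in> Obj B" "Cod A h = fob (radj \<Lambda>) b" "a = Dom A h"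
  shows "rtranspose A \<Lambda> a (ltranspose B \<Lambda> b h) = h"
proof -
  have "far (radj \<Lambda>) (far (ladj \<Lambda>) h) \<cdot>\<^bsub>A\<^esub> unit \<Lambda> a = unit \<Lambda> (fob (radj \<Lambda>) b) \<cdot>\<^bsub>A\<^esub> h"
    using unit_natural[of h] assms by simp
  then show ?thesis
    using assms A.reassoc[OF triangle(2)[of b], of h] by (simp add: ltranspose_def rtranspose_def)
qed

lemma lt_inj:
  assumes "ltranspose B \<Lambda> b h = ltranspose B \<Lambda> b h'" "h \<in> Arr A" "h' \<in> Arr A" "b \<in> Obj B"
    "Cod A h = fob (radj \<Lambda>) b" "Cod A h' = fob (radj \<Lambda>) b" "Dom A h = Dom A h'"
  shows "h = h'"
  using assms by (metis rt_lt)

lemma lt_cmp: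
  assumes "h \<in> Arr A" "v \<in> Arr A" "Dom A h = Cod A v" "b \<in> Obj B" "Cod A h = fob (radj \<Lambda>) b"
  shows "ltranspose B \<Lambda> b (h \<cdot>\<^bsub>A\<^esub> v) = ltranspose B \<Lambda> b h \<cdot>\<^bsub>B\<^esub> far (ladj \<Lambda>) v"
  using assms by (simp add: ltranspose_def)

lemma lt_radj:
  assumes "h \<in> Arr A" "k \<in> Arr B" "Cod A h = fob (radj \<Lambda>) (Dom B k)" "b = Cod B k"
  shows "ltranspose B \<Lambda> b (far (radj \<Lambda>) k \<cdot>\<^bsub>A\<^esub> h) = k \<cdot>\<^bsub>B\<^esub> ltranspose B \<Lambda> (Dom B k) h"
  using B.reassoc[OF counit_natural[of k], of "far (ladj \<Lambda>) h"] assms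
  by (simp add: ltranspose_def)

lemma rt_cmp:
  assumes "k \<in> Arr B" "a \<in> Obj A" "Dom B k = fob (ladj \<Lambda>) a" "l \<in> Arr B" "Dom B l = Cod B k"
  shows "rtranspose A \<Lambda> a (l \<cdot>\<^bsub>B\<^esub> k) = far (radj \<Lambda>) l \<cdot>\<^bsub>A\<^esub> rtranspose A \<Lambda> a k"
  using assms by (simp add: rtranspose_def)

lemma rt_ladj:
  assumes "k \<in> Arr B" "v \<in> Arr A" "Dom B k = fob (ladj \<Lambda>) (Cod A v)" "a = Dom A v"
  shows "rtranspose A \<Lambda> a (k \<cdot>\<^bsub>B\<^esub> far (ladj \<Lambda>) v) = rtranspose A \<Lambda> (Cod A v) k \<cdot>\<^bsub>A\<^esub> v"
  using unit_natural[of v] assms by (simp add: rtranspose_def)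

end

lemma adjunction_comp:
  assumes "category A" "category B" "category D" "adjunction A B \<Lambda>" "adjunction B D \<Lambda>'"
  shows "adjunction A D (comp_adj A D \<Lambda> \<Lambda>')"
proof -
  interpret P: adjoint_pair A B \<Lambda> using assms by (simp add: adjoint_pair_def adjoint_pair_axioms_def)
  interpret Q: adjoint_pair B D \<Lambda>' using assms by (simp add: adjoint_pair_def adjoint_pair_axioms_def)
  let ?L = "ladj \<Lambda>" and ?R = "radj \<Lambda>" and ?L' = "ladj \<Lambda>'" and ?R' = "radj \<Lambda>'"
  let ?\<eta> = "\<lambda>a. far ?R (unit \<Lambda>' (fob ?L a)) \<cdot>\<^bsub>A\<^esub> unit \<Lambda> a"
  let ?\<epsilon> = "\<lambda>d. counit \<Lambda>' d \<cdot>\<^bsub>D\<^esub> far ?L' (counit \<Lambda> (fob ?R' d))"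
  have 1: "nat_trans A A id_func ((?R \<circ>\<^sub>F ?R') \<circ>\<^sub>F (?L' \<circ>\<^sub>F ?L)) ?\<eta>"
    unfolding nat_trans_def
  proof (intro conjI ballI)
    fix f assume f: "f \<in> Arr A"
    have "far ?R (unit \<Lambda>' (fob ?L (Cod A f)) \<cdot>\<^bsub>B\<^esub> far ?L f)
      = far ?R (far ?R' (far ?L' (far ?L f)) \<cdot>\<^bsub>B\<^esub> unit \<Lambda>' (fob ?L (Dom A f)))"
      using Q.unit_natural[of "far ?L f"] f by simp
    then have e: "far ?R (unit \<Lambda>' (fob ?L (Cod A f))) \<cdot>\<^bsub>A\<^esub> far ?R (far ?L f)
      = far ?R (far ?R' (far ?L' (far ?L f))) \<cdot>\<^bsub>A\<^esub> far ?R (unit \<Lambda>' (fob ?L (Dom A f)))"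
      using f by simp
    show "?\<eta> (Cod A f) \<cdot>\<^bsub>A\<^esub> far id_func f = far ((?R \<circ>\<^sub>F ?R') \<circ>\<^sub>F (?L' \<circ>\<^sub>F ?L)) f \<cdot>\<^bsub>A\<^esub> ?\<eta> (Dom A f)"
      using f P.A.reassoc[OF e, of "unit \<Lambda> (Dom A f)"] by (simp add: P.unit_natural)
  qed (simp add: hom_def)
  have 2: "nat_trans D D ((?L' \<circ>\<^sub>F ?L) \<circ>\<^sub>F (?R \<circ>\<^sub>F ?R')) id_func ?\<epsilon>"
    unfolding nat_trans_def
  proof (intro conjI ballI)
    fix f assume f: "f \<in> Arr D"
    have "far ?L' (counit \<Lambda> (fob ?R' (Cod D f)) \<cdot>\<^bsub>B\<^esub> far ?L (far ?R (far ?R' f)))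
      = far ?L' (far ?R' f \<cdot>\<^bsub>B\<^esub> counit \<Lambda> (fob ?R' (Dom D f)))"
      using P.counit_natural[of "far ?R' f"] f by simp
    then have "far ?L' (counit \<Lambda> (fob ?R' (Cod D f))) \<cdot>\<^bsub>D\<^esub> far ?L' (far ?L (far ?R (far ?R' f)))
      = far ?L' (far ?R' f) \<cdot>\<^bsub>D\<^esub> far ?L' (counit \<Lambda> (fob ?R' (Dom D f)))"
      using f by simp
    then show "?\<epsilon> (Cod D f) \<cdot>\<^bsub>D\<^esub> far ((?L' \<circ>\<^sub>F ?L) \<circ>\<^sub>F (?R \<circ>\<^sub>F ?R')) f = far id_func f \<cdot>\<^bsub>D\<^esub> ?\<epsilon> (Dom D f)"
      using f Q.B.reassoc[OF Q.counit_natural[of f]] by simp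
  qed (simp add: hom_def)
  have 3: "?\<epsilon> (fob (?L' \<circ>\<^sub>F ?L) a) \<cdot>\<^bsub>D\<^esub> far (?L' \<circ>\<^sub>F ?L) (?\<eta> a) = Id D (fob (?L' \<circ>\<^sub>F ?L) a)"
    if a: "a \<in> Obj A" for a
  proof -
    let ?u = "unit \<Lambda>' (fob ?L a)"
    have "far ?L' (counit \<Lambda> (fob ?R' (fob ?L' (fob ?L a))) \<cdot>\<^bsub>B\<^esub> far ?L (far ?R ?u))
      = far ?L' (?u \<cdot>\<^bsub>B\<^esub> counit \<Lambda> (fob ?L a))"
      using P.counit_natural[of ?u] a by simp
    then have e: "far ?L' (counit \<Lambda> (fob ?R' (fob ?L' (fob ?L a)))) \<cdot>\<^bsub>D\<^esub> far ?L' (far ?L (far ?R ?u))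
      = far ?L' ?u \<cdot>\<^bsub>D\<^esub> far ?L' (counit \<Lambda> (fob ?L a))"
      using a by simp
    have e2: "far ?L' (counit \<Lambda> (fob ?L a)) \<cdot>\<^bsub>D\<^esub> far ?L' (far ?L (unit \<Lambda> a)) = Id D (fob ?L' (fob ?L a))"
      using a P.triangle(1)[of a] Q.L(6)[of "far ?L (unit \<Lambda> a)" "counit \<Lambda> (fob ?L a)"] by simp
    show ?thesis
      using a Q.B.reassoc[OF e, of "far ?L' (far ?L (unit \<Lambda> a))"] by (simp add: e2 Q.triangle)
  qed
  have 4: "far (?R \<circ>\<^sub>F ?R') (?\<epsilon> d) \<cdot>\<^bsub>A\<^esub> ?\<eta> (fob (?R \<circ>\<^sub>F ?R') d) = Id A (fob (?R \<circ>\<^sub>F ?R') d)"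
    if d: "d \<in> Obj D" for d
  proof -
    let ?c = "counit \<Lambda> (fob ?R' d)"
    have "far ?R (unit \<Lambda>' (fob ?R' d) \<cdot>\<^bsub>B\<^esub> ?c)
      = far ?R (far ?R' (far ?L' ?c) \<cdot>\<^bsub>B\<^esub> unit \<Lambda>' (fob ?L (fob ?R (fob ?R' d))))"
      using Q.unit_natural[of ?c] d by simp
    then have e: "far ?R (far ?R' (far ?L' ?c)) \<cdot>\<^bsub>A\<^esub> far ?R (unit \<Lambda>' (fob ?L (fob ?R (fob ?R' d))))
      = far ?R (unit \<Lambda>' (fob ?R' d)) \<cdot>\<^bsub>A\<^esub> far ?R ?c"
      using d by simp
    have e2: "far ?R (far ?R' (counit \<Lambda>' d)) \<cdot>\<^bsub>A\<^esub> far ?R (unit \<Lambda>' (fob ?R' d)) = Id A (fob ?R (fob ?R' d))"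
      using d Q.triangle(2)[of d] P.R(6)[of "unit \<Lambda>' (fob ?R' d)" "far ?R' (counit \<Lambda>' d)"] by simp
    show ?thesis
      using d P.A.reassoc[OF e, of "unit \<Lambda> (fob ?R (fob ?R' d))"] by (simp add: e2 P.triangle)
  qed
  show ?thesis
    using 1 2 3 4 is_functor_comp[OF P.functor_ladj Q.functor_ladj]
      is_functor_comp[OF Q.functor_radj P.functor_radj]
    by (simp add: adjunction_def comp_adj_def)
qed

text \<open>Transposition turns composition with the mate of \<open>\<tau>\<close> into precomposition with \<open>\<tau>\<close>. As
  transposition is injective, this determines the mate, and naturality and invertibility of \<open>\<tau>\<close>
  pass to it.\<close>

lemma lt_mate:
  assumes "adjoint_pair A B \<Lambda>1" "adjoint_pair A B \<Lambda>2" "nat_trans A B (ladj \<Lambda>1) (ladj \<Lambda>2) \<tau>" "b \<in> Obj B"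
  shows "mate A \<Lambda>1 \<Lambda>2 \<tau> b \<in> Arr A" "Dom A (mate A \<Lambda>1 \<Lambda>2 \<tau> b) = fob (radj \<Lambda>2) b"
    "Cod A (mate A \<Lambda>1 \<Lambda>2 \<tau> b) = fob (radj \<Lambda>1) b"
    and "h \<in> Arr A \<Longrightarrow> Cod A h = fob (radj \<Lambda>2) b \<Longrightarrow>
      ltranspose B \<Lambda>1 b (mate A \<Lambda>1 \<Lambda>2 \<tau> b \<cdot>\<^bsub>A\<^esub> h) = ltranspose B \<Lambda>2 b h \<cdot>\<^bsub>B\<^esub> \<tau> (Dom A h)"
proof -
  interpret P: adjoint_pair A B \<Lambda>1 by fact
  interpret Q: adjoint_pair A B \<Lambda>2 by fact
  note \<tau> [simp] = nat_transD(1-3)[OF assms(3)] and \<tau>n = nat_transD(4)[OF assms(3)]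
  let ?r = "fob (radj \<Lambda>2) b"
  have m: "mate A \<Lambda>1 \<Lambda>2 \<tau> b = rtranspose A \<Lambda>1 ?r (counit \<Lambda>2 b \<cdot>\<^bsub>B\<^esub> \<tau> ?r)"
    using assms(4) by (simp add: mate_def rtranspose_def)
  show "mate A \<Lambda>1 \<Lambda>2 \<tau> b \<in> Arr A" "Dom A (mate A \<Lambda>1 \<Lambda>2 \<tau> b) = ?r"
    "Cod A (mate A \<Lambda>1 \<Lambda>2 \<tau> b) = fob (radj \<Lambda>1) b"
    using assms(4) by (simp_all add: m)
  show "ltranspose B \<Lambda>1 b (mate A \<Lambda>1 \<Lambda>2 \<tau> b \<cdot>\<^bsub>A\<^esub> h) = ltranspose B \<Lambda>2 b h \<cdot>\<^bsub>B\<^esub> \<tau> (Dom A h)"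
    if "h \<in> Arr A" "Cod A h = ?r"
    using that assms(4) \<tau>n[of h] by (simp add: m P.lt_cmp) (simp add: ltranspose_def)
qed

lemma nat_trans_mate:
  assumes "adjoint_pair A B \<Lambda>1" "adjoint_pair A B \<Lambda>2" "nat_trans A B (ladj \<Lambda>1) (ladj \<Lambda>2) \<tau>"
  shows "nat_trans B A (radj \<Lambda>2) (radj \<Lambda>1) (mate A \<Lambda>1 \<Lambda>2 \<tau>)"
  unfolding nat_trans_def
proof (intro conjI ballI)
  interpret P: adjoint_pair A B \<Lambda>1 by fact
  interpret Q: adjoint_pair A B \<Lambda>2 by fact
  note \<tau> [simp] = nat_transD(1-3)[OF assms(3)] and \<tau>n = nat_transD(4)[OF assms(3)]
  note m [simp] = lt_mate(1-3)[OF assms(1-3)] and mt = lt_mate(4)[OF assms(1-3)]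
  show "mate A \<Lambda>1 \<Lambda>2 \<tau> b \<in> hom A (fob (radj \<Lambda>2) b) (fob (radj \<Lambda>1) b)" if "b \<in> Obj B" for b
    using that by (simp add: hom_def)
  fix f assume f [simp]: "f \<in> Arr B"
  let ?b = "Dom B f" and ?b' = "Cod B f" and ?m = "mate A \<Lambda>1 \<Lambda>2 \<tau>"
  have "ltranspose B \<Lambda>2 ?b' (far (radj \<Lambda>2) f \<cdot>\<^bsub>A\<^esub> Id A (fob (radj \<Lambda>2) ?b))
    = f \<cdot>\<^bsub>B\<^esub> ltranspose B \<Lambda>2 ?b (Id A (fob (radj \<Lambda>2) ?b))"
    by (rule Q.lt_radj) simp_all
  then have 1: "ltranspose B \<Lambda>2 ?b' (far (radj \<Lambda>2) f) = f \<cdot>\<^bsub>B\<^esub> ltranspose B \<Lambda>2 ?b (Id A (fob (radj \<Lambda>2) ?b))"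
    by simp
  have 2: "ltranspose B \<Lambda>1 ?b (?m ?b) = ltranspose B \<Lambda>2 ?b (Id A (fob (radj \<Lambda>2) ?b)) \<cdot>\<^bsub>B\<^esub> \<tau> (fob (radj \<Lambda>2) ?b)"
    using mt[of ?b "Id A (fob (radj \<Lambda>2) ?b)"] by simp
  show "?m ?b' \<cdot>\<^bsub>A\<^esub> far (radj \<Lambda>2) f = far (radj \<Lambda>1) f \<cdot>\<^bsub>A\<^esub> ?m ?b"
    by (rule P.lt_inj[of ?b']) (simp_all add: mt 1 2 P.lt_radj)
qed

lemma is_iso_mate:
  assumes "adjoint_pair A B \<Lambda>1" "adjoint_pair A B \<Lambda>2" "nat_trans A B (ladj \<Lambda>1) (ladj \<Lambda>2) \<tau>" "b \<in> Obj B"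
    and "\<And>a. a \<in> Obj A \<Longrightarrow> is_iso B (\<tau> a)"
  shows "is_iso A (mate A \<Lambda>1 \<Lambda>2 \<tau> b)"
proof -
  interpret P: adjoint_pair A B \<Lambda>1 by fact
  interpret Q: adjoint_pair A B \<Lambda>2 by fact
  note \<tau> [simp] = nat_transD(1-3)[OF assms(3)] and \<tau>n = nat_transD(4)[OF assms(3)]
  note m [simp] = lt_mate(1-3)[OF assms(1-4)] and mt = lt_mate(4)[OF assms(1-4)]
  let ?m = "mate A \<Lambda>1 \<Lambda>2 \<tau> b" and ?r1 = "fob (radj \<Lambda>1) b" and ?r2 = "fob (radj \<Lambda>2) b"
  note b [simp] = assms(4)
  obtain \<sigma> where \<sigma>: "\<sigma> \<in> Arr B" "Dom B \<sigma> = fob (ladj \<Lambda>2) ?r1" "Cod B \<sigma> = fob (ladj \<Lambda>1) ?r1"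
    "\<sigma> \<cdot>\<^bsub>B\<^esub> \<tau> ?r1 = Id B (fob (ladj \<Lambda>1) ?r1)"
    using assms(5)[of ?r1] by (auto simp: is_iso_def hom_def)
  obtain \<rho> where \<rho>: "\<rho> \<in> Arr B" "Dom B \<rho> = fob (ladj \<Lambda>2) ?r2" "Cod B \<rho> = fob (ladj \<Lambda>1) ?r2"
    "\<tau> ?r2 \<cdot>\<^bsub>B\<^esub> \<rho> = Id B (fob (ladj \<Lambda>2) ?r2)"
    using assms(5)[of ?r2] by (auto simp: is_iso_def hom_def)
  \<comment> \<open>The inverse of the mate is the mate of the inverse.\<close>
  define w where "w = rtranspose A \<Lambda>2 ?r1 (counit \<Lambda>1 b \<cdot>\<^bsub>B\<^esub> \<sigma>)"
  have w [simp]: "w \<in> Arr A" "Dom A w = ?r1" "Cod A w = ?r2"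
    using \<sigma> by (simp_all add: w_def)
  have 1: "?m \<cdot>\<^bsub>A\<^esub> w = Id A ?r1"
  proof (rule P.lt_inj[of b])
    show "ltranspose B \<Lambda>1 b (?m \<cdot>\<^bsub>A\<^esub> w) = ltranspose B \<Lambda>1 b (Id A ?r1)"
      using \<sigma> by (simp add: mt) (simp add: w_def, simp add: ltranspose_def)
  qed simp_all
  have "ltranspose B \<Lambda>2 b (w \<cdot>\<^bsub>A\<^esub> ?m) \<cdot>\<^bsub>B\<^esub> \<tau> ?r2 = ltranspose B \<Lambda>1 b (?m \<cdot>\<^bsub>A\<^esub> (w \<cdot>\<^bsub>A\<^esub> ?m))"
    by (simp add: mt)
  also have "?m \<cdot>\<^bsub>A\<^esub> (w \<cdot>\<^bsub>A\<^esub> ?m) = ?m \<cdot>\<^bsub>A\<^esub> Id A ?r2"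
    using P.A.reassoc[OF 1, of ?m] by simp
  also have "ltranspose B \<Lambda>1 b \<dots> = ltranspose B \<Lambda>2 b (Id A ?r2) \<cdot>\<^bsub>B\<^esub> \<tau> ?r2"
    by (subst mt) simp_all
  finally have e: "(ltranspose B \<Lambda>2 b (w \<cdot>\<^bsub>A\<^esub> ?m) \<cdot>\<^bsub>B\<^esub> \<tau> ?r2) \<cdot>\<^bsub>B\<^esub> \<rho> = (ltranspose B \<Lambda>2 b (Id A ?r2) \<cdot>\<^bsub>B\<^esub> \<tau> ?r2) \<cdot>\<^bsub>B\<^esub> \<rho>"
    by simp
  have 2: "w \<cdot>\<^bsub>A\<^esub> ?m = Id A ?r2"
  proof (rule Q.lt_inj[of b])
    show "ltranspose B \<Lambda>2 b (w \<cdot>\<^bsub>A\<^esub> ?m) = ltranspose B \<Lambda>2 b (Id A ?r2)"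
      using e \<rho> by simp
  qed simp_all
  show ?thesis
    by (simp add: is_iso_def hom_def) (use 1 2 w in blast)
qed


section \<open>Pullbacks, slices and base change\<close>

lemma slice_simps [simp]:
  "f \<in> Obj (slice C X) \<longleftrightarrow> f \<in> Arr C \<and> Cod C f = X"
  "(f, h, g) \<in> Arr (slice C X) \<longleftrightarrow> f \<in> Arr C \<and> Cod C f = X \<and> g \<in> Arr C \<and> Cod C g = X \<and>
     h \<in> hom C (Dom C f) (Dom C g) \<and> g \<cdot>\<^bsub>C\<^esub> h = f"
  "Dom (slice C X) (f, h, g) = f" "Cod (slice C X) (f, h, g) = g"
  "Id (slice C X) f = (f, Id C (Dom C f), f)"
  "(g', k, l) \<cdot>\<^bsub>slice C X\<^esub> (f, h, g) = (f, k \<cdot>\<^bsub>C\<^esub> h, l)"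
  by (simp_all add: slice_def)

lemma sliceD:
  assumes "(f, h, g) \<in> Arr (slice C X)"
  shows "f \<in> Arr C" "Cod C f = X" "g \<in> Arr C" "Cod C g = X" "h \<in> Arr C" "Dom C h = Dom C f"
    "Cod C h = Dom C g" "g \<cdot>\<^bsub>C\<^esub> h = f"
  using assms by (simp_all add: hom_def)

lemma slice_forget_simps [simp]:
  "far (slice_forget C) (f, h, g) = h" "fob (slice_forget C) f = Dom C f"
  by (simp_all add: slice_forget_def)

lemma (in category) category_slice: "category (slice C X)"
proof
  fix S T V and f g h k
  show "S \<in> Arr (slice C X) \<Longrightarrow> Dom (slice C X) S \<in> Obj (slice C X)"
    "S \<in> Arr (slice C X) \<Longrightarrow> Cod (slice C X) S \<in> Obj (slice C X)"
    by (cases S; simp)+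
  show "f \<in> Obj (slice C X) \<Longrightarrow> Id (slice C X) f \<in> hom (slice C X) f f"
    by (simp add: hom_def)
  show "S \<in> hom (slice C X) f g \<Longrightarrow> T \<in> hom (slice C X) g h \<Longrightarrow>
      T \<cdot>\<^bsub>slice C X\<^esub> S \<in> hom (slice C X) f h"
    by (cases S; cases T) (simp add: hom_def flip: cmp_assoc)
  show "S \<in> hom (slice C X) f g \<Longrightarrow> Id (slice C X) g \<cdot>\<^bsub>slice C X\<^esub> S = S"
    "S \<in> hom (slice C X) f g \<Longrightarrow> S \<cdot>\<^bsub>slice C X\<^esub> Id (slice C X) f = S"
    by (cases S; simp add: hom_def)+
  show "S \<in> hom (slice C X) f g \<Longrightarrow> T \<in> hom (slice C X) g h \<Longrightarrow> V \<in> hom (slice C X) h k \<Longrightarrow>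
      (V \<cdot>\<^bsub>slice C X\<^esub> T) \<cdot>\<^bsub>slice C X\<^esub> S = V \<cdot>\<^bsub>slice C X\<^esub> (T \<cdot>\<^bsub>slice C X\<^esub> S)"
    by (cases S; cases T; cases V) (simp add: hom_def)
qed

lemma (in category) is_pullback_ext:
  assumes "is_pullback C f g p q" "h \<in> Arr C" "h' \<in> Arr C" "Cod C h = Dom C p" "Cod C h' = Dom C p"
    "Dom C h = Dom C h'" "p \<cdot> h = p \<cdot> h'" "q \<cdot> h = q \<cdot> h'"
  shows "h = h'"
proof -
  note pb = assms(1)[unfolded is_pullback_def]
  have "f \<cdot> (p \<cdot> h) = g \<cdot> (q \<cdot> h)"
    using pb assms reassoc[of f p "g \<cdot> q" h] by simp
  moreover have "Dom C h \<in> Obj C" "p \<cdot> h \<in> hom C (Dom C h) (Dom C f)" "q \<cdot> h \<in> hom C (Dom C h) (Dom C g)"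
    using pb assms by (simp_all add: hom_def)
  ultimately have "\<exists>!k. k \<in> hom C (Dom C h) (Dom C p) \<and> p \<cdot> k = p \<cdot> h \<and> q \<cdot> k = q \<cdot> h"
    using pb by blast
  moreover have "h \<in> hom C (Dom C h) (Dom C p)" "h' \<in> hom C (Dom C h) (Dom C p)"
    using assms by (simp_all add: hom_def)
  ultimately show ?thesis using assms(7,8) by metis
qed

locale pullback_category = category +
  assumes has_pb: "f \<in> Arr C \<Longrightarrow> g \<in> Arr C \<Longrightarrow> Cod C f = Cod C g \<Longrightarrow> \<exists>p q. is_pullback C f g p q"
begin

lemma is_pullback_pb:
  assumes "f \<in> Arr C" "g \<in> Arr C" "Cod C f = Cod C g"
  shows "is_pullback C f g (pb1 C f g) (pb2 C f g)"
proof -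
  obtain p q where "is_pullback C f g p q"
    using has_pb assms by blast
  then have "is_pullback C f g (fst (p, q)) (snd (p, q))" by simp
  then show ?thesis unfolding pb_def by (rule someI)
qed

lemma pb_arr [simp]:
  assumes "f \<in> Arr C" "g \<in> Arr C" "Cod C f = Cod C g"
  shows "pb1 C f g \<in> Arr C" "pb2 C f g \<in> Arr C" "Dom C (pb2 C f g) = Dom C (pb1 C f g)"
    "Cod C (pb1 C f g) = Dom C f" "Cod C (pb2 C f g) = Dom C g"
  using is_pullback_pb[OF assms] by (simp_all add: is_pullback_def)

lemma pb_comm:
  assumes "f \<in> Arr C" "g \<in> Arr C" "Cod C f = Cod C g"
  shows "f \<cdot> pb1 C f g = g \<cdot> pb2 C f g"
  using is_pullback_pb[OF assms] by (simp add: is_pullback_def)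

lemma pb_comm':
  assumes "f \<in> Arr C" "g \<in> Arr C" "Cod C f = Cod C g" "w \<in> Arr C" "Cod C w = Dom C (pb1 C f g)"
  shows "f \<cdot> (pb1 C f g \<cdot> w) = g \<cdot> (pb2 C f g \<cdot> w)"
  using reassoc[OF pb_comm] assms by simp

lemma pb_universal:
  assumes "f \<in> Arr C" "g \<in> Arr C" "Cod C f = Cod C g" "a \<in> Arr C" "b \<in> Arr C" "Dom C a = Dom C b"
    "Cod C a = Dom C f" "Cod C b = Dom C g" "f \<cdot> a = g \<cdot> b"
  shows "\<exists>!h. h \<in> hom C (Dom C a) (Dom C (pb1 C f g)) \<and> pb1 C f g \<cdot> h = a \<and> pb2 C f g \<cdot> h = b"
proof -
  have "Dom C a \<in> Obj C" "a \<in> hom C (Dom C a) (Dom C f)" "b \<in> hom C (Dom C a) (Dom C g)"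
    using assms by (simp_all add: hom_def)
  then show ?thesis
    using is_pullback_pb[OF assms(1-3)] assms(9) unfolding is_pullback_def by blast
qed

lemma pb_pair:
  assumes "f \<in> Arr C" "g \<in> Arr C" "Cod C f = Cod C g" "a \<in> Arr C" "b \<in> Arr C" "Dom C a = Dom C b"
    "Cod C a = Dom C f" "Cod C b = Dom C g" "f \<cdot> a = g \<cdot> b"
  shows "pb_pair C f g a b \<in> Arr C" "Dom C (pb_pair C f g a b) = Dom C a"
    "Cod C (pb_pair C f g a b) = Dom C (pb1 C f g)"
    "pb1 C f g \<cdot> pb_pair C f g a b = a" "pb2 C f g \<cdot> pb_pair C f g a b = b"
  using theI'[OF pb_universal[OF assms]] unfolding pb_pair_def hom_def by auto

lemma pb_pair':
  assumes "f \<in> Arr C" "g \<in> Arr C" "Cod C f = Cod C g" "a \<in> Arr C" "b \<in> Arr C" "Dom C a = Dom C b"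
    "Cod C a = Dom C f" "Cod C b = Dom C g" "f \<cdot> a = g \<cdot> b" "w \<in> Arr C" "Cod C w = Dom C a"
  shows "pb1 C f g \<cdot> (pb_pair C f g a b \<cdot> w) = a \<cdot> w" "pb2 C f g \<cdot> (pb_pair C f g a b \<cdot> w) = b \<cdot> w"
  by (rule reassoc; simp add: assms pb_pair)+

lemma pb_ext:
  assumes "f \<in> Arr C" "g \<in> Arr C" "Cod C f = Cod C g" "h \<in> Arr C" "h' \<in> Arr C"
    "Cod C h = Dom C (pb1 C f g)" "Cod C h' = Dom C (pb1 C f g)" "Dom C h = Dom C h'"
    "pb1 C f g \<cdot> h = pb1 C f g \<cdot> h'" "pb2 C f g \<cdot> h = pb2 C f g \<cdot> h'"
  shows "h = h'"
  using is_pullback_ext[OF is_pullback_pb] assms by blast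

lemma pb_pair_eqI:
  assumes "f \<in> Arr C" "g \<in> Arr C" "Cod C f = Cod C g" "h \<in> Arr C" "Cod C h = Dom C (pb1 C f g)"
    "pb1 C f g \<cdot> h = a" "pb2 C f g \<cdot> h = b"
  shows "pb_pair C f g a b = h"
proof -
  have *: "a \<in> Arr C" "b \<in> Arr C" "Dom C a = Dom C h" "Dom C b = Dom C h" "Cod C a = Dom C f"
    "Cod C b = Dom C g" "f \<cdot> a = g \<cdot> b"
    using assms(1-5) pb_comm'[of f g h] unfolding assms(6,7)[symmetric] by simp_all
  show ?thesis
    by (rule pb_ext[OF assms(1-3)]) (use assms * in \<open>simp_all add: pb_pair\<close>)
qed

lemma pull_arr:
  assumes f: "f \<in> Arr C" and S: "(g, k, h) \<in> Arr (slice C (Cod C f))"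
  shows "pb_pair C h f (k \<cdot> pb1 C g f) (pb2 C g f) \<in> Arr C"
    "Dom C (pb_pair C h f (k \<cdot> pb1 C g f) (pb2 C g f)) = Dom C (pb1 C g f)"
    "Cod C (pb_pair C h f (k \<cdot> pb1 C g f) (pb2 C g f)) = Dom C (pb1 C h f)"
    "pb1 C h f \<cdot> pb_pair C h f (k \<cdot> pb1 C g f) (pb2 C g f) = k \<cdot> pb1 C g f"
    "pb2 C h f \<cdot> pb_pair C h f (k \<cdot> pb1 C g f) (pb2 C g f) = pb2 C g f"
proof -
  have "h \<cdot> (k \<cdot> pb1 C g f) = f \<cdot> pb2 C g f"
    using S f reassoc[of h k g "pb1 C g f"] by (simp add: hom_def pb_comm)
  then show "pb_pair C h f (k \<cdot> pb1 C g f) (pb2 C g f) \<in> Arr C"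
    "Dom C (pb_pair C h f (k \<cdot> pb1 C g f) (pb2 C g f)) = Dom C (pb1 C g f)"
    "Cod C (pb_pair C h f (k \<cdot> pb1 C g f) (pb2 C g f)) = Dom C (pb1 C h f)"
    "pb1 C h f \<cdot> pb_pair C h f (k \<cdot> pb1 C g f) (pb2 C g f) = k \<cdot> pb1 C g f"
    "pb2 C h f \<cdot> pb_pair C h f (k \<cdot> pb1 C g f) (pb2 C g f) = pb2 C g f"
    using S f by (simp_all add: hom_def pb_pair)
qed

lemma is_functor_pull:
  assumes f: "f \<in> Arr C"
  shows "is_functor (slice C (Cod C f)) (slice C (Dom C f)) (pull_func C f)"
proof -
  note p = pull_arr[OF f]
  show ?thesis
    unfolding is_functor_def
  proof (intro conjI ballI impI)
    fix S T assume S: "S \<in> Arr (slice C (Cod C f))" and T: "T \<in> Arr (slice C (Cod C f))"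
      and ST: "Dom (slice C (Cod C f)) T = Cod (slice C (Cod C f)) S"
    obtain g k h l m where e: "S = (g, k, h)" "T = (h, l, m)"
      using ST by (cases S, cases T) simp
    have TS: "(g, l \<cdot> k, m) \<in> Arr (slice C (Cod C f))"
      using S T reassoc[of m l h k] by (simp add: e hom_def)
    note s = sliceD[OF S[unfolded e]] and t = sliceD[OF T[unfolded e]] and ts = sliceD[OF TS]
    show "far (pull_func C f) (T \<cdot>\<^bsub>slice C (Cod C f)\<^esub> S)
      = far (pull_func C f) T \<cdot>\<^bsub>slice C (Dom C f)\<^esub> far (pull_func C f) S"
      using f p[OF S[unfolded e]] p[OF T[unfolded e]]
      by (simp add: e pull_func_def s t, intro pb_pair_eqI)
        (simp_all add: s t reassoc[OF p(4)[OF T[unfolded e]]] reassoc[OF p(5)[OF T[unfolded e]]])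
  next
    fix S assume S: "S \<in> Arr (slice C (Cod C f))"
    obtain g k h where e: "S = (g, k, h)" by (cases S)
    show "far (pull_func C f) S \<in> hom (slice C (Dom C f)) (fob (pull_func C f) (Dom (slice C (Cod C f)) S))
        (fob (pull_func C f) (Cod (slice C (Cod C f)) S))"
      using f p[OF S[unfolded e]] sliceD[OF S[unfolded e]] by (simp add: e pull_func_def hom_def)
  next
    fix g assume "g \<in> Obj (slice C (Cod C f))"
    then show "far (pull_func C f) (Id (slice C (Cod C f)) g) = Id (slice C (Dom C f)) (fob (pull_func C f) g)"
      using f by (simp add: pull_func_def) (rule pb_pair_eqI; simp)
  qed (use f in \<open>simp add: pull_func_def\<close>)
qed

lemma is_functor_post:
  assumes f: "f \<in> Arr C"
  shows "is_functor (slice C (Dom C f)) (slice C (Cod C f)) (post_func C f)"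
  unfolding is_functor_def
proof (intro conjI ballI impI)
  fix S assume "S \<in> Arr (slice C (Dom C f))"
  then show "far (post_func C f) S \<in> hom (slice C (Cod C f)) (fob (post_func C f) (Dom (slice C (Dom C f)) S))
      (fob (post_func C f) (Cod (slice C (Dom C f)) S))"
    using f by (cases S) (simp add: post_func_def hom_def)
next
  fix S T assume "S \<in> Arr (slice C (Dom C f))" "T \<in> Arr (slice C (Dom C f))"
  then show "far (post_func C f) (T \<cdot>\<^bsub>slice C (Dom C f)\<^esub> S)
      = far (post_func C f) T \<cdot>\<^bsub>slice C (Cod C f)\<^esub> far (post_func C f) S"
    by (cases S; cases T) (simp add: post_func_def)
qed (use f in \<open>simp_all add: post_func_def\<close>)

lemma adjunction_base:
  assumes f: "f \<in> Arr C"
  shows "adjunction (slice C (Dom C f)) (slice C (Cod C f)) (base_adj C f)"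
proof -
  note P = functorD[OF is_functor_pull[OF f]]
  have p: "pb_pair C (f \<cdot> x) f (Id C (Dom C x)) x \<in> Arr C"
    "Dom C (pb_pair C (f \<cdot> x) f (Id C (Dom C x)) x) = Dom C x"
    "Cod C (pb_pair C (f \<cdot> x) f (Id C (Dom C x)) x) = Dom C (pb1 C (f \<cdot> x) f)"
    "pb1 C (f \<cdot> x) f \<cdot> pb_pair C (f \<cdot> x) f (Id C (Dom C x)) x = Id C (Dom C x)"
    "pb2 C (f \<cdot> x) f \<cdot> pb_pair C (f \<cdot> x) f (Id C (Dom C x)) x = x"
    if "x \<in> Arr C" "Cod C x = Dom C f" for x
    using that f by (simp_all add: pb_pair)
  note r = pull_arr[OF f]
  have 1: "nat_trans (slice C (Dom C f)) (slice C (Dom C f)) id_func (pull_func C f \<circ>\<^sub>F post_func C f)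
      (unit (base_adj C f))"
    unfolding nat_trans_def
  proof (intro conjI ballI)
    fix S assume S: "S \<in> Arr (slice C (Dom C f))"
    obtain x k y where e: "S = (x, k, y)" by (cases S)
    note t = sliceD[OF S[unfolded e]]
    have s: "(f \<cdot> x, k, f \<cdot> y) \<in> Arr (slice C (Cod C f))"
      using f by (simp add: t hom_def)
    have "pb_pair C (f \<cdot> y) f (Id C (Dom C y)) y \<cdot> k
      = pb_pair C (f \<cdot> y) f (k \<cdot> pb1 C (f \<cdot> x) f) (pb2 C (f \<cdot> x) f) \<cdot> pb_pair C (f \<cdot> x) f (Id C (Dom C x)) x"
      by (rule pb_ext[of "f \<cdot> y" f "pb_pair C (f \<cdot> y) f (Id C (Dom C y)) y \<cdot> k"]) (use f p[of x] p[of y] r[OF s] in \<open>simp_all add: t reassoc[OF p(4)] reassoc[OF p(5)]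
          reassoc[OF r(4)[OF s]] reassoc[OF r(5)[OF s]]\<close>)
    then show "unit (base_adj C f) (Cod (slice C (Dom C f)) S) \<cdot>\<^bsub>slice C (Dom C f)\<^esub> far id_func S
      = far (pull_func C f \<circ>\<^sub>F post_func C f) S \<cdot>\<^bsub>slice C (Dom C f)\<^esub>
        unit (base_adj C f) (Dom (slice C (Dom C f)) S)"
      by (simp add: e base_adj_def pull_func_def post_func_def)
  qed (use f in \<open>simp add: p base_adj_def pull_func_def post_func_def hom_def\<close>)
  have 2: "nat_trans (slice C (Cod C f)) (slice C (Cod C f)) (post_func C f \<circ>\<^sub>F pull_func C f) id_func
      (counit (base_adj C f))"
    unfolding nat_trans_def
  proof (intro conjI ballI)
    fix S assume S: "S \<in> Arr (slice C (Cod C f))"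
    obtain x k y where e: "S = (x, k, y)" by (cases S)
    show "counit (base_adj C f) (Cod (slice C (Cod C f)) S) \<cdot>\<^bsub>slice C (Cod C f)\<^esub>
        far (post_func C f \<circ>\<^sub>F pull_func C f) S
      = far id_func S \<cdot>\<^bsub>slice C (Cod C f)\<^esub> counit (base_adj C f) (Dom (slice C (Cod C f)) S)"
      using f r[OF S[unfolded e]] by (simp add: e base_adj_def pull_func_def post_func_def)
  qed (use f in \<open>simp add: base_adj_def pull_func_def post_func_def hom_def pb_comm\<close>)
  have 4: "pb_pair C y f (pb1 C y f \<cdot> pb1 C (f \<cdot> pb2 C y f) f) (pb2 C (f \<cdot> pb2 C y f) f) \<cdot>
      pb_pair C (f \<cdot> pb2 C y f) f (Id C (Dom C (pb1 C y f))) (pb2 C y f) = Id C (Dom C (pb1 C y f))"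
    if "y \<in> Arr C" "Cod C y = Cod C f" for y
  proof -
    have s: "(f \<cdot> pb2 C y f, pb1 C y f, y) \<in> Arr (slice C (Cod C f))"
      using that f by (simp add: hom_def pb_comm)
    show ?thesis
      by (rule pb_ext[of y f]) (use that f p[of "pb2 C y f"] r[OF s] in \<open>simp_all add: reassoc[OF r(4)[OF s]] reassoc[OF r(5)[OF s]]\<close>)
  qed
  show ?thesis
    unfolding adjunction_def
    using is_functor_pull[OF f] is_functor_post[OF f] 1 2
    by (simp add: base_adj_def) (simp add: pull_func_def post_func_def 4 p f)
qed

lemma exch_arr:
  assumes "p \<in> Arr C" "q \<in> Arr C" "s \<in> Arr C" "t \<in> Arr C" "Dom C s = Dom C p" "Cod C s = Dom C q"
    "Dom C t = Cod C p" "Cod C t = Cod C q" "q \<cdot> s = t \<cdot> p" "y \<in> Arr C" "Cod C y = Cod C p"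
    and e: "e = pb_pair C (t \<cdot> y) q (pb1 C y p) (s \<cdot> pb2 C y p)"
  shows "e \<in> Arr C" "Dom C e = Dom C (pb1 C y p)" "Cod C e = Dom C (pb1 C (t \<cdot> y) q)"
    "pb1 C (t \<cdot> y) q \<cdot> e = pb1 C y p" "pb2 C (t \<cdot> y) q \<cdot> e = s \<cdot> pb2 C y p"
proof -
  have "(t \<cdot> y) \<cdot> pb1 C y p = q \<cdot> (s \<cdot> pb2 C y p)"
    using assms reassoc[OF assms(9), of "pb2 C y p"] by (simp add: pb_comm)
  then show "e \<in> Arr C" "Dom C e = Dom C (pb1 C y p)" "Cod C e = Dom C (pb1 C (t \<cdot> y) q)"
    "pb1 C (t \<cdot> y) q \<cdot> e = pb1 C y p" "pb2 C (t \<cdot> y) q \<cdot> e = s \<cdot> pb2 C y p"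
    using assms by (simp_all add: pb_pair)
qed

lemma nat_trans_exch:
  assumes "p \<in> Arr C" "q \<in> Arr C" "s \<in> Arr C" "t \<in> Arr C" "Dom C s = Dom C p" "Cod C s = Dom C q"
    "Dom C t = Cod C p" "Cod C t = Cod C q" "q \<cdot> s = t \<cdot> p"
  shows "nat_trans (slice C (Cod C p)) (slice C (Dom C q)) (post_func C s \<circ>\<^sub>F pull_func C p)
    (pull_func C q \<circ>\<^sub>F post_func C t) (exch C p q s t)"
  unfolding nat_trans_def
proof (intro conjI ballI)
  note e = exch_arr[OF assms _ _ refl]
  fix y assume "y \<in> Obj (slice C (Cod C p))"
  then show "exch C p q s t y \<in> hom (slice C (Dom C q)) (fob (post_func C s \<circ>\<^sub>F pull_func C p) y)
      (fob (pull_func C q \<circ>\<^sub>F post_func C t) y)"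
    using assms e[of y] by (simp add: hom_def exch_def post_func_def pull_func_def)
next
  note e = exch_arr[OF assms _ _ refl]
  fix S assume S: "S \<in> Arr (slice C (Cod C p))"
  obtain x k y where S': "S = (x, k, y)" by (cases S)
  have k [simp]: "x \<in> Arr C" "y \<in> Arr C" "k \<in> Arr C" "Dom C k = Dom C x" "Cod C k = Dom C y"
    "Cod C x = Cod C p" "Cod C y = Cod C p" "y \<cdot> k = x"
    using S by (auto simp: S' hom_def)
  have s1: "y \<cdot> (k \<cdot> pb1 C x p) = p \<cdot> pb2 C x p"
    using assms reassoc[of y k x "pb1 C x p"] by (simp add: pb_comm)
  have s2: "(t \<cdot> y) \<cdot> (k \<cdot> pb1 C (t \<cdot> x) q) = q \<cdot> pb2 C (t \<cdot> x) q"
    using assms pb_comm[of "t \<cdot> x" q] reassoc[of y k x "pb1 C (t \<cdot> x) q"] by simp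
  note P1 = pb_pair[of y p "k \<cdot> pb1 C x p" "pb2 C x p"] and P2 = pb_pair[of "t \<cdot> y" q "k \<cdot> pb1 C (t \<cdot> x) q" "pb2 C (t \<cdot> x) q"]
    and P2' = pb_pair'[of "t \<cdot> y" q "k \<cdot> pb1 C (t \<cdot> x) q" "pb2 C (t \<cdot> x) q"]
  have "pb_pair C (t \<cdot> y) q (pb1 C y p) (s \<cdot> pb2 C y p) \<cdot> pb_pair C y p (k \<cdot> pb1 C x p) (pb2 C x p)
    = pb_pair C (t \<cdot> y) q (k \<cdot> pb1 C (t \<cdot> x) q) (pb2 C (t \<cdot> x) q) \<cdot> pb_pair C (t \<cdot> x) q (pb1 C x p) (s \<cdot> pb2 C x p)"
    by (rule pb_ext[of "t \<cdot> y" q]) (use assms e[of x] e[of y] s1 s2 in \<open>simp_all add: P1 P2 P2' reassoc[OF e(4)] reassoc[OF e(5)]\<close>)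
  then show "exch C p q s t (Cod (slice C (Cod C p)) S) \<cdot>\<^bsub>slice C (Dom C q)\<^esub> far (post_func C s \<circ>\<^sub>F pull_func C p) S
    = far (pull_func C q \<circ>\<^sub>F post_func C t) S \<cdot>\<^bsub>slice C (Dom C q)\<^esub> exch C p q s t (Dom (slice C (Cod C p)) S)"
    by (simp add: S' exch_def post_func_def pull_func_def)
qed

text \<open>By pullback pasting: if the square is a pullback, then a map to \<open>W \<times>\<^sub>V U\<close>, for \<open>y : W \<rightarrow> Y\<close>, is
  the same as a map to \<open>W \<times>\<^sub>Y X\<close>.\<close>

lemma is_iso_exch:
  assumes "p \<in> Arr C" "q \<in> Arr C" "s \<in> Arr C" "t \<in> Arr C" "Dom C s = Dom C p" "Cod C s = Dom C q"
    "Dom C t = Cod C p" "Cod C t = Cod C q" "q \<cdot> s = t \<cdot> p"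
    and pull: "is_pullback C t q p s" and y [simp]: "y \<in> Arr C" "Cod C y = Cod C p"
  shows "is_iso (slice C (Dom C q)) (exch C p q s t y)"
proof -
  define e where "e = pb_pair C (t \<cdot> y) q (pb1 C y p) (s \<cdot> pb2 C y p)"
  note e = exch_arr[OF assms(1-9) y e_def]
  note ty [simp] = assms(1-8)
  have "Dom C (pb1 C (t \<cdot> y) q) \<in> Obj C" "y \<cdot> pb1 C (t \<cdot> y) q \<in> hom C (Dom C (pb1 C (t \<cdot> y) q)) (Dom C t)"
    "pb2 C (t \<cdot> y) q \<in> hom C (Dom C (pb1 C (t \<cdot> y) q)) (Dom C q)"
    "t \<cdot> (y \<cdot> pb1 C (t \<cdot> y) q) = q \<cdot> pb2 C (t \<cdot> y) q"
    using pb_comm[of "t \<cdot> y" q] by (simp_all add: hom_def)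
  then obtain d where d: "d \<in> hom C (Dom C (pb1 C (t \<cdot> y) q)) (Dom C p)"
    "p \<cdot> d = y \<cdot> pb1 C (t \<cdot> y) q" "s \<cdot> d = pb2 C (t \<cdot> y) q"
    using pull unfolding is_pullback_def by metis
  have [simp]: "d \<in> Arr C" "Dom C d = Dom C (pb1 C (t \<cdot> y) q)" "Cod C d = Dom C p"
    using d(1) by (simp_all add: hom_def)
  define i where "i = pb_pair C y p (pb1 C (t \<cdot> y) q) d"
  have i: "i \<in> Arr C" "Dom C i = Dom C (pb1 C (t \<cdot> y) q)" "Cod C i = Dom C (pb1 C y p)"
    "pb1 C y p \<cdot> i = pb1 C (t \<cdot> y) q" "pb2 C y p \<cdot> i = d"
    using d(2) by (simp_all add: i_def pb_pair)
  have ei: "e \<cdot> i = Id C (Dom C (pb1 C (t \<cdot> y) q))"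
    by (rule pb_ext[of "t \<cdot> y" q]) (use e i d(3) reassoc[OF e(4), of i] reassoc[OF e(5), of i] in simp_all)
  have de: "d \<cdot> e = pb2 C y p"
    by (rule is_pullback_ext[OF pull])
      (use e reassoc[OF d(2), of e] reassoc[OF d(3), of e] pb_comm[of y p] in simp_all)
  have ie: "i \<cdot> e = Id C (Dom C (pb1 C y p))"
    by (rule pb_ext[of y p]) (use e i de reassoc[OF i(4), of e] reassoc[OF i(5), of e] in simp_all)
  have i': "(s \<cdot> pb2 C y p) \<cdot> i = pb2 C (t \<cdot> y) q"
    using i d(3) by simp
  show ?thesis
    unfolding is_iso_def
  proof (intro conjI bexI[of _ "(pb2 C (t \<cdot> y) q, i, s \<cdot> pb2 C y p)"])
  qed (use e i ei ie i' in \<open>simp_all add: exch_def flip: e_def, simp_all add: hom_def\<close>)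
qed

end


section \<open>Pushforward\<close>

lemma lt_comp:
  assumes "category A" "category B" "category D" "adjunction A B \<Lambda>" "adjunction B D \<Lambda>'"
    "d \<in> Obj D" "h \<in> Arr A" "Cod A h = fob (radj \<Lambda>) (fob (radj \<Lambda>') d)"
  shows "ltranspose D (comp_adj A D \<Lambda> \<Lambda>') d h
    = ltranspose D \<Lambda>' d (ltranspose B \<Lambda> (fob (radj \<Lambda>') d) h)"
proof -
  interpret P: adjoint_pair A B \<Lambda> using assms by (simp add: adjoint_pair_def adjoint_pair_axioms_def)
  interpret Q: adjoint_pair B D \<Lambda>' using assms by (simp add: adjoint_pair_def adjoint_pair_axioms_def)
  show ?thesis using assms(6-8) by (simp add: ltranspose_def comp_adj_def)
qed

locale lcc_category = pullback_category +
  assumes push_adj: "p \<in> Arr C \<Longrightarrow> is_push_adj C p (push_adj C p)"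
begin

lemma adjoint_pair_push:
  "p \<in> Arr C \<Longrightarrow> adjoint_pair (slice C (Cod C p)) (slice C (Dom C p)) (push_adj C p)"
  using push_adj[of p] by (simp add: is_push_adj_def adjoint_pair_def adjoint_pair_axioms_def category_slice)

lemma ladj_push [simp]: "p \<in> Arr C \<Longrightarrow> ladj (push_adj C p) = pull_func C p"
  using push_adj[of p] by (simp add: is_push_adj_def)

abbreviation pf :: "'b \<Rightarrow> 'b \<Rightarrow> 'b" where
  "pf p b \<equiv> fob (push_func C p) b"

text \<open>The two transpositions of \<open>p\<^sup>* \<stileturn> p\<^sub>*\<close>, on arrows of \<open>C\<close>. An arrow \<open>w\<close> into the domain of \<open>p\<^sub>* b\<close>
  becomes one of the slice with the structure map \<open>p\<^sub>* b \<cdot> w\<close> on its domain.\<close>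

definition push_sharp :: "'b \<Rightarrow> 'b \<Rightarrow> 'b \<Rightarrow> 'b" where
  "push_sharp p b w = far (slice_forget C)
     (ltranspose (slice C (Dom C p)) (push_adj C p) b (pf p b \<cdot> w, w, pf p b))"

definition push_flat :: "'b \<Rightarrow> 'b \<Rightarrow> 'b \<Rightarrow> 'b \<Rightarrow> 'b" where
  "push_flat p y b k = far (slice_forget C)
     (rtranspose (slice C (Cod C p)) (push_adj C p) y (pb2 C y p, k, b))"

lemma slice_eta:
  assumes "S \<in> Arr (slice C X)" "Dom (slice C X) S = f" "Cod (slice C X) S = g"
  shows "S = (f, far (slice_forget C) S, g)"
  using assms by (cases S) simp

lemma pf_arr [simp]:
  assumes "p \<in> Arr C" "b \<in> Arr C" "Cod C b = Dom C p"
  shows "pf p b \<in> Arr C" "Cod C (pf p b) = Cod C p"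
proof -
  interpret adjoint_pair "slice C (Cod C p)" "slice C (Dom C p)" "push_adj C p"
    using assms by (simp add: adjoint_pair_push)
  show "pf p b \<in> Arr C" "Cod C (pf p b) = Cod C p"
    using R(1)[of b] assms by (simp_all add: push_func_def)
qed

lemma push_slice:
  assumes "p \<in> Arr C" "(b, k, b') \<in> Arr (slice C (Dom C p))"
  shows "far (push_func C p) (b, k, b') = (pf p b, far (slice_forget C) (far (push_func C p) (b, k, b')), pf p b')"
    "(pf p b, far (slice_forget C) (far (push_func C p) (b, k, b')), pf p b') \<in> Arr (slice C (Cod C p))"
proof -
  interpret adjoint_pair "slice C (Cod C p)" "slice C (Dom C p)" "push_adj C p"
    using assms by (simp add: adjoint_pair_push)
  note r = R(2-4)[of "(b, k, b')"]
  show e: "far (push_func C p) (b, k, b') = (pf p b, far (slice_forget C) (far (push_func C p) (b, k, b')), pf p b')"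
    unfolding push_func_def using r assms(2) by (intro slice_eta[where X = "Cod C p"]) simp_all
  show "(pf p b, far (slice_forget C) (far (push_func C p) (b, k, b')), pf p b') \<in> Arr (slice C (Cod C p))"
    using r(1) assms(2) e by (simp add: push_func_def)
qed

lemma lt_push:
  assumes p: "p \<in> Arr C" and b: "b \<in> Arr C" "Cod C b = Dom C p" and w: "w \<in> Arr C" "Cod C w = Dom C (pf p b)"
    and y: "y = pf p b \<cdot> w"
  shows "ltranspose (slice C (Dom C p)) (push_adj C p) b (y, w, pf p b) = (pb2 C y p, push_sharp p b w, b)"
    and "(pb2 C y p, push_sharp p b w, b) \<in> Arr (slice C (Dom C p))"
proof -
  interpret adjoint_pair "slice C (Cod C p)" "slice C (Dom C p)" "push_adj C p"
    using p by (rule adjoint_pair_push)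
  let ?h = "(y, w, pf p b)"
  have h: "?h \<in> Arr (slice C (Cod C p))" using assms by (simp add: hom_def)
  have c: "Cod (slice C (Cod C p)) ?h = fob (radj (push_adj C p)) b"
    by (simp add: push_func_def)
  note l = lt_arr[OF h _ c]
  have "ltranspose (slice C (Dom C p)) (push_adj C p) b ?h =
    (pb2 C y p, far (slice_forget C) (ltranspose (slice C (Dom C p)) (push_adj C p) b ?h), b)"
    using l b p by (intro slice_eta) (simp_all add: pull_func_def)
  then show e: "ltranspose (slice C (Dom C p)) (push_adj C p) b ?h = (pb2 C y p, push_sharp p b w, b)"
    by (simp add: push_sharp_def y)
  show "(pb2 C y p, push_sharp p b w, b) \<in> Arr (slice C (Dom C p))"
    using l(1) b e by simp
qed

lemma push_sharp:
  assumes p: "p \<in> Arr C" and b: "b \<in> Arr C" "Cod C b = Dom C p" and w: "w \<in> Arr C" "Cod C w = Dom C (pf p b)"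
  shows "push_sharp p b w \<in> Arr C" "Dom C (push_sharp p b w) = Dom C (pb1 C (pf p b \<cdot> w) p)"
    "Cod C (push_sharp p b w) = Dom C b" "b \<cdot> push_sharp p b w = pb2 C (pf p b \<cdot> w) p"
  using sliceD[OF lt_push(2)[OF assms refl]] assms by simp_all

lemma push_flat:
  assumes p: "p \<in> Arr C" and b: "b \<in> Arr C" "Cod C b = Dom C p" and y: "y \<in> Arr C" "Cod C y = Cod C p"
    and k: "k \<in> Arr C" "Dom C k = Dom C (pb1 C y p)" "Cod C k = Dom C b" "b \<cdot> k = pb2 C y p"
  shows "push_flat p y b k \<in> Arr C" "Dom C (push_flat p y b k) = Dom C y"
    "Cod C (push_flat p y b k) = Dom C (pf p b)" "pf p b \<cdot> push_flat p y b k = y"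
    "push_sharp p b (push_flat p y b k) = k"
    "rtranspose (slice C (Cod C p)) (push_adj C p) y (pb2 C y p, k, b) = (y, push_flat p y b k, pf p b)"
proof -
  interpret adjoint_pair "slice C (Cod C p)" "slice C (Dom C p)" "push_adj C p"
    using p by (rule adjoint_pair_push)
  let ?k = "(pb2 C y p, k, b)"
  have k': "?k \<in> Arr (slice C (Dom C p))" using assms by (simp add: hom_def)
  have d: "Dom (slice C (Dom C p)) ?k = fob (ladj (push_adj C p)) y"
    using p by (simp add: pull_func_def)
  have y': "y \<in> Obj (slice C (Cod C p))" using y by simp
  note r = rt_arr[OF k' y' d]
  show e: "rtranspose (slice C (Cod C p)) (push_adj C p) y ?k = (y, push_flat p y b k, pf p b)"
    using r slice_eta[OF r(1)] by (simp add: push_flat_def push_func_def)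
  note f = sliceD[OF r(1)[unfolded e]]
  show f': "push_flat p y b k \<in> Arr C" "Dom C (push_flat p y b k) = Dom C y"
    "Cod C (push_flat p y b k) = Dom C (pf p b)" "pf p b \<cdot> push_flat p y b k = y"
    using f by simp_all
  show "push_sharp p b (push_flat p y b k) = k"
    using lt_rt[OF k' y' d, of b] lt_push(1)[OF p b f'(1,3) f'(4)[symmetric]] by (simp add: e)
qed

lemma push_sharp_inj:
  assumes p: "p \<in> Arr C" and b: "b \<in> Arr C" "Cod C b = Dom C p"
    and w: "w \<in> Arr C" "Cod C w = Dom C (pf p b)" and w': "w' \<in> Arr C" "Cod C w' = Dom C (pf p b)"
    and e: "pf p b \<cdot> w = pf p b \<cdot> w'" "push_sharp p b w = push_sharp p b w'"
  shows "w = w'"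
proof -
  interpret adjoint_pair "slice C (Cod C p)" "slice C (Dom C p)" "push_adj C p"
    using p by (rule adjoint_pair_push)
  have d: "Dom C w = Dom C w'"
    using assms cmp_arr(2)[of w "pf p b"] cmp_arr(2)[of w' "pf p b"] by simp
  have "(pf p b \<cdot> w, w, pf p b) = (pf p b \<cdot> w', w', pf p b)"
    by (rule lt_inj[of b]) (use lt_push(1)[OF p b w refl] lt_push(1)[OF p b w' refl] assms d
      in \<open>simp_all add: hom_def\<close>, simp_all add: push_func_def)
  then show ?thesis by simp
qed

abbreviation pull_map :: "'b \<Rightarrow> 'b \<Rightarrow> 'b \<Rightarrow> 'b" where
  "pull_map p y v \<equiv> pb_pair C y p (v \<cdot> pb1 C (y \<cdot> v) p) (pb2 C (y \<cdot> v) p)"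

lemma push_sharp_cmp:
  assumes p: "p \<in> Arr C" and b: "b \<in> Arr C" "Cod C b = Dom C p"
    and w: "w \<in> Arr C" "Cod C w = Dom C (pf p b)" and v: "v \<in> Arr C" "Cod C v = Dom C w"
  shows "push_sharp p b (w \<cdot> v) = push_sharp p b w \<cdot> pull_map p (pf p b \<cdot> w) v"
proof -
  interpret adjoint_pair "slice C (Cod C p)" "slice C (Dom C p)" "push_adj C p"
    using p by (rule adjoint_pair_push)
  let ?h = "(pf p b \<cdot> w, w, pf p b)" and ?v = "((pf p b \<cdot> w) \<cdot> v, v, pf p b \<cdot> w)"
  have 1: "?h \<in> Arr (slice C (Cod C p))" "?v \<in> Arr (slice C (Cod C p))"
    using assms by (simp_all add: hom_def)
  have 2: "?h \<cdot>\<^bsub>slice C (Cod C p)\<^esub> ?v = (pf p b \<cdot> (w \<cdot> v), w \<cdot> v, pf p b)"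
    using assms by simp
  have 3: "far (ladj (push_adj C p)) ?v = (pb2 C (pf p b \<cdot> (w \<cdot> v)) p, pull_map p (pf p b \<cdot> w) v, pb2 C (pf p b \<cdot> w) p)"
    using assms by (simp add: pull_func_def)
  show ?thesis
    using lt_cmp[OF 1, of b] lt_push(1)[OF p b w refl] lt_push(1)[OF p b _ _ refl, of "w \<cdot> v"] assms
    unfolding 2 3 by (simp add: push_func_def)
qed

lemma push_sharp_push:
  assumes p: "p \<in> Arr C" and k: "(b, k, b') \<in> Arr (slice C (Dom C p))"
    and w: "w \<in> Arr C" "Cod C w = Dom C (pf p b)"
  shows "push_sharp p b' (far (slice_forget C) (far (push_func C p) (b, k, b')) \<cdot> w) = k \<cdot> push_sharp p b w"
proof -
  interpret adjoint_pair "slice C (Cod C p)" "slice C (Dom C p)" "push_adj C p"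
    using p by (rule adjoint_pair_push)
  let ?h = "(pf p b \<cdot> w, w, pf p b)" and ?k = "far (slice_forget C) (far (push_func C p) (b, k, b'))"
  note pk = push_slice[OF p k] and kk = sliceD[OF k]
  note pk' = sliceD[OF pk(2)]
  have 1: "?h \<in> Arr (slice C (Cod C p))"
    using w p kk by (simp add: hom_def)
  have e: "pf p b \<cdot> w = pf p b' \<cdot> (?k \<cdot> w)"
    using reassoc[OF pk'(8), of w] w pk' by simp
  have 2: "far (radj (push_adj C p)) (b, k, b') \<cdot>\<^bsub>slice C (Cod C p)\<^esub> ?h = (pf p b \<cdot> w, ?k \<cdot> w, pf p b')"
    using pk(1) by (simp add: push_func_def) (metis slice_simps(6))
  show ?thesis
    using lt_radj[OF 1 k, of b'] lt_push(1)[OF p kk(1,2) w refl] lt_push(1)[OF p kk(3,4) _ _ e] w pk' kk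
    unfolding 2 by (simp add: push_func_def)
qed

text \<open>The last claim computes the transpose of a composite with the mate, first along \<open>p\<^sup>* \<stileturn> p\<^sub>*\<close>
  and then along \<open>s\<^sub>! \<stileturn> s\<^sup>*\<close>, where transposing is composing with the projection \<open>pb1 C b s\<close>. It is
  through this formula that the mate is compared with fillers.\<close>

lemma
  assumes sq: "p \<in> Arr C" "q \<in> Arr C" "s \<in> Arr C" "t \<in> Arr C" "Dom C s = Dom C p" "Cod C s = Dom C q"
    "Dom C t = Cod C p" "Cod C t = Cod C q" "q \<cdot> s = t \<cdot> p" and b: "b \<in> Arr C" "Cod C b = Dom C q"
  shows nat_trans_exch_mate: "nat_trans (slice C (Dom C q)) (slice C (Cod C p))
      (pull_func C t \<circ>\<^sub>F push_func C q) (push_func C p \<circ>\<^sub>F pull_func C s) (exch_mate C p q s t)"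
    and exch_mate: "(pb2 C (pf q b) t, far (slice_forget C) (exch_mate C p q s t b), pf p (pb2 C b s)) \<in> Arr (slice C (Cod C p))"
    "exch_mate C p q s t b = (pb2 C (pf q b) t, far (slice_forget C) (exch_mate C p q s t b), pf p (pb2 C b s))"
    "is_pullback C t q p s \<Longrightarrow> is_iso (slice C (Cod C p)) (exch_mate C p q s t b)"
    "w \<in> Arr C \<Longrightarrow> Cod C w = Dom C (pb1 C (pf q b) t) \<Longrightarrow> y = pb2 C (pf q b) t \<cdot> w \<Longrightarrow>
      pb1 C b s \<cdot> push_sharp p (pb2 C b s) (far (slice_forget C) (exch_mate C p q s t b) \<cdot> w)
      = push_sharp q b (pb1 C (pf q b) t \<cdot> w) \<cdot> pb_pair C (t \<cdot> y) q (pb1 C y p) (s \<cdot> pb2 C y p)"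
proof -
  let ?A = "slice C (Cod C p)" and ?B = "slice C (Dom C q)"
  let ?L1 = "comp_adj ?A ?B (push_adj C p) (base_adj C s)" and ?L2 = "comp_adj ?A ?B (base_adj C t) (push_adj C q)"
  have adj: "adjunction ?A (slice C (Dom C p)) (push_adj C p)" "adjunction (slice C (Dom C p)) ?B (base_adj C s)"
    "adjunction ?A (slice C (Cod C q)) (base_adj C t)" "adjunction (slice C (Cod C q)) ?B (push_adj C q)"
    using push_adj[OF sq(1)] push_adj[OF sq(2)] adjunction_base[OF sq(3)] adjunction_base[OF sq(4)] sq
    by (simp_all add: is_push_adj_def)
  have 1: "adjoint_pair ?A ?B ?L1" "adjoint_pair ?A ?B ?L2"
    using adjunction_comp[OF category_slice category_slice category_slice adj(1,2)]
      adjunction_comp[OF category_slice category_slice category_slice adj(3,4)]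
    by (simp_all add: adjoint_pair_def adjoint_pair_axioms_def category_slice)
  have 2: "nat_trans ?A ?B (ladj ?L1) (ladj ?L2) (exch C p q s t)"
    using nat_trans_exch[OF sq] sq by (simp add: comp_adj_def base_adj_def)
  have m: "exch_mate C p q s t b = mate ?A ?L1 ?L2 (exch C p q s t) b"
    by (simp add: exch_mate_def Let_def)
  have m': "exch_mate C p q s t = mate ?A ?L1 ?L2 (exch C p q s t)"
    by (simp add: exch_mate_def Let_def)
  show "nat_trans ?B ?A (pull_func C t \<circ>\<^sub>F push_func C q) (push_func C p \<circ>\<^sub>F pull_func C s) (exch_mate C p q s t)"
    using nat_trans_mate[OF 1 2] unfolding m' by (simp add: comp_adj_def base_adj_def push_func_def)
  have b': "b \<in> Obj ?B" using b by simp
  have r1: "fob (radj ?L1) b = pf p (pb2 C b s)"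
    by (simp add: comp_adj_def base_adj_def pull_func_def push_func_def)
  have r2: "fob (radj ?L2) b = pb2 C (pf q b) t"
    by (simp add: comp_adj_def base_adj_def pull_func_def push_func_def)
  note M = lt_mate[OF 1 2 b', unfolded r1 r2, folded m]
  show m2: "exch_mate C p q s t b = (pb2 C (pf q b) t, far (slice_forget C) (exch_mate C p q s t b), pf p (pb2 C b s))"
    using M(1-3) by (rule slice_eta)
  show m1: "(pb2 C (pf q b) t, far (slice_forget C) (exch_mate C p q s t b), pf p (pb2 C b s)) \<in> Arr ?A"
    using M(1) m2 by simp
  show "is_iso ?A (exch_mate C p q s t b)" if "is_pullback C t q p s"
    unfolding m by (rule is_iso_mate[OF 1 2 b']) (simp add: is_iso_exch[OF sq that])
  let ?m = "far (slice_forget C) (exch_mate C p q s t b)"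
  note m' = sliceD[OF m1]
  show "pb1 C b s \<cdot> push_sharp p (pb2 C b s) (?m \<cdot> w)
      = push_sharp q b (pb1 C (pf q b) t \<cdot> w) \<cdot> pb_pair C (t \<cdot> y) q (pb1 C y p) (s \<cdot> pb2 C y p)"
    if w: "w \<in> Arr C" "Cod C w = Dom C (pb1 C (pf q b) t)" and y: "y = pb2 C (pf q b) t \<cdot> w"
  proof -
    let ?h = "(y, w, pb2 C (pf q b) t)"
    have h: "?h \<in> Arr ?A" using w sq b by (simp add: hom_def y)
    have c: "exch_mate C p q s t b \<cdot>\<^bsub>?A\<^esub> ?h = (y, ?m \<cdot> w, pf p (pb2 C b s))"
      by (subst m2) simp
    have y1: "y = pf p (pb2 C b s) \<cdot> (?m \<cdot> w)"
      using reassoc[OF m'(8), of w] w m' sq b by (simp add: y)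
    have y2: "t \<cdot> y = pf q b \<cdot> (pb1 C (pf q b) t \<cdot> w)"
      using pb_comm'[of "pf q b" t w] sq b w by (simp add: y)
    have pt: "(y, ?m \<cdot> w, pf p (pb2 C b s)) \<in> Arr ?A"
      using m' w sq b y1 by (simp add: hom_def)
    have l1: "ltranspose ?B ?L1 b (y, ?m \<cdot> w, pf p (pb2 C b s))
      = ltranspose ?B (base_adj C s) b (pb2 C y p, push_sharp p (pb2 C b s) (?m \<cdot> w), pb2 C b s)"
    proof -
      have r: "fob (radj (base_adj C s)) b = pb2 C b s" by (simp add: base_adj_def pull_func_def)
      have "ltranspose (slice C (Dom C p)) (push_adj C p) (pb2 C b s) (y, ?m \<cdot> w, pf p (pb2 C b s))
        = (pb2 C y p, push_sharp p (pb2 C b s) (?m \<cdot> w), pb2 C b s)"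
        using sq b w m' by (intro lt_push(1) y1) simp_all
      then show ?thesis
        using lt_comp[OF category_slice category_slice category_slice adj(1,2) b' pt] by (simp add: r push_func_def)
    qed
    have l2: "ltranspose ?B ?L2 b ?h
      = (pb2 C (t \<cdot> y) q, push_sharp q b (pb1 C (pf q b) t \<cdot> w), b)"
    proof -
      have r: "fob (radj (base_adj C t)) (pf q b) = pb2 C (pf q b) t" by (simp add: base_adj_def pull_func_def)
      have "ltranspose (slice C (Cod C q)) (base_adj C t) (pf q b) ?h = (t \<cdot> y, pb1 C (pf q b) t \<cdot> w, pf q b)"
        by (simp add: ltranspose_def base_adj_def post_func_def)
      moreover have "ltranspose ?B (push_adj C q) b (t \<cdot> y, pb1 C (pf q b) t \<cdot> w, pf q b)
        = (pb2 C (t \<cdot> y) q, push_sharp q b (pb1 C (pf q b) t \<cdot> w), b)"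
        using sq b w by (intro lt_push(1) y2) simp_all
      moreover have "Cod ?A ?h = fob (radj (base_adj C t)) (fob (radj (push_adj C q)) b)"
        using r by (simp add: push_func_def)
      ultimately show ?thesis
        using lt_comp[OF category_slice category_slice category_slice adj(3,4) b' h] by (simp add: push_func_def)
    qed
    have "ltranspose ?B ?L1 b (exch_mate C p q s t b \<cdot>\<^bsub>?A\<^esub> ?h)
      = ltranspose ?B ?L2 b ?h \<cdot>\<^bsub>?B\<^esub> exch C p q s t y"
      using M(4)[OF h] by simp
    then show ?thesis
      unfolding c l1 l2 by (simp add: ltranspose_def base_adj_def post_func_def exch_def)
  qed
qed

end


section \<open>Pushouts and initial objects\<close>

lemma small_finite:
  assumes "infinite (UNIV :: 'u set)" "finite (X :: 'u set)"
  shows "small TYPE('u) X"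
  unfolding small_def using assms
  by (intro finite_ordLess_infinite) (auto simp: card_of_well_order_on Field_card_of)

context category
begin

lemma is_pushout_ext:
  assumes "is_pushout C f g p q" "h \<in> Arr C" "h' \<in> Arr C" "Dom C h = Cod C p" "Dom C h' = Cod C p"
    "Cod C h = Cod C h'" "h \<cdot> p = h' \<cdot> p" "h \<cdot> q = h' \<cdot> q"
  shows "h = h'"
proof -
  note po = assms(1)[unfolded is_pushout_def]
  have "(h \<cdot> p) \<cdot> f = (h \<cdot> q) \<cdot> g"
    using po assms by simp
  moreover have "Cod C h \<in> Obj C" "h \<cdot> p \<in> hom C (Cod C f) (Cod C h)" "h \<cdot> q \<in> hom C (Cod C g) (Cod C h)"
    using po assms by (simp_all add: hom_def)
  ultimately have "\<exists>!k. k \<in> hom C (Cod C p) (Cod C h) \<and> k \<cdot> p = h \<cdot> p \<and> k \<cdot> q = h \<cdot> q"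
    using po by blast
  moreover have "h \<in> hom C (Cod C p) (Cod C h)" "h' \<in> hom C (Cod C p) (Cod C h)"
    using assms by (simp_all add: hom_def)
  ultimately show ?thesis using assms(7,8) by metis
qed

lemma po_copair:
  assumes "\<exists>p q. is_pushout C f g p q" "a \<in> Arr C" "b \<in> Arr C" "Cod C a = Cod C b"
    "Dom C a = Cod C f" "Dom C b = Cod C g" "a \<cdot> f = b \<cdot> g"
  shows "po_copair C f g a b \<in> Arr C" "Cod C (po_copair C f g a b) = Cod C a"
    "Dom C (po_copair C f g a b) = Cod C (po1 C f g)"
    "po_copair C f g a b \<cdot> po1 C f g = a" "po_copair C f g a b \<cdot> po2 C f g = b"
proof -
  have po: "is_pushout C f g (po1 C f g) (po2 C f g)"
  proof -
    obtain p q where "is_pushout C f g p q" using assms(1) by blast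
    then have "is_pushout C f g (fst (p, q)) (snd (p, q))" by simp
    then show ?thesis unfolding po_def by (rule someI)
  qed
  have "Cod C a \<in> Obj C" "a \<in> hom C (Cod C f) (Cod C a)" "b \<in> hom C (Cod C g) (Cod C a)"
    using assms by (simp_all add: hom_def)
  then have "\<exists>!h. h \<in> hom C (Cod C (po1 C f g)) (Cod C a) \<and> h \<cdot> po1 C f g = a \<and> h \<cdot> po2 C f g = b"
    using po assms(7) unfolding is_pushout_def by blast
  from theI'[OF this] show "po_copair C f g a b \<in> Arr C" "Cod C (po_copair C f g a b) = Cod C a"
    "Dom C (po_copair C f g a b) = Cod C (po1 C f g)"
    "po_copair C f g a b \<cdot> po1 C f g = a" "po_copair C f g a b \<cdot> po2 C f g = b"
    unfolding po_copair_def hom_def by auto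
qed

lemma is_pushout_po:
  assumes "\<exists>p q. is_pushout C f g p q"
  shows "is_pushout C f g (po1 C f g) (po2 C f g)"
proof -
  obtain p q where "is_pushout C f g p q" using assms by blast
  then have "is_pushout C f g (fst (p, q)) (snd (p, q))" by simp
  then show ?thesis unfolding po_def by (rule someI)
qed

lemma initial_from_cocomplete:
  assumes "cocomplete TYPE('u) C" "infinite (UNIV :: 'u set)"
  shows "\<exists>z. initial C z"
proof -
  let ?J = "\<lparr>Obj = {}, Arr = {}, Dom = undefined, Cod = undefined, Id = undefined, Cmp = undefined\<rparr> :: ('u, 'u) cat"
  let ?D = "\<lparr>fob = undefined, far = undefined\<rparr> :: ('u, 'u, 'o, 'm) func"
  note fin = small_finite[OF assms(2)]
  have "small_category TYPE('u) ?J" "is_functor ?J C ?D"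
    by (auto simp: small_category_def category_def is_functor_def hom_def fin)
  then obtain z \<tau> where "is_colimit ?J C ?D z \<tau>"
    using assms(1) unfolding cocomplete_def by blast
  then have "initial C z"
    by (auto simp: is_colimit_def cocone_def initial_def)
  then show ?thesis by blast
qed

text \<open>Cocompleteness speaks of diagrams whose shape is carved out of the type that measures
  smallness, so the shape of a pushout has to be embedded in that type.\<close>

lemma pushout_from_cocomplete:
  assumes "cocomplete TYPE('u) C" "infinite (UNIV :: 'u set)" "f \<in> Arr C" "g \<in> Arr C" "Dom C f = Dom C g"
  shows "\<exists>p q. is_pushout C f g p q"
proof -
  \<comment> \<open>The span \<open>5 \<leftarrow> 0 \<rightarrow> 2\<close>, whose identities are its objects; \<open>3\<close> and \<open>4\<close> are its two legs.\<close>
  obtain e :: "nat \<Rightarrow> 'u" where e: "inj e"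
    using infinite_countable_subset[OF assms(2)] by blast
  have ee [simp]: "e i = e j \<longleftrightarrow> i = j" for i j using e by (simp add: inj_eq)
  let ?J = "\<lparr>Obj = {e 0, e 5, e 2}, Arr = {e 0, e 5, e 2, e 3, e 4},
    Dom = (\<lambda>x. if x = e 3 \<or> x = e 4 then e 0 else x),
    Cod = (\<lambda>x. if x = e 3 then e 5 else if x = e 4 then e 2 else x), Id = (\<lambda>x. x),
    Cmp = (\<lambda>y x. if x = e 3 \<or> x = e 4 then x else y)\<rparr> :: ('u, 'u) cat"
  define ob where "ob = (\<lambda>x. if x = e 0 then Dom C f else if x = e 5 then Cod C f else Cod C g)"
  define ar where "ar = (\<lambda>x. if x = e 3 then f else if x = e 4 then g else Id C (ob x))"
  let ?D = "\<lparr>fob = ob, far = ar\<rparr> :: ('u, 'u, 'o, 'm) func"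
  note fin = small_finite[OF assms(2)]
  have 1: "small_category TYPE('u) ?J"
    by (auto simp: small_category_def category_def hom_def fin)
  have o [simp]: "ob (e 0) = Dom C f" "ob (e 5) = Cod C f" "ob (e 2) = Cod C g"
    by (simp_all add: ob_def)
  have a [simp]: "ar (e 3) = f" "ar (e 4) = g" "ar (e 0) = Id C (Dom C f)" "ar (e 5) = Id C (Cod C f)"
    "ar (e 2) = Id C (Cod C g)"
    by (simp_all add: ar_def)
  have oO: "ob x \<in> Obj C" for x using assms by (simp add: ob_def)
  have 2: "is_functor ?J C ?D"
    using assms(3-5) oO by (auto simp: is_functor_def hom_def)
  obtain z \<tau> where z: "is_colimit ?J C ?D z \<tau>"
    using assms(1) 1 2 unfolding cocomplete_def by blast
  note cz = z[unfolded is_colimit_def cocone_def]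
  have \<tau>: "\<tau> (e 0) \<in> hom C (Dom C f) z" "\<tau> (e 5) \<in> hom C (Cod C f) z" "\<tau> (e 2) \<in> hom C (Cod C g) z"
    "\<tau> (e 5) \<cdot> f = \<tau> (e 0)" "\<tau> (e 2) \<cdot> g = \<tau> (e 0)"
    using cz by auto
  have "is_pushout C f g (\<tau> (e 5)) (\<tau> (e 2))"
    unfolding is_pushout_def
  proof (intro conjI ballI impI)
    fix x a b assume x: "x \<in> Obj C" and ab: "a \<in> hom C (Cod C f) x" "b \<in> hom C (Cod C g) x" "a \<cdot> f = b \<cdot> g"
    define \<sigma> where "\<sigma> = (\<lambda>y. if y = e 0 then a \<cdot> f else if y = e 5 then a else b)"
    have "cocone ?J C ?D x \<sigma>"
      using x ab assms(3-5) by (auto simp: cocone_def \<sigma>_def hom_def)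
    then have "\<exists>!h. h \<in> hom C z x \<and> (\<forall>j \<in> Obj ?J. h \<cdot> \<tau> j = \<sigma> j)"
      using z unfolding is_colimit_def by blast
    moreover have "(\<forall>j \<in> Obj ?J. h \<cdot> \<tau> j = \<sigma> j) \<longleftrightarrow> h \<cdot> \<tau> (e 5) = a \<and> h \<cdot> \<tau> (e 2) = b"
      if "h \<in> hom C z x" for h
    proof -
      have "h \<cdot> \<tau> (e 0) = (h \<cdot> \<tau> (e 5)) \<cdot> f"
        using \<tau> that assms(3,4) by (auto simp: hom_def)
      then show ?thesis by (auto simp: \<sigma>_def)
    qed
    moreover have "Cod C (\<tau> (e 5)) = z" using \<tau> by (simp add: hom_def)
    ultimately show "\<exists>!h. h \<in> hom C (Cod C (\<tau> (e 5))) x \<and> h \<cdot> \<tau> (e 5) = a \<and> h \<cdot> \<tau> (e 2) = b"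
      by (metis (no_types, lifting))
  qed (use \<tau> assms(3-5) in \<open>simp_all add: hom_def\<close>)
  then show ?thesis by blast
qed

end

context adjoint_pair
begin

text \<open>For \<open>I \<otimes> (-)\<close> this means that homotopies on a pushout, in particular on the domain of a Leibniz
  product, can be defined and compared on the two summands.\<close>

lemma is_pushout_ladj:
  assumes "is_pushout A f g p q"
  shows "is_pushout B (far (ladj \<Lambda>) f) (far (ladj \<Lambda>) g) (far (ladj \<Lambda>) p) (far (ladj \<Lambda>) q)"
proof -
  let ?L = "far (ladj \<Lambda>)"
  note po = assms[unfolded is_pushout_def]
  have po' [simp]: "f \<in> Arr A" "g \<in> Arr A" "p \<in> Arr A" "q \<in> Arr A" "Dom A f = Dom A g" "Cod A p = Cod A q"
    "Dom A p = Cod A f" "Dom A q = Cod A g"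
    using po by auto
  show ?thesis
    unfolding is_pushout_def
  proof (intro conjI ballI impI)
    show "?L p \<cdot>\<^bsub>B\<^esub> ?L f = ?L q \<cdot>\<^bsub>B\<^esub> ?L g"
      using po L(6)[of f p] L(6)[of g q] by simp
    fix x a b assume x: "x \<in> Obj B" and ab: "a \<in> hom B (Cod B (?L f)) x" "b \<in> hom B (Cod B (?L g)) x"
      "a \<cdot>\<^bsub>B\<^esub> ?L f = b \<cdot>\<^bsub>B\<^esub> ?L g"
    have ab' [simp]: "a \<in> Arr B" "Dom B a = fob (ladj \<Lambda>) (Cod A f)" "Cod B a = x"
      "b \<in> Arr B" "Dom B b = fob (ladj \<Lambda>) (Cod A g)" "Cod B b = x" and x' [simp]: "x \<in> Obj B"
      using ab x by (simp_all add: hom_def)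
    define a' b' where "a' = rtranspose A \<Lambda> (Cod A f) a" and "b' = rtranspose A \<Lambda> (Cod A g) b"
    have [simp]: "a' \<in> Arr A" "Dom A a' = Cod A f" "Cod A a' = fob (radj \<Lambda>) x"
      "b' \<in> Arr A" "Dom A b' = Cod A g" "Cod A b' = fob (radj \<Lambda>) x"
      by (simp_all add: a'_def b'_def)
    have "a' \<cdot>\<^bsub>A\<^esub> f = b' \<cdot>\<^bsub>A\<^esub> g"
      using rt_ladj[of a f "Dom A f"] rt_ladj[of b g "Dom A f"] ab by (simp add: a'_def b'_def)
    moreover have "fob (radj \<Lambda>) x \<in> Obj A" "a' \<in> hom A (Cod A f) (fob (radj \<Lambda>) x)"
      "b' \<in> hom A (Cod A g) (fob (radj \<Lambda>) x)"
      by (simp_all add: hom_def)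
    ultimately obtain h where h: "h \<in> hom A (Cod A p) (fob (radj \<Lambda>) x)" "h \<cdot>\<^bsub>A\<^esub> p = a'" "h \<cdot>\<^bsub>A\<^esub> q = b'"
      using po by metis
    have [simp]: "h \<in> Arr A" "Dom A h = Cod A q" "Cod A h = fob (radj \<Lambda>) x"
      using h(1) by (simp_all add: hom_def)
    let ?h = "ltranspose B \<Lambda> x h"
    show "\<exists>!h. h \<in> hom B (Cod B (?L p)) x \<and> h \<cdot>\<^bsub>B\<^esub> ?L p = a \<and> h \<cdot>\<^bsub>B\<^esub> ?L q = b"
    proof (rule ex1I[of _ ?h])
      show "?h \<in> hom B (Cod B (?L p)) x \<and> ?h \<cdot>\<^bsub>B\<^esub> ?L p = a \<and> ?h \<cdot>\<^bsub>B\<^esub> ?L q = b"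
        using lt_cmp[of h p x] lt_cmp[of h q x] h(2,3) by (simp add: hom_def) (simp add: a'_def b'_def)
      fix k assume k: "k \<in> hom B (Cod B (?L p)) x \<and> k \<cdot>\<^bsub>B\<^esub> ?L p = a \<and> k \<cdot>\<^bsub>B\<^esub> ?L q = b"
      then have k' [simp]: "k \<in> Arr B" "Dom B k = fob (ladj \<Lambda>) (Cod A q)" "Cod B k = x"
        by (simp_all add: hom_def)
      have "rtranspose A \<Lambda> (Cod A q) k = h"
      proof (rule A.is_pushout_ext[OF assms])
        show "rtranspose A \<Lambda> (Cod A q) k \<cdot>\<^bsub>A\<^esub> p = h \<cdot>\<^bsub>A\<^esub> p" "rtranspose A \<Lambda> (Cod A q) k \<cdot>\<^bsub>A\<^esub> q = h \<cdot>\<^bsub>A\<^esub> q"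
          using rt_ladj[of k p "Cod A f"] rt_ladj[of k q "Cod A g"] k h(2,3) by (simp_all add: a'_def b'_def)
      qed simp_all
      then show "k = ?h" by auto
    qed
  qed simp_all
qed

lemma initial_ladj:
  assumes "initial A z"
  shows "initial B (fob (ladj \<Lambda>) z)"
  unfolding initial_def
proof (intro conjI ballI)
  have z [simp]: "z \<in> Obj A" using assms by (simp add: initial_def)
  show "fob (ladj \<Lambda>) z \<in> Obj B" by simp
  fix x assume x [simp]: "x \<in> Obj B"
  then have "\<exists>!h. h \<in> hom A z (fob (radj \<Lambda>) x)" using assms by (simp add: initial_def)
  then obtain h where h: "h \<in> hom A z (fob (radj \<Lambda>) x)" "\<And>h'. h' \<in> hom A z (fob (radj \<Lambda>) x) \<Longrightarrow> h' = h"
    by blast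
  show "\<exists>!k. k \<in> hom B (fob (ladj \<Lambda>) z) x"
  proof (rule ex1I[of _ "ltranspose B \<Lambda> x h"])
    show "ltranspose B \<Lambda> x h \<in> hom B (fob (ladj \<Lambda>) z) x" using h(1) by (simp add: hom_def)
    fix k assume k: "k \<in> hom B (fob (ladj \<Lambda>) z) x"
    then have "rtranspose A \<Lambda> z k = h" by (intro h(2)) (simp add: hom_def)
    then show "k = ltranspose B \<Lambda> x h" using k by (auto simp: hom_def)
  qed
qed

end


section \<open>Lifting coalgebras against algebras\<close>

lemma arrow_cat_simps [simp]:
  "Obj (arrow_cat C) = Arr C"
  "(f, a, b, g) \<in> Arr (arrow_cat C) \<longleftrightarrow> f \<in> Arr C \<and> g \<in> Arr C \<and> a \<in> hom C (Dom C f) (Dom C g) \<and>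
     b \<in> hom C (Cod C f) (Cod C g) \<and> g \<cdot>\<^bsub>C\<^esub> a = b \<cdot>\<^bsub>C\<^esub> f"
  "Dom (arrow_cat C) (f, a, b, g) = f" "Cod (arrow_cat C) (f, a, b, g) = g"
  "Id (arrow_cat C) f = (f, Id C (Dom C f), Id C (Cod C f), f)"
  "(g', a', b', h) \<cdot>\<^bsub>arrow_cat C\<^esub> (f, a, b, g) = (f, a' \<cdot>\<^bsub>C\<^esub> a, b' \<cdot>\<^bsub>C\<^esub> b, h)"
  by (simp_all add: arrow_cat_def)

lemma top_bot_simps [simp]: "top_of (f, a, b, g) = a" "bot_of (f, a, b, g) = b"
  by (simp_all add: top_of_def bot_of_def)

lemma squareD:
  assumes "(f, a, b, g) \<in> Arr (arrow_cat C)"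
  shows "f \<in> Arr C" "g \<in> Arr C" "a \<in> Arr C" "b \<in> Arr C" "Dom C a = Dom C f" "Cod C a = Dom C g"
    "Dom C b = Cod C f" "Cod C b = Cod C g" "g \<cdot>\<^bsub>C\<^esub> a = b \<cdot>\<^bsub>C\<^esub> f"
  using assms by (simp_all add: hom_def)

lemma arrow_cat_eta:
  assumes "S \<in> Arr (arrow_cat C)" "Dom (arrow_cat C) S = f" "Cod (arrow_cat C) S = g"
  shows "S = (f, top_of S, bot_of S, g)"
  using assms by (cases S) simp

lemma forget_simps [simp]: "fob forget x = fst x" "far forget (x, S, y) = S"
  by (simp_all add: forget_def)

lemma (in category) square_cmp:
  assumes "(f, a, b, g) \<in> Arr (arrow_cat C)" "(g, a', b', h) \<in> Arr (arrow_cat C)"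
  shows "(f, a' \<cdot> a, b' \<cdot> b, h) \<in> Arr (arrow_cat C)"
  using squareD[OF assms(1)] squareD[OF assms(2)] reassoc[of h a' "b' \<cdot> g" a]
  by (simp add: hom_def)

locale awfs_category = category C for C :: "('o, 'm) cat" (structure) +
  fixes W :: "('o, 'm) awfs_data"
  assumes awfs: "awfs C W"
begin

lemma factorization: "is_functor (arrow_cat C) C (mid W)" "nat_trans (arrow_cat C) C (dom_func C) (mid W) (lpart W)"
  "nat_trans (arrow_cat C) C (mid W) (cod_func C) (rpart W)"
  "f \<in> Arr C \<Longrightarrow> rpart W f \<cdot> lpart W f = f"
  using awfs by (auto simp: awfs_def functorial_factorization_def)

lemmas mid [simp] = functorD(2-4)[OF factorization(1)]
lemma mid_obj [simp]: "f \<in> Arr C \<Longrightarrow> fob (mid W) f \<in> Obj C"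
  using functorD(1)[OF factorization(1)] by simp
lemma lpart [simp]: "f \<in> Arr C \<Longrightarrow> lpart W f \<in> Arr C" "f \<in> Arr C \<Longrightarrow> Dom C (lpart W f) = Dom C f"
  "f \<in> Arr C \<Longrightarrow> Cod C (lpart W f) = fob (mid W) f"
  using nat_transD(1-3)[OF factorization(2), of f] by (simp_all add: dom_func_def)
lemma rpart [simp]: "f \<in> Arr C \<Longrightarrow> rpart W f \<in> Arr C" "f \<in> Arr C \<Longrightarrow> Cod C (rpart W f) = Cod C f"
  "f \<in> Arr C \<Longrightarrow> Dom C (rpart W f) = fob (mid W) f"
  using nat_transD(1-3)[OF factorization(3), of f] by (simp_all add: cod_func_def)
lemma lpart_natural: "S \<in> Arr (arrow_cat C) \<Longrightarrow> S = (f, a, b, g) \<Longrightarrow> lpart W g \<cdot> a = far (mid W) S \<cdot> lpart W f"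
  using nat_transD(4)[OF factorization(2), of S] by (simp add: dom_func_def)
lemma rpart_natural: "S \<in> Arr (arrow_cat C) \<Longrightarrow> S = (f, a, b, g) \<Longrightarrow> rpart W g \<cdot> far (mid W) S = b \<cdot> rpart W f"
  using nat_transD(4)[OF factorization(3), of S] by (simp add: cod_func_def)

lemma mid_cmp:
  assumes "(f, a, b, g) \<in> Arr (arrow_cat C)" "(g, a', b', h) \<in> Arr (arrow_cat C)"
  shows "far (mid W) (f, a' \<cdot> a, b' \<cdot> b, h) = far (mid W) (g, a', b', h) \<cdot> far (mid W) (f, a, b, g)"
  using functorD(6)[OF factorization(1) assms(1,2)] by simp

text \<open>The counit law forces the domain component of a coalgebra structure to be the identity. What
  remains is a map \<open>bot_of \<alpha>\<close> from the codomain to the middle object. Dually an algebra structure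
  amounts to a map \<open>top_of \<beta>\<close> out of the middle object.\<close>

lemma LmapD:
  assumes "(c, \<alpha>) \<in> Obj (Lmap C W)"
  shows "c \<in> Arr C" "bot_of \<alpha> \<in> Arr C" "Dom C (bot_of \<alpha>) = Cod C c" "Cod C (bot_of \<alpha>) = fob (mid W) c"
    "bot_of \<alpha> \<cdot> c = lpart W c" "\<alpha> = (c, top_of \<alpha>, bot_of \<alpha>, lpart W c)"
proof -
  have c: "c \<in> Arr C" and \<alpha>: "\<alpha> \<in> Arr (arrow_cat C)" "Dom (arrow_cat C) \<alpha> = c" "Cod (arrow_cat C) \<alpha> = lpart W c"
    and i: "copoint C W c \<cdot>\<^bsub>arrow_cat C\<^esub> \<alpha> = Id (arrow_cat C) c"
    using assms by (simp_all add: Lmap_def copointed_coalgs_def Let_def Lfunc_def hom_def)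
  show e: "\<alpha> = (c, top_of \<alpha>, bot_of \<alpha>, lpart W c)" using \<alpha> by (rule arrow_cat_eta)
  have \<alpha>': "(c, top_of \<alpha>, bot_of \<alpha>, lpart W c) \<in> Arr (arrow_cat C)" using \<alpha>(1) e by simp
  note s = squareD[OF \<alpha>']
  have "copoint C W c \<cdot>\<^bsub>arrow_cat C\<^esub> (c, top_of \<alpha>, bot_of \<alpha>, lpart W c) = Id (arrow_cat C) c"
    using i e by simp
  then have "top_of \<alpha> = Id C (Dom C c)"
    using s c by (simp add: copoint_def)
  then show "bot_of \<alpha> \<cdot> c = lpart W c" using s c by simp
  show "c \<in> Arr C" "bot_of \<alpha> \<in> Arr C" "Dom C (bot_of \<alpha>) = Cod C c" "Cod C (bot_of \<alpha>) = fob (mid W) c"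
    using s c by simp_all
qed

lemma Lmap_section:
  assumes "(c, \<alpha>) \<in> Obj (Lmap C W)"
  shows "rpart W c \<cdot> bot_of \<alpha> = Id C (Cod C c)"
proof -
  have "copoint C W c \<cdot>\<^bsub>arrow_cat C\<^esub> (c, top_of \<alpha>, bot_of \<alpha>, lpart W c) = Id (arrow_cat C) c"
    using assms LmapD(6)[OF assms] by (simp add: Lmap_def copointed_coalgs_def Let_def)
  then show ?thesis by (simp add: copoint_def)
qed

lemma LmapI:
  assumes "c \<in> Arr C" "b \<in> Arr C" "Dom C b = Cod C c" "Cod C b = fob (mid W) c" "b \<cdot> c = lpart W c"
    "rpart W c \<cdot> b = Id C (Cod C c)"
  shows "(c, (c, Id C (Dom C c), b, lpart W c)) \<in> Obj (Lmap C W)"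
  using assms by (simp add: Lmap_def copointed_coalgs_def Let_def Lfunc_def hom_def copoint_def)

lemma Lmap_arr:
  "((c, \<alpha>), (c', a, b, d'), (d, \<beta>)) \<in> Arr (Lmap C W) \<longleftrightarrow> c' = c \<and> d' = d \<and>
    (c, \<alpha>) \<in> Obj (Lmap C W) \<and> (d, \<beta>) \<in> Obj (Lmap C W) \<and> (c, a, b, d) \<in> Arr (arrow_cat C) \<and>
    bot_of \<beta> \<cdot> b = far (mid W) (c, a, b, d) \<cdot> bot_of \<alpha>"
proof -
  have "\<beta> \<cdot>\<^bsub>arrow_cat C\<^esub> (c, a, b, d) = far (Lfunc W) (c, a, b, d) \<cdot>\<^bsub>arrow_cat C\<^esub> \<alpha> \<longleftrightarrow>
      bot_of \<beta> \<cdot> b = far (mid W) (c, a, b, d) \<cdot> bot_of \<alpha>"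
    if 1: "(c, \<alpha>) \<in> Obj (Lmap C W)" and 2: "(d, \<beta>) \<in> Obj (Lmap C W)" and S: "(c, a, b, d) \<in> Arr (arrow_cat C)"
  proof -
    have t: "top_of \<gamma> = Id C (Dom C e)" if "(e, \<gamma>) \<in> Obj (Lmap C W)" for e \<gamma>
    proof -
      have g: "\<gamma> = (e, top_of \<gamma>, bot_of \<gamma>, lpart W e)" using LmapD(6)[OF that] .
      have "(e, top_of \<gamma>, bot_of \<gamma>, lpart W e) \<in> Arr (arrow_cat C)"
        "copoint C W e \<cdot>\<^bsub>arrow_cat C\<^esub> (e, top_of \<gamma>, bot_of \<gamma>, lpart W e) = Id (arrow_cat C) e"
        using that g by (simp_all add: Lmap_def copointed_coalgs_def Let_def hom_def)
      then show ?thesis using LmapD(1)[OF that] by (simp add: copoint_def hom_def)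
    qed
    have "\<beta> \<cdot>\<^bsub>arrow_cat C\<^esub> (c, a, b, d) = (d, Id C (Dom C d), bot_of \<beta>, lpart W d) \<cdot>\<^bsub>arrow_cat C\<^esub> (c, a, b, d)"
      using LmapD(6)[OF 2] t[OF 2] by metis
    moreover have "far (Lfunc W) (c, a, b, d) \<cdot>\<^bsub>arrow_cat C\<^esub> \<alpha>
      = far (Lfunc W) (c, a, b, d) \<cdot>\<^bsub>arrow_cat C\<^esub> (c, Id C (Dom C c), bot_of \<alpha>, lpart W c)"
      using LmapD(6)[OF 1] t[OF 1] by metis
    ultimately show ?thesis
      using squareD[OF S] by (simp add: Lfunc_def)
  qed
  then show ?thesis
    by (auto simp: Lmap_def copointed_coalgs_def Let_def hom_def)
qed

lemma RMapD:
  assumes "(f, \<beta>) \<in> Obj (RMap C W)"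
  shows "f \<in> Arr C" "top_of \<beta> \<in> Arr C" "Dom C (top_of \<beta>) = fob (mid W) f" "Cod C (top_of \<beta>) = Dom C f"
    "top_of \<beta> \<cdot> lpart W f = Id C (Dom C f)" "f \<cdot> top_of \<beta> = rpart W f"
    "\<beta> = (rpart W f, top_of \<beta>, Id C (Cod C f), f)"
proof -
  have f: "f \<in> Arr C" and \<beta>: "\<beta> \<in> Arr (arrow_cat C)" "Dom (arrow_cat C) \<beta> = rpart W f" "Cod (arrow_cat C) \<beta> = f"
    and i: "\<beta> \<cdot>\<^bsub>arrow_cat C\<^esub> point C W f = Id (arrow_cat C) f"
    using assms by (simp_all add: RMap_def monad_algs_def Let_def Rfunc_def hom_def)
  have e: "\<beta> = (rpart W f, top_of \<beta>, bot_of \<beta>, f)" using \<beta> by (rule arrow_cat_eta)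
  have "(rpart W f, top_of \<beta>, bot_of \<beta>, f) \<in> Arr (arrow_cat C)" using \<beta>(1) e by simp
  note s = squareD[OF this]
  have i': "(rpart W f, top_of \<beta>, bot_of \<beta>, f) \<cdot>\<^bsub>arrow_cat C\<^esub> point C W f = Id (arrow_cat C) f"
    using i e by simp
  then have b: "bot_of \<beta> = Id C (Cod C f)"
    using s f by (simp add: point_def)
  show "\<beta> = (rpart W f, top_of \<beta>, Id C (Cod C f), f)" using e b by simp
  show "f \<in> Arr C" "top_of \<beta> \<in> Arr C" "Dom C (top_of \<beta>) = fob (mid W) f" "Cod C (top_of \<beta>) = Dom C f"
    "top_of \<beta> \<cdot> lpart W f = Id C (Dom C f)" "f \<cdot> top_of \<beta> = rpart W f"
    using s f i' b by (simp_all add: point_def)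
qed

lemma RMap_arrD:
  assumes "((f, \<beta>), (f', x, y, g'), (g, \<gamma>)) \<in> Arr (RMap C W)"
  shows "(f, \<beta>) \<in> Obj (RMap C W)" "(g, \<gamma>) \<in> Obj (RMap C W)" "f' = f" "g' = g" "(f, x, y, g) \<in> Arr (arrow_cat C)"
    "x \<cdot> top_of \<beta> = top_of \<gamma> \<cdot> far (mid W) (f, x, y, g)"
proof -
  show 1: "(f, \<beta>) \<in> Obj (RMap C W)" "(g, \<gamma>) \<in> Obj (RMap C W)" "f' = f" "g' = g" "(f, x, y, g) \<in> Arr (arrow_cat C)"
    using assms by (auto simp: RMap_def monad_algs_def Let_def hom_def)
  have "(f, x, y, g) \<cdot>\<^bsub>arrow_cat C\<^esub> \<beta> = \<gamma> \<cdot>\<^bsub>arrow_cat C\<^esub> far (Rfunc W) (f, x, y, g)"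
    using assms 1 by (auto simp: RMap_def monad_algs_def Let_def)
  then have "(f, x, y, g) \<cdot>\<^bsub>arrow_cat C\<^esub> (rpart W f, top_of \<beta>, Id C (Cod C f), f)
    = (rpart W g, top_of \<gamma>, Id C (Cod C g), g) \<cdot>\<^bsub>arrow_cat C\<^esub> far (Rfunc W) (f, x, y, g)"
    using RMapD(7)[OF 1(1)] RMapD(7)[OF 1(2)] by metis
  then show "x \<cdot> top_of \<beta> = top_of \<gamma> \<cdot> far (mid W) (f, x, y, g)"
    by (simp add: Rfunc_def)
qed

text \<open>The coalgebra structure leads from the codomain of \<open>c\<close> to the middle object of \<open>c\<close>, the square
  from there to the middle object of \<open>f\<close>, and the algebra structure from there to the domain of
  \<open>f\<close>.\<close>

definition diag :: "'m \<Rightarrow> 'm sq \<Rightarrow> 'm \<Rightarrow> 'm sq \<Rightarrow> 'm \<Rightarrow> 'm \<Rightarrow> 'm" where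
  "diag c \<alpha> f \<beta> s t = top_of \<beta> \<cdot> (far (mid W) (c, s, t, f) \<cdot> bot_of \<alpha>)"

lemma diag:
  assumes c: "(c, \<alpha>) \<in> Obj (Lmap C W)" and f: "(f, \<beta>) \<in> Obj (RMap C W)"
    and S: "(c, s, t, f) \<in> Arr (arrow_cat C)"
  shows "diag c \<alpha> f \<beta> s t \<in> Arr C" "Dom C (diag c \<alpha> f \<beta> s t) = Cod C c" "Cod C (diag c \<alpha> f \<beta> s t) = Dom C f"
    "diag c \<alpha> f \<beta> s t \<cdot> c = s" "f \<cdot> diag c \<alpha> f \<beta> s t = t"
proof -
  note c' [simp] = LmapD(1-4)[OF c] and f' [simp] = RMapD(1-4)[OF f] and s [simp] = squareD(1-8)[OF S]
  note m [simp] = mid[OF S, unfolded arrow_cat_simps]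
  show "diag c \<alpha> f \<beta> s t \<in> Arr C" "Dom C (diag c \<alpha> f \<beta> s t) = Cod C c" "Cod C (diag c \<alpha> f \<beta> s t) = Dom C f"
    by (simp_all add: diag_def)
  show "diag c \<alpha> f \<beta> s t \<cdot> c = s"
    using LmapD(5)[OF c] lpart_natural[OF S refl] reassoc[OF RMapD(5)[OF f], of s] by (simp add: diag_def)
  show "f \<cdot> diag c \<alpha> f \<beta> s t = t"
    using Lmap_section[OF c] reassoc[OF rpart_natural[OF S refl], of "bot_of \<alpha>"]
      reassoc[OF RMapD(6)[OF f], of "far (mid W) (c, s, t, f) \<cdot> bot_of \<alpha>"]
    by (simp add: diag_def)
qed

lemma diag_left:
  assumes c: "((c', \<alpha>'), (c', a, b, c), (c, \<alpha>)) \<in> Arr (Lmap C W)" and f: "(f, \<beta>) \<in> Obj (RMap C W)"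
    and S: "(c, s, t, f) \<in> Arr (arrow_cat C)"
  shows "diag c \<alpha> f \<beta> s t \<cdot> b = diag c' \<alpha>' f \<beta> (s \<cdot> a) (t \<cdot> b)"
proof -
  have c': "(c', \<alpha>') \<in> Obj (Lmap C W)" "(c, \<alpha>) \<in> Obj (Lmap C W)" "(c', a, b, c) \<in> Arr (arrow_cat C)"
    "bot_of \<alpha> \<cdot> b = far (mid W) (c', a, b, c) \<cdot> bot_of \<alpha>'"
    using c by (auto simp: Lmap_arr)
  note [simp] = LmapD(1-4)[OF c'(1)] LmapD(1-4)[OF c'(2)] RMapD(1-4)[OF f] squareD(1-8)[OF S] squareD(1-8)[OF c'(3)]
    mid[OF S, unfolded arrow_cat_simps] mid[OF c'(3), unfolded arrow_cat_simps]
  show ?thesis by (simp add: diag_def mid_cmp[OF c'(3) S] c'(4))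
qed

lemma diag_right:
  assumes c: "(c, \<alpha>) \<in> Obj (Lmap C W)" and f: "((f, \<beta>), (f, x, y, g), (g, \<gamma>)) \<in> Arr (RMap C W)"
    and S: "(c, s, t, f) \<in> Arr (arrow_cat C)"
  shows "x \<cdot> diag c \<alpha> f \<beta> s t = diag c \<alpha> g \<gamma> (x \<cdot> s) (y \<cdot> t)"
proof -
  note f' = RMap_arrD[OF f]
  note [simp] = LmapD(1-4)[OF c] RMapD(1-4)[OF f'(1)] RMapD(1-4)[OF f'(2)] squareD(1-8)[OF S] squareD(1-8)[OF f'(5)]
    mid[OF S, unfolded arrow_cat_simps] mid[OF f'(5), unfolded arrow_cat_simps]
  show ?thesis
    using reassoc[OF f'(6), of "far (mid W) (c, s, t, f) \<cdot> bot_of \<alpha>"]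
    by (simp add: diag_def mid_cmp[OF S f'(5)])
qed

end


section \<open>Right maps\<close>

lemma lift_problems_iff [simp]:
  "(i, s, t) \<in> lift_problems C I u f \<longleftrightarrow> i \<in> Obj I \<and> (fob u i, s, t, f) \<in> Arr (arrow_cat C)"
  by (simp add: lift_problems_def)

lemma right_mapD:
  assumes "right_map C I u (f, \<phi>)"
  shows "f \<in> Arr C" "\<phi> \<in> extensional (lift_problems C I u f)"
    and "i \<in> Obj I \<Longrightarrow> (fob u i, s, t, f) \<in> Arr (arrow_cat C) \<Longrightarrow> \<phi> (i, s, t) \<in> Arr C"
    and "i \<in> Obj I \<Longrightarrow> (fob u i, s, t, f) \<in> Arr (arrow_cat C) \<Longrightarrow> Dom C (\<phi> (i, s, t)) = Cod C (fob u i)"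
    and "i \<in> Obj I \<Longrightarrow> (fob u i, s, t, f) \<in> Arr (arrow_cat C) \<Longrightarrow> Cod C (\<phi> (i, s, t)) = Dom C f"
    and "i \<in> Obj I \<Longrightarrow> (fob u i, s, t, f) \<in> Arr (arrow_cat C) \<Longrightarrow> \<phi> (i, s, t) \<cdot>\<^bsub>C\<^esub> fob u i = s"
    and "i \<in> Obj I \<Longrightarrow> (fob u i, s, t, f) \<in> Arr (arrow_cat C) \<Longrightarrow> f \<cdot>\<^bsub>C\<^esub> \<phi> (i, s, t) = t"
    and "\<sigma> \<in> Arr I \<Longrightarrow> Cod I \<sigma> \<in> Obj I \<Longrightarrow> (fob u (Cod I \<sigma>), s, t, f) \<in> Arr (arrow_cat C) \<Longrightarrow>
      \<phi> (Cod I \<sigma>, s, t) \<cdot>\<^bsub>C\<^esub> bot_of (far u \<sigma>)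
      = \<phi> (Dom I \<sigma>, s \<cdot>\<^bsub>C\<^esub> top_of (far u \<sigma>), t \<cdot>\<^bsub>C\<^esub> bot_of (far u \<sigma>))"
proof -
  note r = assms[unfolded right_map_def prod.case]
  show "f \<in> Arr C" "\<phi> \<in> extensional (lift_problems C I u f)" using r by auto
  show "\<phi> (Cod I \<sigma>, s, t) \<cdot>\<^bsub>C\<^esub> bot_of (far u \<sigma>)
      = \<phi> (Dom I \<sigma>, s \<cdot>\<^bsub>C\<^esub> top_of (far u \<sigma>), t \<cdot>\<^bsub>C\<^esub> bot_of (far u \<sigma>))"
    if "\<sigma> \<in> Arr I" "Cod I \<sigma> \<in> Obj I" "(fob u (Cod I \<sigma>), s, t, f) \<in> Arr (arrow_cat C)"
    using r that by (simp add: lift_problems_def)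
  fix i s t assume "i \<in> Obj I" "(fob u i, s, t, f) \<in> Arr (arrow_cat C)"
  then have "(i, s, t) \<in> lift_problems C I u f" by simp
  then have "\<phi> (i, s, t) \<in> hom C (Cod C (fob u i)) (Dom C f) \<and>
      \<phi> (i, s, t) \<cdot>\<^bsub>C\<^esub> fob u i = s \<and> f \<cdot>\<^bsub>C\<^esub> \<phi> (i, s, t) = t"
    using r by blast
  then show "\<phi> (i, s, t) \<in> Arr C" "Dom C (\<phi> (i, s, t)) = Cod C (fob u i)" "Cod C (\<phi> (i, s, t)) = Dom C f"
    "\<phi> (i, s, t) \<cdot>\<^bsub>C\<^esub> fob u i = s" "f \<cdot>\<^bsub>C\<^esub> \<phi> (i, s, t) = t"
    by (auto simp: hom_def)
qed

lemma right_maps_arr: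
  "((f, \<phi>), (f', x, y, g'), (g, \<psi>)) \<in> Arr (right_maps C I u) \<longleftrightarrow> f' = f \<and> g' = g \<and>
    right_map C I u (f, \<phi>) \<and> right_map C I u (g, \<psi>) \<and> (f, x, y, g) \<in> Arr (arrow_cat C) \<and>
    (\<forall>i s t. i \<in> Obj I \<longrightarrow> (fob u i, s, t, f) \<in> Arr (arrow_cat C) \<longrightarrow>
      x \<cdot>\<^bsub>C\<^esub> \<phi> (i, s, t) = \<psi> (i, x \<cdot>\<^bsub>C\<^esub> s, y \<cdot>\<^bsub>C\<^esub> t))"
  by (auto simp: right_maps_def hom_def lift_problems_def)

lemma right_maps_obj [simp]: "x \<in> Obj (right_maps C I u) \<longleftrightarrow> right_map C I u x"
  by (simp add: right_maps_def)

context awfs_category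
begin

text \<open>The generating arrows are coalgebras: the free algebra \<open>rpart (u i)\<close> is a right \<open>I\<close>-map,
  and the filler of the square \<open>(lpart (u i), id)\<close> is the coalgebra structure. Uniformity of fillers
  gives naturality.\<close>

lemma generators_coalgebras:
  assumes I: "category I" and u: "is_functor I (arrow_cat C) u"
    and iso: "iso_over (RMap C W) (right_maps C I u) forget forget"
  shows "\<exists>F. lifts_functor I (Lmap C W) id_func forget u F"
proof -
  obtain F where F: "is_functor (RMap C W) (right_maps C I u) F"
      "eq_func (RMap C W) (forget \<circ>\<^sub>F F) forget"
    using iso by (auto simp: iso_over_def)
  interpret I: category I by fact
  have u_arr [simp]: "fob u i \<in> Arr C" if "i \<in> Obj I" for i
    using functorD(1)[OF u that] by simp
  have u_sq: "far u \<sigma> = (fob u (Dom I \<sigma>), top_of (far u \<sigma>), bot_of (far u \<sigma>), fob u (Cod I \<sigma>))"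
    "(fob u (Dom I \<sigma>), top_of (far u \<sigma>), bot_of (far u \<sigma>), fob u (Cod I \<sigma>)) \<in> Arr (arrow_cat C)"
    if "\<sigma> \<in> Arr I" for \<sigma>
  proof -
    show e: "far u \<sigma> = (fob u (Dom I \<sigma>), top_of (far u \<sigma>), bot_of (far u \<sigma>), fob u (Cod I \<sigma>))"
      by (rule arrow_cat_eta) (use functorD(2-4)[OF u that] in simp_all)
    then show "(fob u (Dom I \<sigma>), top_of (far u \<sigma>), bot_of (far u \<sigma>), fob u (Cod I \<sigma>)) \<in> Arr (arrow_cat C)"
      using functorD(2)[OF u that] by simp
  qed
  have mon: "nat_trans (arrow_cat C) (arrow_cat C) (Rfunc W \<circ>\<^sub>F Rfunc W) (Rfunc W) (mult W)"
    "is_functor (arrow_cat C) (arrow_cat C) (Rfunc W)"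
    "f \<in> Arr C \<Longrightarrow> mult W f \<cdot>\<^bsub>arrow_cat C\<^esub> point C W (rpart W f) = Id (arrow_cat C) (rpart W f)"
    "f \<in> Arr C \<Longrightarrow> mult W f \<cdot>\<^bsub>arrow_cat C\<^esub> mult W (rpart W f)
      = mult W f \<cdot>\<^bsub>arrow_cat C\<^esub> far (Rfunc W) (mult W f)" for f
    using awfs by (auto simp: awfs_def monad_def Rfunc_def)
  have free: "(rpart W f, mult W f) \<in> Obj (RMap C W)" if "f \<in> Arr C" for f
    using that mon(3,4)[OF that] nat_transD(1-3)[OF mon(1), of f]
    by (simp add: RMap_def monad_algs_def Let_def hom_def Rfunc_def)
  have free_arr: "((rpart W (fob u (Dom I \<sigma>)), mult W (fob u (Dom I \<sigma>))), far (Rfunc W) (far u \<sigma>),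
      (rpart W (fob u (Cod I \<sigma>)), mult W (fob u (Cod I \<sigma>)))) \<in> Arr (RMap C W)" if "\<sigma> \<in> Arr I" for \<sigma>
    using nat_transD(4)[OF mon(1), of "far u \<sigma>"] functorD(2-4)[OF u that] functorD(2-4)[OF mon(2), of "far u \<sigma>"]
      free[OF u_arr, of "Dom I \<sigma>"] free[OF u_arr, of "Cod I \<sigma>"] that
    by (simp add: RMap_def monad_algs_def Let_def hom_def) (simp add: Rfunc_def)
  define \<phi> where "\<phi> = (\<lambda>i. snd (fob F (rpart W (fob u i), mult W (fob u i))))"
  have F_ob: "fob F (rpart W (fob u i), mult W (fob u i)) = (rpart W (fob u i), \<phi> i)" if "i \<in> Obj I" for i
  proof -
    have "fst (fob F (rpart W (fob u i), mult W (fob u i))) = rpart W (fob u i)"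
      using F(2) free[OF u_arr[OF that]] by (auto simp: eq_func_def)
    then show ?thesis by (simp add: \<phi>_def prod_eq_iff)
  qed
  have rm: "right_map C I u (rpart W (fob u i), \<phi> i)" if "i \<in> Obj I" for i
    using functorD(1)[OF F(1) free[OF u_arr[OF that]]] F_ob[OF that] by simp
  have rm_arr: "((rpart W (fob u (Dom I \<sigma>)), \<phi> (Dom I \<sigma>)), far (Rfunc W) (far u \<sigma>),
      (rpart W (fob u (Cod I \<sigma>)), \<phi> (Cod I \<sigma>))) \<in> Arr (right_maps C I u)" if "\<sigma> \<in> Arr I" for \<sigma>
  proof -
    let ?S = "((rpart W (fob u (Dom I \<sigma>)), mult W (fob u (Dom I \<sigma>))), far (Rfunc W) (far u \<sigma>),
      (rpart W (fob u (Cod I \<sigma>)), mult W (fob u (Cod I \<sigma>))))"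
    have "far F ?S \<in> Arr (right_maps C I u)"
      "Dom (right_maps C I u) (far F ?S) = (rpart W (fob u (Dom I \<sigma>)), \<phi> (Dom I \<sigma>))"
      "Cod (right_maps C I u) (far F ?S) = (rpart W (fob u (Cod I \<sigma>)), \<phi> (Cod I \<sigma>))"
      using functorD(2-4)[OF F(1) free_arr[OF that]] F_ob that
      by (simp_all add: RMap_def monad_algs_def Let_def)
    moreover have "far forget (far F ?S) = far (Rfunc W) (far u \<sigma>)"
      using F(2) free_arr[OF that] by (auto simp: eq_func_def)
    ultimately show ?thesis
      by (cases "far F ?S") (auto simp: right_maps_def forget_def)
  qed
  define \<kappa> where "\<kappa> = (\<lambda>i. \<phi> i (i, lpart W (fob u i), Id C (Cod C (fob u i))))"
  have sq: "(fob u i, lpart W (fob u i), Id C (Cod C (fob u i)), rpart W (fob u i)) \<in> Arr (arrow_cat C)"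
    if "i \<in> Obj I" for i
    using that by (simp add: hom_def factorization(4))
  have \<kappa>: "\<kappa> i \<in> Arr C" "Dom C (\<kappa> i) = Cod C (fob u i)" "Cod C (\<kappa> i) = fob (mid W) (fob u i)"
    "\<kappa> i \<cdot> fob u i = lpart W (fob u i)" "rpart W (fob u i) \<cdot> \<kappa> i = Id C (Cod C (fob u i))" if "i \<in> Obj I" for i
    using right_mapD(3-7)[OF rm[OF that] that sq[OF that]] that by (simp_all add: \<kappa>_def)
  define F' where "F' = (\<lambda>i. (fob u i, (fob u i, Id C (Dom C (fob u i)), \<kappa> i, lpart W (fob u i))))"
  have F'_obj: "F' i \<in> Obj (Lmap C W)" if "i \<in> Obj I" for i
    unfolding F'_def using \<kappa>[OF that] that by (intro LmapI) simp_all
  have F'_arr: "(F' (Dom I \<sigma>), far u \<sigma>, F' (Cod I \<sigma>)) \<in> Arr (Lmap C W)" if \<sigma>: "\<sigma> \<in> Arr I" for \<sigma>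
  proof -
    let ?i = "Dom I \<sigma>" and ?j = "Cod I \<sigma>" and ?a = "top_of (far u \<sigma>)" and ?b = "bot_of (far u \<sigma>)"
    let ?S = "(fob u ?i, ?a, ?b, fob u ?j)"
    have ij [simp]: "?i \<in> Obj I" "?j \<in> Obj I" using \<sigma> by simp_all
    note s = squareD[OF u_sq(2)[OF \<sigma>]]
    have rj: "((rpart W (fob u ?i), \<phi> ?i), (rpart W (fob u ?i), far (mid W) ?S, ?b, rpart W (fob u ?j)),
        (rpart W (fob u ?j), \<phi> ?j)) \<in> Arr (right_maps C I u)"
      using rm_arr[OF \<sigma>] u_sq(1)[OF \<sigma>] unfolding Rfunc_def by (metis (mono_tags, lifting) case_prod_conv func.select_convs(2))
    have "\<kappa> ?j \<cdot> ?b = \<phi> ?j (?i, lpart W (fob u ?j) \<cdot> ?a, ?b)"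
      using right_mapD(8)[OF rm[OF ij(2)] \<sigma> ij(2) sq[OF ij(2)]] s by (simp add: \<kappa>_def)
    also have "lpart W (fob u ?j) \<cdot> ?a = far (mid W) ?S \<cdot> lpart W (fob u ?i)"
      using lpart_natural[OF u_sq(2)[OF \<sigma>] refl] .
    also have "\<phi> ?j (?i, \<dots>, ?b) = far (mid W) ?S \<cdot> \<kappa> ?i"
      using rj sq[OF ij(1)] s unfolding right_maps_arr by (simp add: \<kappa>_def)
    finally show ?thesis
      using F'_obj[OF ij(1)] F'_obj[OF ij(2)] u_sq(2)[OF \<sigma>]
      unfolding F'_def by (subst u_sq(1)[OF \<sigma>]) (simp add: Lmap_arr del: arrow_cat_simps)
  qed
  let ?F = "\<lparr>fob = F', far = (\<lambda>\<sigma>. (F' (Dom I \<sigma>), far u \<sigma>, F' (Cod I \<sigma>)))\<rparr>"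
  have dc: "Dom (Lmap C W) (x, S, y) = x" "Cod (Lmap C W) (x, S, y) = y"
    "Id (Lmap C W) x = (x, Id (arrow_cat C) (fst x), x)"
    "(y', T, z) \<cdot>\<^bsub>Lmap C W\<^esub> (x, S, y) = (x, T \<cdot>\<^bsub>arrow_cat C\<^esub> S, z)" for x S y y' T z
    by (simp_all add: Lmap_def copointed_coalgs_def Let_def)
  have "is_functor I (Lmap C W) ?F"
    using F'_obj F'_arr functorD(5,6)[OF u]
    by (simp add: is_functor_def hom_def dc) (simp add: F'_def)
  moreover have "eq_func I (forget \<circ>\<^sub>F ?F) (u \<circ>\<^sub>F id_func)"
    by (simp add: eq_func_def F'_def)
  ultimately show ?thesis unfolding lifts_functor_def by blast
qed

end


section \<open>Uniform fibrations and the pullback hom\<close>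

text \<open>Kept opaque, as the simplifier turns \<open>k \<in> {0, 1}\<close> into a disjunction.\<close>

definition endpoint :: "nat \<Rightarrow> bool" where
  "endpoint k \<longleftrightarrow> k \<in> {0, 1}"

definition opp :: "nat \<Rightarrow> nat" where
  "opp k = 1 - k"

lemma opp [simp]: "endpoint k \<Longrightarrow> endpoint (opp k)" "endpoint k \<Longrightarrow> opp (opp k) = k"
  by (auto simp: endpoint_def opp_def)

definition tag :: "nat \<Rightarrow> 'i \<Rightarrow> 'i + 'i" where
  "tag k i = (if k = 0 then Inl i else Inr i)"

lemma tag_cases:
  assumes "x \<in> Obj (sum_cat I I)"
  obtains k i where "endpoint k" "i \<in> Obj I" "x = tag k i"
proof (cases x)
  case (Inl i) with assms that[of 0 i] show ?thesis by (auto simp: tag_def sum_cat_def endpoint_def)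
next
  case (Inr i) with assms that[of 1 i] show ?thesis by (auto simp: tag_def sum_cat_def endpoint_def)
qed

lemma tag_arr_cases:
  assumes "x \<in> Arr (sum_cat I I)"
  obtains k \<sigma> where "endpoint k" "\<sigma> \<in> Arr I" "x = tag k \<sigma>"
proof (cases x)
  case (Inl i) with assms that[of 0 i] show ?thesis by (auto simp: tag_def sum_cat_def endpoint_def)
next
  case (Inr i) with assms that[of 1 i] show ?thesis by (auto simp: tag_def sum_cat_def endpoint_def)
qed

lemma tag_simps [simp]:
  "tag k i \<in> Obj (sum_cat I I) \<longleftrightarrow> i \<in> Obj I" "tag k \<sigma> \<in> Arr (sum_cat I I) \<longleftrightarrow> \<sigma> \<in> Arr I"
  "Dom (sum_cat I I) (tag k \<sigma>) = tag k (Dom I \<sigma>)" "Cod (sum_cat I I) (tag k \<sigma>) = tag k (Cod I \<sigma>)"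
  by (auto simp: tag_def sum_cat_def endpoint_def)

lemma tensor_gen_tag:
  assumes "endpoint k"
  shows "fob (tensor_gen C K \<delta> u) (tag k i) = leibniz_ob C K (\<delta> k) (fob u i)"
    "far (tensor_gen C K \<delta> u) (tag k \<sigma>) = far (leibniz C K (\<delta> k)) (far u \<sigma>)"
  using assms by (auto simp: tensor_gen_def case_func_def tag_def leibniz_def endpoint_def)

locale cylinder_category = lcc_category C + K: adjoint_pair C C \<Lambda>
  for C :: "('o, 'm) cat" (structure) and \<Lambda> :: "('o, 'm, 'o, 'm) adj" +
  fixes \<delta> :: "nat \<Rightarrow> 'o \<Rightarrow> 'm" and I :: "('i, 'j) cat" and u :: "('i, 'j, 'm, 'm sq) func"
  assumes \<delta>: "endpoint k \<Longrightarrow> nat_trans C C id_func (ladj \<Lambda>) (\<delta> k)"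
    and has_po: "f \<in> Arr C \<Longrightarrow> g \<in> Arr C \<Longrightarrow> Dom C f = Dom C g \<Longrightarrow> \<exists>p q. is_pushout C f g p q"
    and category_I: "category I" and functor_u: "is_functor I (arrow_cat C) u"
begin

abbreviation K :: "'m \<Rightarrow> 'm" where "K \<equiv> far (ladj \<Lambda>)"
abbreviation H :: "'m \<Rightarrow> 'm" where "H \<equiv> far (radj \<Lambda>)"
abbreviation K0 :: "'o \<Rightarrow> 'o" where "K0 \<equiv> fob (ladj \<Lambda>)"
abbreviation H0 :: "'o \<Rightarrow> 'o" where "H0 \<equiv> fob (radj \<Lambda>)"
abbreviation lt :: "'o \<Rightarrow> 'm \<Rightarrow> 'm" where "lt \<equiv> ltranspose C \<Lambda>"
abbreviation rt :: "'o \<Rightarrow> 'm \<Rightarrow> 'm" where "rt \<equiv> rtranspose C \<Lambda>"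

lemma \<delta>_arr [simp]:
  assumes "endpoint k" "X \<in> Obj C"
  shows "\<delta> k X \<in> Arr C" "Dom C (\<delta> k X) = X" "Cod C (\<delta> k X) = K0 X"
  using nat_transD(1-3)[OF \<delta>[OF assms(1)] assms(2)] by simp_all

lemma \<delta>_natural:
  assumes "endpoint k" "f \<in> Arr C" "X = Dom C f" "Y = Cod C f"
  shows "K f \<cdot> \<delta> k X = \<delta> k Y \<cdot> f"
  using nat_transD(4)[OF \<delta>[OF assms(1)] assms(2)] assms by simp

lemma u_arr [simp]: "i \<in> Obj I \<Longrightarrow> fob u i \<in> Arr C"
  using functorD(1)[OF functor_u] by simp

lemma u_sq:
  assumes "\<sigma> \<in> Arr I"
  shows "far u \<sigma> = (fob u (Dom I \<sigma>), top_of (far u \<sigma>), bot_of (far u \<sigma>), fob u (Cod I \<sigma>))"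
    "(fob u (Dom I \<sigma>), top_of (far u \<sigma>), bot_of (far u \<sigma>), fob u (Cod I \<sigma>)) \<in> Arr (arrow_cat C)"
proof -
  show e: "far u \<sigma> = (fob u (Dom I \<sigma>), top_of (far u \<sigma>), bot_of (far u \<sigma>), fob u (Cod I \<sigma>))"
    by (rule arrow_cat_eta) (use functorD(2-4)[OF functor_u assms] in simp_all)
  then show "(fob u (Dom I \<sigma>), top_of (far u \<sigma>), bot_of (far u \<sigma>), fob u (Cod I \<sigma>)) \<in> Arr (arrow_cat C)"
    using functorD(2)[OF functor_u assms] by simp
qed

lemma I_obj [simp]: "\<sigma> \<in> Arr I \<Longrightarrow> Dom I \<sigma> \<in> Obj I" "\<sigma> \<in> Arr I \<Longrightarrow> Cod I \<sigma> \<in> Obj I"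
  using category.dom_obj[OF category_I] category.cod_obj[OF category_I] by blast+

text \<open>With the span \<open>\<delta> k\<close>, \<open>i\<close> fixed, maps out of \<open>(I \<otimes> A) +\<^sub>A B\<close> are handled by their restrictions along
  \<open>in1\<close> and \<open>in2\<close>.\<close>

abbreviation in1 :: "nat \<Rightarrow> 'm \<Rightarrow> 'm" where "in1 k i \<equiv> po1 C (\<delta> k (Dom C i)) i"
abbreviation in2 :: "nat \<Rightarrow> 'm \<Rightarrow> 'm" where "in2 k i \<equiv> po2 C (\<delta> k (Dom C i)) i"
abbreviation copair :: "nat \<Rightarrow> 'm \<Rightarrow> 'm \<Rightarrow> 'm \<Rightarrow> 'm" where
  "copair k i \<equiv> po_copair C (\<delta> k (Dom C i)) i"
abbreviation LZ :: "nat \<Rightarrow> 'm \<Rightarrow> 'm" where "LZ k i \<equiv> leibniz_ob C (ladj \<Lambda>) (\<delta> k) i"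

lemma LZ_pushout:
  assumes "endpoint k" "i \<in> Arr C"
  shows "is_pushout C (\<delta> k (Dom C i)) i (in1 k i) (in2 k i)"
  using assms by (intro is_pushout_po has_po) simp_all

lemma in_arr [simp]:
  assumes "endpoint k" "i \<in> Arr C"
  shows "in1 k i \<in> Arr C" "in2 k i \<in> Arr C" "Dom C (in1 k i) = K0 (Dom C i)" "Dom C (in2 k i) = Cod C i"
    "Cod C (in2 k i) = Cod C (in1 k i)"
  using LZ_pushout[OF assms] assms by (simp_all add: is_pushout_def)

lemma in_comm:
  assumes "endpoint k" "i \<in> Arr C"
  shows "in1 k i \<cdot> \<delta> k (Dom C i) = in2 k i \<cdot> i"
  using LZ_pushout[OF assms] by (simp add: is_pushout_def)

lemma copair:
  assumes "endpoint k" "i \<in> Arr C" "a \<in> Arr C" "b \<in> Arr C" "Cod C a = Cod C b"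
    "Dom C a = K0 (Dom C i)" "Dom C b = Cod C i" "a \<cdot> \<delta> k (Dom C i) = b \<cdot> i"
  shows "copair k i a b \<in> Arr C" "Cod C (copair k i a b) = Cod C a"
    "Dom C (copair k i a b) = Cod C (in1 k i)" "copair k i a b \<cdot> in1 k i = a" "copair k i a b \<cdot> in2 k i = b"
  using assms has_po[of "\<delta> k (Dom C i)" i] by (intro po_copair; simp)+

lemma in_ext:
  assumes "endpoint k" "i \<in> Arr C" "h \<in> Arr C" "h' \<in> Arr C" "Dom C h = Cod C (in1 k i)"
    "Dom C h' = Cod C (in1 k i)" "Cod C h = Cod C h'" "h \<cdot> in1 k i = h' \<cdot> in1 k i" "h \<cdot> in2 k i = h' \<cdot> in2 k i"
  shows "h = h'"
  using is_pushout_ext[OF LZ_pushout] assms by blast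

lemma LZ [simp]:
  assumes "endpoint k" "i \<in> Arr C"
  shows "LZ k i \<in> Arr C" "Dom C (LZ k i) = Cod C (in1 k i)" "Cod C (LZ k i) = K0 (Cod C i)"
    and LZ_in: "LZ k i \<cdot> in1 k i = K i" "LZ k i \<cdot> in2 k i = \<delta> k (Cod C i)"
proof -
  have "K i \<cdot> \<delta> k (Dom C i) = \<delta> k (Cod C i) \<cdot> i"
    using assms by (intro \<delta>_natural) simp_all
  then show "LZ k i \<in> Arr C" "Dom C (LZ k i) = Cod C (in1 k i)" "Cod C (LZ k i) = K0 (Cod C i)"
    "LZ k i \<cdot> in1 k i = K i" "LZ k i \<cdot> in2 k i = \<delta> k (Cod C i)"
    unfolding leibniz_ob_def using assms copair[of k i "K i" "\<delta> k (Cod C i)"] by simp_all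
qed

abbreviation LZ_top :: "nat \<Rightarrow> 'm \<Rightarrow> 'm \<Rightarrow> 'm \<Rightarrow> 'm \<Rightarrow> 'm" where
  "LZ_top k i a b j \<equiv> copair k i (in1 k j \<cdot> K a) (in2 k j \<cdot> b)"

lemma LZ_top:
  assumes "endpoint k" "(i, a, b, j) \<in> Arr (arrow_cat C)"
  shows "LZ_top k i a b j \<in> Arr C" "Dom C (LZ_top k i a b j) = Cod C (in1 k i)"
    "Cod C (LZ_top k i a b j) = Cod C (in1 k j)" "LZ_top k i a b j \<cdot> in1 k i = in1 k j \<cdot> K a"
    "LZ_top k i a b j \<cdot> in2 k i = in2 k j \<cdot> b"
    "far (leibniz C (ladj \<Lambda>) (\<delta> k)) (i, a, b, j) = (LZ k i, LZ_top k i a b j, K b, LZ k j)"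
    "LZ k j \<cdot> LZ_top k i a b j = K b \<cdot> LZ k i"
proof -
  note k [simp] = assms(1) and s = squareD[OF assms(2)]
  note s' [simp] = s(1-8)
  have d: "K a \<cdot> \<delta> k (Dom C i) = \<delta> k (Dom C j) \<cdot> a" "K b \<cdot> \<delta> k (Cod C i) = \<delta> k (Cod C j) \<cdot> b"
    by (intro \<delta>_natural; simp)+
  have "(in1 k j \<cdot> K a) \<cdot> \<delta> k (Dom C i) = (in2 k j \<cdot> b) \<cdot> i"
    using reassoc[OF in_comm[of k j], of a] by (simp add: d s(9))
  then show t: "LZ_top k i a b j \<in> Arr C" "Dom C (LZ_top k i a b j) = Cod C (in1 k i)"
    "Cod C (LZ_top k i a b j) = Cod C (in1 k j)" "LZ_top k i a b j \<cdot> in1 k i = in1 k j \<cdot> K a"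
    "LZ_top k i a b j \<cdot> in2 k i = in2 k j \<cdot> b"
    by (simp_all add: copair)
  show "far (leibniz C (ladj \<Lambda>) (\<delta> k)) (i, a, b, j) = (LZ k i, LZ_top k i a b j, K b, LZ k j)"
    by (simp add: leibniz_def)
  have "K j \<cdot> K a = K b \<cdot> K i"
    using s(9) K.L(6)[of a j] K.L(6)[of i b] by simp
  then show "LZ k j \<cdot> LZ_top k i a b j = K b \<cdot> LZ k i"
    by (intro in_ext[of k i "LZ k j \<cdot> LZ_top k i a b j"])
      (simp_all add: t LZ_in d reassoc[OF LZ_in(1)] reassoc[OF LZ_in(2)])
qed

text \<open>A lifting problem against \<open>f\<close> of the Leibniz product of \<open>\<delta>\<^sup>k\<close> and \<open>i\<close>, with the map out of the
  pushout replaced by its two components. In this form it can be transposed along the adjunction of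
  \<open>I \<otimes> (-)\<close>, and for \<open>i : 0 \<rightarrow> Z\<close> it is visibly a lifting problem of \<open>\<delta>\<^sup>k\<close> at \<open>Z\<close>.\<close>

definition leibniz_problem :: "nat \<Rightarrow> 'm \<Rightarrow> 'm \<Rightarrow> 'm \<Rightarrow> 'm \<Rightarrow> 'm \<Rightarrow> bool" where
  "leibniz_problem k i f s1 s2 t \<longleftrightarrow> endpoint k \<and> i \<in> Arr C \<and> f \<in> Arr C \<and> s1 \<in> hom C (K0 (Dom C i)) (Dom C f) \<and>
     s2 \<in> hom C (Cod C i) (Dom C f) \<and> t \<in> hom C (K0 (Cod C i)) (Cod C f) \<and>
     s1 \<cdot> \<delta> k (Dom C i) = s2 \<cdot> i \<and> f \<cdot> s1 = t \<cdot> K i \<and> f \<cdot> s2 = t \<cdot> \<delta> k (Cod C i)"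

lemma leibniz_problemD:
  assumes "leibniz_problem k i f s1 s2 t"
  shows "endpoint k" "i \<in> Arr C" "f \<in> Arr C" "s1 \<in> Arr C" "Dom C s1 = K0 (Dom C i)" "Cod C s1 = Dom C f"
    "s2 \<in> Arr C" "Dom C s2 = Cod C i" "Cod C s2 = Dom C f" "t \<in> Arr C" "Dom C t = K0 (Cod C i)"
    "Cod C t = Cod C f" "s1 \<cdot> \<delta> k (Dom C i) = s2 \<cdot> i" "f \<cdot> s1 = t \<cdot> K i" "f \<cdot> s2 = t \<cdot> \<delta> k (Cod C i)"
  using assms by (simp_all add: leibniz_problem_def hom_def)

lemma leibniz_problem_square:
  assumes "leibniz_problem k i f s1 s2 t"
  shows "(LZ k i, copair k i s1 s2, t, f) \<in> Arr (arrow_cat C)"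
    "copair k i s1 s2 \<cdot> in1 k i = s1" "copair k i s1 s2 \<cdot> in2 k i = s2"
proof -
  note l = leibniz_problemD[OF assms]
  note l' [simp] = l(1-12)
  note c = copair[OF l(1,2,4,7) _ l(5,8,13), simplified]
  show "copair k i s1 s2 \<cdot> in1 k i = s1" "copair k i s1 s2 \<cdot> in2 k i = s2" by (fact c(4), fact c(5))
  have "f \<cdot> copair k i s1 s2 = t \<cdot> LZ k i"
    by (rule in_ext[of k i]) (simp_all add: c LZ_in l(14,15))
  then show "(LZ k i, copair k i s1 s2, t, f) \<in> Arr (arrow_cat C)"
    by (simp add: hom_def c)
qed

lemma leibniz_problem_left:
  assumes "leibniz_problem k j f s1 s2 t" "(i, a, b, j) \<in> Arr (arrow_cat C)"
  shows "leibniz_problem k i f (s1 \<cdot> K a) (s2 \<cdot> b) (t \<cdot> K b)"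
    "copair k i (s1 \<cdot> K a) (s2 \<cdot> b) = copair k j s1 s2 \<cdot> LZ_top k i a b j"
proof -
  note l = leibniz_problemD[OF assms(1)] and s = squareD[OF assms(2)]
  note [simp] = l(1-12) s(1-8)
  have d: "K a \<cdot> \<delta> k (Dom C i) = \<delta> k (Dom C j) \<cdot> a" "K b \<cdot> \<delta> k (Cod C i) = \<delta> k (Cod C j) \<cdot> b"
    by (intro \<delta>_natural; simp)+
  have "K j \<cdot> K a = K b \<cdot> K i"
    using s(9) K.L(6)[of a j] K.L(6)[of i b] by simp
  then show p: "leibniz_problem k i f (s1 \<cdot> K a) (s2 \<cdot> b) (t \<cdot> K b)"
    unfolding leibniz_problem_def
    using reassoc[OF l(13), of a] reassoc[OF l(14), of "K a"] reassoc[OF l(15), of b]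
    by (simp add: hom_def d s(9))
  note T = LZ_top[OF l(1) assms(2)] and c = squareD[OF leibniz_problem_square(1)[OF assms(1)]]
    and c' = squareD[OF leibniz_problem_square(1)[OF p]]
  have cj: "copair k j s1 s2 \<in> Arr C" "Dom C (copair k j s1 s2) = Cod C (in1 k j)" "Cod C (copair k j s1 s2) = Dom C f"
    and ci: "copair k i (s1 \<cdot> K a) (s2 \<cdot> b) \<in> Arr C" "Dom C (copair k i (s1 \<cdot> K a) (s2 \<cdot> b)) = Cod C (in1 k i)"
      "Cod C (copair k i (s1 \<cdot> K a) (s2 \<cdot> b)) = Dom C f"
    using c c' by simp_all
  show "copair k i (s1 \<cdot> K a) (s2 \<cdot> b) = copair k j s1 s2 \<cdot> LZ_top k i a b j"
    by (rule in_ext[of k i]) (simp_all add: T(1-5) ci cj leibniz_problem_square(2,3)[OF p]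
        reassoc[OF leibniz_problem_square(2)[OF assms(1)]] reassoc[OF leibniz_problem_square(3)[OF assms(1)]])
qed

lemma leibniz_problem_right:
  assumes "leibniz_problem k i f s1 s2 t" "(f, x, y, g) \<in> Arr (arrow_cat C)"
  shows "leibniz_problem k i g (x \<cdot> s1) (x \<cdot> s2) (y \<cdot> t)"
    "copair k i (x \<cdot> s1) (x \<cdot> s2) = x \<cdot> copair k i s1 s2"
proof -
  note l = leibniz_problemD[OF assms(1)] and s = squareD[OF assms(2)]
  note [simp] = l(1-12) s(1-8)
  show p: "leibniz_problem k i g (x \<cdot> s1) (x \<cdot> s2) (y \<cdot> t)"
    unfolding leibniz_problem_def
    using l(13-15) reassoc[OF s(9), of s1] reassoc[OF s(9), of s2]
    by (simp add: hom_def)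
  note c = squareD[OF leibniz_problem_square(1)[OF assms(1)]] and c' = squareD[OF leibniz_problem_square(1)[OF p]]
  show "copair k i (x \<cdot> s1) (x \<cdot> s2) = x \<cdot> copair k i s1 s2"
    by (rule in_ext[of k i]) (use c c' leibniz_problem_square(2,3)[OF p] leibniz_problem_square(2,3)[OF assms(1)] in simp_all)
qed

abbreviation fib :: "'m \<Rightarrow> (('i + 'i) \<times> 'm \<times> 'm \<Rightarrow> 'm) \<Rightarrow> bool" where
  "fib f \<phi> \<equiv> right_map C (sum_cat I I) (tensor_gen C (ladj \<Lambda>) \<delta> u) (f, \<phi>)"

abbreviation fib_mor :: "'m \<Rightarrow> (('i + 'i) \<times> 'm \<times> 'm \<Rightarrow> 'm) \<Rightarrow> 'm \<Rightarrow> 'm \<Rightarrow> 'm \<Rightarrow> (('i + 'i) \<times> 'm \<times> 'm \<Rightarrow> 'm) \<Rightarrow> bool" where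
  "fib_mor f \<phi> x y g \<psi> \<equiv>
     ((f, \<phi>), (f, x, y, g), (g, \<psi>)) \<in> Arr (right_maps C (sum_cat I I) (tensor_gen C (ladj \<Lambda>) \<delta> u))"

lemma fib_morD:
  assumes "fib_mor f \<phi> x y g \<psi>"
  shows "fib f \<phi>" "fib g \<psi>" "(f, x, y, g) \<in> Arr (arrow_cat C)"
  using assms by (simp_all add: right_maps_arr del: arrow_cat_simps)

abbreviation lz_fill :: "nat \<Rightarrow> 'i \<Rightarrow> (('i + 'i) \<times> 'm \<times> 'm \<Rightarrow> 'm) \<Rightarrow> 'm \<Rightarrow> 'm \<Rightarrow> 'm \<Rightarrow> 'm" where
  "lz_fill k i \<phi> s1 s2 t \<equiv> \<phi> (tag k i, copair k (fob u i) s1 s2, t)"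

lemma lz_fill:
  assumes f: "fib f \<phi>" and i [simp]: "i \<in> Obj I" and p: "leibniz_problem k (fob u i) f s1 s2 t"
  shows "lz_fill k i \<phi> s1 s2 t \<in> Arr C" "Dom C (lz_fill k i \<phi> s1 s2 t) = K0 (Cod C (fob u i))"
    "Cod C (lz_fill k i \<phi> s1 s2 t) = Dom C f" "lz_fill k i \<phi> s1 s2 t \<cdot> K (fob u i) = s1"
    "lz_fill k i \<phi> s1 s2 t \<cdot> \<delta> k (Cod C (fob u i)) = s2" "f \<cdot> lz_fill k i \<phi> s1 s2 t = t"
proof -
  note l = leibniz_problemD[OF p]
  note k [simp] = l(1)
  note sq = leibniz_problem_square[OF p]
  note s = squareD[OF sq(1)]
  note r = right_mapD(3-7)[OF f, of "tag k i" "copair k (fob u i) s1 s2" t, unfolded tensor_gen_tag[OF k] tag_simps, OF i sq(1)]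
  show r': "lz_fill k i \<phi> s1 s2 t \<in> Arr C" "Dom C (lz_fill k i \<phi> s1 s2 t) = K0 (Cod C (fob u i))"
    "Cod C (lz_fill k i \<phi> s1 s2 t) = Dom C f" "f \<cdot> lz_fill k i \<phi> s1 s2 t = t"
    using r by simp_all
  show "lz_fill k i \<phi> s1 s2 t \<cdot> K (fob u i) = s1" "lz_fill k i \<phi> s1 s2 t \<cdot> \<delta> k (Cod C (fob u i)) = s2"
    using reassoc[OF r(4), of "in1 k (fob u i)"] reassoc[OF r(4), of "in2 k (fob u i)"] r' LZ_in[of k "fob u i"] sq(2,3)
    by simp_all
qed

lemma lz_fill_left:
  assumes f: "fib f \<phi>" and \<sigma>: "\<sigma> \<in> Arr I" and p: "leibniz_problem k (fob u (Cod I \<sigma>)) f s1 s2 t"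
  shows "lz_fill k (Cod I \<sigma>) \<phi> s1 s2 t \<cdot> K (bot_of (far u \<sigma>))
    = lz_fill k (Dom I \<sigma>) \<phi> (s1 \<cdot> K (top_of (far u \<sigma>))) (s2 \<cdot> bot_of (far u \<sigma>)) (t \<cdot> K (bot_of (far u \<sigma>)))"
proof -
  note k = leibniz_problemD(1)[OF p]
  note e = LZ_top(6)[OF k u_sq(2)[OF \<sigma>], folded u_sq(1)[OF \<sigma>]]
  have "(fob (tensor_gen C (ladj \<Lambda>) \<delta> u) (Cod (sum_cat I I) (tag k \<sigma>)), copair k (fob u (Cod I \<sigma>)) s1 s2, t, f) \<in> Arr (arrow_cat C)"
    using leibniz_problem_square(1)[OF p] by (simp add: tensor_gen_tag[OF k] del: arrow_cat_simps)
  note r = right_mapD(8)[OF f _ _ this, unfolded tag_simps, OF \<sigma> I_obj(2)[OF \<sigma>]]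
  show ?thesis
    using r unfolding tensor_gen_tag[OF k] e top_bot_simps leibniz_problem_left(2)[OF p u_sq(2)[OF \<sigma>]] .
qed

lemma lz_fill_right:
  assumes f: "fib_mor f \<phi> x y g \<psi>" and i: "i \<in> Obj I" and p: "leibniz_problem k (fob u i) f s1 s2 t"
  shows "x \<cdot> lz_fill k i \<phi> s1 s2 t = lz_fill k i \<psi> (x \<cdot> s1) (x \<cdot> s2) (y \<cdot> t)"
proof -
  note k = leibniz_problemD(1)[OF p]
  have "(fob (tensor_gen C (ladj \<Lambda>) \<delta> u) (tag k i), copair k (fob u i) s1 s2, t, f) \<in> Arr (arrow_cat C)"
    using leibniz_problem_square(1)[OF p] by (simp add: tensor_gen_tag[OF k] del: arrow_cat_simps)
  then show ?thesis
    using f i unfolding right_maps_arr leibniz_problem_right(2)[OF p fib_morD(3)[OF f]] by simp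
qed

text \<open>\<open>phom k f\<close> is the pullback hom \<open>H X \<rightarrow> X \<times>\<^sub>Y H Y\<close> of \<open>\<delta>\<^sup>k\<close> and \<open>f : X \<rightarrow> Y\<close>, where \<open>ev k\<close> evaluates at
  the endpoint \<open>k\<close>. Lifting against it is the transpose of lifting a Leibniz product with \<open>\<delta>\<^sup>k\<close>
  against \<open>f\<close>.\<close>

definition ev :: "nat \<Rightarrow> 'o \<Rightarrow> 'm" where
  "ev k X = counit \<Lambda> X \<cdot> \<delta> k (H0 X)"

lemma ev_arr [simp]:
  assumes "endpoint k" "X \<in> Obj C"
  shows "ev k X \<in> Arr C" "Dom C (ev k X) = H0 X" "Cod C (ev k X) = X"
  using assms by (simp_all add: ev_def)

lemma ev_cmp:
  assumes k: "endpoint k" and "X \<in> Obj C" "g \<in> Arr C" "Cod C g = H0 X" "A = Dom C g"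
  shows "ev k X \<cdot> g = lt X g \<cdot> \<delta> k A"
  using assms \<delta>_natural[OF k, of g] by (simp add: ev_def ltranspose_def)

definition phom :: "nat \<Rightarrow> 'm \<Rightarrow> 'm" where
  "phom k f = pb_pair C f (ev k (Cod C f)) (ev k (Dom C f)) (H f)"

lemma ev_natural:
  assumes k: "endpoint k" and f: "f \<in> Arr C"
  shows "ev k (Cod C f) \<cdot> H f = f \<cdot> ev k (Dom C f)"
proof -
  have "H0 (Dom C f) \<in> Obj C" using f by simp
  have "lt (Cod C f) (H f \<cdot> Id C (H0 (Dom C f))) = f \<cdot> lt (Dom C f) (Id C (H0 (Dom C f)))"
    using f by (intro K.lt_radj) simp_all
  then have "lt (Cod C f) (H f) = f \<cdot> counit \<Lambda> (Dom C f)"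
    using f by (simp add: ltranspose_def)
  then show ?thesis
    using k f ev_cmp[OF k, of "Cod C f" "H f"] by (simp add: ev_def)
qed

lemma phom [simp]:
  assumes "endpoint k" "f \<in> Arr C"
  shows "phom k f \<in> Arr C" "Dom C (phom k f) = H0 (Dom C f)"
    "Cod C (phom k f) = Dom C (pb1 C f (ev k (Cod C f)))"
    and phom_pb: "pb1 C f (ev k (Cod C f)) \<cdot> phom k f = ev k (Dom C f)" "pb2 C f (ev k (Cod C f)) \<cdot> phom k f = H f"
  unfolding phom_def using assms ev_natural[OF assms] by (simp_all add: pb_pair)

lemma phom_problem:
  assumes k: "endpoint k" and f: "f \<in> Arr C" and sq: "(i, s, t, phom k f) \<in> Arr (arrow_cat C)"
  shows "leibniz_problem k i f (lt (Dom C f) s) (pb1 C f (ev k (Cod C f)) \<cdot> t)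
    (lt (Cod C f) (pb2 C f (ev k (Cod C f)) \<cdot> t))"
proof -
  note kf [simp] = k f and s = squareD[OF sq]
  have [simp]: "i \<in> Arr C" "s \<in> Arr C" "t \<in> Arr C" "Dom C s = Dom C i" "Cod C s = H0 (Dom C f)"
    "Dom C t = Cod C i" "Cod C t = Dom C (pb1 C f (ev k (Cod C f)))"
    using s by simp_all
  let ?p = "pb1 C f (ev k (Cod C f))" and ?q = "pb2 C f (ev k (Cod C f))"
  have e1: "?p \<cdot> (t \<cdot> i) = ev k (Dom C f) \<cdot> s" and e2: "?q \<cdot> (t \<cdot> i) = H f \<cdot> s"
    using reassoc[OF phom_pb(1)[OF k f], of s] reassoc[OF phom_pb(2)[OF k f], of s] s(9) by simp_all
  have "lt (Dom C f) s \<cdot> \<delta> k (Dom C i) = (?p \<cdot> t) \<cdot> i"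
    using ev_cmp[OF k, of "Dom C f" s] by (simp add: e1)
  moreover have "f \<cdot> lt (Dom C f) s = lt (Cod C f) (?q \<cdot> t) \<cdot> K i"
    using K.lt_cmp[of "?q \<cdot> t" i "Cod C f"] K.lt_radj[of s f "Cod C f"] by (simp add: e2)
  moreover have "f \<cdot> (?p \<cdot> t) = lt (Cod C f) (?q \<cdot> t) \<cdot> \<delta> k (Cod C i)"
    using ev_cmp[OF k, of "Cod C f" "?q \<cdot> t"] by (simp add: pb_comm')
  ultimately show ?thesis by (simp add: leibniz_problem_def hom_def)
qed

lemma problem_phom:
  assumes p: "leibniz_problem k i f s1 s2 t"
  shows "(i, rt (Dom C i) s1, pb_pair C f (ev k (Cod C f)) s2 (rt (Cod C i) t), phom k f) \<in> Arr (arrow_cat C)"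
    "pb1 C f (ev k (Cod C f)) \<cdot> pb_pair C f (ev k (Cod C f)) s2 (rt (Cod C i) t) = s2"
    "pb2 C f (ev k (Cod C f)) \<cdot> pb_pair C f (ev k (Cod C f)) s2 (rt (Cod C i) t) = rt (Cod C i) t"
proof -
  note l = leibniz_problemD[OF p]
  note [simp] = l(1-12)
  have "f \<cdot> s2 = ev k (Cod C f) \<cdot> rt (Cod C i) t"
    using ev_cmp[OF l(1), of "Cod C f" "rt (Cod C i) t"] by (simp add: l(15))
  then have P: "pb_pair C f (ev k (Cod C f)) s2 (rt (Cod C i) t) \<in> Arr C"
    "Dom C (pb_pair C f (ev k (Cod C f)) s2 (rt (Cod C i) t)) = Cod C i"
    "Cod C (pb_pair C f (ev k (Cod C f)) s2 (rt (Cod C i) t)) = Dom C (pb1 C f (ev k (Cod C f)))"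
    "pb1 C f (ev k (Cod C f)) \<cdot> pb_pair C f (ev k (Cod C f)) s2 (rt (Cod C i) t) = s2"
    "pb2 C f (ev k (Cod C f)) \<cdot> pb_pair C f (ev k (Cod C f)) s2 (rt (Cod C i) t) = rt (Cod C i) t"
    using pb_pair[of f "ev k (Cod C f)" s2 "rt (Cod C i) t"] by simp_all
  show "pb1 C f (ev k (Cod C f)) \<cdot> pb_pair C f (ev k (Cod C f)) s2 (rt (Cod C i) t) = s2"
    "pb2 C f (ev k (Cod C f)) \<cdot> pb_pair C f (ev k (Cod C f)) s2 (rt (Cod C i) t) = rt (Cod C i) t"
    by (fact P(4), fact P(5))
  have "H f \<cdot> rt (Dom C i) s1 = rt (Cod C i) t \<cdot> i"
    using K.rt_cmp[of s1 "Dom C i" f] K.rt_ladj[of t i "Dom C i"] by (simp add: l(14))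
  then have "phom k f \<cdot> rt (Dom C i) s1 = pb_pair C f (ev k (Cod C f)) s2 (rt (Cod C i) t) \<cdot> i"
    using ev_cmp[OF l(1), of "Dom C f" "rt (Dom C i) s1"]
    by (intro pb_ext[of f "ev k (Cod C f)" "phom k f \<cdot> rt (Dom C i) s1"])
      (simp_all add: P(1-3) l(13) reassoc[OF P(4)] reassoc[OF P(5)] reassoc[OF phom_pb(1)] reassoc[OF phom_pb(2)])
  then show "(i, rt (Dom C i) s1, pb_pair C f (ev k (Cod C f)) s2 (rt (Cod C i) t), phom k f) \<in> Arr (arrow_cat C)"
    by (simp add: hom_def P(1-3))
qed

definition phom_fill :: "nat \<Rightarrow> 'm \<Rightarrow> (('i + 'i) \<times> 'm \<times> 'm \<Rightarrow> 'm) \<Rightarrow> 'i \<times> 'm \<times> 'm \<Rightarrow> 'm" where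
  "phom_fill k f \<phi> = restrict (\<lambda>(i, s, t). rt (Cod C (fob u i))
     (lz_fill k i \<phi> (lt (Dom C f) s) (pb1 C f (ev k (Cod C f)) \<cdot> t) (lt (Cod C f) (pb2 C f (ev k (Cod C f)) \<cdot> t))))
     (lift_problems C I u (phom k f))"

text \<open>Squares from \<open>u i\<close> to the pullback hom of \<open>f\<close> transpose to Leibniz problems against \<open>f\<close>, whose
  fillers transpose back.\<close>

lemma right_map_phom:
  assumes k [simp]: "endpoint k" and f: "fib f \<phi>"
  shows "right_map C I u (phom k f, phom_fill k f \<phi>)"
proof -
  note f' [simp] = right_mapD(1)[OF f]
  let ?p = "pb1 C f (ev k (Cod C f))" and ?q = "pb2 C f (ev k (Cod C f))"
  let ?w = "\<lambda>i s t. lz_fill k i \<phi> (lt (Dom C f) s) (?p \<cdot> t) (lt (Cod C f) (?q \<cdot> t))"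
  have w: "?w i s t \<in> Arr C" "Dom C (?w i s t) = K0 (Cod C (fob u i))" "Cod C (?w i s t) = Dom C f"
    "?w i s t \<cdot> K (fob u i) = lt (Dom C f) s" "?w i s t \<cdot> \<delta> k (Cod C (fob u i)) = ?p \<cdot> t"
    "f \<cdot> ?w i s t = lt (Cod C f) (?q \<cdot> t)"
    if "i \<in> Obj I" "(fob u i, s, t, phom k f) \<in> Arr (arrow_cat C)" for i s t
    using lz_fill[OF f that(1) phom_problem[OF k f' that(2)]] by simp_all
  show ?thesis
    unfolding right_map_def prod.case
  proof (intro conjI ballI allI impI)
    show "phom_fill k f \<phi> \<in> extensional (lift_problems C I u (phom k f))" by (simp add: phom_fill_def)
    show "phom k f \<in> Arr C" by simp
  next
    fix x assume "x \<in> lift_problems C I u (phom k f)"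
    then obtain i s t where x: "x = (i, s, t)" and i [simp]: "i \<in> Obj I" and sq: "(fob u i, s, t, phom k f) \<in> Arr (arrow_cat C)"
      by (cases x) (auto simp: lift_problems_def)
    note S = squareD[OF sq] and w' = w[OF i sq]
    have [simp]: "s \<in> Arr C" "t \<in> Arr C" "Dom C s = Dom C (fob u i)" "Cod C s = H0 (Dom C f)"
      "Dom C t = Cod C (fob u i)" "Cod C t = Dom C ?p"
      using S by simp_all
    let ?r = "rt (Cod C (fob u i)) (?w i s t)"
    have [simp]: "?r \<in> Arr C" "Dom C ?r = Cod C (fob u i)" "Cod C ?r = H0 (Dom C f)"
      using w' by simp_all
    have e: "phom_fill k f \<phi> (i, s, t) = ?r"
      using sq by (simp add: phom_fill_def)
    have 1: "?r \<cdot> fob u i = s"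
      using w' K.rt_ladj[of "?w i s t" "fob u i" "Dom C (fob u i)"] by simp
    have "H f \<cdot> ?r = ?q \<cdot> t"
      using w' K.rt_cmp[of "?w i s t" "Cod C (fob u i)" f] by simp
    moreover have "ev k (Dom C f) \<cdot> ?r = ?p \<cdot> t"
      using w' ev_cmp[OF k, of "Dom C f" ?r] by simp
    ultimately have 2: "phom k f \<cdot> ?r = t"
      by (intro pb_ext[of f "ev k (Cod C f)" "phom k f \<cdot> ?r"])
        (simp_all add: reassoc[OF phom_pb(1)] reassoc[OF phom_pb(2)])
    show "case x of (i, s, t) \<Rightarrow> phom_fill k f \<phi> (i, s, t) \<in> hom C (Cod C (fob u i)) (Dom C (phom k f)) \<and>
        phom_fill k f \<phi> (i, s, t) \<cdot> fob u i = s \<and> phom k f \<cdot> phom_fill k f \<phi> (i, s, t) = t"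
      using 1 2 by (simp add: x e) (simp add: hom_def)
  next
    fix \<sigma> s t assume \<sigma> [simp]: "\<sigma> \<in> Arr I" and "(Cod I \<sigma>, s, t) \<in> lift_problems C I u (phom k f)"
    then have sq: "(fob u (Cod I \<sigma>), s, t, phom k f) \<in> Arr (arrow_cat C)" by simp
    let ?a = "top_of (far u \<sigma>)" and ?b = "bot_of (far u \<sigma>)"
    note S = squareD[OF sq] and u = squareD[OF u_sq(2)[OF \<sigma>]]
    note w' = w[OF I_obj(2)[OF \<sigma>] sq]
    have sq': "(fob u (Dom I \<sigma>), s \<cdot> ?a, t \<cdot> ?b, phom k f) \<in> Arr (arrow_cat C)"
      using square_cmp[OF u_sq(2)[OF \<sigma>] sq] .
    have [simp]: "s \<in> Arr C" "t \<in> Arr C" "Dom C s = Dom C (fob u (Cod I \<sigma>))" "Cod C s = H0 (Dom C f)"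
      "Dom C t = Cod C (fob u (Cod I \<sigma>))" "Cod C t = Dom C ?p"
      using S by simp_all
    note u' [simp] = u(1-8)
    have "?w (Cod I \<sigma>) s t \<cdot> K ?b = ?w (Dom I \<sigma>) (s \<cdot> ?a) (t \<cdot> ?b)"
      using lz_fill_left[OF f \<sigma> phom_problem[OF k f' sq]] K.lt_cmp[of s ?a "Dom C f"] K.lt_cmp[of "?q \<cdot> t" ?b "Cod C f"]
      by simp
    then have "rt (Cod C (fob u (Cod I \<sigma>))) (?w (Cod I \<sigma>) s t) \<cdot> ?b
      = rt (Cod C (fob u (Dom I \<sigma>))) (?w (Dom I \<sigma>) (s \<cdot> ?a) (t \<cdot> ?b))"
      using w' K.rt_ladj[of "?w (Cod I \<sigma>) s t" ?b "Cod C (fob u (Dom I \<sigma>))"] by simp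
    then show "phom_fill k f \<phi> (Cod I \<sigma>, s, t) \<cdot> bot_of (far u \<sigma>) =
        phom_fill k f \<phi> (Dom I \<sigma>, s \<cdot> top_of (far u \<sigma>), t \<cdot> bot_of (far u \<sigma>))"
      using sq sq' by (simp add: phom_fill_def)
  qed
qed

definition phom_bot :: "nat \<Rightarrow> 'm \<Rightarrow> 'm \<Rightarrow> 'm \<Rightarrow> 'm \<Rightarrow> 'm" where
  "phom_bot k f x y g = pb_pair C g (ev k (Cod C g)) (x \<cdot> pb1 C f (ev k (Cod C f))) (H y \<cdot> pb2 C f (ev k (Cod C f)))"

lemma phom_bot:
  assumes k [simp]: "endpoint k" and S: "(f, x, y, g) \<in> Arr (arrow_cat C)"
  shows "phom_bot k f x y g \<in> Arr C" "Dom C (phom_bot k f x y g) = Dom C (pb1 C f (ev k (Cod C f)))"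
    "Cod C (phom_bot k f x y g) = Dom C (pb1 C g (ev k (Cod C g)))"
    "pb1 C g (ev k (Cod C g)) \<cdot> phom_bot k f x y g = x \<cdot> pb1 C f (ev k (Cod C f))"
    "pb2 C g (ev k (Cod C g)) \<cdot> phom_bot k f x y g = H y \<cdot> pb2 C f (ev k (Cod C f))"
proof -
  note s = squareD[OF S]
  note s' [simp] = s(1-8)
  have "g \<cdot> (x \<cdot> pb1 C f (ev k (Cod C f))) = ev k (Cod C g) \<cdot> (H y \<cdot> pb2 C f (ev k (Cod C f)))"
    using reassoc[OF s(9), of "pb1 C f (ev k (Cod C f))"] reassoc[OF ev_natural[OF k s(4)], of "pb2 C f (ev k (Cod C f))"]
    by (simp add: pb_comm)
  then show "phom_bot k f x y g \<in> Arr C" "Dom C (phom_bot k f x y g) = Dom C (pb1 C f (ev k (Cod C f)))"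
    "Cod C (phom_bot k f x y g) = Dom C (pb1 C g (ev k (Cod C g)))"
    "pb1 C g (ev k (Cod C g)) \<cdot> phom_bot k f x y g = x \<cdot> pb1 C f (ev k (Cod C f))"
    "pb2 C g (ev k (Cod C g)) \<cdot> phom_bot k f x y g = H y \<cdot> pb2 C f (ev k (Cod C f))"
    unfolding phom_bot_def by (simp_all add: pb_pair)
qed

lemma right_maps_phom:
  assumes k [simp]: "endpoint k" and m: "fib_mor f \<phi> x y g \<psi>"
  shows "((phom k f, phom_fill k f \<phi>), (phom k f, H x, phom_bot k f x y g, phom k g), (phom k g, phom_fill k g \<psi>))
    \<in> Arr (right_maps C I u)"
proof -
  note m' = fib_morD[OF m]
  note S = squareD[OF m'(3)] and B = phom_bot[OF k m'(3)]
  note S' [simp] = S(1-8) B(1-3)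
  let ?p = "pb1 C f (ev k (Cod C f))" and ?q = "pb2 C f (ev k (Cod C f))"
  let ?p' = "pb1 C g (ev k (Cod C g))" and ?q' = "pb2 C g (ev k (Cod C g))"
  have "H g \<cdot> H x = H y \<cdot> H f"
    using S(9) K.R(6)[of x g] K.R(6)[of f y] by simp
  then have "phom k g \<cdot> H x = phom_bot k f x y g \<cdot> phom k f"
    using ev_natural[OF k S(3)]
    by (intro pb_ext[of g "ev k (Cod C g)" "phom k g \<cdot> H x"])
      (simp_all add: reassoc[OF phom_pb(1)] reassoc[OF phom_pb(2)] reassoc[OF B(4)] reassoc[OF B(5)] phom_pb)
  then have sqH: "(phom k f, H x, phom_bot k f x y g, phom k g) \<in> Arr (arrow_cat C)"
    by (simp add: hom_def)
  have "H x \<cdot> phom_fill k f \<phi> (i, s, t) = phom_fill k g \<psi> (i, H x \<cdot> s, phom_bot k f x y g \<cdot> t)"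
    if i [simp]: "i \<in> Obj I" and sq: "(fob u i, s, t, phom k f) \<in> Arr (arrow_cat C)" for i s t
  proof -
    have [simp]: "s \<in> Arr C" "t \<in> Arr C" "Dom C s = Dom C (fob u i)" "Cod C s = H0 (Dom C f)"
      "Dom C t = Cod C (fob u i)" "Cod C t = Dom C ?p"
      using squareD[OF sq] by simp_all
    note p = phom_problem[OF k S(1) sq]
    note w = lz_fill[OF m'(1) i p]
    have sq': "(fob u i, H x \<cdot> s, phom_bot k f x y g \<cdot> t, phom k g) \<in> Arr (arrow_cat C)"
      using square_cmp[OF sq sqH] .
    have 1: "lt (Dom C g) (H x \<cdot> s) = x \<cdot> lt (Dom C f) s"
      using K.lt_radj[of s x] by simp
    have 2: "?p' \<cdot> (phom_bot k f x y g \<cdot> t) = x \<cdot> (?p \<cdot> t)"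
      using reassoc[OF B(4), of t] by simp
    have 3: "lt (Cod C g) (?q' \<cdot> (phom_bot k f x y g \<cdot> t)) = y \<cdot> lt (Cod C f) (?q \<cdot> t)"
      using reassoc[OF B(5), of t] K.lt_radj[of "?q \<cdot> t" y] by simp
    show ?thesis
      using sq sq' w K.rt_cmp[of "lz_fill k i \<phi> (lt (Dom C f) s) (?p \<cdot> t) (lt (Cod C f) (?q \<cdot> t))" "Cod C (fob u i)" x]
      by (simp add: phom_fill_def 1 2 3 del: arrow_cat_simps) (simp add: lz_fill_right[OF m i p])
  qed
  then show ?thesis
    using right_map_phom[OF k m'(1)] right_map_phom[OF k m'(2)] sqH
    unfolding right_maps_arr by blast
qed

end


section \<open>Fibrations lift against Leibniz products with cofibrations\<close>

locale cofibration_category = cylinder_category C \<Lambda> \<delta> I u + awfs_category C W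
  for C :: "('o, 'm) cat" (structure) and \<Lambda> :: "('o, 'm, 'o, 'm) adj"
    and \<delta> :: "nat \<Rightarrow> 'o \<Rightarrow> 'm" and I :: "('i, 'j) cat" and u :: "('i, 'j, 'm, 'm sq) func"
    and W :: "('o, 'm) awfs_data" +
  fixes G :: "('m \<times> ('i \<times> 'm \<times> 'm \<Rightarrow> 'm),
     ('m \<times> ('i \<times> 'm \<times> 'm \<Rightarrow> 'm)) \<times> 'm sq \<times> ('m \<times> ('i \<times> 'm \<times> 'm \<Rightarrow> 'm)),
     'm \<times> 'm sq, ('m \<times> 'm sq) \<times> 'm sq \<times> ('m \<times> 'm sq)) func"
  assumes G: "is_functor (right_maps C I u) (RMap C W) G" "eq_func (right_maps C I u) (forget \<circ>\<^sub>F G) forget"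
begin

lemma G_ob:
  assumes "right_map C I u (f, \<phi>)"
  shows "fob G (f, \<phi>) = (f, snd (fob G (f, \<phi>)))" "(f, snd (fob G (f, \<phi>))) \<in> Obj (RMap C W)"
proof -
  show e: "fob G (f, \<phi>) = (f, snd (fob G (f, \<phi>)))"
    using G(2) assms by (auto simp: eq_func_def prod_eq_iff)
  show "(f, snd (fob G (f, \<phi>))) \<in> Obj (RMap C W)"
    using functorD(1)[OF G(1), of "(f, \<phi>)"] assms e by simp
qed

lemma G_arr:
  assumes "((f, \<phi>), (f, x, y, g), (g, \<psi>)) \<in> Arr (right_maps C I u)"
  shows "((f, snd (fob G (f, \<phi>))), (f, x, y, g), (g, snd (fob G (g, \<psi>)))) \<in> Arr (RMap C W)"
proof -
  have r: "right_map C I u (f, \<phi>)" "right_map C I u (g, \<psi>)"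
    using assms by (simp_all add: right_maps_arr)
  let ?S = "((f, \<phi>), (f, x, y, g), (g, \<psi>))"
  have "far G ?S \<in> Arr (RMap C W)" "Dom (RMap C W) (far G ?S) = (f, snd (fob G (f, \<phi>)))"
    "Cod (RMap C W) (far G ?S) = (g, snd (fob G (g, \<psi>)))"
    using functorD(2-4)[OF G(1) assms] G_ob(1)[OF r(1)] G_ob(1)[OF r(2)] by (simp_all add: right_maps_def)
  moreover have "far forget (far G ?S) = (f, x, y, g)"
    using G(2) assms by (auto simp: eq_func_def)
  ultimately show ?thesis
    by (cases "far G ?S") (auto simp: RMap_def monad_algs_def Let_def forget_def)
qed

text \<open>Cofibrations are more general than the generating maps: the pullback hom of a fibration is a
  right \<open>I\<close>-map, which \<open>G\<close> makes an algebra, and this lifts against all coalgebras.\<close>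

definition cof_fill :: "nat \<Rightarrow> 'm \<Rightarrow> 'm sq \<Rightarrow> 'm \<Rightarrow> (('i + 'i) \<times> 'm \<times> 'm \<Rightarrow> 'm) \<Rightarrow> 'm \<Rightarrow> 'm \<Rightarrow> 'm \<Rightarrow> 'm" where
  "cof_fill k c \<alpha> f \<phi> s1 s2 t = lt (Dom C f)
     (diag c \<alpha> (phom k f) (snd (fob G (phom k f, phom_fill k f \<phi>))) (rt (Dom C c) s1)
       (pb_pair C f (ev k (Cod C f)) s2 (rt (Cod C c) t)))"

lemma cof_fill:
  assumes f: "fib f \<phi>" and c: "(c, \<alpha>) \<in> Obj (Lmap C W)" and p: "leibniz_problem k c f s1 s2 t"
  shows "cof_fill k c \<alpha> f \<phi> s1 s2 t \<in> Arr C" "Dom C (cof_fill k c \<alpha> f \<phi> s1 s2 t) = K0 (Cod C c)"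
    "Cod C (cof_fill k c \<alpha> f \<phi> s1 s2 t) = Dom C f" "cof_fill k c \<alpha> f \<phi> s1 s2 t \<cdot> K c = s1"
    "cof_fill k c \<alpha> f \<phi> s1 s2 t \<cdot> \<delta> k (Cod C c) = s2" "f \<cdot> cof_fill k c \<alpha> f \<phi> s1 s2 t = t"
proof -
  note l = leibniz_problemD[OF p]
  note [simp] = l(1-12)
  note P = problem_phom[OF p]
  note d = diag[OF c G_ob(2)[OF right_map_phom[OF l(1) f]] P(1)]
  let ?d = "diag c \<alpha> (phom k f) (snd (fob G (phom k f, phom_fill k f \<phi>))) (rt (Dom C c) s1)
       (pb_pair C f (ev k (Cod C f)) s2 (rt (Cod C c) t))"
  have d' [simp]: "?d \<in> Arr C" "Dom C ?d = Cod C c" "Cod C ?d = H0 (Dom C f)"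
    using d by simp_all
  show "cof_fill k c \<alpha> f \<phi> s1 s2 t \<in> Arr C" "Dom C (cof_fill k c \<alpha> f \<phi> s1 s2 t) = K0 (Cod C c)"
    "Cod C (cof_fill k c \<alpha> f \<phi> s1 s2 t) = Dom C f"
    by (simp_all add: cof_fill_def)
  show "cof_fill k c \<alpha> f \<phi> s1 s2 t \<cdot> K c = s1"
    using K.lt_cmp[of ?d c "Dom C f"] by (simp add: cof_fill_def d(4))
  show "cof_fill k c \<alpha> f \<phi> s1 s2 t \<cdot> \<delta> k (Cod C c) = s2"
    using ev_cmp[OF l(1), of "Dom C f" ?d] reassoc[OF phom_pb(1)[OF l(1,3)], of ?d]
    by (simp add: cof_fill_def d(5) P)
  show "f \<cdot> cof_fill k c \<alpha> f \<phi> s1 s2 t = t"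
    using K.lt_radj[of ?d f "Cod C f"] reassoc[OF phom_pb(2)[OF l(1,3)], of ?d]
    by (simp add: cof_fill_def d(5) P)
qed

lemma cof_fill_left:
  assumes f: "fib f \<phi>" and c: "((c', \<alpha>'), (c', a, b, c), (c, \<alpha>)) \<in> Arr (Lmap C W)"
    and p: "leibniz_problem k c f s1 s2 t"
  shows "cof_fill k c \<alpha> f \<phi> s1 s2 t \<cdot> K b = cof_fill k c' \<alpha>' f \<phi> (s1 \<cdot> K a) (s2 \<cdot> b) (t \<cdot> K b)"
proof -
  have c': "(c, \<alpha>) \<in> Obj (Lmap C W)" "(c', a, b, c) \<in> Arr (arrow_cat C)" using c by (auto simp: Lmap_arr)
  note l = leibniz_problemD[OF p] and P = problem_phom[OF p]
  note p' = leibniz_problem_left(1)[OF p c'(2)]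
  note P' = problem_phom[OF p']
  note [simp] = l(1-12) squareD(1-8)[OF c'(2)]
  note R = G_ob(2)[OF right_map_phom[OF l(1) f]]
  note d = diag[OF c'(1) R P(1)]
  let ?d = "diag c \<alpha> (phom k f) (snd (fob G (phom k f, phom_fill k f \<phi>))) (rt (Dom C c) s1)
       (pb_pair C f (ev k (Cod C f)) s2 (rt (Cod C c) t))"
  have 1: "rt (Dom C c') (s1 \<cdot> K a) = rt (Dom C c) s1 \<cdot> a"
    using K.rt_ladj[of s1 a] by simp
  have 2: "rt (Cod C c') (t \<cdot> K b) = rt (Cod C c) t \<cdot> b"
    using K.rt_ladj[of t b] by simp
  have q: "pb_pair C f (ev k (Cod C f)) s2 (rt (Cod C c) t) \<in> Arr C"
    "Dom C (pb_pair C f (ev k (Cod C f)) s2 (rt (Cod C c) t)) = Cod C c"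
    "Cod C (pb_pair C f (ev k (Cod C f)) s2 (rt (Cod C c) t)) = Dom C (pb1 C f (ev k (Cod C f)))"
    using squareD[OF P(1)] by simp_all
  have 3: "pb_pair C f (ev k (Cod C f)) (s2 \<cdot> b) (rt (Cod C c') (t \<cdot> K b))
    = pb_pair C f (ev k (Cod C f)) s2 (rt (Cod C c) t) \<cdot> b"
    by (rule pb_pair_eqI) (simp_all add: q 2 reassoc[OF P(2)] reassoc[OF P(3)])
  have "?d \<cdot> b = diag c' \<alpha>' (phom k f) (snd (fob G (phom k f, phom_fill k f \<phi>))) (rt (Dom C c') (s1 \<cdot> K a))
       (pb_pair C f (ev k (Cod C f)) (s2 \<cdot> b) (rt (Cod C c') (t \<cdot> K b)))"
    unfolding 1 3 by (rule diag_left[OF c R P(1)])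
  then show ?thesis
    using K.lt_cmp[of ?d b "Dom C f"] d by (simp add: cof_fill_def)
qed

lemma cof_fill_right:
  assumes m: "fib_mor f \<phi> x y g \<psi>" and c: "(c, \<alpha>) \<in> Obj (Lmap C W)" and p: "leibniz_problem k c f s1 s2 t"
  shows "x \<cdot> cof_fill k c \<alpha> f \<phi> s1 s2 t = cof_fill k c \<alpha> g \<psi> (x \<cdot> s1) (x \<cdot> s2) (y \<cdot> t)"
proof -
  note m' = fib_morD[OF m]
  note l = leibniz_problemD[OF p] and P = problem_phom[OF p]
  note p' = leibniz_problem_right(1)[OF p m'(3)]
  note P' = problem_phom[OF p']
  note B = phom_bot[OF l(1) m'(3)]
  note [simp] = l(1-12) squareD(1-8)[OF m'(3)] B(1-3)
  note R = G_ob(2)[OF right_map_phom[OF l(1) m'(1)]]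
  note d = diag[OF c R P(1)]
  let ?d = "diag c \<alpha> (phom k f) (snd (fob G (phom k f, phom_fill k f \<phi>))) (rt (Dom C c) s1)
       (pb_pair C f (ev k (Cod C f)) s2 (rt (Cod C c) t))"
  have 1: "rt (Dom C c) (x \<cdot> s1) = H x \<cdot> rt (Dom C c) s1"
    using K.rt_cmp[of s1 "Dom C c" x] by simp
  have 2: "rt (Cod C c) (y \<cdot> t) = H y \<cdot> rt (Cod C c) t"
    using K.rt_cmp[of t "Cod C c" y] by simp
  have q: "pb_pair C f (ev k (Cod C f)) s2 (rt (Cod C c) t) \<in> Arr C"
    "Dom C (pb_pair C f (ev k (Cod C f)) s2 (rt (Cod C c) t)) = Cod C c"
    "Cod C (pb_pair C f (ev k (Cod C f)) s2 (rt (Cod C c) t)) = Dom C (pb1 C f (ev k (Cod C f)))"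
    using squareD[OF P(1)] by simp_all
  have 3: "pb_pair C g (ev k (Cod C g)) (x \<cdot> s2) (rt (Cod C c) (y \<cdot> t))
    = phom_bot k f x y g \<cdot> pb_pair C f (ev k (Cod C f)) s2 (rt (Cod C c) t)"
    by (rule pb_pair_eqI) (simp_all add: q 2 P(2,3) reassoc[OF B(4)] reassoc[OF B(5)])
  have "H x \<cdot> ?d = diag c \<alpha> (phom k g) (snd (fob G (phom k g, phom_fill k g \<psi>))) (rt (Dom C c) (x \<cdot> s1))
       (pb_pair C g (ev k (Cod C g)) (x \<cdot> s2) (rt (Cod C c) (y \<cdot> t)))"
    unfolding 1 3 by (rule diag_right[OF c G_arr[OF right_maps_phom[OF l(1) m]] P(1)])
  then show ?thesis
    using K.lt_radj[of ?d x "Dom C g"] d by (simp add: cof_fill_def)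
qed

end


section \<open>Strong homotopy equivalences and the Frobenius property\<close>

lemma (in awfs_category) lifts_Lmap:
  assumes "is_functor A (Lmap C W) F" "eq_func A (forget \<circ>\<^sub>F F) B"
  shows "a \<in> Obj A \<Longrightarrow> (fob B a, snd (fob F a)) \<in> Obj (Lmap C W)"
    and "f \<in> Arr A \<Longrightarrow> Dom A f \<in> Obj A \<Longrightarrow> Cod A f \<in> Obj A \<Longrightarrow>
      ((fob B (Dom A f), snd (fob F (Dom A f))), far B f, (fob B (Cod A f), snd (fob F (Cod A f)))) \<in> Arr (Lmap C W)"
proof -
  have e: "fob F a = (fob B a, snd (fob F a))" if "a \<in> Obj A" for a
    using assms(2) that by (auto simp: eq_func_def prod_eq_iff)
  show "a \<in> Obj A \<Longrightarrow> (fob B a, snd (fob F a)) \<in> Obj (Lmap C W)"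
    using functorD(1)[OF assms(1)] e by metis
  assume f: "f \<in> Arr A" "Dom A f \<in> Obj A" "Cod A f \<in> Obj A"
  have "far F f \<in> Arr (Lmap C W)" "Dom (Lmap C W) (far F f) = (fob B (Dom A f), snd (fob F (Dom A f)))"
    "Cod (Lmap C W) (far F f) = (fob B (Cod A f), snd (fob F (Cod A f)))"
    using functorD(2-4)[OF assms(1) f(1)] e[OF f(2)] e[OF f(3)] by simp_all
  moreover have "far forget (far F f) = far B f"
    using assms(2) f by (auto simp: eq_func_def)
  ultimately show "((fob B (Dom A f), snd (fob F (Dom A f))), far B f, (fob B (Cod A f), snd (fob F (Cod A f)))) \<in> Arr (Lmap C W)"
    by (cases "far F f") (auto simp: Lmap_def copointed_coalgs_def Let_def forget_def)
qed

text \<open>\<open>\<epsilon>\<close> and \<open>\<gamma>\<close> are the contraction and the connections. The functors \<open>M k\<close>, \<open>Z\<close> and \<open>P\<close> provide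
  coalgebra structures on the Leibniz products of \<open>\<delta> k\<close> with the generating maps, on the maps
  \<open>0 \<rightarrow> X\<close>, and on pullbacks of coalgebras.\<close>

locale frobenius_category = cofibration_category C \<Lambda> \<delta> I u W G
  for C :: "('o, 'm) cat" (structure) and \<Lambda> :: "('o, 'm, 'o, 'm) adj"
    and \<delta> :: "nat \<Rightarrow> 'o \<Rightarrow> 'm" and I :: "('i, 'j) cat" and u :: "('i, 'j, 'm, 'm sq) func"
    and W :: "('o, 'm) awfs_data" and G +
  fixes \<epsilon> :: "'o \<Rightarrow> 'm" and \<gamma> :: "nat \<Rightarrow> 'o \<Rightarrow> 'm"
    and M :: "nat \<Rightarrow> ('i, 'j, 'm \<times> 'm sq, ('m \<times> 'm sq) \<times> 'm sq \<times> ('m \<times> 'm sq)) func"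
    and Z :: "('o, 'm, 'm \<times> 'm sq, ('m \<times> 'm sq) \<times> 'm sq \<times> ('m \<times> 'm sq)) func"
    and P :: "(('m \<times> 'm sq) \<times> 'm, (('m \<times> 'm sq) \<times> 'm sq \<times> ('m \<times> 'm sq)) \<times> 'm sq,
       'm \<times> 'm sq, ('m \<times> 'm sq) \<times> 'm sq \<times> ('m \<times> 'm sq)) func"
  assumes \<epsilon>: "nat_trans C C (ladj \<Lambda>) id_func \<epsilon>"
    and \<epsilon>_\<delta>: "endpoint k \<Longrightarrow> X \<in> Obj C \<Longrightarrow> \<epsilon> X \<cdot> \<delta> k X = Id C X"
    and \<gamma>: "endpoint k \<Longrightarrow> nat_trans C C (ladj \<Lambda> \<circ>\<^sub>F ladj \<Lambda>) (ladj \<Lambda>) (\<gamma> k)"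
    and \<gamma>_\<delta>: "endpoint k \<Longrightarrow> X \<in> Obj C \<Longrightarrow> \<gamma> k X \<cdot> \<delta> k (K0 X) = \<delta> k X \<cdot> \<epsilon> X"
      "endpoint k \<Longrightarrow> X \<in> Obj C \<Longrightarrow> \<gamma> k X \<cdot> K (\<delta> k X) = \<delta> k X \<cdot> \<epsilon> X"
      "endpoint k \<Longrightarrow> X \<in> Obj C \<Longrightarrow> \<gamma> k X \<cdot> \<delta> (opp k) (K0 X) = Id C (K0 X)"
    and M: "endpoint k \<Longrightarrow> lifts_functor I (Lmap C W) id_func forget (leibniz C (ladj \<Lambda>) (\<delta> k) \<circ>\<^sub>F u) (M k)"
    and Z: "lifts_functor C (Lmap C W) id_func forget (init_func C) Z"
    and P: "lifts_functor (fibre_prod (Lmap C W) (arrow_cat C) (cod_func C \<circ>\<^sub>F forget) (cod_func C)) (Lmap C W)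
      (prod_func forget id_func) forget (pull_bifunc C) P"
    and has_initial: "\<exists>z. initial C z"
begin

lemma \<epsilon>_arr [simp]: "X \<in> Obj C \<Longrightarrow> \<epsilon> X \<in> Arr C" "X \<in> Obj C \<Longrightarrow> Dom C (\<epsilon> X) = K0 X"
  "X \<in> Obj C \<Longrightarrow> Cod C (\<epsilon> X) = X"
  using nat_transD(1-3)[OF \<epsilon>, of X] by simp_all

lemma \<epsilon>_natural: "f \<in> Arr C \<Longrightarrow> A = Dom C f \<Longrightarrow> B = Cod C f \<Longrightarrow> \<epsilon> B \<cdot> K f = f \<cdot> \<epsilon> A"
  using nat_transD(4)[OF \<epsilon>, of f] by simp

lemma \<gamma>_arr [simp]: "endpoint k \<Longrightarrow> X \<in> Obj C \<Longrightarrow> \<gamma> k X \<in> Arr C"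
  "endpoint k \<Longrightarrow> X \<in> Obj C \<Longrightarrow> Dom C (\<gamma> k X) = K0 (K0 X)"
  "endpoint k \<Longrightarrow> X \<in> Obj C \<Longrightarrow> Cod C (\<gamma> k X) = K0 X"
  using nat_transD(1-3)[OF \<gamma>, of k X] by simp_all

lemma \<gamma>_natural: "endpoint k \<Longrightarrow> f \<in> Arr C \<Longrightarrow> A = Dom C f \<Longrightarrow> B = Cod C f \<Longrightarrow> \<gamma> k B \<cdot> K (K f) = K f \<cdot> \<gamma> k A"
  using nat_transD(4)[OF \<gamma>, of k f] by simp

subsection \<open>The three lifted functors on objects and arrows\<close>

definition z0 :: 'o where "z0 = (SOME z. initial C z)"

lemma initial_z0: "initial C z0"
  unfolding z0_def using has_initial by (rule someI_ex)

lemma z0_obj [simp]: "z0 \<in> Obj C"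
  using initial_z0 by (simp add: initial_def)

abbreviation from0 :: "'o \<Rightarrow> 'm" where "from0 X \<equiv> fob (init_func C) X"

lemma from0 [simp]:
  assumes "X \<in> Obj C"
  shows "from0 X \<in> Arr C" "Dom C (from0 X) = z0" "Cod C (from0 X) = X"
proof -
  have "\<exists>!h. h \<in> hom C z0 X" using initial_z0 assms by (simp add: initial_def)
  from theI'[OF this] show "from0 X \<in> Arr C" "Dom C (from0 X) = z0" "Cod C (from0 X) = X"
    by (auto simp: init_func_def Let_def hom_def z0_def[symmetric])
qed

lemma initial_ext:
  assumes "initial C z" "f \<in> Arr C" "g \<in> Arr C" "Dom C f = z" "Dom C g = z" "Cod C f = Cod C g"
  shows "f = g"
proof -
  have "\<exists>!h. h \<in> hom C z (Cod C f)" using assms by (simp add: initial_def)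
  moreover have "f \<in> hom C z (Cod C f)" "g \<in> hom C z (Cod C f)" using assms by (simp_all add: hom_def)
  ultimately show ?thesis by blast
qed

definition K_from0 :: "'o \<Rightarrow> 'm" where "K_from0 X = (THE h. h \<in> hom C (K0 z0) X)"

lemma initial_K0: "initial C (K0 z0)"
  by (rule K.initial_ladj[OF initial_z0])

lemma K_from0 [simp]:
  assumes "X \<in> Obj C"
  shows "K_from0 X \<in> Arr C" "Dom C (K_from0 X) = K0 z0" "Cod C (K_from0 X) = X"
proof -
  have "\<exists>!h. h \<in> hom C (K0 z0) X" using initial_K0 assms by (simp add: initial_def)
  from theI'[OF this] show "K_from0 X \<in> Arr C" "Dom C (K_from0 X) = K0 z0" "Cod C (K_from0 X) = X"
    by (auto simp: K_from0_def hom_def)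
qed

definition coalg0 :: "'o \<Rightarrow> 'm sq" where "coalg0 X = snd (fob Z X)"

lemma coalg0:
  "X \<in> Obj C \<Longrightarrow> (from0 X, coalg0 X) \<in> Obj (Lmap C W)"
  "f \<in> Arr C \<Longrightarrow> ((from0 (Dom C f), coalg0 (Dom C f)), (from0 (Dom C f), Id C z0, f, from0 (Cod C f)),
     (from0 (Cod C f), coalg0 (Cod C f))) \<in> Arr (Lmap C W)"
proof -
  have F: "is_functor C (Lmap C W) Z" "eq_func C (forget \<circ>\<^sub>F Z) (init_func C)"
    using Z by (auto simp: lifts_functor_def eq_func_def)
  show "X \<in> Obj C \<Longrightarrow> (from0 X, coalg0 X) \<in> Obj (Lmap C W)"
    using lifts_Lmap(1)[OF F] by (simp add: coalg0_def)
  have "far (init_func C) f = (from0 (Dom C f), Id C z0, f, from0 (Cod C f))"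
    by (simp add: init_func_def Let_def z0_def)
  then show "f \<in> Arr C \<Longrightarrow> ((from0 (Dom C f), coalg0 (Dom C f)), (from0 (Dom C f), Id C z0, f, from0 (Cod C f)),
     (from0 (Cod C f), coalg0 (Cod C f))) \<in> Arr (Lmap C W)"
    using lifts_Lmap(2)[OF F, of f] by (simp add: coalg0_def)
qed

definition LZ_coalg :: "nat \<Rightarrow> 'i \<Rightarrow> 'm sq" where "LZ_coalg k i = snd (fob (M k) i)"

lemma LZ_coalg:
  assumes k: "endpoint k"
  shows "i \<in> Obj I \<Longrightarrow> (LZ k (fob u i), LZ_coalg k i) \<in> Obj (Lmap C W)"
    "\<sigma> \<in> Arr I \<Longrightarrow> ((LZ k (fob u (Dom I \<sigma>)), LZ_coalg k (Dom I \<sigma>)),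
      (LZ k (fob u (Dom I \<sigma>)), LZ_top k (fob u (Dom I \<sigma>)) (top_of (far u \<sigma>)) (bot_of (far u \<sigma>)) (fob u (Cod I \<sigma>)),
       K (bot_of (far u \<sigma>)), LZ k (fob u (Cod I \<sigma>))),
      (LZ k (fob u (Cod I \<sigma>)), LZ_coalg k (Cod I \<sigma>))) \<in> Arr (Lmap C W)"
proof -
  have F: "is_functor I (Lmap C W) (M k)" "eq_func I (forget \<circ>\<^sub>F M k) (leibniz C (ladj \<Lambda>) (\<delta> k) \<circ>\<^sub>F u)"
    using M[OF k] by (auto simp: lifts_functor_def eq_func_def)
  have b: "fob (leibniz C (ladj \<Lambda>) (\<delta> k) \<circ>\<^sub>F u) i = LZ k (fob u i)" for i
    by (simp add: leibniz_def)
  show "i \<in> Obj I \<Longrightarrow> (LZ k (fob u i), LZ_coalg k i) \<in> Obj (Lmap C W)"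
    using lifts_Lmap(1)[OF F] unfolding b by (simp add: LZ_coalg_def)
  assume \<sigma>: "\<sigma> \<in> Arr I"
  show "((LZ k (fob u (Dom I \<sigma>)), LZ_coalg k (Dom I \<sigma>)),
      (LZ k (fob u (Dom I \<sigma>)), LZ_top k (fob u (Dom I \<sigma>)) (top_of (far u \<sigma>)) (bot_of (far u \<sigma>)) (fob u (Cod I \<sigma>)),
       K (bot_of (far u \<sigma>)), LZ k (fob u (Cod I \<sigma>))),
      (LZ k (fob u (Cod I \<sigma>)), LZ_coalg k (Cod I \<sigma>))) \<in> Arr (Lmap C W)"
    using lifts_Lmap(2)[OF F \<sigma>] \<sigma> LZ_top(6)[OF k u_sq(2)[OF \<sigma>]] u_sq(1)[OF \<sigma>] unfolding b
    by (simp add: LZ_coalg_def)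
qed

definition pb_coalg :: "'m \<Rightarrow> 'm sq \<Rightarrow> 'm \<Rightarrow> 'm sq" where
  "pb_coalg c \<alpha> h = snd (fob P ((c, \<alpha>), h))"

lemma pb_coalg:
  "(c, \<alpha>) \<in> Obj (Lmap C W) \<Longrightarrow> h \<in> Arr C \<Longrightarrow> Cod C h = Cod C c \<Longrightarrow> (pb2 C c h, pb_coalg c \<alpha> h) \<in> Obj (Lmap C W)"
  "((c, \<alpha>), (c, a, b, d), (d, \<beta>)) \<in> Arr (Lmap C W) \<Longrightarrow> (h, x, b, h') \<in> Arr (arrow_cat C) \<Longrightarrow>
    Cod C h = Cod C c \<Longrightarrow> Cod C h' = Cod C d \<Longrightarrow>
    ((pb2 C c h, pb_coalg c \<alpha> h), (pb2 C c h, pb_pair C d h' (a \<cdot> pb1 C c h) (x \<cdot> pb2 C c h), x, pb2 C d h'),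
     (pb2 C d h', pb_coalg d \<beta> h')) \<in> Arr (Lmap C W)"
proof -
  let ?A = "fibre_prod (Lmap C W) (arrow_cat C) (cod_func C \<circ>\<^sub>F forget) (cod_func C)"
  have F: "is_functor ?A (Lmap C W) P" "eq_func ?A (forget \<circ>\<^sub>F P) (pull_bifunc C \<circ>\<^sub>F prod_func forget id_func)"
    using P by (auto simp: lifts_functor_def)
  let ?B = "pull_bifunc C \<circ>\<^sub>F prod_func forget id_func"
  have b: "fob ?B ((c, \<alpha>), h) = pb2 C c h" for c \<alpha> h
    by (simp add: pull_bifunc_def prod_func_def)
  have o: "((c, \<alpha>), h) \<in> Obj ?A \<longleftrightarrow> (c, \<alpha>) \<in> Obj (Lmap C W) \<and> h \<in> Arr C \<and> Cod C c = Cod C h" for c \<alpha> h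
    by (simp add: fibre_prod_def cod_func_def)
  show "(c, \<alpha>) \<in> Obj (Lmap C W) \<Longrightarrow> h \<in> Arr C \<Longrightarrow> Cod C h = Cod C c \<Longrightarrow> (pb2 C c h, pb_coalg c \<alpha> h) \<in> Obj (Lmap C W)"
    using lifts_Lmap(1)[OF F, of "((c, \<alpha>), h)"] unfolding b o by (simp add: pb_coalg_def)
  assume 1: "((c, \<alpha>), (c, a, b, d), (d, \<beta>)) \<in> Arr (Lmap C W)" and 2: "(h, x, b, h') \<in> Arr (arrow_cat C)"
    and 3: "Cod C h = Cod C c" "Cod C h' = Cod C d"
  let ?S = "(((c, \<alpha>), (c, a, b, d), (d, \<beta>)), (h, x, b, h'))"
  have S: "?S \<in> Arr ?A"
    using 1 2 by (simp add: fibre_prod_def cod_func_def)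
  have d: "Dom ?A ?S = ((c, \<alpha>), h)" "Cod ?A ?S = ((d, \<beta>), h')"
    by (simp_all add: fibre_prod_def Lmap_def copointed_coalgs_def Let_def)
  have "far ?B ?S = (pb2 C c h, pb_pair C d h' (a \<cdot> pb1 C c h) (x \<cdot> pb2 C c h), x, pb2 C d h')"
    by (simp add: pull_bifunc_def prod_func_def)
  then show "((pb2 C c h, pb_coalg c \<alpha> h), (pb2 C c h, pb_pair C d h' (a \<cdot> pb1 C c h) (x \<cdot> pb2 C c h), x, pb2 C d h'),
     (pb2 C d h', pb_coalg d \<beta> h')) \<in> Arr (Lmap C W)"
    using lifts_Lmap(2)[OF F S] 1 2 3 squareD(1,2)[OF 2] unfolding d o b
    by (simp add: pb_coalg_def Lmap_arr del: arrow_cat_simps)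
qed

subsection \<open>Strong homotopy equivalences\<close>

text \<open>\<open>r\<close> is a homotopy inverse of \<open>m\<close>, with homotopies \<open>a\<close> from the identity to \<open>r \<cdot> m\<close> and \<open>h\<close>
  from the identity to \<open>m \<cdot> r\<close> that correspond under \<open>m\<close>; the identities are at the endpoint \<open>opp k\<close>.
  Equivalently, \<open>a\<close> and \<open>r\<close> on the summands of the domain, with \<open>h\<close> on the codomain, are a retraction
  from the Leibniz product of \<open>\<delta>\<^sup>k\<close> and \<open>m\<close> to \<open>m\<close>, with a section induced by the other
  endpoint.\<close>

definition strong_heq :: "nat \<Rightarrow> 'm \<Rightarrow> 'm \<Rightarrow> 'm \<Rightarrow> 'm \<Rightarrow> bool" where
  "strong_heq k m r a h \<longleftrightarrow> endpoint k \<and> m \<in> Arr C \<and> r \<in> hom C (Cod C m) (Dom C m) \<and>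
     a \<in> hom C (K0 (Dom C m)) (Dom C m) \<and> h \<in> hom C (K0 (Cod C m)) (Cod C m) \<and>
     m \<cdot> a = h \<cdot> K m \<and> a \<cdot> \<delta> k (Dom C m) = r \<cdot> m \<and> a \<cdot> \<delta> (opp k) (Dom C m) = Id C (Dom C m) \<and>
     h \<cdot> \<delta> k (Cod C m) = m \<cdot> r \<and> h \<cdot> \<delta> (opp k) (Cod C m) = Id C (Cod C m)"

lemma strong_heqD:
  assumes "strong_heq k m r a h"
  shows "endpoint k" "m \<in> Arr C" "r \<in> Arr C" "Dom C r = Cod C m" "Cod C r = Dom C m"
    "a \<in> Arr C" "Dom C a = K0 (Dom C m)" "Cod C a = Dom C m"
    "h \<in> Arr C" "Dom C h = K0 (Cod C m)" "Cod C h = Cod C m"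
    "m \<cdot> a = h \<cdot> K m" "a \<cdot> \<delta> k (Dom C m) = r \<cdot> m" "a \<cdot> \<delta> (opp k) (Dom C m) = Id C (Dom C m)"
    "h \<cdot> \<delta> k (Cod C m) = m \<cdot> r" "h \<cdot> \<delta> (opp k) (Cod C m) = Id C (Cod C m)"
  using assms by (simp_all add: strong_heq_def hom_def)

definition strong_heq_map :: "'m \<Rightarrow> 'm \<Rightarrow> 'm \<Rightarrow> 'm \<Rightarrow> 'm \<Rightarrow> 'm \<Rightarrow> 'm \<Rightarrow> 'm \<Rightarrow> 'm \<Rightarrow> 'm \<Rightarrow> bool" where
  "strong_heq_map m r a h x y m' r' a' h' \<longleftrightarrow> (m, x, y, m') \<in> Arr (arrow_cat C) \<and>
     r' \<cdot> y = x \<cdot> r \<and> a' \<cdot> K x = x \<cdot> a \<and> h' \<cdot> K y = y \<cdot> h"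

lemma strong_heq_mapD:
  assumes "strong_heq_map m r a h x y m' r' a' h'"
  shows "(m, x, y, m') \<in> Arr (arrow_cat C)" "r' \<cdot> y = x \<cdot> r" "a' \<cdot> K x = x \<cdot> a" "h' \<cdot> K y = y \<cdot> h"
  using assms by (simp_all add: strong_heq_map_def del: arrow_cat_simps)

text \<open>The connection is a homotopy on the codomain of the Leibniz product. As \<open>I \<otimes> (-)\<close> preserves the
  pushout \<open>(I \<otimes> A) +\<^sub>A B\<close>, the homotopy on the domain may be taken to be the connection on the first
  summand and constant, by the contraction, on the second.\<close>

abbreviation LZ_inv :: "nat \<Rightarrow> 'm \<Rightarrow> 'm" where
  "LZ_inv k i \<equiv> in2 k i \<cdot> \<epsilon> (Cod C i)"

definition LZ_hty :: "nat \<Rightarrow> 'm \<Rightarrow> 'm" where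
  "LZ_hty k i = lt (Cod C (in1 k i))
     (copair k i (rt (K0 (Dom C i)) (in1 k i \<cdot> \<gamma> k (Dom C i))) (rt (Cod C i) (in2 k i \<cdot> \<epsilon> (Cod C i))))"

lemma LZ_hty:
  assumes k [simp]: "endpoint k" and i [simp]: "i \<in> Arr C"
  shows "LZ_hty k i \<in> Arr C" "Dom C (LZ_hty k i) = K0 (Cod C (in1 k i))" "Cod C (LZ_hty k i) = Cod C (in1 k i)"
    "LZ_hty k i \<cdot> K (in1 k i) = in1 k i \<cdot> \<gamma> k (Dom C i)"
    "LZ_hty k i \<cdot> K (in2 k i) = in2 k i \<cdot> \<epsilon> (Cod C i)"
proof -
  let ?f = "rt (K0 (Dom C i)) (in1 k i \<cdot> \<gamma> k (Dom C i))" and ?g = "rt (Cod C i) (in2 k i \<cdot> \<epsilon> (Cod C i))"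
  have "(in1 k i \<cdot> \<gamma> k (Dom C i)) \<cdot> K (\<delta> k (Dom C i)) = (in2 k i \<cdot> \<epsilon> (Cod C i)) \<cdot> K i"
    using reassoc[OF in_comm[of k i], of "\<epsilon> (Dom C i)"] \<epsilon>_natural[of i]
    by (simp add: \<gamma>_\<delta>)
  then have "?f \<cdot> \<delta> k (Dom C i) = ?g \<cdot> i"
    using K.rt_ladj[of "in1 k i \<cdot> \<gamma> k (Dom C i)" "\<delta> k (Dom C i)" "Dom C i"]
      K.rt_ladj[of "in2 k i \<cdot> \<epsilon> (Cod C i)" i "Dom C i"] by simp
  then have c: "copair k i ?f ?g \<in> Arr C" "Cod C (copair k i ?f ?g) = H0 (Cod C (in1 k i))"
    "Dom C (copair k i ?f ?g) = Cod C (in1 k i)" "copair k i ?f ?g \<cdot> in1 k i = ?f" "copair k i ?f ?g \<cdot> in2 k i = ?g"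
    using copair[of k i ?f ?g] by simp_all
  show "LZ_hty k i \<in> Arr C" "Dom C (LZ_hty k i) = K0 (Cod C (in1 k i))" "Cod C (LZ_hty k i) = Cod C (in1 k i)"
    by (simp_all add: LZ_hty_def c)
  show "LZ_hty k i \<cdot> K (in1 k i) = in1 k i \<cdot> \<gamma> k (Dom C i)"
    "LZ_hty k i \<cdot> K (in2 k i) = in2 k i \<cdot> \<epsilon> (Cod C i)"
    using K.lt_cmp[of "copair k i ?f ?g" "in1 k i" "Cod C (in1 k i)"]
      K.lt_cmp[of "copair k i ?f ?g" "in2 k i" "Cod C (in1 k i)"]
    by (simp_all add: LZ_hty_def c)
qed

lemma K_in_ext:
  assumes "endpoint k" "i \<in> Arr C" "h \<in> Arr C" "h' \<in> Arr C" "Dom C h = K0 (Cod C (in1 k i))"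
    "Dom C h' = K0 (Cod C (in1 k i))" "Cod C h = Cod C h'" "h \<cdot> K (in1 k i) = h' \<cdot> K (in1 k i)"
    "h \<cdot> K (in2 k i) = h' \<cdot> K (in2 k i)"
  shows "h = h'"
  by (rule is_pushout_ext[OF K.is_pushout_ladj[OF LZ_pushout[OF assms(1,2)]]]) (use assms in simp_all)

lemma strong_heq_LZ:
  assumes k [simp]: "endpoint k" and i [simp]: "i \<in> Arr C"
  shows "strong_heq k (LZ k i) (LZ_inv k i) (LZ_hty k i) (\<gamma> k (Cod C i))"
proof -
  note h = LZ_hty[OF k i]
  note h' [simp] = h(1-3)
  have "K (LZ k i) \<cdot> K (in1 k i) = K (K i)" "K (LZ k i) \<cdot> K (in2 k i) = K (\<delta> k (Cod C i))"
    using K.L(6)[of "in1 k i" "LZ k i"] K.L(6)[of "in2 k i" "LZ k i"] by (simp_all add: LZ_in)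
  then have 1: "LZ k i \<cdot> LZ_hty k i = \<gamma> k (Cod C i) \<cdot> K (LZ k i)"
    using \<gamma>_natural[of k i]
    by (intro K_in_ext[of k i "LZ k i \<cdot> LZ_hty k i"])
      (simp_all add: h reassoc[OF LZ_in(1)] reassoc[OF LZ_in(2)] \<gamma>_\<delta>)
  have d: "K (in1 k i) \<cdot> \<delta> l (K0 (Dom C i)) = \<delta> l (Cod C (in1 k i)) \<cdot> in1 k i"
    "K (in2 k i) \<cdot> \<delta> l (Cod C i) = \<delta> l (Cod C (in1 k i)) \<cdot> in2 k i" if "endpoint l" for l
    using that by (intro \<delta>_natural; simp)+
  have e: "LZ_hty k i \<cdot> (\<delta> l (Cod C (in1 k i)) \<cdot> in1 k i) = in1 k i \<cdot> (\<gamma> k (Dom C i) \<cdot> \<delta> l (K0 (Dom C i)))"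
    "LZ_hty k i \<cdot> (\<delta> l (Cod C (in1 k i)) \<cdot> in2 k i) = in2 k i"
    if [simp]: "endpoint l" for l
    using reassoc[OF h(4), of "\<delta> l (K0 (Dom C i))"] reassoc[OF h(5), of "\<delta> l (Cod C i)"]
    by (simp_all add: d \<epsilon>_\<delta>)
  have 2: "LZ_hty k i \<cdot> \<delta> k (Cod C (in1 k i)) = LZ_inv k i \<cdot> LZ k i"
    using reassoc[OF in_comm[of k i], of "\<epsilon> (Dom C i)"] \<epsilon>_natural[of i]
    by (intro in_ext[of k i "LZ_hty k i \<cdot> \<delta> k (Cod C (in1 k i))"]) (simp_all add: e LZ_in \<gamma>_\<delta> \<epsilon>_\<delta>)
  have 3: "LZ_hty k i \<cdot> \<delta> (opp k) (Cod C (in1 k i)) = Id C (Cod C (in1 k i))"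
    by (intro in_ext[of k i "LZ_hty k i \<cdot> \<delta> (opp k) (Cod C (in1 k i))"]) (simp_all add: e \<gamma>_\<delta>)
  show ?thesis
    unfolding strong_heq_def using 1 2 3 by (simp add: hom_def \<gamma>_\<delta> reassoc[OF LZ_in(2)])
qed

lemma strong_heq_map_LZ:
  assumes k [simp]: "endpoint k" and sq: "(i, a, b, j) \<in> Arr (arrow_cat C)"
  shows "strong_heq_map (LZ k i) (LZ_inv k i) (LZ_hty k i) (\<gamma> k (Cod C i)) (LZ_top k i a b j) (K b)
    (LZ k j) (LZ_inv k j) (LZ_hty k j) (\<gamma> k (Cod C j))"
proof -
  note s = squareD[OF sq]
  note s' [simp] = s(1-8)
  note T = LZ_top[OF k sq]
  note T' [simp] = T(1-3)
  note hi = LZ_hty[OF k s(1)] and hj = LZ_hty[OF k s(2)]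
  note h' [simp] = hi(1-3) hj(1-3)
  have 1: "(LZ k i, LZ_top k i a b j, K b, LZ k j) \<in> Arr (arrow_cat C)"
    using T(7) by (simp add: hom_def)
  have 2: "LZ_inv k j \<cdot> K b = LZ_top k i a b j \<cdot> LZ_inv k i"
    using \<epsilon>_natural[of b] by (simp add: reassoc[OF T(5)])
  have "K (LZ_top k i a b j) \<cdot> K (in1 k i) = K (in1 k j) \<cdot> K (K a)"
    "K (LZ_top k i a b j) \<cdot> K (in2 k i) = K (in2 k j) \<cdot> K b"
    using K.L(6)[of "in1 k i" "LZ_top k i a b j"] K.L(6)[of "in2 k i" "LZ_top k i a b j"]
    by (simp_all add: T)
  then have 3: "LZ_hty k j \<cdot> K (LZ_top k i a b j) = LZ_top k i a b j \<cdot> LZ_hty k i"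
    using \<gamma>_natural[of k a] \<epsilon>_natural[of b]
    by (intro K_in_ext[of k i "LZ_hty k j \<cdot> K (LZ_top k i a b j)"])
      (simp_all add: hi hj reassoc[OF hj(4)] reassoc[OF hj(5)] reassoc[OF T(4)] reassoc[OF T(5)])
  show ?thesis
    unfolding strong_heq_map_def using 1 2 3 \<gamma>_natural[of k b] by simp
qed

text \<open>The retraction turns a square from \<open>n\<close> to \<open>g\<close> into one from the Leibniz product of \<open>\<delta>\<^sup>k\<close> and \<open>n\<close>,
  which has a filler if \<open>n\<close> is a cofibration; this is restricted along the section, the other
  endpoint.\<close>

definition strong_heq_fill where
  "strong_heq_fill k n \<nu> r a h g \<psi> s t = cof_fill k n \<nu> g \<psi> (s \<cdot> a) (s \<cdot> r) (t \<cdot> h) \<cdot> \<delta> (opp k) (Cod C n)"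

lemma strong_heq_problem:
  assumes n: "strong_heq k n r a h" and S: "(n, s, t, g) \<in> Arr (arrow_cat C)"
  shows "leibniz_problem k n g (s \<cdot> a) (s \<cdot> r) (t \<cdot> h)"
proof -
  note n' = strong_heqD[OF n] and S' = squareD[OF S]
  note [simp] = n'(1-11) S'(1-8)
  show ?thesis
    unfolding leibniz_problem_def
    using n' S'(9) reassoc[OF S'(9), of a] reassoc[OF S'(9), of r] by (simp add: hom_def)
qed

lemma strong_heq_fill:
  assumes g: "fib g \<psi>" and \<nu>: "(n, \<nu>) \<in> Obj (Lmap C W)" and n: "strong_heq k n r a h"
    and S: "(n, s, t, g) \<in> Arr (arrow_cat C)"
  shows "strong_heq_fill k n \<nu> r a h g \<psi> s t \<in> Arr C" "Dom C (strong_heq_fill k n \<nu> r a h g \<psi> s t) = Cod C n"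
    "Cod C (strong_heq_fill k n \<nu> r a h g \<psi> s t) = Dom C g" "strong_heq_fill k n \<nu> r a h g \<psi> s t \<cdot> n = s"
    "g \<cdot> strong_heq_fill k n \<nu> r a h g \<psi> s t = t"
proof -
  note n' = strong_heqD[OF n] and S' = squareD[OF S]
  note [simp] = n'(1-11) S'(1-8)
  note w = cof_fill[OF g \<nu> strong_heq_problem[OF n S]]
  note w' [simp] = w(1-3)
  show "strong_heq_fill k n \<nu> r a h g \<psi> s t \<in> Arr C" "Dom C (strong_heq_fill k n \<nu> r a h g \<psi> s t) = Cod C n"
    "Cod C (strong_heq_fill k n \<nu> r a h g \<psi> s t) = Dom C g"
    by (simp_all add: strong_heq_fill_def)
  have d: "\<delta> (opp k) (Cod C n) \<cdot> n = K n \<cdot> \<delta> (opp k) (Dom C n)"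
    using \<delta>_natural[of "opp k" n] by simp
  show "strong_heq_fill k n \<nu> r a h g \<psi> s t \<cdot> n = s"
    using reassoc[OF w(4), of "\<delta> (opp k) (Dom C n)"] by (simp add: strong_heq_fill_def d n')
  show "g \<cdot> strong_heq_fill k n \<nu> r a h g \<psi> s t = t"
    using reassoc[OF w(6), of "\<delta> (opp k) (Cod C n)"] by (simp add: strong_heq_fill_def n')
qed

lemma strong_heq_fill_left:
  assumes g: "fib g \<psi>" and \<nu>: "((n, \<nu>), (n, x, y, n'), (n', \<nu>')) \<in> Arr (Lmap C W)"
    and n: "strong_heq k n r a h" and n': "strong_heq k n' r' a' h'" and xy: "strong_heq_map n r a h x y n' r' a' h'"
    and S: "(n', s, t, g) \<in> Arr (arrow_cat C)"
  shows "strong_heq_fill k n' \<nu>' r' a' h' g \<psi> s t \<cdot> y = strong_heq_fill k n \<nu> r a h g \<psi> (s \<cdot> x) (t \<cdot> y)"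
proof -
  note nD = strong_heqD[OF n] and nD' = strong_heqD[OF n'] and S' = squareD[OF S] and xyD = strong_heq_mapD[OF xy]
  note xyS = squareD[OF xyD(1)]
  note [simp] = nD(1-11) nD'(1-11) S'(1-8) xyS(1-8)
  have \<nu>': "(n', \<nu>') \<in> Obj (Lmap C W)" using \<nu> by (auto simp: Lmap_arr)
  note w = cof_fill[OF g \<nu>' strong_heq_problem[OF n' S]]
  note w' [simp] = w(1-3)
  have d: "\<delta> (opp k) (Cod C n') \<cdot> y = K y \<cdot> \<delta> (opp k) (Cod C n)"
    using \<delta>_natural[of "opp k" y] by simp
  note l = cof_fill_left[OF g \<nu> strong_heq_problem[OF n' S]]
  show ?thesis
    using reassoc[OF l, of "\<delta> (opp k) (Cod C n)"] xyD by (simp add: strong_heq_fill_def d)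
qed

lemma strong_heq_fill_right:
  assumes m: "fib_mor f \<phi> x y g \<psi>" and \<nu>: "(n, \<nu>) \<in> Obj (Lmap C W)" and n: "strong_heq k n r a h"
    and S: "(n, s, t, f) \<in> Arr (arrow_cat C)"
  shows "x \<cdot> strong_heq_fill k n \<nu> r a h f \<phi> s t = strong_heq_fill k n \<nu> r a h g \<psi> (x \<cdot> s) (y \<cdot> t)"
proof -
  note n' = strong_heqD[OF n] and S' = squareD[OF S] and m' = fib_morD[OF m]
  note [simp] = n'(1-11) S'(1-8) squareD(1-8)[OF m'(3)]
  note w = cof_fill[OF m'(1) \<nu> strong_heq_problem[OF n S]]
  note w' [simp] = w(1-3)
  note r = cof_fill_right[OF m \<nu> strong_heq_problem[OF n S]]
  show ?thesis
    using reassoc[OF r, of "\<delta> (opp k) (Cod C n)"] by (simp add: strong_heq_fill_def)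
qed

subsection \<open>Pullback along a fibration\<close>

text \<open>For \<open>Z\<close> the domain of the base change \<open>pb1 y p\<close> of the fibration \<open>p\<close>, a homotopy \<open>h\<close> that is the
  identity at the endpoint \<open>opp k\<close> lifts to a homotopy on \<open>Z\<close> that is the identity there: this is a
  lifting problem against \<open>p\<close> of the Leibniz product of that endpoint and the cofibration \<open>0 \<rightarrow> Z\<close>.\<close>

abbreviation hlift_bot :: "'m \<Rightarrow> 'm \<Rightarrow> 'm \<Rightarrow> 'm" where
  "hlift_bot h p y \<equiv> h \<cdot> K (pb1 C y p)"

definition hlift_fill where
  "hlift_fill k h p \<phi> y = cof_fill (opp k) (from0 (Dom C (pb1 C y p))) (coalg0 (Dom C (pb1 C y p))) p \<phi>
     (K_from0 (Dom C p)) (pb2 C y p) (y \<cdot> hlift_bot h p y)"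

definition hlift where
  "hlift k h p \<phi> y = pb_pair C y p (hlift_bot h p y) (hlift_fill k h p \<phi> y)"

lemma hlift_problem:
  assumes k: "endpoint k" and p: "p \<in> Arr C" and y: "y \<in> Arr C" "Cod C y = Cod C p"
    and h: "h \<in> Arr C" "Dom C h = K0 (Dom C y)" "Cod C h = Dom C y" "h \<cdot> \<delta> (opp k) (Dom C y) = Id C (Dom C y)"
  shows "leibniz_problem (opp k) (from0 (Dom C (pb1 C y p))) p (K_from0 (Dom C p)) (pb2 C y p) (y \<cdot> hlift_bot h p y)"
proof -
  note [simp] = k p y h(1-3)
  have "K (pb1 C y p) \<cdot> \<delta> (opp k) (Dom C (pb1 C y p)) = \<delta> (opp k) (Dom C y) \<cdot> pb1 C y p"
    by (intro \<delta>_natural) simp_all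
  then have "p \<cdot> pb2 C y p = (y \<cdot> hlift_bot h p y) \<cdot> \<delta> (opp k) (Dom C (pb1 C y p))"
    using reassoc[OF h(4), of "pb1 C y p"] pb_comm[of y p] by simp
  moreover have "K_from0 (Dom C p) \<cdot> \<delta> (opp k) z0 = pb2 C y p \<cdot> from0 (Dom C (pb1 C y p))"
    by (rule initial_ext[OF initial_z0]) simp_all
  moreover have "p \<cdot> K_from0 (Dom C p) = (y \<cdot> hlift_bot h p y) \<cdot> K (from0 (Dom C (pb1 C y p)))"
    by (rule initial_ext[OF initial_K0]) simp_all
  ultimately show ?thesis by (simp add: leibniz_problem_def hom_def)
qed

lemma hlift:
  assumes k: "endpoint k" and p: "fib p \<phi>" and y: "y \<in> Arr C" "Cod C y = Cod C p"
    and h: "h \<in> Arr C" "Dom C h = K0 (Dom C y)" "Cod C h = Dom C y" "h \<cdot> \<delta> (opp k) (Dom C y) = Id C (Dom C y)"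
  shows "hlift k h p \<phi> y \<in> Arr C" "Dom C (hlift k h p \<phi> y) = K0 (Dom C (pb1 C y p))"
    "Cod C (hlift k h p \<phi> y) = Dom C (pb1 C y p)" "pb1 C y p \<cdot> hlift k h p \<phi> y = h \<cdot> K (pb1 C y p)"
    "pb2 C y p \<cdot> hlift k h p \<phi> y = hlift_fill k h p \<phi> y"
    "hlift k h p \<phi> y \<cdot> \<delta> (opp k) (Dom C (pb1 C y p)) = Id C (Dom C (pb1 C y p))"
proof -
  have p' [simp]: "p \<in> Arr C" using right_mapD(1)[OF p] .
  note [simp] = k y h(1-3)
  have z: "Dom C (pb1 C y p) \<in> Obj C" by simp
  note f = cof_fill[OF p coalg0(1)[OF z] hlift_problem[OF k p' y h], folded hlift_fill_def]
  have f' [simp]: "hlift_fill k h p \<phi> y \<in> Arr C" "Dom C (hlift_fill k h p \<phi> y) = K0 (Dom C (pb1 C y p))"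
    "Cod C (hlift_fill k h p \<phi> y) = Dom C p"
    using f(1-3) by simp_all
  have f5: "hlift_fill k h p \<phi> y \<cdot> \<delta> (opp k) (Dom C (pb1 C y p)) = pb2 C y p"
    and f6: "p \<cdot> hlift_fill k h p \<phi> y = y \<cdot> hlift_bot h p y"
    using f(5,6) by simp_all
  show l: "hlift k h p \<phi> y \<in> Arr C" "Dom C (hlift k h p \<phi> y) = K0 (Dom C (pb1 C y p))"
    "Cod C (hlift k h p \<phi> y) = Dom C (pb1 C y p)" "pb1 C y p \<cdot> hlift k h p \<phi> y = h \<cdot> K (pb1 C y p)"
    "pb2 C y p \<cdot> hlift k h p \<phi> y = hlift_fill k h p \<phi> y"
    unfolding hlift_def using f6 by (simp_all add: pb_pair)
  have "K (pb1 C y p) \<cdot> \<delta> (opp k) (Dom C (pb1 C y p)) = \<delta> (opp k) (Dom C y) \<cdot> pb1 C y p"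
    by (intro \<delta>_natural) simp_all
  then show "hlift k h p \<phi> y \<cdot> \<delta> (opp k) (Dom C (pb1 C y p)) = Id C (Dom C (pb1 C y p))"
    using reassoc[OF h(4), of "pb1 C y p"]
    by (intro pb_ext[of y p "hlift k h p \<phi> y \<cdot> \<delta> (opp k) (Dom C (pb1 C y p))"])
      (simp_all add: l(1-3) reassoc[OF l(4)] reassoc[OF l(5)] f5)
qed

lemma hlift_natural:
  assumes k: "endpoint k" and p: "fib_mor p \<phi> x0 x1 p' \<phi>'" and y: "y \<in> Arr C" "Cod C y = Cod C p"
    and y': "y' \<in> Arr C" "Cod C y' = Cod C p'"
    and h: "h \<in> Arr C" "Dom C h = K0 (Dom C y)" "Cod C h = Dom C y" "h \<cdot> \<delta> (opp k) (Dom C y) = Id C (Dom C y)"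
    and h': "h' \<in> Arr C" "Dom C h' = K0 (Dom C y')" "Cod C h' = Dom C y'" "h' \<cdot> \<delta> (opp k) (Dom C y') = Id C (Dom C y')"
    and v: "v \<in> Arr C" "Dom C v = Dom C y" "Cod C v = Dom C y'" "y' \<cdot> v = x1 \<cdot> y" "h' \<cdot> K v = v \<cdot> h"
    and z: "z = pb_pair C y' p' (v \<cdot> pb1 C y p) (x0 \<cdot> pb2 C y p)"
  shows "z \<in> Arr C" "Dom C z = Dom C (pb1 C y p)" "Cod C z = Dom C (pb1 C y' p')"
    "pb1 C y' p' \<cdot> z = v \<cdot> pb1 C y p" "pb2 C y' p' \<cdot> z = x0 \<cdot> pb2 C y p"
    "hlift k h' p' \<phi>' y' \<cdot> K z = z \<cdot> hlift k h p \<phi> y"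
proof -
  note pD = fib_morD[OF p]
  note S = squareD[OF pD(3)]
  note [simp] = S(1-8) k y y' h(1-3) h'(1-3) v(1-3)
  have "y' \<cdot> (v \<cdot> pb1 C y p) = p' \<cdot> (x0 \<cdot> pb2 C y p)"
    using reassoc[OF v(4), of "pb1 C y p"] reassoc[OF S(9), of "pb2 C y p"] by (simp add: pb_comm)
  then show z': "z \<in> Arr C" "Dom C z = Dom C (pb1 C y p)" "Cod C z = Dom C (pb1 C y' p')"
    "pb1 C y' p' \<cdot> z = v \<cdot> pb1 C y p" "pb2 C y' p' \<cdot> z = x0 \<cdot> pb2 C y p"
    by (simp_all add: z pb_pair)
  note z'' [simp] = z'(1-3)
  note l = hlift[OF k pD(1) y h] and l' = hlift[OF k pD(2) y' h']
  note [simp] = l(1-3) l'(1-3)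
  note pr = hlift_problem[OF k S(1) y h] and pr' = hlift_problem[OF k S(2) y' h']
  have Kz: "K (pb1 C y' p') \<cdot> K z = K v \<cdot> K (pb1 C y p)"
    using K.L(6)[of z "pb1 C y' p'"] K.L(6)[of "pb1 C y p" v] z'(4) by simp
  have hb: "hlift_bot h' p' y' \<cdot> K z = v \<cdot> hlift_bot h p y"
    using Kz reassoc[OF v(5), of "K (pb1 C y p)"] by simp
  have bot: "(y' \<cdot> hlift_bot h' p' y') \<cdot> K z = x1 \<cdot> (y \<cdot> hlift_bot h p y)"
    using hb reassoc[OF v(4), of "hlift_bot h p y"] by simp
  have Z: "Dom C (pb1 C y p) \<in> Obj C" "Dom C (pb1 C y' p') \<in> Obj C" by simp_all
  have c0: "((from0 (Dom C (pb1 C y p)), coalg0 (Dom C (pb1 C y p))),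
      (from0 (Dom C (pb1 C y p)), Id C z0, z, from0 (Dom C (pb1 C y' p'))),
      (from0 (Dom C (pb1 C y' p')), coalg0 (Dom C (pb1 C y' p')))) \<in> Arr (Lmap C W)"
    using coalg0(2)[OF z'(1)] by simp
  have i: "K_from0 (Dom C p') \<cdot> K (Id C z0) = x0 \<cdot> K_from0 (Dom C p)"
    by (rule initial_ext[OF initial_K0]) simp_all
  have "hlift_fill k h' p' \<phi>' y' \<cdot> K z = x0 \<cdot> hlift_fill k h p \<phi> y"
    unfolding hlift_fill_def cof_fill_left[OF pD(2) c0 pr'] cof_fill_right[OF p coalg0(1)[OF Z(1)] pr] z'(5) bot i ..
  then have 2: "pb2 C y' p' \<cdot> (hlift k h' p' \<phi>' y' \<cdot> K z) = pb2 C y' p' \<cdot> (z \<cdot> hlift k h p \<phi> y)"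
    using reassoc[OF l'(5), of "K z"] reassoc[OF z'(5), of "hlift k h p \<phi> y"] l(5) by simp
  have 1: "pb1 C y' p' \<cdot> (hlift k h' p' \<phi>' y' \<cdot> K z) = pb1 C y' p' \<cdot> (z \<cdot> hlift k h p \<phi> y)"
    using reassoc[OF l'(4), of "K z"] reassoc[OF z'(4), of "hlift k h p \<phi> y"] l(4) hb by simp
  show "hlift k h' p' \<phi>' y' \<cdot> K z = z \<cdot> hlift k h p \<phi> y"
    by (rule pb_ext[OF _ _ _ _ _ _ _ _ 1 2]) simp_all
qed

text \<open>The Frobenius property. The lifted homotopy on \<open>Z\<close> is over the homotopy on the codomain of \<open>m\<close>, so
  by the universal property of the pullback it combines with the homotopy inverse and the homotopy
  on the domain of \<open>m\<close>.\<close>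

abbreviation pbm :: "'m \<Rightarrow> 'm \<Rightarrow> 'm \<Rightarrow> 'm" where
  "pbm m p y \<equiv> pb2 C m (pb1 C y p)"

definition pb_inv where
  "pb_inv k m r h p \<phi> y = pb_pair C m (pb1 C y p) (r \<cdot> pb1 C y p) (hlift k h p \<phi> y \<cdot> \<delta> k (Dom C (pb1 C y p)))"

definition pb_hty where
  "pb_hty k m a h p \<phi> y = pb_pair C m (pb1 C y p) (a \<cdot> K (pb1 C m (pb1 C y p))) (hlift k h p \<phi> y \<cdot> K (pbm m p y))"

lemma frobenius:
  assumes p: "fib p \<phi>" and m: "strong_heq k m r a h" and y: "y \<in> Arr C" "Dom C y = Cod C m" "Cod C y = Cod C p"
  shows "pb_inv k m r h p \<phi> y \<in> Arr C" "pb_hty k m a h p \<phi> y \<in> Arr C"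
    "pb1 C m (pb1 C y p) \<cdot> pb_inv k m r h p \<phi> y = r \<cdot> pb1 C y p"
    "pbm m p y \<cdot> pb_inv k m r h p \<phi> y = hlift k h p \<phi> y \<cdot> \<delta> k (Dom C (pb1 C y p))"
    "pb1 C m (pb1 C y p) \<cdot> pb_hty k m a h p \<phi> y = a \<cdot> K (pb1 C m (pb1 C y p))"
    "pbm m p y \<cdot> pb_hty k m a h p \<phi> y = hlift k h p \<phi> y \<cdot> K (pbm m p y)"
    "strong_heq k (pbm m p y) (pb_inv k m r h p \<phi> y) (pb_hty k m a h p \<phi> y) (hlift k h p \<phi> y)"
proof -
  have p' [simp]: "p \<in> Arr C" using right_mapD(1)[OF p] .
  note mD = strong_heqD[OF m]
  note [simp] = mD(1-11) y
  note l = hlift[OF mD(1) p y(1,3) mD(9), unfolded y(2), OF mD(10,11,16)]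
  note l' [simp] = l(1-3)
  let ?\<pi> = "pb1 C y p" and ?h = "hlift k h p \<phi> y"
  let ?n = "pb2 C m ?\<pi>" and ?n1 = "pb1 C m ?\<pi>"
  let ?z = "Dom C ?\<pi>" and ?N = "Dom C ?n1"
  have K\<pi>: "K ?\<pi> \<cdot> \<delta> j ?z = \<delta> j (Cod C m) \<cdot> ?\<pi>" "K ?n1 \<cdot> \<delta> j ?N = \<delta> j (Dom C m) \<cdot> ?n1"
    "K ?n \<cdot> \<delta> j ?N = \<delta> j ?z \<cdot> ?n" if "endpoint j" for j
    using that by (intro \<delta>_natural; simp)+
  have pc: "m \<cdot> ?n1 = ?\<pi> \<cdot> ?n" by (rule pb_comm) simp_all
  have Kpc: "K m \<cdot> K ?n1 = K ?\<pi> \<cdot> K ?n"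
    using K.L(6)[of ?n1 m] K.L(6)[of ?n ?\<pi>] pc by simp
  have "m \<cdot> (r \<cdot> ?\<pi>) = ?\<pi> \<cdot> (?h \<cdot> \<delta> k ?z)"
    using reassoc[OF l(4), of "\<delta> k ?z"] reassoc[OF mD(15), of ?\<pi>] by (simp add: K\<pi>)
  then have r: "pb_inv k m r h p \<phi> y \<in> Arr C" "Dom C (pb_inv k m r h p \<phi> y) = ?z" "Cod C (pb_inv k m r h p \<phi> y) = ?N"
    "?n1 \<cdot> pb_inv k m r h p \<phi> y = r \<cdot> ?\<pi>" "?n \<cdot> pb_inv k m r h p \<phi> y = ?h \<cdot> \<delta> k ?z"
    unfolding pb_inv_def by (simp_all add: pb_pair)
  have "m \<cdot> (a \<cdot> K ?n1) = ?\<pi> \<cdot> (?h \<cdot> K ?n)"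
    using reassoc[OF l(4), of "K ?n"] reassoc[OF mD(12), of "K ?n1"] by (simp add: Kpc)
  then have a: "pb_hty k m a h p \<phi> y \<in> Arr C" "Dom C (pb_hty k m a h p \<phi> y) = K0 ?N" "Cod C (pb_hty k m a h p \<phi> y) = ?N"
    "?n1 \<cdot> pb_hty k m a h p \<phi> y = a \<cdot> K ?n1" "?n \<cdot> pb_hty k m a h p \<phi> y = ?h \<cdot> K ?n"
    unfolding pb_hty_def by (simp_all add: pb_pair)
  note [simp] = r(1-3) a(1-3)
  show "pb_inv k m r h p \<phi> y \<in> Arr C" "pb_hty k m a h p \<phi> y \<in> Arr C" by simp_all
  show "?n1 \<cdot> pb_inv k m r h p \<phi> y = r \<cdot> ?\<pi>" "?n \<cdot> pb_inv k m r h p \<phi> y = ?h \<cdot> \<delta> k ?z"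
    "?n1 \<cdot> pb_hty k m a h p \<phi> y = a \<cdot> K ?n1" "?n \<cdot> pb_hty k m a h p \<phi> y = ?h \<cdot> K ?n"
    by (fact r(4), fact r(5), fact a(4), fact a(5))
  have 1: "pb_hty k m a h p \<phi> y \<cdot> \<delta> k ?N = pb_inv k m r h p \<phi> y \<cdot> ?n"
    using reassoc[OF mD(13), of ?n1]
    by (intro pb_ext[of m ?\<pi> "pb_hty k m a h p \<phi> y \<cdot> \<delta> k ?N"])
      (simp_all add: reassoc[OF r(4)] reassoc[OF r(5)] reassoc[OF a(4)] reassoc[OF a(5)] K\<pi> pc)
  have 2: "pb_hty k m a h p \<phi> y \<cdot> \<delta> (opp k) ?N = Id C ?N"
    using reassoc[OF mD(14), of ?n1] reassoc[OF l(6), of ?n]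
    by (intro pb_ext[of m ?\<pi> "pb_hty k m a h p \<phi> y \<cdot> \<delta> (opp k) ?N"])
      (simp_all add: reassoc[OF a(4)] reassoc[OF a(5)] K\<pi>)
  show "strong_heq k ?n (pb_inv k m r h p \<phi> y) (pb_hty k m a h p \<phi> y) ?h"
    unfolding strong_heq_def using 1 2 by (simp add: hom_def l(6) r(5) a(5))
qed

text \<open>Naturality is in \<open>p\<close> and \<open>m\<close> at once; the case of an identity on \<open>p\<close> is behind the uniformity of
  the fillers of a pushforward, and the case of an identity on \<open>m\<close> behind the compatibility of
  pushforward with change of \<open>p\<close>.\<close>

lemma frobenius_natural:
  assumes p: "fib_mor p \<phi> x0 x1 p' \<phi>'" and m: "strong_heq k m r a h" and m': "strong_heq k m' r' a' h'"
    and xv: "strong_heq_map m r a h x v m' r' a' h'"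
    and y: "y \<in> Arr C" "Dom C y = Cod C m" "Cod C y = Cod C p"
    and y': "y' \<in> Arr C" "Dom C y' = Cod C m'" "Cod C y' = Cod C p'" and yv: "y' \<cdot> v = x1 \<cdot> y"
    and z: "z = pb_pair C y' p' (v \<cdot> pb1 C y p) (x0 \<cdot> pb2 C y p)"
    and w: "w = pb_pair C m' (pb1 C y' p') (x \<cdot> pb1 C m (pb1 C y p)) (z \<cdot> pbm m p y)"
  shows "(pb1 C y p, z, v, pb1 C y' p') \<in> Arr (arrow_cat C)" "pb2 C y' p' \<cdot> z = x0 \<cdot> pb2 C y p"
    "pb1 C m' (pb1 C y' p') \<cdot> w = x \<cdot> pb1 C m (pb1 C y p)" "pbm m' p' y' \<cdot> w = z \<cdot> pbm m p y"
    "strong_heq_map (pbm m p y) (pb_inv k m r h p \<phi> y) (pb_hty k m a h p \<phi> y) (hlift k h p \<phi> y) w z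
      (pbm m' p' y') (pb_inv k m' r' h' p' \<phi>' y') (pb_hty k m' a' h' p' \<phi>' y') (hlift k h' p' \<phi>' y')"
proof -
  note pD = fib_morD[OF p] and mD = strong_heqD[OF m] and mD' = strong_heqD[OF m'] and xvD = strong_heq_mapD[OF xv]
  note S = squareD[OF pD(3)] and T = squareD[OF xvD(1)]
  note [simp] = S(1-8) T(1-8) mD(1-11) mD'(1-11) y y'
  note zz = hlift_natural[OF mD(1) p y(1,3) y'(1,3) mD(9) _ _ _ mD'(9) _ _ _ T(4) _ _ yv xvD(4) z, unfolded y(2) y'(2),
    OF mD(10,11,16) mD'(10,11,16) T(7,8)]
  note zz' [simp] = zz(1-3)
  note F = frobenius[OF pD(1) m y] and F' = frobenius[OF pD(2) m' y']
  note FD = strong_heqD[OF F(7)] and FD' = strong_heqD[OF F'(7)]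
  let ?\<pi> = "pb1 C y p" and ?\<pi>' = "pb1 C y' p'"
  let ?n = "pb2 C m ?\<pi>" and ?n1 = "pb1 C m ?\<pi>" and ?n' = "pb2 C m' ?\<pi>'" and ?n1' = "pb1 C m' ?\<pi>'"
  let ?r = "pb_inv k m r h p \<phi> y" and ?r' = "pb_inv k m' r' h' p' \<phi>' y'"
  let ?a = "pb_hty k m a h p \<phi> y" and ?a' = "pb_hty k m' a' h' p' \<phi>' y'"
  let ?h = "hlift k h p \<phi> y" and ?h' = "hlift k h' p' \<phi>' y'"
  have [simp]: "?r \<in> Arr C" "Dom C ?r = Dom C ?\<pi>" "Cod C ?r = Dom C ?n1"
    "?a \<in> Arr C" "Dom C ?a = K0 (Dom C ?n1)" "Cod C ?a = Dom C ?n1"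
    "?h \<in> Arr C" "Dom C ?h = K0 (Dom C ?\<pi>)" "Cod C ?h = Dom C ?\<pi>"
    using FD by simp_all
  have [simp]: "?r' \<in> Arr C" "Dom C ?r' = Dom C ?\<pi>'" "Cod C ?r' = Dom C ?n1'"
    "?a' \<in> Arr C" "Dom C ?a' = K0 (Dom C ?n1')" "Cod C ?a' = Dom C ?n1'"
    "?h' \<in> Arr C" "Dom C ?h' = K0 (Dom C ?\<pi>')" "Cod C ?h' = Dom C ?\<pi>'"
    using FD' by simp_all
  show sq: "(?\<pi>, z, v, ?\<pi>') \<in> Arr (arrow_cat C)" using zz(4) by (simp add: hom_def)
  show "pb2 C y' p' \<cdot> z = x0 \<cdot> pb2 C y p" by (fact zz(5))
  have "m' \<cdot> (x \<cdot> ?n1) = ?\<pi>' \<cdot> (z \<cdot> ?n)"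
    using reassoc[OF T(9), of ?n1] reassoc[OF zz(4), of ?n] by (simp add: pb_comm)
  then have w': "w \<in> Arr C" "Dom C w = Dom C ?n1" "Cod C w = Dom C ?n1'" "?n1' \<cdot> w = x \<cdot> ?n1" "?n' \<cdot> w = z \<cdot> ?n"
    by (simp_all add: w pb_pair)
  note [simp] = w'(1-3)
  show "?n1' \<cdot> w = x \<cdot> ?n1" "?n' \<cdot> w = z \<cdot> ?n" by (fact w'(4), fact w'(5))
  have d: "K z \<cdot> \<delta> k (Dom C ?\<pi>) = \<delta> k (Dom C ?\<pi>') \<cdot> z"
    by (intro \<delta>_natural) simp_all
  have 1: "?r' \<cdot> z = w \<cdot> ?r"
    using reassoc[OF xvD(2), of ?\<pi>] reassoc[OF zz(6), of "\<delta> k (Dom C ?\<pi>)"]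
    by (intro pb_ext[of m' ?\<pi>' "?r' \<cdot> z"])
      (simp_all add: reassoc[OF F'(3)] reassoc[OF F'(4)] reassoc[OF w'(4)] reassoc[OF w'(5)] F(3,4) zz(4) d)
  have Kw: "K ?n1' \<cdot> K w = K x \<cdot> K ?n1" "K ?n' \<cdot> K w = K z \<cdot> K ?n"
    using K.L(6)[of w ?n1'] K.L(6)[of w ?n'] K.L(6)[of ?n1 x] K.L(6)[of ?n z] w'(4,5) by simp_all
  have 2: "?a' \<cdot> K w = w \<cdot> ?a"
    using reassoc[OF xvD(3), of "K ?n1"] reassoc[OF zz(6), of "K ?n"]
    by (intro pb_ext[of m' ?\<pi>' "?a' \<cdot> K w"])
      (simp_all add: reassoc[OF F'(5)] reassoc[OF F'(6)] reassoc[OF w'(4)] reassoc[OF w'(5)] F(5,6) Kw)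
  show "strong_heq_map ?n ?r ?a ?h w z ?n' ?r' ?a' ?h'"
    unfolding strong_heq_map_def using 1 2 zz(6) w'(5) by (simp add: hom_def)
qed

abbreviation gen :: "nat \<Rightarrow> 'i \<Rightarrow> 'm" where "gen k i \<equiv> LZ k (fob u i)"
abbreviation gen_top :: "nat \<Rightarrow> 'j \<Rightarrow> 'm" where
  "gen_top k \<sigma> \<equiv> LZ_top k (fob u (Dom I \<sigma>)) (top_of (far u \<sigma>)) (bot_of (far u \<sigma>)) (fob u (Cod I \<sigma>))"
abbreviation gen_bot :: "'j \<Rightarrow> 'm" where "gen_bot \<sigma> \<equiv> K (bot_of (far u \<sigma>))"

text \<open>The pullback of a generator is a cofibration, since cofibrations are stable under pullback, and a
  strong homotopy equivalence by the Frobenius property; so it lifts against fibrations.\<close>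

definition frob where
  "frob k i p \<phi> y g \<psi> s t = strong_heq_fill k (pbm (gen k i) p y) (pb_coalg (gen k i) (LZ_coalg k i) (pb1 C y p))
     (pb_inv k (gen k i) (LZ_inv k (fob u i)) (\<gamma> k (Cod C (fob u i))) p \<phi> y)
     (pb_hty k (gen k i) (LZ_hty k (fob u i)) (\<gamma> k (Cod C (fob u i))) p \<phi> y)
     (hlift k (\<gamma> k (Cod C (fob u i))) p \<phi> y) g \<psi> s t"

lemma frob:
  assumes k: "endpoint k" and i: "i \<in> Obj I" and p: "fib p \<phi>" and g: "fib g \<psi>"
    and y: "y \<in> Arr C" "Dom C y = K0 (Cod C (fob u i))" "Cod C y = Cod C p"
    and S: "(pbm (gen k i) p y, s, t, g) \<in> Arr (arrow_cat C)"
  shows "frob k i p \<phi> y g \<psi> s t \<in> Arr C" "Dom C (frob k i p \<phi> y g \<psi> s t) = Dom C (pb1 C y p)"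
    "Cod C (frob k i p \<phi> y g \<psi> s t) = Dom C g" "frob k i p \<phi> y g \<psi> s t \<cdot> pbm (gen k i) p y = s"
    "g \<cdot> frob k i p \<phi> y g \<psi> s t = t"
proof -
  have p' [simp]: "p \<in> Arr C" using right_mapD(1)[OF p] .
  note [simp] = k i y
  have "(pbm (gen k i) p y, pb_coalg (gen k i) (LZ_coalg k i) (pb1 C y p)) \<in> Obj (Lmap C W)"
    by (intro pb_coalg(1) LZ_coalg(1)) simp_all
  note f = strong_heq_fill[OF g this frobenius(7)[OF p strong_heq_LZ] S, folded frob_def]
  show "frob k i p \<phi> y g \<psi> s t \<in> Arr C" "Dom C (frob k i p \<phi> y g \<psi> s t) = Dom C (pb1 C y p)"
    "Cod C (frob k i p \<phi> y g \<psi> s t) = Dom C g" "frob k i p \<phi> y g \<psi> s t \<cdot> pbm (gen k i) p y = s"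
    "g \<cdot> frob k i p \<phi> y g \<psi> s t = t"
    using f by simp_all
qed

lemma frob_right:
  assumes k: "endpoint k" and i: "i \<in> Obj I" and p: "fib p \<phi>" and g: "fib_mor g \<psi> e f g' \<psi>'"
    and y: "y \<in> Arr C" "Dom C y = K0 (Cod C (fob u i))" "Cod C y = Cod C p"
    and S: "(pbm (gen k i) p y, s, t, g) \<in> Arr (arrow_cat C)"
  shows "e \<cdot> frob k i p \<phi> y g \<psi> s t = frob k i p \<phi> y g' \<psi>' (e \<cdot> s) (f \<cdot> t)"
proof -
  have p' [simp]: "p \<in> Arr C" using right_mapD(1)[OF p] .
  note [simp] = k i y
  have "(pbm (gen k i) p y, pb_coalg (gen k i) (LZ_coalg k i) (pb1 C y p)) \<in> Obj (Lmap C W)"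
    by (intro pb_coalg(1) LZ_coalg(1)) simp_all
  note f = strong_heq_fill_right[OF g this frobenius(7)[OF p strong_heq_LZ] S, folded frob_def]
  show ?thesis using f by simp
qed

lemma frob_left:
  assumes k: "endpoint k" and \<sigma>: "\<sigma> \<in> Arr I" and p: "fib_mor p \<phi> x0 x1 p' \<phi>'" and g: "fib g \<psi>"
    and y: "y \<in> Arr C" "Dom C y = K0 (Cod C (fob u (Dom I \<sigma>)))" "Cod C y = Cod C p"
    and y': "y' \<in> Arr C" "Dom C y' = K0 (Cod C (fob u (Cod I \<sigma>)))" "Cod C y' = Cod C p'"
    and yv: "y' \<cdot> gen_bot \<sigma> = x1 \<cdot> y"
    and z: "z = pb_pair C y' p' (gen_bot \<sigma> \<cdot> pb1 C y p) (x0 \<cdot> pb2 C y p)"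
    and w: "w = pb_pair C (gen k (Cod I \<sigma>)) (pb1 C y' p') (gen_top k \<sigma> \<cdot> pb1 C (gen k (Dom I \<sigma>)) (pb1 C y p))
      (z \<cdot> pbm (gen k (Dom I \<sigma>)) p y)"
    and S: "(pbm (gen k (Cod I \<sigma>)) p' y', s, t, g) \<in> Arr (arrow_cat C)"
  shows "frob k (Cod I \<sigma>) p' \<phi>' y' g \<psi> s t \<cdot> z = frob k (Dom I \<sigma>) p \<phi> y g \<psi> (s \<cdot> w) (t \<cdot> z)"
proof -
  note pD = fib_morD[OF p]
  note [simp] = k \<sigma> y y' squareD(1-8)[OF pD(3)]
  note usq = u_sq(2)[OF \<sigma>]
  note [simp] = squareD(1-8)[OF usq]
  note N = frobenius_natural[OF p strong_heq_LZ strong_heq_LZ strong_heq_map_LZ[OF k usq] y(1) _ y(3) y'(1) _ y'(3) yv z w]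
  note [simp] = squareD(1-8)[OF pD(3)]
  have c: "((pbm (gen k (Dom I \<sigma>)) p y, pb_coalg (gen k (Dom I \<sigma>)) (LZ_coalg k (Dom I \<sigma>)) (pb1 C y p)),
      (pbm (gen k (Dom I \<sigma>)) p y, w, z, pbm (gen k (Cod I \<sigma>)) p' y'),
      (pbm (gen k (Cod I \<sigma>)) p' y', pb_coalg (gen k (Cod I \<sigma>)) (LZ_coalg k (Cod I \<sigma>)) (pb1 C y' p'))) \<in> Arr (Lmap C W)"
    unfolding w by (rule pb_coalg(2)[OF LZ_coalg(2)[OF k \<sigma>] N(1)]) simp_all
  show ?thesis
    unfolding frob_def
    by (rule strong_heq_fill_left[OF g c frobenius(7)[OF pD(1) strong_heq_LZ] frobenius(7)[OF pD(2) strong_heq_LZ] N(5) S]) simp_all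
qed

end


section \<open>Pulling back and inverting right maps\<close>

lemma (in pullback_category) pull_func_simps:
  "fob (pull_func C f) g = pb2 C g f"
  "far (pull_func C f) (x, g, y) = (pb2 C x f, pb_pair C y f (g \<cdot> pb1 C x f) (pb2 C x f), pb2 C y f)"
  by (simp_all add: pull_func_def)

text \<open>The transposed fillers along \<open>f\<^sub>! \<stileturn> f\<^sup>*\<close> are those induced by the pullback: their first
  projection is the given filler.\<close>

lemma (in pullback_category) pull_fillers:
  assumes f: "f \<in> Arr C" and g: "right_map C J v (g, \<phi>)" and e: "(x, g, y) \<in> Arr (slice C (Cod C f))"
    and g': "g' = pb_pair C y f (g \<cdot> pb1 C x f) (pb2 C x f)"
    and j: "j \<in> Obj J" and S: "(fob v j, s, t, g') \<in> Arr (arrow_cat C)"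
    and F: "F = pull_fillers C J v f \<phi> (x, g, y) (j, s, t)"
  shows "(fob v j, pb1 C x f \<cdot> s, pb1 C y f \<cdot> t, g) \<in> Arr (arrow_cat C)"
    "F \<in> Arr C" "Dom C F = Cod C (fob v j)" "Cod C F = Dom C (pb1 C x f)"
    "pb1 C x f \<cdot> F = \<phi> (j, pb1 C x f \<cdot> s, pb1 C y f \<cdot> t)" "pb2 C x f \<cdot> F = pb2 C y f \<cdot> t"
proof -
  note e' = sliceD[OF e]
  note [simp] = f e'(1-7)
  note p = pull_arr[OF f e, folded g']
  note [simp] = p(1-3)
  have [simp]: "fob v j \<in> Arr C" "s \<in> Arr C" "t \<in> Arr C" "Dom C s = Dom C (fob v j)" "Cod C s = Dom C (pb1 C x f)"
    "Dom C t = Cod C (fob v j)" "Cod C t = Dom C (pb1 C y f)"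
    using squareD[OF S] by simp_all
  have "g \<cdot> (pb1 C x f \<cdot> s) = pb1 C y f \<cdot> (t \<cdot> fob v j)"
    using reassoc[OF p(4), of s] squareD(9)[OF S] by simp
  then show S': "(fob v j, pb1 C x f \<cdot> s, pb1 C y f \<cdot> t, g) \<in> Arr (arrow_cat C)"
    by (simp add: hom_def)
  let ?q = "\<phi> (j, pb1 C x f \<cdot> s, pb1 C y f \<cdot> t)" and ?d = "pb2 C y f \<cdot> t"
  note q = right_mapD(3-7)[OF g j S']
  note q' [simp] = q(1-3)
  have xq: "x \<cdot> ?q = f \<cdot> ?d"
    using reassoc[OF e'(8), of ?q] q(5) pb_comm'[of y f t] by simp
  let ?U = "pb_pair C (f \<cdot> ?d) f (Id C (Cod C (fob v j))) ?d"
  have u: "?U \<in> Arr C" "Dom C ?U = Cod C (fob v j)" "Cod C ?U = Dom C (pb1 C (f \<cdot> ?d) f)"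
    "pb1 C (f \<cdot> ?d) f \<cdot> ?U = Id C (Cod C (fob v j))" "pb2 C (f \<cdot> ?d) f \<cdot> ?U = ?d"
    using pb_pair[of "f \<cdot> ?d" f "Id C (Cod C (fob v j))" ?d] by simp_all
  have sl: "(f \<cdot> ?d, ?q, x) \<in> Arr (slice C (Cod C f))"
    using xq by (simp add: hom_def)
  note r = pull_arr[OF f sl]
  have Fe: "F = pb_pair C x f (?q \<cdot> pb1 C (f \<cdot> ?d) f) (pb2 C (f \<cdot> ?d) f) \<cdot> ?U"
    using S j unfolding F pull_fillers_def g'
    by (simp add: pull_func_simps Let_def ltranspose_def rtranspose_def base_adj_def post_func_def)
  show "F \<in> Arr C" "Dom C F = Cod C (fob v j)" "Cod C F = Dom C (pb1 C x f)"
    unfolding Fe using r(1-3) u(1-3) by simp_all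
  show "pb1 C x f \<cdot> F = ?q" "pb2 C x f \<cdot> F = ?d"
    unfolding Fe using r(1-3) u(1-3) by (simp_all add: reassoc[OF r(4)] reassoc[OF r(5)] u(4,5))
qed

lemma (in pullback_category) right_map_pull:
  assumes f: "f \<in> Arr C" and g: "right_map C J v (g, \<phi>)" and e: "(x, g, y) \<in> Arr (slice C (Cod C f))"
    and g': "g' = pb_pair C y f (g \<cdot> pb1 C x f) (pb2 C x f)"
    and J: "category J" and v: "\<And>\<sigma>. \<sigma> \<in> Arr J \<Longrightarrow> far v \<sigma> \<in> hom (arrow_cat C) (fob v (Dom J \<sigma>)) (fob v (Cod J \<sigma>))"
  shows "right_map C J v (g', pull_fillers C J v f \<phi> (x, g, y))"
    "((g', pull_fillers C J v f \<phi> (x, g, y)), (g', pb1 C x f, pb1 C y f, g), (g, \<phi>)) \<in> Arr (right_maps C J v)"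
proof -
  note e' = sliceD[OF e]
  note [simp] = f e'(1-7)
  note p = pull_arr[OF f e, folded g']
  note [simp] = p(1-3)
  let ?F = "pull_fillers C J v f \<phi> (x, g, y)"
  note F = pull_fillers[OF f g e g' _ _ refl]
  have st: "s \<in> Arr C" "t \<in> Arr C" "Dom C s = Dom C (fob v j)" "Cod C s = Dom C (pb1 C x f)"
    "Dom C t = Cod C (fob v j)" "Cod C t = Dom C (pb1 C y f)" "fob v j \<in> Arr C" "g' \<cdot> s = t \<cdot> fob v j"
    if "(fob v j, s, t, g') \<in> Arr (arrow_cat C)" for j s t
    using squareD[OF that] by simp_all
  show r: "right_map C J v (g', ?F)"
    unfolding right_map_def prod.case
  proof (intro conjI ballI allI impI)
    show "g' \<in> Arr C" by simp
    show "?F \<in> extensional (lift_problems C J v g')"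
      by (simp add: pull_fillers_def pull_func_simps Let_def g')
  next
    fix z assume "z \<in> lift_problems C J v g'"
    then obtain j s t where z: "z = (j, s, t)" and j: "j \<in> Obj J" and S: "(fob v j, s, t, g') \<in> Arr (arrow_cat C)"
      by (cases z) (auto simp: lift_problems_def)
    note F' = F[OF j S] and S' = st[OF S]
    note [simp] = F'(2-4) S'(1-7)
    note q = right_mapD(3-7)[OF g j F'(1)]
    have 1: "?F (j, s, t) \<cdot> fob v j = s"
      using reassoc[OF F'(5), of "fob v j"] reassoc[OF F'(6), of "fob v j"] q(4) S'(8) reassoc[OF p(5), of s]
      by (intro pb_ext[of x f "?F (j, s, t) \<cdot> fob v j"]) simp_all
    have 2: "g' \<cdot> ?F (j, s, t) = t"
      using reassoc[OF p(4), of "?F (j, s, t)"] reassoc[OF p(5), of "?F (j, s, t)"] F'(5,6) q(5)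
      by (intro pb_ext[of y f "g' \<cdot> ?F (j, s, t)"]) simp_all
    show "case z of (i, s, t) \<Rightarrow> ?F (i, s, t) \<in> hom C (Cod C (fob v i)) (Dom C g') \<and>
        ?F (i, s, t) \<cdot> fob v i = s \<and> g' \<cdot> ?F (i, s, t) = t"
      using 1 2 by (simp add: z) (simp add: hom_def)
  next
    fix \<sigma> s t assume \<sigma>: "\<sigma> \<in> Arr J" and "(Cod J \<sigma>, s, t) \<in> lift_problems C J v g'"
    then have j: "Cod J \<sigma> \<in> Obj J" "Dom J \<sigma> \<in> Obj J" and S: "(fob v (Cod J \<sigma>), s, t, g') \<in> Arr (arrow_cat C)"
      using category.dom_obj[OF J \<sigma>] by simp_all
    let ?a = "top_of (far v \<sigma>)" and ?b = "bot_of (far v \<sigma>)"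
    have V: "(fob v (Dom J \<sigma>), ?a, ?b, fob v (Cod J \<sigma>)) \<in> Arr (arrow_cat C)"
      using v[OF \<sigma>] arrow_cat_eta[of "far v \<sigma>" C "fob v (Dom J \<sigma>)" "fob v (Cod J \<sigma>)"] by (simp add: hom_def[of "arrow_cat C"])
    note S1 = square_cmp[OF V S]
    note F' = F[OF j(1) S] and F1 = F[OF j(2) S1] and S' = st[OF S] and V' = squareD[OF V]
    note [simp] = F'(2-4) F1(2-4) S'(1-7) V'(1-8)
    have "\<phi> (Cod J \<sigma>, pb1 C x f \<cdot> s, pb1 C y f \<cdot> t) \<cdot> ?b
      = \<phi> (Dom J \<sigma>, pb1 C x f \<cdot> (s \<cdot> ?a), pb1 C y f \<cdot> (t \<cdot> ?b))"
      using right_mapD(8)[OF g \<sigma> j(1) F'(1)] by simp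
    then show "?F (Cod J \<sigma>, s, t) \<cdot> ?b = ?F (Dom J \<sigma>, s \<cdot> ?a, t \<cdot> ?b)"
      using reassoc[OF F'(5), of ?b] reassoc[OF F'(6), of ?b] F1(5,6)
      by (intro pb_ext[of x f "?F (Cod J \<sigma>, s, t) \<cdot> ?b"]) simp_all
  qed
  have "(g', pb1 C x f, pb1 C y f, g) \<in> Arr (arrow_cat C)" using p(4) by (simp add: hom_def)
  then show "((g', ?F), (g', pb1 C x f, pb1 C y f, g), (g, \<phi>)) \<in> Arr (right_maps C J v)"
    using r g F(5) unfolding right_maps_arr by blast
qed

text \<open>Hence a morphism of right maps whose underlying square is invertible is an isomorphism of right
  maps.\<close>

lemma (in category) right_maps_inverse:
  assumes m: "((f, \<phi>), (f, x, y, g), (g, \<psi>)) \<in> Arr (right_maps C J v)"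
    and x': "x' \<in> hom C (Dom C g) (Dom C f)" "x' \<cdot> x = Id C (Dom C f)" "x \<cdot> x' = Id C (Dom C g)"
    and y': "y' \<in> hom C (Cod C g) (Cod C f)" "y' \<cdot> y = Id C (Cod C f)" "y \<cdot> y' = Id C (Cod C g)"
  shows "((g, \<psi>), (g, x', y', f), (f, \<phi>)) \<in> Arr (right_maps C J v)"
proof -
  have r: "right_map C J v (f, \<phi>)" "right_map C J v (g, \<psi>)" "(f, x, y, g) \<in> Arr (arrow_cat C)"
    and e: "\<And>i s t. i \<in> Obj J \<Longrightarrow> (fob v i, s, t, f) \<in> Arr (arrow_cat C) \<Longrightarrow> x \<cdot> \<phi> (i, s, t) = \<psi> (i, x \<cdot> s, y \<cdot> t)"
    using m unfolding right_maps_arr by blast+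
  note S = squareD[OF r(3)]
  have [simp]: "x' \<in> Arr C" "Dom C x' = Dom C g" "Cod C x' = Dom C f" "y' \<in> Arr C" "Dom C y' = Cod C g" "Cod C y' = Cod C f"
    using x'(1) y'(1) by (simp_all add: hom_def)
  note [simp] = S(1-8)
  have "f \<cdot> x' = y' \<cdot> (y \<cdot> (f \<cdot> x'))"
    using reassoc[OF y'(2), of "f \<cdot> x'"] by simp
  also have "y \<cdot> (f \<cdot> x') = g \<cdot> (x \<cdot> x')"
    using reassoc[OF S(9), of x'] by simp
  also have "\<dots> = g"
    unfolding x'(3) by simp
  finally have S': "(g, x', y', f) \<in> Arr (arrow_cat C)" by (simp add: hom_def)
  have "x' \<cdot> \<psi> (i, s, t) = \<phi> (i, x' \<cdot> s, y' \<cdot> t)" if i: "i \<in> Obj J" and T: "(fob v i, s, t, g) \<in> Arr (arrow_cat C)" for i s t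
  proof -
    note T1 = square_cmp[OF T S']
    note T' = squareD[OF T]
    note q = right_mapD(3-5)[OF r(1) i T1]
    have "x \<cdot> \<phi> (i, x' \<cdot> s, y' \<cdot> t) = \<psi> (i, s, t)"
      using e[OF i T1] reassoc[OF x'(3), of s] reassoc[OF y'(3), of t] T' by simp
    then show ?thesis
      using reassoc[OF x'(2), of "\<phi> (i, x' \<cdot> s, y' \<cdot> t)"] q by simp
  qed
  then show ?thesis using r S' unfolding right_maps_arr by blast
qed


section \<open>Pushforward of fillers\<close>

definition untag :: "'i + 'i \<Rightarrow> nat \<times> 'i" where
  "untag = case_sum (Pair 0) (Pair 1)"

lemma untag_tag [simp]: "endpoint k \<Longrightarrow> untag (tag k i) = (k, i)"
  by (auto simp: untag_def tag_def endpoint_def)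

context frobenius_category
begin

abbreviation v :: "('i + 'i, 'j + 'j, 'm, 'm sq) func" where
  "v \<equiv> tensor_gen C (ladj \<Lambda>) \<delta> u"

lemma v_tag:
  assumes "endpoint k"
  shows "fob v (tag k i) = gen k i"
    "\<sigma> \<in> Arr I \<Longrightarrow> far v (tag k \<sigma>) = (gen k (Dom I \<sigma>), gen_top k \<sigma>, gen_bot \<sigma>, gen k (Cod I \<sigma>))"
  using tensor_gen_tag[OF assms, of C "ladj \<Lambda>" \<delta> u] LZ_top(6)[OF assms u_sq(2)] u_sq(1) by simp_all

lemma v_sq:
  assumes k: "endpoint k" and \<sigma>: "\<sigma> \<in> Arr I"
  shows "(gen k (Dom I \<sigma>), gen_top k \<sigma>, gen_bot \<sigma>, gen k (Cod I \<sigma>)) \<in> Arr (arrow_cat C)"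
  using LZ_top[OF k u_sq(2)[OF \<sigma>]] squareD[OF u_sq(2)[OF \<sigma>]] assms by (simp add: hom_def)

lemma v_hom:
  assumes "\<sigma> \<in> Arr (sum_cat I I)"
  shows "far v \<sigma> \<in> hom (arrow_cat C) (fob v (Dom (sum_cat I I) \<sigma>)) (fob v (Cod (sum_cat I I) \<sigma>))"
proof -
  obtain k \<tau> where k: "endpoint k" "\<tau> \<in> Arr I" "\<sigma> = tag k \<tau>" using assms by (rule tag_arr_cases)
  then show ?thesis using v_sq[OF k(1,2)] v_tag[OF k(1)] by (simp add: hom_def[of "arrow_cat C"] del: arrow_cat_simps(2))
qed

lemma category_sum: "category (sum_cat I I)"
proof -
  interpret I: category I by (rule category_I)
  have *: "x \<in> hom (sum_cat I I) a b \<longleftrightarrow> (\<exists>y a' b'. y \<in> hom I a' b' \<and> (x = Inl y \<and> a = Inl a' \<and> b = Inl b' \<or> x = Inr y \<and> a = Inr a' \<and> b = Inr b'))"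
    for x a b by (auto simp: hom_def sum_cat_def)
  show ?thesis
  proof
    fix f g h a b c d
    show "f \<in> Arr (sum_cat I I) \<Longrightarrow> Dom (sum_cat I I) f \<in> Obj (sum_cat I I)"
      "f \<in> Arr (sum_cat I I) \<Longrightarrow> Cod (sum_cat I I) f \<in> Obj (sum_cat I I)"
      by (auto simp: sum_cat_def)
    show "a \<in> Obj (sum_cat I I) \<Longrightarrow> Id (sum_cat I I) a \<in> hom (sum_cat I I) a a"
      by (auto simp: sum_cat_def hom_def)
    show "f \<in> hom (sum_cat I I) a b \<Longrightarrow> g \<in> hom (sum_cat I I) b c \<Longrightarrow> g \<cdot>\<^bsub>sum_cat I I\<^esub> f \<in> hom (sum_cat I I) a c"
      unfolding * by (auto simp: sum_cat_def intro: I.cmp_hom)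
    show "f \<in> hom (sum_cat I I) a b \<Longrightarrow> Id (sum_cat I I) b \<cdot>\<^bsub>sum_cat I I\<^esub> f = f"
      "f \<in> hom (sum_cat I I) a b \<Longrightarrow> f \<cdot>\<^bsub>sum_cat I I\<^esub> Id (sum_cat I I) a = f"
      unfolding * by (auto simp: sum_cat_def I.id_left I.id_right)
    show "f \<in> hom (sum_cat I I) a b \<Longrightarrow> g \<in> hom (sum_cat I I) b c \<Longrightarrow> h \<in> hom (sum_cat I I) c d \<Longrightarrow>
        (h \<cdot>\<^bsub>sum_cat I I\<^esub> g) \<cdot>\<^bsub>sum_cat I I\<^esub> f = h \<cdot>\<^bsub>sum_cat I I\<^esub> (g \<cdot>\<^bsub>sum_cat I I\<^esub> f)"
      unfolding * by (auto simp: sum_cat_def I.assoc)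
  qed
qed

text \<open>The two ways \<open>pbm m p y\<close> and \<open>p\<^sup>* m\<close> of pulling back \<open>m\<close> agree up to the isomorphism \<open>pb_cmp\<close> of
  their domains, by pullback pasting.\<close>

abbreviation pb_cmp :: "'m \<Rightarrow> 'm \<Rightarrow> 'm \<Rightarrow> 'm" where
  "pb_cmp m p y \<equiv> pb_pair C (y \<cdot> m) p (pb1 C m (pb1 C y p)) (pb2 C y p \<cdot> pbm m p y)"

lemma pb_cmp:
  assumes "p \<in> Arr C" "m \<in> Arr C" "y \<in> Arr C" "Dom C y = Cod C m" "Cod C y = Cod C p"
  shows "pb_cmp m p y \<in> Arr C" "Dom C (pb_cmp m p y) = Dom C (pb1 C m (pb1 C y p))"
    "Cod C (pb_cmp m p y) = Dom C (pb1 C (y \<cdot> m) p)"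
    "pb1 C (y \<cdot> m) p \<cdot> pb_cmp m p y = pb1 C m (pb1 C y p)"
    "pb2 C (y \<cdot> m) p \<cdot> pb_cmp m p y = pb2 C y p \<cdot> pbm m p y"
proof -
  note [simp] = assms
  have "(y \<cdot> m) \<cdot> pb1 C m (pb1 C y p) = p \<cdot> (pb2 C y p \<cdot> pbm m p y)"
    using pb_comm'[of y p "pbm m p y"] by (simp add: pb_comm)
  then show "pb_cmp m p y \<in> Arr C" "Dom C (pb_cmp m p y) = Dom C (pb1 C m (pb1 C y p))"
    "Cod C (pb_cmp m p y) = Dom C (pb1 C (y \<cdot> m) p)"
    "pb1 C (y \<cdot> m) p \<cdot> pb_cmp m p y = pb1 C m (pb1 C y p)"
    "pb2 C (y \<cdot> m) p \<cdot> pb_cmp m p y = pb2 C y p \<cdot> pbm m p y"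
    by (simp_all add: pb_pair)
qed

lemma pull_map:
  assumes "p \<in> Arr C" "m \<in> Arr C" "y \<in> Arr C" "Dom C y = Cod C m" "Cod C y = Cod C p"
  shows "pull_map p y m \<in> Arr C" "Dom C (pull_map p y m) = Dom C (pb1 C (y \<cdot> m) p)"
    "Cod C (pull_map p y m) = Dom C (pb1 C y p)" "pb1 C y p \<cdot> pull_map p y m = m \<cdot> pb1 C (y \<cdot> m) p"
    "pb2 C y p \<cdot> pull_map p y m = pb2 C (y \<cdot> m) p"
  using pull_arr[OF assms(1), of "y \<cdot> m" m y] assms by (simp_all add: hom_def)

lemma pb_cmp_iso:
  assumes "p \<in> Arr C" "m \<in> Arr C" "y \<in> Arr C" "Dom C y = Cod C m" "Cod C y = Cod C p"
  shows "pull_map p y m \<cdot> pb_cmp m p y = pbm m p y"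
    "\<exists>i \<in> hom C (Dom C (pb1 C (y \<cdot> m) p)) (Dom C (pb1 C m (pb1 C y p))).
      pb_cmp m p y \<cdot> i = Id C (Dom C (pb1 C (y \<cdot> m) p)) \<and> pbm m p y \<cdot> i = pull_map p y m"
proof -
  note [simp] = assms
  note c = pb_cmp[OF assms] and q = pull_map[OF assms]
  note [simp] = c(1-3) q(1-3)
  show "pull_map p y m \<cdot> pb_cmp m p y = pbm m p y"
    by (rule pb_ext[of y p]) (simp_all add: reassoc[OF q(4)] reassoc[OF q(5)] c(4,5) pb_comm)
  define i where "i = pb_pair C m (pb1 C y p) (pb1 C (y \<cdot> m) p) (pull_map p y m)"
  have i: "i \<in> Arr C" "Dom C i = Dom C (pb1 C (y \<cdot> m) p)" "Cod C i = Dom C (pb1 C m (pb1 C y p))"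
    "pb1 C m (pb1 C y p) \<cdot> i = pb1 C (y \<cdot> m) p" "pbm m p y \<cdot> i = pull_map p y m"
    unfolding i_def using q(4) pb_pair[of m "pb1 C y p" "pb1 C (y \<cdot> m) p" "pull_map p y m"] by simp_all
  have "pb_cmp m p y \<cdot> i = Id C (Dom C (pb1 C (y \<cdot> m) p))"
    by (rule pb_ext[of "y \<cdot> m" p]) (simp_all add: i reassoc[OF c(4)] reassoc[OF c(5)] q(5))
  then show "\<exists>i \<in> hom C (Dom C (pb1 C (y \<cdot> m) p)) (Dom C (pb1 C m (pb1 C y p))).
      pb_cmp m p y \<cdot> i = Id C (Dom C (pb1 C (y \<cdot> m) p)) \<and> pbm m p y \<cdot> i = pull_map p y m"
    using i by (intro bexI[of _ i]) (simp_all add: hom_def)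
qed

abbreviation push_arr :: "'m \<Rightarrow> 'm \<Rightarrow> 'm \<Rightarrow> 'm \<Rightarrow> 'm" where
  "push_arr p b g b' \<equiv> far (slice_forget C) (far (push_func C p) (b, g, b'))"

text \<open>A filler for \<open>p\<^sub>* g\<close> is the transpose of a filler for \<open>g\<close> along the pullback of the
  generator.\<close>

definition push_out where
  "push_out k i p \<phi> b g \<psi> b' s t = frob k i p \<phi> (pf p b' \<cdot> t) g \<psi>
     (push_sharp p b s \<cdot> pb_cmp (gen k i) p (pf p b' \<cdot> t)) (push_sharp p b' t)"

definition push_fill where
  "push_fill k i p \<phi> b g \<psi> b' s t = push_flat p (pf p b' \<cdot> t) b (push_out k i p \<phi> b g \<psi> b' s t)"

lemma push_problem:
  assumes p: "fib p \<phi>" and g: "fib g \<psi>" and e: "(b, g, b') \<in> Arr (slice C (Dom C p))"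
    and k: "endpoint k" and i: "i \<in> Obj I" and S: "(gen k i, s, t, push_arr p b g b') \<in> Arr (arrow_cat C)"
    and y: "y = pf p b' \<cdot> t"
  shows "y \<in> Arr C" "Dom C y = K0 (Cod C (fob u i))" "Cod C y = Cod C p" "pf p b \<cdot> s = y \<cdot> gen k i"
    "(pbm (gen k i) p y, push_sharp p b s \<cdot> pb_cmp (gen k i) p y, push_sharp p b' t, g) \<in> Arr (arrow_cat C)"
proof -
  have p' [simp]: "p \<in> Arr C" using right_mapD(1)[OF p] .
  note e' = sliceD[OF e]
  note pe = push_slice[OF p' e] and pe' = sliceD[OF push_slice(2)[OF p' e]]
  note [simp] = e'(1-7) k i pe'(1-7)
  have [simp]: "s \<in> Arr C" "Dom C s = Cod C (in1 k (fob u i))" "Cod C s = Dom C (pf p b)"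
    "t \<in> Arr C" "Dom C t = K0 (Cod C (fob u i))" "Cod C t = Dom C (pf p b')"
    using squareD[OF S] by simp_all
  show y' [simp]: "y \<in> Arr C" "Dom C y = K0 (Cod C (fob u i))" "Cod C y = Cod C p"
    by (simp_all add: y)
  have pS: "push_arr p b g b' \<cdot> s = t \<cdot> gen k i" using squareD(9)[OF S] .
  have "pf p b \<cdot> s = pf p b' \<cdot> (push_arr p b g b' \<cdot> s)"
    using reassoc[OF pe'(8), of s] by simp
  then show ys: "pf p b \<cdot> s = y \<cdot> gen k i"
    by (simp add: pS y)
  note ss = push_sharp[of p b s, unfolded ys] and ts = push_sharp[of p b' t, folded y]
  note c = pb_cmp[of p "gen k i" y]
  note [simp] = ss(1-3) ts(1-3) c(1-3)
  have "g \<cdot> push_sharp p b s = push_sharp p b' (t \<cdot> gen k i)"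
    using push_sharp_push[OF p' e, of s] by (simp add: pS)
  also have "\<dots> = push_sharp p b' t \<cdot> pull_map p y (gen k i)"
    using push_sharp_cmp[of p b' t "gen k i"] by (simp add: y)
  finally have *: "g \<cdot> push_sharp p b s = push_sharp p b' t \<cdot> pull_map p y (gen k i)" .
  note q = pull_map[of p "gen k i" y]
  have "g \<cdot> (push_sharp p b s \<cdot> pb_cmp (gen k i) p y) = push_sharp p b' t \<cdot> pbm (gen k i) p y"
    using reassoc[OF *, of "pb_cmp (gen k i) p y"] pb_cmp_iso(1)[of p "gen k i" y] q(1-3) by simp
  then show "(pbm (gen k i) p y, push_sharp p b s \<cdot> pb_cmp (gen k i) p y, push_sharp p b' t, g) \<in> Arr (arrow_cat C)"
    by (simp add: hom_def)
qed

lemma push_out: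
  assumes p: "fib p \<phi>" and g: "fib g \<psi>" and e: "(b, g, b') \<in> Arr (slice C (Dom C p))"
    and k: "endpoint k" and i: "i \<in> Obj I" and S: "(gen k i, s, t, push_arr p b g b') \<in> Arr (arrow_cat C)"
    and y: "y = pf p b' \<cdot> t"
  shows "push_out k i p \<phi> b g \<psi> b' s t \<in> Arr C" "Dom C (push_out k i p \<phi> b g \<psi> b' s t) = Dom C (pb1 C y p)"
    "Cod C (push_out k i p \<phi> b g \<psi> b' s t) = Dom C b"
    "push_out k i p \<phi> b g \<psi> b' s t \<cdot> pull_map p y (gen k i) = push_sharp p b s"
    "g \<cdot> push_out k i p \<phi> b g \<psi> b' s t = push_sharp p b' t"
    "b \<cdot> push_out k i p \<phi> b g \<psi> b' s t = pb2 C y p"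
proof -
  have p' [simp]: "p \<in> Arr C" using right_mapD(1)[OF p] .
  note e' = sliceD[OF e]
  note pe' = sliceD[OF push_slice(2)[OF p' e]]
  note [simp] = e'(1-7) k i pe'(1-7)
  have [simp]: "s \<in> Arr C" "Dom C s = Cod C (in1 k (fob u i))" "Cod C s = Dom C (pf p b)"
    "t \<in> Arr C" "Dom C t = K0 (Cod C (fob u i))" "Cod C t = Dom C (pf p b')"
    using squareD[OF S] by simp_all
  note pr = push_problem[OF p g e k i S y]
  note [simp] = pr(1-3)
  note ss = push_sharp[of p b s, unfolded pr(4)] and ts = push_sharp[of p b' t, folded y]
  note c = pb_cmp[of p "gen k i" y]
  note [simp] = ss(1-3) ts(1-3) c(1-3)
  note f = frob[OF k i p g pr(1-3,5)]
  have o: "push_out k i p \<phi> b g \<psi> b' s t = frob k i p \<phi> y g \<psi> (push_sharp p b s \<cdot> pb_cmp (gen k i) p y) (push_sharp p b' t)"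
    by (simp add: push_out_def y)
  let ?o = "push_out k i p \<phi> b g \<psi> b' s t"
  show o1 [simp]: "?o \<in> Arr C" "Dom C ?o = Dom C (pb1 C y p)" "Cod C ?o = Dom C b"
    unfolding o using f(1-3) by simp_all
  show o5: "g \<cdot> ?o = push_sharp p b' t"
    unfolding o by (fact f(5))
  obtain j where j: "j \<in> hom C (Dom C (pb1 C (y \<cdot> gen k i) p)) (Dom C (pb1 C (gen k i) (pb1 C y p)))"
    "pb_cmp (gen k i) p y \<cdot> j = Id C (Dom C (pb1 C (y \<cdot> gen k i) p))" "pbm (gen k i) p y \<cdot> j = pull_map p y (gen k i)"
    using pb_cmp_iso(2)[of p "gen k i" y] by auto
  have [simp]: "j \<in> Arr C" "Dom C j = Dom C (pb1 C (y \<cdot> gen k i) p)" "Cod C j = Dom C (pb1 C (gen k i) (pb1 C y p))"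
    using j(1) by (simp_all add: hom_def)
  have "?o \<cdot> pbm (gen k i) p y = push_sharp p b s \<cdot> pb_cmp (gen k i) p y"
    unfolding o by (fact f(4))
  from reassoc[OF this, of j] show "?o \<cdot> pull_map p y (gen k i) = push_sharp p b s"
    using j(2,3) by simp
  show "b \<cdot> ?o = pb2 C y p"
    using reassoc[OF e'(8), of ?o] o5 ts(4) by simp
qed

lemma push_fill:
  assumes p: "fib p \<phi>" and g: "fib g \<psi>" and e: "(b, g, b') \<in> Arr (slice C (Dom C p))"
    and k: "endpoint k" and i: "i \<in> Obj I" and S: "(gen k i, s, t, push_arr p b g b') \<in> Arr (arrow_cat C)"
  shows "push_fill k i p \<phi> b g \<psi> b' s t \<in> Arr C" "Dom C (push_fill k i p \<phi> b g \<psi> b' s t) = K0 (Cod C (fob u i))"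
    "Cod C (push_fill k i p \<phi> b g \<psi> b' s t) = Dom C (pf p b)"
    "pf p b \<cdot> push_fill k i p \<phi> b g \<psi> b' s t = pf p b' \<cdot> t"
    "push_sharp p b (push_fill k i p \<phi> b g \<psi> b' s t) = push_out k i p \<phi> b g \<psi> b' s t"
    "push_fill k i p \<phi> b g \<psi> b' s t \<cdot> gen k i = s" "push_arr p b g b' \<cdot> push_fill k i p \<phi> b g \<psi> b' s t = t"
proof -
  have p' [simp]: "p \<in> Arr C" using right_mapD(1)[OF p] .
  note e' = sliceD[OF e]
  note pe' = sliceD[OF push_slice(2)[OF p' e]]
  note [simp] = e'(1-7) k i pe'(1-7)
  have [simp]: "s \<in> Arr C" "Dom C s = Cod C (in1 k (fob u i))" "Cod C s = Dom C (pf p b)"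
    "t \<in> Arr C" "Dom C t = K0 (Cod C (fob u i))" "Cod C t = Dom C (pf p b')"
    using squareD[OF S] by simp_all
  define y where "y = pf p b' \<cdot> t"
  note pr = push_problem[OF p g e k i S y_def]
  note [simp] = pr(1-3)
  note o = push_out[OF p g e k i S y_def]
  let ?w = "push_fill k i p \<phi> b g \<psi> b' s t" and ?o = "push_out k i p \<phi> b g \<psi> b' s t"
  note w = push_flat[OF p' e'(1,2) pr(1,3) o(1-3,6), folded push_fill_def[of k i p \<phi> b g \<psi> b' s t, folded y_def]]
  show w1: "?w \<in> Arr C" "Dom C ?w = K0 (Cod C (fob u i))" "Cod C ?w = Dom C (pf p b)" "pf p b \<cdot> ?w = pf p b' \<cdot> t"
    and w5: "push_sharp p b ?w = ?o"
    using w(1-5) by (simp_all add: y_def)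
  note [simp] = w1(1-3)
  show "?w \<cdot> gen k i = s"
  proof (rule push_sharp_inj[of p b])
    show "pf p b \<cdot> (?w \<cdot> gen k i) = pf p b \<cdot> s"
      using reassoc[OF w1(4), of "gen k i"] pr(4) by (simp add: y_def)
    show "push_sharp p b (?w \<cdot> gen k i) = push_sharp p b s"
      using push_sharp_cmp[of p b ?w "gen k i"] o(4) by (simp add: w1(4) w5 flip: y_def)
  qed simp_all
  show "push_arr p b g b' \<cdot> ?w = t"
  proof (rule push_sharp_inj[of p b'])
    show "pf p b' \<cdot> (push_arr p b g b' \<cdot> ?w) = pf p b' \<cdot> t"
      using reassoc[OF pe'(8), of ?w] w1(4) by simp
    show "push_sharp p b' (push_arr p b g b' \<cdot> ?w) = push_sharp p b' t"
      using push_sharp_push[OF p' e, of ?w] o(5) by (simp add: w5)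
  qed simp_all
qed

text \<open>Transposition is natural, so this is naturality of \<open>frob\<close> with the identity morphism on \<open>p\<close>.\<close>

lemma push_fill_left:
  assumes p: "fib p \<phi>" and g: "fib g \<psi>" and e: "(b, g, b') \<in> Arr (slice C (Dom C p))"
    and k: "endpoint k" and \<sigma>: "\<sigma> \<in> Arr I" and S: "(gen k (Cod I \<sigma>), s, t, push_arr p b g b') \<in> Arr (arrow_cat C)"
  shows "push_fill k (Cod I \<sigma>) p \<phi> b g \<psi> b' s t \<cdot> gen_bot \<sigma>
    = push_fill k (Dom I \<sigma>) p \<phi> b g \<psi> b' (s \<cdot> gen_top k \<sigma>) (t \<cdot> gen_bot \<sigma>)"
proof -
  have p' [simp]: "p \<in> Arr C" using right_mapD(1)[OF p] .
  note e' = sliceD[OF e]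
  note pe' = sliceD[OF push_slice(2)[OF p' e]]
  let ?i = "Dom I \<sigma>" and ?j = "Cod I \<sigma>" and ?d = "gen_top k \<sigma>" and ?v = "gen_bot \<sigma>"
  have ij: "?i \<in> Obj I" "?j \<in> Obj I" using \<sigma> by simp_all
  note V = v_sq[OF k \<sigma>]
  note V' = squareD[OF V]
  note S1 = square_cmp[OF V S]
  note [simp] = e'(1-7) k \<sigma> pe'(1-7)
  have Vs [simp]: "?d \<in> Arr C" "?v \<in> Arr C" "Dom C ?d = Cod C (in1 k (fob u ?i))" "Cod C ?d = Cod C (in1 k (fob u ?j))"
    "Dom C ?v = K0 (Cod C (fob u ?i))" "Cod C ?v = K0 (Cod C (fob u ?j))"
    using V' by simp_all
  have [simp]: "s \<in> Arr C" "Dom C s = Cod C (in1 k (fob u ?j))" "Cod C s = Dom C (pf p b)"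
    "t \<in> Arr C" "Dom C t = K0 (Cod C (fob u ?j))" "Cod C t = Dom C (pf p b')"
    using squareD[OF S] by simp_all
  define y where "y = pf p b' \<cdot> t"
  define y1 where "y1 = pf p b' \<cdot> (t \<cdot> ?v)"
  have yv: "y \<cdot> ?v = y1" by (simp add: y_def y1_def)
  note pr = push_problem[OF p g e k ij(2) S y_def] and pr1 = push_problem[OF p g e k ij(1) S1 y1_def]
  note [simp] = pr(1-3) pr1(1-3)
  note w = push_fill[OF p g e k ij(2) S] and w1 = push_fill[OF p g e k ij(1) S1]
  note [simp] = w(1-3) w1(1-3)
  note o = push_out[OF p g e k ij(2) S y_def] and o1 = push_out[OF p g e k ij(1) S1 y1_def]
  note q = pull_map[of p ?v y, unfolded yv]
  note [simp] = q(1-3)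
  have id: "fib_mor p \<phi> (Id C (Dom C p)) (Id C (Cod C p)) p \<phi>"
    using p right_mapD(3,5)[OF p] unfolding right_maps_arr by (auto simp: hom_def)
  define z where "z = pull_map p y ?v"
  have z: "z = pb_pair C y p (?v \<cdot> pb1 C y1 p) (Id C (Dom C p) \<cdot> pb2 C y1 p)"
    unfolding z_def yv by simp
  have z' [simp]: "z \<in> Arr C" "Dom C z = Dom C (pb1 C y1 p)" "Cod C z = Dom C (pb1 C y p)"
    and z4: "pb1 C y p \<cdot> z = ?v \<cdot> pb1 C y1 p" and z5: "pb2 C y p \<cdot> z = pb2 C y1 p"
    unfolding z_def using pull_map[of p ?v y, unfolded yv] by (simp_all add: yv)
  define x where "x = pb_pair C (gen k ?j) (pb1 C y p) (?d \<cdot> pb1 C (gen k ?i) (pb1 C y1 p)) (z \<cdot> pbm (gen k ?i) p y1)"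
  have "gen k ?j \<cdot> (?d \<cdot> pb1 C (gen k ?i) (pb1 C y1 p)) = pb1 C y p \<cdot> (z \<cdot> pbm (gen k ?i) p y1)"
    using reassoc[OF V'(9), of "pb1 C (gen k ?i) (pb1 C y1 p)"] reassoc[OF z4, of "pbm (gen k ?i) p y1"]
    by (simp add: ij pb_comm)
  then have x [simp]: "x \<in> Arr C" "Dom C x = Dom C (pb1 C (gen k ?i) (pb1 C y1 p))" "Cod C x = Dom C (pb1 C (gen k ?j) (pb1 C y p))"
    and x4: "pb1 C (gen k ?j) (pb1 C y p) \<cdot> x = ?d \<cdot> pb1 C (gen k ?i) (pb1 C y1 p)"
    and x5: "pbm (gen k ?j) p y \<cdot> x = z \<cdot> pbm (gen k ?i) p y1"
    using pb_pair[of "gen k ?j" "pb1 C y p" "?d \<cdot> pb1 C (gen k ?i) (pb1 C y1 p)" "z \<cdot> pbm (gen k ?i) p y1"]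
    unfolding x_def by (simp_all add: ij)
  have yd: "(y \<cdot> gen k ?j) \<cdot> ?d = y1 \<cdot> gen k ?i"
    using V'(9) by (simp add: ij flip: yv)
  define Q where "Q = pull_map p (y \<cdot> gen k ?j) ?d"
  have q1: "Q \<in> Arr C" "Dom C Q = Dom C (pb1 C (y1 \<cdot> gen k ?i) p)" "Cod C Q = Dom C (pb1 C (y \<cdot> gen k ?j) p)"
    "pb1 C (y \<cdot> gen k ?j) p \<cdot> Q = ?d \<cdot> pb1 C (y1 \<cdot> gen k ?i) p"
    "pb2 C (y \<cdot> gen k ?j) p \<cdot> Q = pb2 C (y1 \<cdot> gen k ?i) p"
    using pull_map[of p ?d "y \<cdot> gen k ?j", folded Q_def] unfolding yd by (simp_all add: ij)
  note [simp] = q1(1-3)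
  note c = pb_cmp[of p "gen k ?j" y] and c1 = pb_cmp[of p "gen k ?i" y1]
  note ss = push_sharp[of p b s, unfolded pr(4)] and ts = push_sharp[of p b' t, folded y_def]
  have cc: "pb_cmp (gen k ?j) p y \<cdot> x = Q \<cdot> pb_cmp (gen k ?i) p y1"
    using c c1
    by (intro pb_ext[of "y \<cdot> gen k ?j" p "pb_cmp (gen k ?j) p y \<cdot> x"])
      (simp_all add: ij reassoc[OF c(4)] reassoc[OF c(5)] reassoc[OF q1(4)] reassoc[OF q1(5)] x4 x5 reassoc[OF z5])
  have "push_sharp p b (s \<cdot> ?d) = push_sharp p b s \<cdot> Q"
    unfolding Q_def by (rule push_sharp_cmp[of p b s ?d, unfolded pr(4)]) (simp_all add: ij)
  then have sx: "(push_sharp p b s \<cdot> pb_cmp (gen k ?j) p y) \<cdot> x = push_sharp p b (s \<cdot> ?d) \<cdot> pb_cmp (gen k ?i) p y1"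
    using cc c(1-3) c1(1-3) ss(1-3) by (simp add: ij)
  have tz: "push_sharp p b' t \<cdot> z = push_sharp p b' (t \<cdot> ?v)"
    using push_sharp_cmp[of p b' t ?v] by (simp add: z_def flip: y_def)
  note fl = frob_left[OF k \<sigma> id g pr1(1-3) pr(1-3) _ z x_def pr(5)]
  have oo: "push_out k ?j p \<phi> b g \<psi> b' s t \<cdot> z = push_out k ?i p \<phi> b g \<psi> b' (s \<cdot> ?d) (t \<cdot> ?v)"
    using fl unfolding sx tz by (simp add: yv push_out_def flip: y_def y1_def)
  show ?thesis
  proof (rule push_sharp_inj[of p b])
    show "pf p b \<cdot> (push_fill k ?j p \<phi> b g \<psi> b' s t \<cdot> ?v) = pf p b \<cdot> push_fill k ?i p \<phi> b g \<psi> b' (s \<cdot> ?d) (t \<cdot> ?v)"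
      using reassoc[OF w(4), of ?v] w1(4) by (simp add: ij)
    show "push_sharp p b (push_fill k ?j p \<phi> b g \<psi> b' s t \<cdot> ?v) = push_sharp p b (push_fill k ?i p \<phi> b g \<psi> b' (s \<cdot> ?d) (t \<cdot> ?v))"
      using push_sharp_cmp[of p b "push_fill k ?j p \<phi> b g \<psi> b' s t" ?v] oo w(4,5) w1(5) by (simp add: ij z_def flip: y_def)
  qed (simp_all add: ij)
qed

lemma push_fill_right:
  assumes p: "fib p \<phi>" and g: "fib_mor g \<psi> a a' h \<chi>" and e: "(b, g, b') \<in> Arr (slice C (Dom C p))"
    and e1: "(d, h, d') \<in> Arr (slice C (Dom C p))" and a: "(b, a, d) \<in> Arr (slice C (Dom C p))" "(b', a', d') \<in> Arr (slice C (Dom C p))"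
    and pS: "(push_arr p b g b', push_arr p b a d, push_arr p b' a' d', push_arr p d h d') \<in> Arr (arrow_cat C)"
    and k: "endpoint k" and i: "i \<in> Obj I" and S: "(gen k i, s, t, push_arr p b g b') \<in> Arr (arrow_cat C)"
  shows "push_arr p b a d \<cdot> push_fill k i p \<phi> b g \<psi> b' s t
    = push_fill k i p \<phi> d h \<chi> d' (push_arr p b a d \<cdot> s) (push_arr p b' a' d' \<cdot> t)"
proof -
  have p' [simp]: "p \<in> Arr C" using right_mapD(1)[OF p] .
  note gD = fib_morD[OF g]
  note S1 = square_cmp[OF S pS]
  note pa = sliceD[OF push_slice(2)[OF p' a(1)]] and pa' = sliceD[OF push_slice(2)[OF p' a(2)]]
  note eD = sliceD[OF e] and e1D = sliceD[OF e1]
  note [simp] = pa(1-7) pa'(1-7) k i eD(1-7) e1D(1-7)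
  have [simp]: "s \<in> Arr C" "Dom C s = Cod C (in1 k (fob u i))" "Cod C s = Dom C (pf p b)"
    "t \<in> Arr C" "Dom C t = K0 (Cod C (fob u i))" "Cod C t = Dom C (pf p b')"
    using squareD[OF S] sliceD(7)[OF push_slice(2)[OF p' e]] sliceD(6)[OF push_slice(2)[OF p' e]] by simp_all
  define y where "y = pf p b' \<cdot> t"
  have y1: "y = pf p d' \<cdot> (push_arr p b' a' d' \<cdot> t)"
    using reassoc[OF pa'(8), of t] by (simp add: y_def)
  note pr = push_problem[OF p gD(1) e k i S y_def]
  note w = push_fill[OF p gD(1) e k i S] and w1 = push_fill[OF p gD(2) e1 k i S1]
  note [simp] = w(1-3) w1(1-3) pr(1-3)
  note c = pb_cmp[of p "gen k i" y] and ss = push_sharp[of p b s, unfolded pr(4)]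
  note aD = sliceD[OF a(1)]
  have sa: "push_sharp p d (push_arr p b a d \<cdot> s) \<cdot> pb_cmp (gen k i) p y = a \<cdot> (push_sharp p b s \<cdot> pb_cmp (gen k i) p y)"
    using push_sharp_push[OF p' a(1), of s] c(1-3) ss(1-3) aD(5-7) by simp
  have ta: "push_sharp p d' (push_arr p b' a' d' \<cdot> t) = a' \<cdot> push_sharp p b' t"
    using push_sharp_push[OF p' a(2), of t] by simp
  have oo: "a \<cdot> push_out k i p \<phi> b g \<psi> b' s t
    = push_out k i p \<phi> d h \<chi> d' (push_arr p b a d \<cdot> s) (push_arr p b' a' d' \<cdot> t)"
    using frob_right[OF k i p g pr(1-3,5)] unfolding push_out_def y1[symmetric] y_def[symmetric] sa ta .
  show ?thesis
  proof (rule push_sharp_inj[of p d])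
    show "pf p d \<cdot> (push_arr p b a d \<cdot> push_fill k i p \<phi> b g \<psi> b' s t)
      = pf p d \<cdot> push_fill k i p \<phi> d h \<chi> d' (push_arr p b a d \<cdot> s) (push_arr p b' a' d' \<cdot> t)"
      using reassoc[OF pa(8), of "push_fill k i p \<phi> b g \<psi> b' s t"] w(4) w1(4) y1 by (simp flip: y_def)
    show "push_sharp p d (push_arr p b a d \<cdot> push_fill k i p \<phi> b g \<psi> b' s t)
      = push_sharp p d (push_fill k i p \<phi> d h \<chi> d' (push_arr p b a d \<cdot> s) (push_arr p b' a' d' \<cdot> t))"
      using push_sharp_push[OF p' a(1), of "push_fill k i p \<phi> b g \<psi> b' s t"] w(5) w1(5) oo by simp
  qed simp_all
qed

end


type_synonym ('i, 'm) fillers = "('i + 'i) \<times> 'm \<times> 'm \<Rightarrow> 'm"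
type_synonym ('i, 'm) fib_obj = "('m \<times> ('i, 'm) fillers) \<times> ('m \<times> 'm \<times> 'm)"
type_synonym ('i, 'm) fib_arr =
  "(('m \<times> ('i, 'm) fillers) \<times> 'm sq \<times> ('m \<times> ('i, 'm) fillers)) \<times> ('m \<times> 'm \<times> 'm) sq"

context frobenius_category
begin

subsection \<open>Lifting functors between slices to fibrations\<close>

abbreviation FibO :: "'o \<Rightarrow> (('i, 'm) fib_obj, ('i, 'm) fib_arr) cat" where
  "FibO X \<equiv> Fib_over C (ladj \<Lambda>) \<delta> I u X"

text \<open>An arrow of uniform fibrations over an object repeats its underlying square several times; this
  is the general arrow with that redundancy removed. The structure maps \<open>b\<close>, \<open>b'\<close>, \<open>d\<close>, \<open>d'\<close> are those
  of the four corners.\<close>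

definition fo_arr :: "'m \<Rightarrow> ('i, 'm) fillers \<Rightarrow> 'm \<Rightarrow> 'm \<Rightarrow> 'm \<Rightarrow> ('i, 'm) fillers \<Rightarrow>
    'm \<Rightarrow> 'm \<Rightarrow> 'm \<Rightarrow> 'm \<Rightarrow> ('i, 'm) fib_arr" where
  "fo_arr f \<phi> a a' g \<psi> b b' d d' = (((f, \<phi>), (f, a, a', g), (g, \<psi>)), ((b, f, b'), (b, a, d), (b', a', d'), (d, g, d')))"

lemma fo_obj_iff:
  "((g, \<psi>), (b, g', b')) \<in> Obj (FibO X) \<longleftrightarrow> g' = g \<and> fib g \<psi> \<and> (b, g, b') \<in> Arr (slice C X)"
  by (auto simp: Fib_over_def over_slice_def fibre_prod_def Fib_def arrow_func_def forget_def right_maps_def)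

lemma fo_obj_cases:
  assumes "w \<in> Obj (FibO X)"
  obtains g \<psi> b b' where "w = ((g, \<psi>), (b, g, b'))" "fib g \<psi>" "(b, g, b') \<in> Arr (slice C X)"
proof -
  obtain g \<psi> b g' b' where w: "w = ((g, \<psi>), (b, g', b'))" by (cases w) auto
  then show ?thesis using assms that by (auto simp: fo_obj_iff)
qed

lemma fo_arr_iff:
  "fo_arr f \<phi> a a' g \<psi> b b' d d' \<in> Arr (FibO X) \<longleftrightarrow> fib_mor f \<phi> a a' g \<psi> \<and> (b, f, b') \<in> Arr (slice C X) \<and>
     (d, g, d') \<in> Arr (slice C X) \<and> (b, a, d) \<in> Arr (slice C X) \<and> (b', a', d') \<in> Arr (slice C X)"
proof -
  have "((b, f, b'), (b, a, d), (b', a', d'), (d, g, d')) \<in> Arr (arrow_cat (slice C X))"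
    if "fib_mor f \<phi> a a' g \<psi>" "(b, f, b') \<in> Arr (slice C X)" "(d, g, d') \<in> Arr (slice C X)"
      "(b, a, d) \<in> Arr (slice C X)" "(b', a', d') \<in> Arr (slice C X)"
    using that(2-5) squareD(9)[OF fib_morD(3)[OF that(1)]] by (simp add: hom_def)
  moreover have "fo_arr f \<phi> a a' g \<psi> b b' d d' \<in> Arr (FibO X) \<longleftrightarrow> fib_mor f \<phi> a a' g \<psi> \<and>
      ((b, f, b'), (b, a, d), (b', a', d'), (d, g, d')) \<in> Arr (arrow_cat (slice C X))"
    by (simp add: fo_arr_def Fib_over_def over_slice_def fibre_prod_def Fib_def arrow_func_def forget_def
        del: arrow_cat_simps slice_simps)
  moreover have "(b, f, b') \<in> Arr (slice C X) \<and> (d, g, d') \<in> Arr (slice C X) \<and> (b, a, d) \<in> Arr (slice C X) \<and>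
      (b', a', d') \<in> Arr (slice C X)"
    if "((b, f, b'), (b, a, d), (b', a', d'), (d, g, d')) \<in> Arr (arrow_cat (slice C X))"
    using squareD(1-4)[OF that] by blast
  ultimately show ?thesis by blast
qed

lemma fo_arr_cases:
  assumes "T \<in> Arr (FibO X)"
  obtains f \<phi> a a' g \<psi> b b' d d' where "T = fo_arr f \<phi> a a' g \<psi> b b' d d'"
proof -
  obtain x S y e A A' e' where T: "T = ((x, S, y), (e, A, A', e'))" by (cases T) auto
  have 1: "(x, S, y) \<in> Arr (right_maps C (sum_cat I I) v)" "(e, A, A', e') \<in> Arr (arrow_cat (slice C X))"
    "S = (far (slice_forget C) e, far (slice_forget C) A, far (slice_forget C) A', far (slice_forget C) e')"
    using assms by (auto simp: T Fib_over_def over_slice_def fibre_prod_def Fib_def arrow_func_def forget_def)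
  obtain f \<phi> g \<psi> where xy: "x = (f, \<phi>)" "y = (g, \<psi>)" by (cases x; cases y)
  obtain b f' b' d g' d' where ee: "e = (b, f', b')" "e' = (d, g', d')" by (cases e; cases e')
  obtain b1 a d1 b2 a' d2 where AA: "A = (b1, a, d1)" "A' = (b2, a', d2)" by (cases A; cases A')
  have "f' = f" "g' = g"
    using 1(1) unfolding 1(3) xy ee slice_forget_simps right_maps_arr by blast+
  moreover have "b1 = b" "d1 = d" "b2 = b'" "d2 = d'"
    using squareD(5-8)[OF 1(2)[unfolded ee AA]] unfolding slice_simps(3,4) by blast+
  ultimately show ?thesis
    using that[of f \<phi> a a' g \<psi> b b' d d'] by (simp add: T 1(3) xy ee AA fo_arr_def)
qed

lemma fo_simps:
  "Dom (FibO X) (fo_arr f \<phi> a a' g \<psi> b b' d d') = ((f, \<phi>), (b, f, b'))"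
  "Cod (FibO X) (fo_arr f \<phi> a a' g \<psi> b b' d d') = ((g, \<psi>), (d, g, d'))"
  "fo_arr g \<psi> c c' h \<chi> d d' e e' \<cdot>\<^bsub>FibO X\<^esub> fo_arr f \<phi> a a' g \<psi> b b' d d'
    = fo_arr f \<phi> (c \<cdot> a) (c' \<cdot> a') h \<chi> b b' e e'"
  "Dom C f = Dom C b \<Longrightarrow> Cod C f = Dom C b' \<Longrightarrow>
    Id (FibO X) ((f, \<phi>), (b, f, b')) = fo_arr f \<phi> (Id C (Dom C f)) (Id C (Cod C f)) f \<phi> b b' b b'"
  by (simp_all add: fo_arr_def Fib_over_def over_slice_def fibre_prod_def Fib_def right_maps_def)

text \<open>Both \<open>f\<^sup>*\<close> and \<open>p\<^sub>*\<close> on uniform fibrations act by a functor \<open>\<Phi>\<close> between slices on underlying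
  arrows, and by some operation \<open>\<theta>\<close> on fillers.\<close>

definition over_ob :: "('m, 'm \<times> 'm \<times> 'm, 'm, 'm \<times> 'm \<times> 'm) func \<Rightarrow>
    (('i, 'm) fillers \<Rightarrow> 'm \<times> 'm \<times> 'm \<Rightarrow> ('i, 'm) fillers) \<Rightarrow> ('i, 'm) fib_obj \<Rightarrow> ('i, 'm) fib_obj" where
  "over_ob \<Phi> \<theta> = (\<lambda>((g, \<psi>), e). ((far (slice_forget C) (far \<Phi> e), \<theta> \<psi> e), far \<Phi> e))"

definition over_lift :: "('m, 'm \<times> 'm \<times> 'm, 'm, 'm \<times> 'm \<times> 'm) func \<Rightarrow>
    (('i, 'm) fillers \<Rightarrow> 'm \<times> 'm \<times> 'm \<Rightarrow> ('i, 'm) fillers) \<Rightarrow>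
    (('i, 'm) fib_obj, ('i, 'm) fib_arr, ('i, 'm) fib_obj, ('i, 'm) fib_arr) func" where
  "over_lift \<Phi> \<theta> =
     \<lparr>fob = over_ob \<Phi> \<theta>,
      far = (\<lambda>((x, S, y), (e, a, b, e')). let Q = far (arrow_func \<Phi>) (e, a, b, e')
        in ((fst (over_ob \<Phi> \<theta> (x, e)), far (arrow_func (slice_forget C)) Q, fst (over_ob \<Phi> \<theta> (y, e'))), Q))\<rparr>"

lemma Fib_pull_over_lift:
  "Fib_pull C (ladj \<Lambda>) \<delta> I u f = over_lift (pull_func C f) (pull_fillers C (sum_cat I I) v f)"
proof -
  have "pull_lift_ob C (sum_cat I I) v f = over_ob (pull_func C f) (pull_fillers C (sum_cat I I) v f)"
    by (simp add: pull_lift_ob_def over_ob_def Let_def)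
  then show ?thesis by (simp add: Fib_pull_def pull_lift_def over_lift_def)
qed

abbreviation sl :: "('m, 'm \<times> 'm \<times> 'm, 'm, 'm \<times> 'm \<times> 'm) func \<Rightarrow> 'm \<Rightarrow> 'm \<Rightarrow> 'm \<Rightarrow> 'm" where
  "sl \<Phi> b g b' \<equiv> far (slice_forget C) (far \<Phi> (b, g, b'))"

lemma slice_functor:
  assumes "is_functor (slice C X) (slice C Y) \<Phi>" "(b, g, b') \<in> Arr (slice C X)"
  shows "far \<Phi> (b, g, b') = (fob \<Phi> b, sl \<Phi> b g b', fob \<Phi> b')"
    "(fob \<Phi> b, sl \<Phi> b g b', fob \<Phi> b') \<in> Arr (slice C Y)"
proof -
  note F = functorD(2-4)[OF assms]
  show e: "far \<Phi> (b, g, b') = (fob \<Phi> b, sl \<Phi> b g b', fob \<Phi> b')"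
    by (rule slice_eta[where X = Y]) (use F in simp_all)
  then show "(fob \<Phi> b, sl \<Phi> b g b', fob \<Phi> b') \<in> Arr (slice C Y)"
    using F(1) by simp
qed

lemma over_lift_ob:
  assumes "is_functor (slice C X) (slice C Y) \<Phi>" "(b, g, b') \<in> Arr (slice C X)"
  shows "fob (over_lift \<Phi> \<theta>) ((g, \<psi>), (b, g, b'))
    = ((sl \<Phi> b g b', \<theta> \<psi> (b, g, b')), (fob \<Phi> b, sl \<Phi> b g b', fob \<Phi> b'))"
  using slice_functor(1)[OF assms] by (simp add: over_lift_def over_ob_def)

lemma over_lift_arr:
  assumes F: "is_functor (slice C X) (slice C Y) \<Phi>"
    and s: "(b, f, b') \<in> Arr (slice C X)" "(d, g, d') \<in> Arr (slice C X)" "(b, a, d) \<in> Arr (slice C X)"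
      "(b', a', d') \<in> Arr (slice C X)"
  shows "far (over_lift \<Phi> \<theta>) (fo_arr f \<phi> a a' g \<psi> b b' d d')
    = fo_arr (sl \<Phi> b f b') (\<theta> \<phi> (b, f, b')) (sl \<Phi> b a d) (sl \<Phi> b' a' d') (sl \<Phi> d g d') (\<theta> \<psi> (d, g, d'))
        (fob \<Phi> b) (fob \<Phi> b') (fob \<Phi> d) (fob \<Phi> d')"
  using slice_functor(1)[OF F s(1)] slice_functor(1)[OF F s(2)] slice_functor(1)[OF F s(3)] slice_functor(1)[OF F s(4)]
  by (simp add: fo_arr_def over_lift_def over_ob_def arrow_func_def Let_def del: slice_simps)

lemma slice_functor_square:
  assumes F: "is_functor (slice C X) (slice C Y) \<Phi>" and s: "(b, f, b') \<in> Arr (slice C X)"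
    "(d, g, d') \<in> Arr (slice C X)" "(b, a, d) \<in> Arr (slice C X)" "(b', a', d') \<in> Arr (slice C X)"
    and e: "g \<cdot> a = a' \<cdot> f"
  shows "(sl \<Phi> b f b', sl \<Phi> b a d, sl \<Phi> b' a' d', sl \<Phi> d g d') \<in> Arr (arrow_cat C)"
proof -
  have "far \<Phi> ((d, g, d') \<cdot>\<^bsub>slice C X\<^esub> (b, a, d)) = far \<Phi> ((b', a', d') \<cdot>\<^bsub>slice C X\<^esub> (b, f, b'))"
    using e by simp
  then have "far \<Phi> (d, g, d') \<cdot>\<^bsub>slice C Y\<^esub> far \<Phi> (b, a, d) = far \<Phi> (b', a', d') \<cdot>\<^bsub>slice C Y\<^esub> far \<Phi> (b, f, b')"
    using functorD(6)[OF F s(3,2)] functorD(6)[OF F s(1,4)] by simp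
  then have "(fob \<Phi> d, sl \<Phi> d g d', fob \<Phi> d') \<cdot>\<^bsub>slice C Y\<^esub> (fob \<Phi> b, sl \<Phi> b a d, fob \<Phi> d)
    = (fob \<Phi> b', sl \<Phi> b' a' d', fob \<Phi> d') \<cdot>\<^bsub>slice C Y\<^esub> (fob \<Phi> b, sl \<Phi> b f b', fob \<Phi> b')"
    using slice_functor(1)[OF F s(1)] slice_functor(1)[OF F s(2)] slice_functor(1)[OF F s(3)]
      slice_functor(1)[OF F s(4)] by metis
  then show ?thesis
    using sliceD[OF slice_functor(2)[OF F s(1)]] sliceD[OF slice_functor(2)[OF F s(2)]]
      sliceD[OF slice_functor(2)[OF F s(3)]] sliceD[OF slice_functor(2)[OF F s(4)]]
    by (simp add: hom_def)
qed

lemma lifts_over_lift: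
  assumes F: "is_functor (slice C X) (slice C Y) \<Phi>"
    and ob: "\<And>b g \<psi> b'. fib g \<psi> \<Longrightarrow> (b, g, b') \<in> Arr (slice C X) \<Longrightarrow> fib (sl \<Phi> b g b') (\<theta> \<psi> (b, g, b'))"
    and ar: "\<And>f \<phi> a a' g \<psi> b b' d d'. fo_arr f \<phi> a a' g \<psi> b b' d d' \<in> Arr (FibO X) \<Longrightarrow>
      fib_mor (sl \<Phi> b f b') (\<theta> \<phi> (b, f, b')) (sl \<Phi> b a d) (sl \<Phi> b' a' d') (sl \<Phi> d g d') (\<theta> \<psi> (d, g, d'))"
  shows "lifts_functor (FibO X) (FibO Y) snd_func snd_func (arrow_func \<Phi>) (over_lift \<Phi> \<theta>)"
proof -
  have comp: "sl \<Phi> b (k \<cdot> a) e = sl \<Phi> d k e \<cdot> sl \<Phi> b a d"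
    if "(b, a, d) \<in> Arr (slice C X)" "(d, k, e) \<in> Arr (slice C X)" for a b d k e
  proof -
    have "far \<Phi> (b, k \<cdot> a, e) = far \<Phi> (d, k, e) \<cdot>\<^bsub>slice C Y\<^esub> far \<Phi> (b, a, d)"
      using functorD(6)[OF F that] by simp
    also have "\<dots> = (fob \<Phi> d, sl \<Phi> d k e, fob \<Phi> e) \<cdot>\<^bsub>slice C Y\<^esub> (fob \<Phi> b, sl \<Phi> b a d, fob \<Phi> d)"
      using slice_functor(1)[OF F that(1)] slice_functor(1)[OF F that(2)] by metis
    finally show ?thesis by simp
  qed
  have ids: "sl \<Phi> b (Id C (Dom C b)) b = Id C (Dom C (fob \<Phi> b))" if "b \<in> Arr C" "Cod C b = X" for b
    using functorD(5)[OF F, of b] that by simp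
  have A: "far (over_lift \<Phi> \<theta>) T \<in> hom (FibO Y) (fob (over_lift \<Phi> \<theta>) (Dom (FibO X) T)) (fob (over_lift \<Phi> \<theta>) (Cod (FibO X) T))"
    if T: "T \<in> Arr (FibO X)" for T
  proof -
    obtain f \<phi> a a' g \<psi> b b' d d' where t: "T = fo_arr f \<phi> a a' g \<psi> b b' d d'" using T by (rule fo_arr_cases)
    note T' = T[unfolded t]
    have s: "(b, f, b') \<in> Arr (slice C X)" "(d, g, d') \<in> Arr (slice C X)" "(b, a, d) \<in> Arr (slice C X)"
      "(b', a', d') \<in> Arr (slice C X)"
      using T' unfolding fo_arr_iff by blast+
    show ?thesis
      unfolding t over_lift_arr[OF F s] fo_simps over_lift_ob[OF F s(1)] over_lift_ob[OF F s(2)]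
      unfolding hom_def mem_Collect_eq fo_arr_iff fo_simps
      using ar[OF T'] slice_functor(2)[OF F s(1)] slice_functor(2)[OF F s(2)] slice_functor(2)[OF F s(3)]
        slice_functor(2)[OF F s(4)] by blast
  qed
  have "is_functor (FibO X) (FibO Y) (over_lift \<Phi> \<theta>)"
    unfolding is_functor_def
  proof (intro conjI ballI impI)
    fix w assume w: "w \<in> Obj (FibO X)"
    obtain g \<psi> b b' where e: "w = ((g, \<psi>), (b, g, b'))" "fib g \<psi>" "(b, g, b') \<in> Arr (slice C X)"
      using w by (rule fo_obj_cases)
    show "fob (over_lift \<Phi> \<theta>) w \<in> Obj (FibO Y)"
      unfolding e(1) over_lift_ob[OF F e(3)] fo_obj_iff using ob[OF e(2,3)] slice_functor(2)[OF F e(3)] by blast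
    note eD = sliceD[OF e(3)] and pD = sliceD[OF slice_functor(2)[OF F e(3)]]
    have "fib_mor g \<psi> (Id C (Dom C b)) (Id C (Dom C b')) g \<psi>"
      using e(2) right_mapD(3,5)[OF e(2)] eD unfolding right_maps_arr by (auto simp: hom_def)
    then have i: "fo_arr g \<psi> (Id C (Dom C b)) (Id C (Dom C b')) g \<psi> b b' b b' \<in> Arr (FibO X)"
      unfolding fo_arr_iff using e(3) eD by (simp add: hom_def)
    show "far (over_lift \<Phi> \<theta>) (Id (FibO X) w) = Id (FibO Y) (fob (over_lift \<Phi> \<theta>) w)"
      unfolding e(1) over_lift_ob[OF F e(3)]
      using eD pD ids[of b] ids[of b'] i by (simp add: fo_simps over_lift_arr[OF F] fo_arr_iff del: slice_simps(2))
  next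
    fix S T assume S: "S \<in> Arr (FibO X)" and T: "T \<in> Arr (FibO X)" and ST: "Dom (FibO X) T = Cod (FibO X) S"
    obtain f \<phi> a a' g \<psi> b b' d d' where s: "S = fo_arr f \<phi> a a' g \<psi> b b' d d'" using S by (rule fo_arr_cases)
    obtain g1 \<psi>1 k k' h \<chi> d1 d1' e e' where t1: "T = fo_arr g1 \<psi>1 k k' h \<chi> d1 d1' e e'" using T by (rule fo_arr_cases)
    have t: "T = fo_arr g \<psi> k k' h \<chi> d d' e e'" using ST unfolding s t1 fo_simps by simp
    have sS: "fib_mor f \<phi> a a' g \<psi>" "(b, f, b') \<in> Arr (slice C X)" "(d, g, d') \<in> Arr (slice C X)" "(b, a, d) \<in> Arr (slice C X)"
      "(b', a', d') \<in> Arr (slice C X)"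
      using S unfolding s fo_arr_iff by blast+
    have sT: "fib_mor g \<psi> k k' h \<chi>" "(e, h, e') \<in> Arr (slice C X)" "(d, k, e) \<in> Arr (slice C X)" "(d', k', e') \<in> Arr (slice C X)"
      using T unfolding t fo_arr_iff by blast+
    have kS: "(b, k \<cdot> a, e) \<in> Arr (slice C X)" "(b', k' \<cdot> a', e') \<in> Arr (slice C X)"
      using sliceD[OF sS(4)] sliceD[OF sT(3)] reassoc[of e k d a] sliceD[OF sS(5)] sliceD[OF sT(4)]
        reassoc[of e' k' d' a'] by (simp_all add: hom_def)
    show "far (over_lift \<Phi> \<theta>) (T \<cdot>\<^bsub>FibO X\<^esub> S) = far (over_lift \<Phi> \<theta>) T \<cdot>\<^bsub>FibO Y\<^esub> far (over_lift \<Phi> \<theta>) S"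
      unfolding s t fo_simps over_lift_arr[OF F sS(2) sT(2) kS] over_lift_arr[OF F sS(2-5)] over_lift_arr[OF F sS(3) sT(2-4)]
        comp[OF sS(4) sT(3)] comp[OF sS(5) sT(4)] ..
  qed (rule A)
  moreover have "eq_func (FibO X) (snd_func \<circ>\<^sub>F over_lift \<Phi> \<theta>) (arrow_func \<Phi> \<circ>\<^sub>F snd_func)"
    by (auto simp: eq_func_def over_lift_def over_ob_def snd_func_def arrow_func_def Let_def split: prod.splits)
  ultimately show ?thesis by (simp add: lifts_functor_def)
qed

subsection \<open>The lift of pushforward\<close>

definition push_fillers where
  "push_fillers p \<phi> = (\<lambda>\<psi> (b, g, b'). restrict (\<lambda>(j, s, t). case untag j of (k, i) \<Rightarrow> push_fill k i p \<phi> b g \<psi> b' s t)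
     (lift_problems C (sum_cat I I) v (push_arr p b g b')))"

lemma push_fillers_tag:
  assumes k: "endpoint k" and i: "i \<in> Obj I" and S: "(gen k i, s, t, push_arr p b g b') \<in> Arr (arrow_cat C)"
  shows "push_fillers p \<phi> \<psi> (b, g, b') (tag k i, s, t) = push_fill k i p \<phi> b g \<psi> b' s t"
  using S k i by (simp add: push_fillers_def v_tag del: arrow_cat_simps)

lemma fib_push:
  assumes p: "fib p \<phi>" and g: "fib g \<psi>" and e: "(b, g, b') \<in> Arr (slice C (Dom C p))"
  shows "fib (push_arr p b g b') (push_fillers p \<phi> \<psi> (b, g, b'))"
proof -
  have p' [simp]: "p \<in> Arr C" using right_mapD(1)[OF p] .
  let ?F = "push_fillers p \<phi> \<psi> (b, g, b')" and ?g = "push_arr p b g b'"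
  note pe = sliceD[OF push_slice(2)[OF p' e]]
  show ?thesis
    unfolding right_map_def prod.case
  proof (intro conjI ballI allI impI)
    show "?g \<in> Arr C" using pe by simp
    show "?F \<in> extensional (lift_problems C (sum_cat I I) v ?g)" by (simp add: push_fillers_def)
  next
    fix z assume "z \<in> lift_problems C (sum_cat I I) v ?g"
    then obtain j s t where z: "z = (j, s, t)" and j: "j \<in> Obj (sum_cat I I)" and S: "(fob v j, s, t, ?g) \<in> Arr (arrow_cat C)"
      by (cases z) (auto simp: lift_problems_def)
    obtain k i where k: "endpoint k" and i: "i \<in> Obj I" and t: "j = tag k i" using j by (rule tag_cases)
    note S' = S[unfolded t v_tag(1)[OF k]]
    show "case z of (j, s, t) \<Rightarrow> ?F (j, s, t) \<in> hom C (Cod C (fob v j)) (Dom C ?g) \<and>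
        ?F (j, s, t) \<cdot> fob v j = s \<and> ?g \<cdot> ?F (j, s, t) = t"
      using push_fill[OF p g e k i S'] push_fillers_tag[OF k i S'] k i pe
      by (simp add: z t v_tag(1)[OF k]) (simp add: hom_def)
  next
    fix \<tau> s t assume \<tau>: "\<tau> \<in> Arr (sum_cat I I)" and L: "(Cod (sum_cat I I) \<tau>, s, t) \<in> lift_problems C (sum_cat I I) v ?g"
    obtain k \<sigma> where k: "endpoint k" and \<sigma>: "\<sigma> \<in> Arr I" and t: "\<tau> = tag k \<sigma>" using \<tau> by (rule tag_arr_cases)
    have S: "(gen k (Cod I \<sigma>), s, t, ?g) \<in> Arr (arrow_cat C)"
      using L by (simp add: t v_tag(1)[OF k] del: arrow_cat_simps)
    note S1 = square_cmp[OF v_sq[OF k \<sigma>] S]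
    show "?F (Cod (sum_cat I I) \<tau>, s, t) \<cdot> bot_of (far v \<tau>)
      = ?F (Dom (sum_cat I I) \<tau>, s \<cdot> top_of (far v \<tau>), t \<cdot> bot_of (far v \<tau>))"
      using push_fill_left[OF p g e k \<sigma> S] push_fillers_tag[OF k I_obj(2)[OF \<sigma>] S]
        push_fillers_tag[OF k I_obj(1)[OF \<sigma>] S1]
      by (simp add: t v_tag(2)[OF k \<sigma>])
  qed
qed

lemma is_functor_push: "p \<in> Arr C \<Longrightarrow> is_functor (slice C (Dom C p)) (slice C (Cod C p)) (push_func C p)"
  using adjoint_pair.functor_radj[OF adjoint_pair_push] by (simp add: push_func_def)

lemma fib_mor_push:
  assumes p: "fib p \<phi>" and T: "fo_arr f \<chi> a a' g \<psi> b b' d d' \<in> Arr (FibO (Dom C p))"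
  shows "fib_mor (push_arr p b f b') (push_fillers p \<phi> \<chi> (b, f, b')) (push_arr p b a d) (push_arr p b' a' d')
    (push_arr p d g d') (push_fillers p \<phi> \<psi> (d, g, d'))"
proof -
  have p': "p \<in> Arr C" using right_mapD(1)[OF p] .
  have s: "fib_mor f \<chi> a a' g \<psi>" "(b, f, b') \<in> Arr (slice C (Dom C p))" "(d, g, d') \<in> Arr (slice C (Dom C p))"
    "(b, a, d) \<in> Arr (slice C (Dom C p))" "(b', a', d') \<in> Arr (slice C (Dom C p))"
    using T unfolding fo_arr_iff by blast+
  note m = fib_morD[OF s(1)]
  note Q = slice_functor_square[OF is_functor_push[OF p'] s(2-5) squareD(9)[OF m(3)]]
  have "push_arr p b a d \<cdot> push_fillers p \<phi> \<chi> (b, f, b') (j, r, q)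
    = push_fillers p \<phi> \<psi> (d, g, d') (j, push_arr p b a d \<cdot> r, push_arr p b' a' d' \<cdot> q)"
    if j: "j \<in> Obj (sum_cat I I)" and R: "(fob v j, r, q, push_arr p b f b') \<in> Arr (arrow_cat C)" for j r q
  proof -
    obtain k i where k: "endpoint k" and i: "i \<in> Obj I" and t: "j = tag k i" using j by (rule tag_cases)
    note R' = R[unfolded t v_tag(1)[OF k]]
    show ?thesis
      unfolding t push_fillers_tag[OF k i R'] push_fillers_tag[OF k i square_cmp[OF R' Q]]
      by (rule push_fill_right[OF p s(1,2,3,4,5) Q k i R'])
  qed
  then show ?thesis
    using fib_push[OF p m(1) s(2)] fib_push[OF p m(2) s(3)] Q unfolding right_maps_arr by blast
qed

subsection \<open>Exchange of pullback and pushforward\<close>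

lemma exch_mate_natural:
  assumes sq: "p \<in> Arr C" "q \<in> Arr C" "s \<in> Arr C" "t \<in> Arr C" "Dom C s = Dom C p" "Cod C s = Dom C q"
    "Dom C t = Cod C p" "Cod C t = Cod C q" "q \<cdot> s = t \<cdot> p" and a: "(b, a, d) \<in> Arr (slice C (Dom C q))"
  shows "far (slice_forget C) (exch_mate C p q s t d) \<cdot> sl (pull_func C t) (pf q b) (push_arr q b a d) (pf q d)
    = push_arr p (pb2 C b s) (sl (pull_func C s) b a d) (pb2 C d s) \<cdot> far (slice_forget C) (exch_mate C p q s t b)"
proof -
  let ?m = "\<lambda>b. far (slice_forget C) (exch_mate C p q s t b)"
  note aD = sliceD[OF a]
  have a0: "(b, a, d) \<in> Arr (slice C (Cod C s))" using a sq by simp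
  note qs = push_slice[OF sq(2) a]
  have qs0: "(pf q b, push_arr q b a d, pf q d) \<in> Arr (slice C (Cod C t))" using qs(2) sq by simp
  note ps = slice_functor[OF is_functor_pull[OF sq(3)] a0, unfolded pull_func_simps(1)]
  have ps0: "(pb2 C b s, sl (pull_func C s) b a d, pb2 C d s) \<in> Arr (slice C (Dom C p))"
    using ps(2) sq by simp
  note X = exch_mate(2)[OF sq aD(1,2)] and X' = exch_mate(2)[OF sq aD(3,4)]
  have "exch_mate C p q s t d \<cdot>\<^bsub>slice C (Cod C p)\<^esub> far (pull_func C t \<circ>\<^sub>F push_func C q) (b, a, d)
    = far (push_func C p \<circ>\<^sub>F pull_func C s) (b, a, d) \<cdot>\<^bsub>slice C (Cod C p)\<^esub> exch_mate C p q s t b"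
    using nat_transD(4)[OF nat_trans_exch_mate[OF sq aD(1,2)] a] by simp
  moreover have "far (pull_func C t \<circ>\<^sub>F push_func C q) (b, a, d)
    = (pb2 C (pf q b) t, sl (pull_func C t) (pf q b) (push_arr q b a d) (pf q d), pb2 C (pf q d) t)"
    using slice_functor(1)[OF is_functor_pull[OF sq(4)] qs0] qs(1) by (simp add: pull_func_simps(1))
  moreover have "far (push_func C p \<circ>\<^sub>F pull_func C s) (b, a, d)
    = (pf p (pb2 C b s), push_arr p (pb2 C b s) (sl (pull_func C s) b a d) (pb2 C d s), pf p (pb2 C d s))"
    using ps(1) push_slice(1)[OF sq(1) ps0] by simp
  ultimately have "(pb2 C (pf q d) t, ?m d, pf p (pb2 C d s)) \<cdot>\<^bsub>slice C (Cod C p)\<^esub>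
      (pb2 C (pf q b) t, sl (pull_func C t) (pf q b) (push_arr q b a d) (pf q d), pb2 C (pf q d) t)
    = (pf p (pb2 C b s), push_arr p (pb2 C b s) (sl (pull_func C s) b a d) (pb2 C d s), pf p (pb2 C d s))
      \<cdot>\<^bsub>slice C (Cod C p)\<^esub> (pb2 C (pf q b) t, ?m b, pf p (pb2 C b s))"
    using X X' by metis
  then show ?thesis by simp
qed

lemma frob_base:
  assumes k: "endpoint k" and i: "i \<in> Obj I" and p: "fib_mor p \<phi> x0 x1 p' \<phi>'" and g: "fib g \<psi>"
    and y: "y \<in> Arr C" "Dom C y = K0 (Cod C (fob u i))" "Cod C y = Cod C p" and y': "y' = x1 \<cdot> y"
    and z: "z = pb_pair C y' p' (pb1 C y p) (x0 \<cdot> pb2 C y p)"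
    and w: "w = pb_pair C (gen k i) (pb1 C y' p') (pb1 C (gen k i) (pb1 C y p)) (z \<cdot> pbm (gen k i) p y)"
    and S: "(pbm (gen k i) p' y', s, t, g) \<in> Arr (arrow_cat C)"
  shows "frob k i p' \<phi>' y' g \<psi> s t \<cdot> z = frob k i p \<phi> y g \<psi> (s \<cdot> w) (t \<cdot> z)"
proof -
  interpret I: category I by (rule category_I)
  have ii [simp]: "Id I i \<in> Arr I" "Dom I (Id I i) = i" "Cod I (Id I i) = i" using i by simp_all
  note m = fib_morD[OF p]
  note [simp] = squareD(1-8)[OF m(3)] i y k
  have ui: "far u (Id I i) = (fob u i, Id C (Dom C (fob u i)), Id C (Cod C (fob u i)), fob u i)"
    using functorD(5)[OF functor_u i] by simp
  have b: "gen_bot (Id I i) = Id C (K0 (Cod C (fob u i)))"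
    by (simp add: ui)
  have t: "gen_top k (Id I i) = Id C (Cod C (in1 k (fob u i)))"
  proof -
    have "(fob u i, Id C (Dom C (fob u i)), Id C (Cod C (fob u i)), fob u i) \<in> Arr (arrow_cat C)"
      by (simp add: hom_def)
    note T = LZ_top[OF k this]
    show ?thesis
      by (simp add: ui) (rule in_ext[of k "fob u i"]; use T in simp)
  qed
  show ?thesis
    by (rule frob_left[OF k ii(1) p g, unfolded t, unfolded b ii])
      (use z w S in \<open>simp_all add: y' del: arrow_cat_simps\<close>)
qed

text \<open>The components of \<open>\<psi> : t\<^sup>* q\<^sub>* \<rightarrow> p\<^sub>* s\<^sup>*\<close> commute with fillers. Both composites to be compared
  are determined by their transposes to the pullback of \<open>b\<close> along \<open>s0\<close>. The projection to the base
  is the same for both; on the other projection, the formula for the transposed mate reduces the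
  claim to naturality of \<open>frob\<close> in the fibration, from \<open>p\<close> to \<open>q\<close>.\<close>

lemma push_exch:
  assumes pq: "fib_mor p \<phi> s0 t0 q \<chi>" and g: "fib g \<psi>" and e: "(b, g, b') \<in> Arr (slice C (Dom C q))"
    and g1: "g1 = sl (pull_func C t0) (pf q b) (push_arr q b g b') (pf q b')"
    and \<theta>1: "\<theta>1 = pull_fillers C (sum_cat I I) v t0 (push_fillers q \<chi> \<psi> (b, g, b')) (pf q b, push_arr q b g b', pf q b')"
    and gs: "gs = sl (pull_func C s0) b g b'" and \<psi>s: "\<psi>s = pull_fillers C (sum_cat I I) v s0 \<psi> (b, g, b')"
    and g2: "g2 = push_arr p (pb2 C b s0) gs (pb2 C b' s0)"
    and \<theta>2: "\<theta>2 = push_fillers p \<phi> \<psi>s (pb2 C b s0, gs, pb2 C b' s0)"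
    and \<mu>: "\<And>b. \<mu> b = far (slice_forget C) (exch_mate C p q s0 t0 b)"
  shows "fib_mor g1 \<theta>1 (\<mu> b) (\<mu> b') g2 \<theta>2"
proof -
  note m = fib_morD[OF pq] and eD = sliceD[OF e]
  note sq = squareD[OF m(3)]
  note [simp] = sq(1-8) eD(1-7)
  have e0: "(b, g, b') \<in> Arr (slice C (Cod C s0))" using e by simp
  note qs = push_slice[OF sq(2) e] and qD = sliceD[OF push_slice(2)[OF sq(2) e]]
  note [simp] = qD(1-7)
  have qs0: "(pf q b, push_arr q b g b', pf q b') \<in> Arr (slice C (Cod C t0))" using qs(2) by simp
  have g1': "g1 = pb_pair C (pf q b') t0 (push_arr q b g b' \<cdot> pb1 C (pf q b) t0) (pb2 C (pf q b) t0)"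
    unfolding g1 by (simp add: pull_func_simps)
  have gs': "gs = pb_pair C b' s0 (g \<cdot> pb1 C b s0) (pb2 C b s0)"
    unfolding gs by (simp add: pull_func_simps)
  note fg1 = right_map_pull[OF sq(4) fib_push[OF m(2) g e] qs0 g1' category_sum v_hom, folded \<theta>1]
  note fgs = right_map_pull[OF sq(3) g e0 gs' category_sum v_hom, folded \<psi>s]
  have es: "(pb2 C b s0, gs, pb2 C b' s0) \<in> Arr (slice C (Dom C p))"
    using slice_functor(2)[OF is_functor_pull[OF sq(3)] e0] by (simp add: pull_func_simps(1) gs)
  note fg2 = fib_push[OF m(1) fgs(1) es, folded g2 \<theta>2]
  have bD: "b \<in> Arr C" "Cod C b = Dom C q" "b' \<in> Arr C" "Cod C b' = Dom C q" by simp_all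
  note X = exch_mate(1,2,4)[OF sq(1-8) sq(9) bD(1,2), folded \<mu>]
    and X' = exch_mate(1,2,4)[OF sq(1-8) sq(9) bD(3,4), folded \<mu>]
  note XD = sliceD[OF X(1)] and XD' = sliceD[OF X'(1)]
  note [simp] = XD(1-7) XD'(1-7)
  note g1D = pull_arr[OF sq(4) qs0, folded g1']
  note g2D = sliceD[OF push_slice(2)[OF sq(1) es], folded g2]
  note [simp] = g1D(1-3) g2D(1-7)
  have sqm: "(g1, \<mu> b, \<mu> b', g2) \<in> Arr (arrow_cat C)"
  proof -
    have "\<mu> b' \<cdot> g1 = g2 \<cdot> \<mu> b"
      unfolding \<mu> g1 g2 gs by (rule exch_mate_natural[OF sq e])
    then show ?thesis by (simp add: hom_def)
  qed
  have "\<mu> b \<cdot> \<theta>1 (j, s, t) = \<theta>2 (j, \<mu> b \<cdot> s, \<mu> b' \<cdot> t)"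
    if j: "j \<in> Obj (sum_cat I I)" and S: "(fob v j, s, t, g1) \<in> Arr (arrow_cat C)" for j s t
  proof -
    obtain k i where k: "endpoint k" and i: "i \<in> Obj I" and j': "j = tag k i" using j by (rule tag_cases)
    note [simp] = k i
    note Sg = S[unfolded j' v_tag(1)[OF k]]
    note Sg2 = square_cmp[OF Sg sqm]
    have [simp]: "s \<in> Arr C" "Dom C s = Cod C (in1 k (fob u i))" "Cod C s = Dom C (pb1 C (pf q b) t0)"
      "t \<in> Arr C" "Dom C t = K0 (Cod C (fob u i))" "Cod C t = Dom C (pb1 C (pf q b') t0)"
      using squareD[OF Sg] by simp_all
    have g1s: "g1 \<cdot> s = t \<cdot> gen k i" using squareD(9)[OF Sg] .
    note P = pull_fillers[OF sq(4) fib_push[OF m(2) g e] qs0 g1' j S refl, folded \<theta>1]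
    define F where "F = \<theta>1 (j, s, t)"
    let ?bs = "pb2 C b s0" and ?bs' = "pb2 C b' s0"
    let ?s = "pb1 C (pf q b) t0 \<cdot> s" and ?t = "pb1 C (pf q b') t0 \<cdot> t"
    define y where "y = pb2 C (pf q b') t0 \<cdot> t"
    have PS: "(gen k i, ?s, ?t, push_arr q b g b') \<in> Arr (arrow_cat C)"
      using P(1) unfolding j' v_tag(1)[OF k] .
    have [simp]: "F \<in> Arr C" "Dom C F = K0 (Cod C (fob u i))" "Cod C F = Dom C (pb1 C (pf q b) t0)"
      and F5: "pb1 C (pf q b) t0 \<cdot> F = push_fill k i q \<chi> b g \<psi> b' ?s ?t" and F6: "pb2 C (pf q b) t0 \<cdot> F = y"
      unfolding F_def y_def using P(2-6) push_fillers_tag[OF k i PS] by (simp_all add: j' v_tag(1)[OF k])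
    have y [simp]: "y \<in> Arr C" "Dom C y = K0 (Cod C (fob u i))" "Cod C y = Cod C p"
      by (simp_all add: y_def)
    have ty: "t0 \<cdot> y = pf q b' \<cdot> ?t"
      unfolding y_def using pb_comm'[of "pf q b'" t0 t] by simp
    have y2: "y = pf p ?bs' \<cdot> (\<mu> b' \<cdot> t)"
      using reassoc[OF XD'(8), of t] by (simp add: y_def)
    have R: "\<theta>2 (j, \<mu> b \<cdot> s, \<mu> b' \<cdot> t) = push_fill k i p \<phi> ?bs gs \<psi>s ?bs' (\<mu> b \<cdot> s) (\<mu> b' \<cdot> t)"
      using push_fillers_tag[OF k i Sg2[unfolded g2]] by (simp add: \<theta>2 j')
    note Sg2' = Sg2[unfolded g2]
    note w2 = push_fill[OF m(1) fgs(1) es k i Sg2'] and o2 = push_out[OF m(1) fgs(1) es k i Sg2' y2]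
      and pr2 = push_problem[OF m(1) fgs(1) es k i Sg2' y2]
    note w1 = push_fill[OF m(2) g e k i PS] and o1 = push_out[OF m(2) g e k i PS ty] and pr1 = push_problem[OF m(2) g e k i PS ty]
    let ?w2 = "push_fill k i p \<phi> ?bs gs \<psi>s ?bs' (\<mu> b \<cdot> s) (\<mu> b' \<cdot> t)"
    note [simp] = w2(1-3) o2(1-3)
    define z where "z = pb_pair C (t0 \<cdot> y) q (pb1 C y p) (s0 \<cdot> pb2 C y p)"
    define w where "w = pb_pair C (gen k i) (pb1 C (t0 \<cdot> y) q) (pb1 C (gen k i) (pb1 C y p)) (z \<cdot> pbm (gen k i) p y)"
    note zz = exch_arr[OF sq(1-9) y(1,3) z_def]
    note [simp] = zz(1-3)
    have "gen k i \<cdot> pb1 C (gen k i) (pb1 C y p) = pb1 C (t0 \<cdot> y) q \<cdot> (z \<cdot> pbm (gen k i) p y)"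
      using reassoc[OF zz(4), of "pbm (gen k i) p y"] by (simp add: pb_comm)
    then have ww: "w \<in> Arr C" "Dom C w = Dom C (pb1 C (gen k i) (pb1 C y p))" "Cod C w = Dom C (pb1 C (gen k i) (pb1 C (t0 \<cdot> y) q))"
      "pb1 C (gen k i) (pb1 C (t0 \<cdot> y) q) \<cdot> w = pb1 C (gen k i) (pb1 C y p)"
      "pbm (gen k i) q (t0 \<cdot> y) \<cdot> w = z \<cdot> pbm (gen k i) p y"
      unfolding w_def using pb_pair[of "gen k i" "pb1 C (t0 \<cdot> y) q" "pb1 C (gen k i) (pb1 C y p)" "z \<cdot> pbm (gen k i) p y"]
      by simp_all
    note [simp] = ww(1-3)
    let ?m = "gen k i"
    define zm where "zm = pb_pair C (t0 \<cdot> (y \<cdot> ?m)) q (pb1 C (y \<cdot> ?m) p) (s0 \<cdot> pb2 C (y \<cdot> ?m) p)"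
    have ym: "y \<cdot> ?m \<in> Arr C" "Cod C (y \<cdot> ?m) = Cod C p" by simp_all
    note zm = exch_arr[OF sq(1-9) ym zm_def]
    note [simp] = zm(1-3)
    have tym: "(t0 \<cdot> y) \<cdot> ?m = t0 \<cdot> (y \<cdot> ?m)" by simp
    note c1 = pb_cmp[of q ?m "t0 \<cdot> y", unfolded tym] and c2 = pb_cmp[of p ?m y]
    have c1' [simp]: "pb_pair C (t0 \<cdot> (y \<cdot> ?m)) q (pb1 C ?m (pb1 C (t0 \<cdot> y) q)) (pb2 C (t0 \<cdot> y) q \<cdot> pbm ?m q (t0 \<cdot> y)) \<in> Arr C"
      "Dom C (pb_pair C (t0 \<cdot> (y \<cdot> ?m)) q (pb1 C ?m (pb1 C (t0 \<cdot> y) q)) (pb2 C (t0 \<cdot> y) q \<cdot> pbm ?m q (t0 \<cdot> y))) = Dom C (pb1 C ?m (pb1 C (t0 \<cdot> y) q))"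
      "Cod C (pb_pair C (t0 \<cdot> (y \<cdot> ?m)) q (pb1 C ?m (pb1 C (t0 \<cdot> y) q)) (pb2 C (t0 \<cdot> y) q \<cdot> pbm ?m q (t0 \<cdot> y))) = Dom C (pb1 C (t0 \<cdot> (y \<cdot> ?m)) q)"
      and c2' [simp]: "pb_cmp ?m p y \<in> Arr C" "Dom C (pb_cmp ?m p y) = Dom C (pb1 C ?m (pb1 C y p))"
      "Cod C (pb_cmp ?m p y) = Dom C (pb1 C (y \<cdot> ?m) p)"
      using c1(1-3) c2(1-3) by simp_all
    \<comment> \<open>Exchange commutes with the comparison of the two pullbacks of the generator.\<close>
    have cz: "zm \<cdot> pb_cmp ?m p y = pb_cmp ?m q (t0 \<cdot> y) \<cdot> w"
      unfolding tym
      by (rule pb_ext[of "t0 \<cdot> (y \<cdot> ?m)" q]) (simp_all add: reassoc[OF zm(4)] reassoc[OF zm(5)] reassoc[OF c1(4)]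
          reassoc[OF c1(5)] ww(4,5) c2(4,5) reassoc[OF zz(5)])
    have y1m: "y \<cdot> ?m = pb2 C (pf q b) t0 \<cdot> s"
      using reassoc[OF g1D(5), of s] g1s by (simp add: y_def)
    have ts: "pb1 C b' s0 \<cdot> push_sharp p ?bs' (\<mu> b' \<cdot> t) = push_sharp q b' ?t \<cdot> z"
      unfolding z_def by (rule X'(3)) (simp_all add: y_def)
    have ss: "pb1 C b s0 \<cdot> push_sharp p ?bs (\<mu> b \<cdot> s) = push_sharp q b ?s \<cdot> zm"
      unfolding zm_def by (rule X(3)) (simp_all add: y1m)
    have pbs: "push_sharp p ?bs (\<mu> b \<cdot> s) \<in> Arr C" "Dom C (push_sharp p ?bs (\<mu> b \<cdot> s)) = Dom C (pb1 C (y \<cdot> ?m) p)"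
      "Cod C (push_sharp p ?bs (\<mu> b \<cdot> s)) = Dom C (pb1 C b s0)"
      using push_sharp[of p ?bs "\<mu> b \<cdot> s"] pr2(4) by simp_all
    have qbs: "push_sharp q b ?s \<in> Arr C" "Dom C (push_sharp q b ?s) = Dom C (pb1 C (t0 \<cdot> (y \<cdot> ?m)) q)"
      "Cod C (push_sharp q b ?s) = Dom C b"
      using push_sharp[of q b ?s] pr1(4) by simp_all
    have ss2: "pb1 C b s0 \<cdot> (push_sharp p ?bs (\<mu> b \<cdot> s) \<cdot> pb_cmp ?m p y) = (push_sharp q b ?s \<cdot> pb_cmp ?m q (t0 \<cdot> y)) \<cdot> w"
      using reassoc[OF ss, of "pb_cmp ?m p y"] cz pbs qbs by simp
    have "push_out k i q \<chi> b g \<psi> b' ?s ?t \<cdot> z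
      = frob k i p \<phi> y g \<psi> ((push_sharp q b ?s \<cdot> pb_cmp ?m q (t0 \<cdot> y)) \<cdot> w) (push_sharp q b' ?t \<cdot> z)"
      unfolding push_out_def ty[symmetric] by (rule frob_base[OF k i pq g y refl z_def w_def pr1(5)])
    also have "\<dots> = pb1 C b s0 \<cdot> push_out k i p \<phi> ?bs gs \<psi>s ?bs' (\<mu> b \<cdot> s) (\<mu> b' \<cdot> t)"
    proof -
      have "pb1 C b s0 \<cdot> push_out k i p \<phi> ?bs gs \<psi>s ?bs' (\<mu> b \<cdot> s) (\<mu> b' \<cdot> t)
        = frob k i p \<phi> y g \<psi> (pb1 C b s0 \<cdot> (push_sharp p ?bs (\<mu> b \<cdot> s) \<cdot> pb_cmp ?m p y))
            (pb1 C b' s0 \<cdot> push_sharp p ?bs' (\<mu> b' \<cdot> t))"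
        unfolding push_out_def y2[symmetric] by (rule frob_right[OF k i m(1) fgs(2) pr2(1-3,5)])
      then show ?thesis unfolding ss2 ts by (rule sym)
    qed
    finally have oo: "push_out k i q \<chi> b g \<psi> b' ?s ?t \<cdot> z = pb1 C b s0 \<cdot> push_out k i p \<phi> ?bs gs \<psi>s ?bs' (\<mu> b \<cdot> s) (\<mu> b' \<cdot> t)" .
    have "pb1 C b s0 \<cdot> push_sharp p ?bs (\<mu> b \<cdot> F) = push_sharp q b (pb1 C (pf q b) t0 \<cdot> F) \<cdot> z"
      unfolding z_def by (rule X(3)) (simp_all add: F6)
    also have "\<dots> = push_out k i q \<chi> b g \<psi> b' ?s ?t \<cdot> z"
      by (simp only: F5 w1(5))
    also have "\<dots> = pb1 C b s0 \<cdot> push_sharp p ?bs ?w2"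
      by (simp only: oo w2(5))
    finally have p1: "pb1 C b s0 \<cdot> push_sharp p ?bs (\<mu> b \<cdot> F) = pb1 C b s0 \<cdot> push_sharp p ?bs ?w2" .
    have a1: "pf p ?bs \<cdot> (\<mu> b \<cdot> F) = y"
      using reassoc[OF XD(8), of F] F6 by simp
    have a2: "pf p ?bs \<cdot> ?w2 = y" using w2(4) y2 by simp
    have "push_sharp p ?bs (\<mu> b \<cdot> F) = push_sharp p ?bs ?w2"
      by (rule pb_ext[OF _ _ _ _ _ _ _ _ p1])
        (use push_sharp[of p ?bs "\<mu> b \<cdot> F", unfolded a1] push_sharp[of p ?bs ?w2, unfolded a2] in simp_all)
    then have "\<mu> b \<cdot> F = ?w2"
      by (intro push_sharp_inj[of p ?bs "\<mu> b \<cdot> F"]) (simp_all add: a1 a2 del: cmp_assoc)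
    then show ?thesis unfolding R F_def .
  qed
  then show ?thesis using fg1(1) fg2 sqm unfolding right_maps_arr by blast
qed

end


context frobenius_category
begin

lemma is_iso_fo_arr:
  assumes T: "fo_arr f \<phi> a a' g \<psi> b b' d d' \<in> Arr (FibO X)"
    and a: "is_iso (slice C X) (b, a, d)" and a': "is_iso (slice C X) (b', a', d')"
  shows "is_iso (FibO X) (fo_arr f \<phi> a a' g \<psi> b b' d d')"
proof -
  have s: "fib_mor f \<phi> a a' g \<psi>" "(b, f, b') \<in> Arr (slice C X)" "(d, g, d') \<in> Arr (slice C X)" "(b, a, d) \<in> Arr (slice C X)"
    "(b', a', d') \<in> Arr (slice C X)"
    using T unfolding fo_arr_iff by blast+
  have inv: "\<exists>n. (d, n, b) \<in> Arr (slice C X) \<and> n \<cdot> a = Id C (Dom C b) \<and> a \<cdot> n = Id C (Dom C d)"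
    if iso: "is_iso (slice C X) (b, a, d)" for a b d
  proof -
    obtain N where N: "N \<in> hom (slice C X) d b" "N \<cdot>\<^bsub>slice C X\<^esub> (b, a, d) = Id (slice C X) b"
      "(b, a, d) \<cdot>\<^bsub>slice C X\<^esub> N = Id (slice C X) d"
      using iso unfolding is_iso_def slice_simps(3,4) by blast
    have e: "N = (d, far (slice_forget C) N, b)"
      using N(1) by (intro slice_eta[where X = X]) (simp_all add: hom_def)
    then obtain n where n: "N = (d, n, b)" by blast
    have "(d, n, b) \<in> Arr (slice C X)" using N(1) unfolding n hom_def by blast
    then show ?thesis using N(2,3) unfolding n slice_simps(5,6) by blast
  qed
  obtain n where n: "(d, n, b) \<in> Arr (slice C X)" "n \<cdot> a = Id C (Dom C b)" "a \<cdot> n = Id C (Dom C d)"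
    using inv[OF a] by blast
  obtain n' where n': "(d', n', b') \<in> Arr (slice C X)" "n' \<cdot> a' = Id C (Dom C b')" "a' \<cdot> n' = Id C (Dom C d')"
    using inv[OF a'] by blast
  note D = sliceD[OF s(2)] sliceD[OF s(3)]
  have "fib_mor g \<psi> n n' f \<phi>"
    using right_maps_inverse[OF s(1), of n n'] n n' sliceD[OF n(1)] sliceD[OF n'(1)] D by (simp add: hom_def)
  then have N: "fo_arr g \<psi> n n' f \<phi> d d' b b' \<in> Arr (FibO X)"
    unfolding fo_arr_iff using s n n' by blast
  have i: "Id (FibO X) ((f, \<phi>), (b, f, b')) = fo_arr f \<phi> (Id C (Dom C b)) (Id C (Dom C b')) f \<phi> b b' b b'"
    "Id (FibO X) ((g, \<psi>), (d, g, d')) = fo_arr g \<psi> (Id C (Dom C d)) (Id C (Dom C d')) g \<psi> d d' d d'"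
    using D by (simp_all add: fo_simps(4))
  show ?thesis
    unfolding is_iso_def fo_simps i
  proof (intro conjI bexI[of _ "fo_arr g \<psi> n n' f \<phi> d d' b b'"])
    show "fo_arr g \<psi> n n' f \<phi> d d' b b' \<in> hom (FibO X) ((g, \<psi>), (d, g, d')) ((f, \<phi>), (b, f, b'))"
      unfolding hom_def mem_Collect_eq fo_simps using N by blast
  qed (simp_all only: T fo_simps n n')
qed

lemma snd_func_simps: "fob snd_func x = snd x" "far snd_func y = snd y"
  by (simp_all add: snd_func_def)

lemma pushforward_lifts:
  "\<exists>push_lift.
    (\<forall>x \<in> Obj (Fib C (ladj \<Lambda>) \<delta> I u). let p = fst x in
       lifts_functor (FibO (Dom C p)) (FibO (Cod C p))
         snd_func snd_func (arrow_func (push_func C p)) (push_lift x)) \<and>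
    (\<forall>(x, (p, s, t, q), y) \<in> Arr (Fib C (ladj \<Lambda>) \<delta> I u).
       \<exists>\<psi>. let A = FibO (Dom C q); B = FibO (Cod C p);
               F = Fib_pull C (ladj \<Lambda>) \<delta> I u t \<circ>\<^sub>F push_lift y;
               G = push_lift x \<circ>\<^sub>F Fib_pull C (ladj \<Lambda>) \<delta> I u s in
         nat_trans A B F G \<psi> \<and>
         (\<forall>w \<in> Obj A. far snd_func (\<psi> w) = exch_mate_arrow C p q s t (fob snd_func w)) \<and>
         (is_pullback C t q p s \<longrightarrow> nat_iso A B F G \<psi>))"
proof -
  define PL where "PL = (\<lambda>x. over_lift (push_func C (fst x)) (push_fillers (fst x) (snd x)))"
  have lift: "lifts_functor (FibO (Dom C p)) (FibO (Cod C p)) snd_func snd_func (arrow_func (push_func C p)) (PL (p, \<phi>))"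
    if p: "fib p \<phi>" for p \<phi>
    unfolding PL_def fst_conv snd_conv
    by (rule lifts_over_lift[OF is_functor_push[OF right_mapD(1)[OF p]] fib_push[OF p] fib_mor_push[OF p]])
  have "\<exists>\<psi>. nat_trans (FibO (Dom C q)) (FibO (Cod C p)) (Fib_pull C (ladj \<Lambda>) \<delta> I u t \<circ>\<^sub>F PL (q, \<chi>))
          (PL (p, \<phi>) \<circ>\<^sub>F Fib_pull C (ladj \<Lambda>) \<delta> I u s) \<psi> \<and>
        (\<forall>w \<in> Obj (FibO (Dom C q)). snd (\<psi> w) = exch_mate_arrow C p q s t (snd w)) \<and>
        (is_pullback C t q p s \<longrightarrow> nat_iso (FibO (Dom C q)) (FibO (Cod C p)) (Fib_pull C (ladj \<Lambda>) \<delta> I u t \<circ>\<^sub>F PL (q, \<chi>))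
          (PL (p, \<phi>) \<circ>\<^sub>F Fib_pull C (ladj \<Lambda>) \<delta> I u s) \<psi>)"
    if pq: "fib_mor p \<phi> s t q \<chi>" for p \<phi> s t q \<chi>
  proof -
    note m = fib_morD[OF pq]
    note sq = squareD[OF m(3)]
    let ?F = "Fib_pull C (ladj \<Lambda>) \<delta> I u t \<circ>\<^sub>F PL (q, \<chi>)" and ?G = "PL (p, \<phi>) \<circ>\<^sub>F Fib_pull C (ladj \<Lambda>) \<delta> I u s"
    let ?A = "FibO (Dom C q)" and ?B = "FibO (Cod C p)"
    define \<mu> where "\<mu> = (\<lambda>b. far (slice_forget C) (exch_mate C p q s t b))"
    have fp: "is_functor (slice C (Dom C p)) (slice C (Cod C p)) (push_func C p)"
      "is_functor (slice C (Dom C q)) (slice C (Cod C q)) (push_func C q)"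
      "is_functor (slice C (Cod C q)) (slice C (Cod C p)) (pull_func C t)"
      "is_functor (slice C (Dom C q)) (slice C (Dom C p)) (pull_func C s)"
      using is_functor_push[OF sq(1)] is_functor_push[OF sq(2)] is_functor_pull[OF sq(4)] is_functor_pull[OF sq(3)] sq
      by simp_all
    define Fa where "Fa = (\<lambda>b g b'. sl (pull_func C t) (pf q b) (push_arr q b g b') (pf q b'))"
    define Ga where "Ga = (\<lambda>b g b'. push_arr p (pb2 C b s) (sl (pull_func C s) b g b') (pb2 C b' s))"
    define F\<theta> where "F\<theta> = (\<lambda>\<psi> b g b'. pull_fillers C (sum_cat I I) v t (push_fillers q \<chi> \<psi> (b, g, b')) (pf q b, push_arr q b g b', pf q b'))"
    define G\<theta> where "G\<theta> = (\<lambda>\<psi> b g b'. push_fillers p \<phi> (pull_fillers C (sum_cat I I) v s \<psi> (b, g, b'))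
      (pb2 C b s, sl (pull_func C s) b g b', pb2 C b' s))"
    have qs: "(pf q b, push_arr q b g b', pf q b') \<in> Arr (slice C (Cod C q))"
      "(pb2 C b s, sl (pull_func C s) b g b', pb2 C b' s) \<in> Arr (slice C (Dom C p))"
      "(pb2 C (pf q b) t, Fa b g b', pb2 C (pf q b') t) \<in> Arr (slice C (Cod C p))"
      "(pf p (pb2 C b s), Ga b g b', pf p (pb2 C b' s)) \<in> Arr (slice C (Cod C p))"
      if "(b, g, b') \<in> Arr (slice C (Dom C q))" for b g b'
    proof -
      show 1: "(pf q b, push_arr q b g b', pf q b') \<in> Arr (slice C (Cod C q))"
        by (rule slice_functor(2)[OF fp(2) that])
      show 2: "(pb2 C b s, sl (pull_func C s) b g b', pb2 C b' s) \<in> Arr (slice C (Dom C p))"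
        using slice_functor(2)[OF fp(4) that] unfolding pull_func_simps(1) .
      show "(pb2 C (pf q b) t, Fa b g b', pb2 C (pf q b') t) \<in> Arr (slice C (Cod C p))"
        using slice_functor(2)[OF fp(3) 1] unfolding pull_func_simps(1) Fa_def .
      show "(pf p (pb2 C b s), Ga b g b', pf p (pb2 C b' s)) \<in> Arr (slice C (Cod C p))"
        using slice_functor(2)[OF fp(1) 2] unfolding Ga_def .
    qed
    have FG_ob: "fob ?F ((g, \<psi>), (b, g, b')) = ((Fa b g b', F\<theta> \<psi> b g b'), (pb2 C (pf q b) t, Fa b g b', pb2 C (pf q b') t))"
      "fob ?G ((g, \<psi>), (b, g, b')) = ((Ga b g b', G\<theta> \<psi> b g b'), (pf p (pb2 C b s), Ga b g b', pf p (pb2 C b' s)))"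
      if e: "(b, g, b') \<in> Arr (slice C (Dom C q))" for g \<psi> b b'
      unfolding comp_func_simps PL_def fst_conv snd_conv Fib_pull_over_lift over_lift_ob[OF fp(2) e] over_lift_ob[OF fp(4) e]
        pull_func_simps(1) over_lift_ob[OF fp(3) qs(1)[OF e]] over_lift_ob[OF fp(1) qs(2)[OF e]] Fa_def Ga_def F\<theta>_def G\<theta>_def
      by (rule refl)+
    have tgt: "fo_arr (Fa b g b') (F\<theta> \<psi> b g b') (\<mu> b) (\<mu> b') (Ga b g b') (G\<theta> \<psi> b g b')
        (pb2 C (pf q b) t) (pb2 C (pf q b') t) (pf p (pb2 C b s)) (pf p (pb2 C b' s)) \<in> Arr ?B"
      if g: "fib g \<psi>" and e: "(b, g, b') \<in> Arr (slice C (Dom C q))" for g \<psi> b b'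
    proof -
      note eD = sliceD[OF e]
      show ?thesis
        unfolding fo_arr_iff
        using push_exch[OF pq g e Fa_def[THEN fun_cong, THEN fun_cong, THEN fun_cong]
            F\<theta>_def[THEN fun_cong, THEN fun_cong, THEN fun_cong, THEN fun_cong] refl refl
            Ga_def[THEN fun_cong, THEN fun_cong, THEN fun_cong]
            G\<theta>_def[THEN fun_cong, THEN fun_cong, THEN fun_cong, THEN fun_cong] \<mu>_def[THEN fun_cong]]
          qs(3,4)[OF e] exch_mate(1)[OF sq eD(1,2)] exch_mate(1)[OF sq eD(3,4)]
        unfolding \<mu>_def by blast
    qed
    define tr where "tr = (\<lambda>w. let E = exch_mate_arrow C p q s t (snd w)
      in ((fst (fob ?F w), far (arrow_func (slice_forget C)) E, fst (fob ?G w)), E))"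
    have E: "exch_mate_arrow C p q s t (b, g, b') = ((pb2 C (pf q b) t, Fa b g b', pb2 C (pf q b') t),
        (pb2 C (pf q b) t, \<mu> b, pf p (pb2 C b s)), (pb2 C (pf q b') t, \<mu> b', pf p (pb2 C b' s)),
        (pf p (pb2 C b s), Ga b g b', pf p (pb2 C b' s)))"
      if e: "(b, g, b') \<in> Arr (slice C (Dom C q))" for b g b'
    proof -
      note eD = sliceD[OF e]
      have "far (pull_func C t \<circ>\<^sub>F push_func C q) (b, g, b') = (pb2 C (pf q b) t, Fa b g b', pb2 C (pf q b') t)"
        using slice_functor(1)[OF fp(2) e] slice_functor(1)[OF fp(3) qs(1)[OF e]]
        unfolding comp_func_simps pull_func_simps(1) Fa_def by metis
      moreover have "far (push_func C p \<circ>\<^sub>F pull_func C s) (b, g, b') = (pf p (pb2 C b s), Ga b g b', pf p (pb2 C b' s))"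
        using slice_functor(1)[OF fp(4) e] slice_functor(1)[OF fp(1) qs(2)[OF e]]
        unfolding comp_func_simps pull_func_simps(1) Ga_def by metis
      ultimately show ?thesis
        using exch_mate(2)[OF sq eD(1,2)] exch_mate(2)[OF sq eD(3,4)]
        unfolding exch_mate_arrow_def arrow_nat_def slice_simps(3,4) \<mu>_def by metis
    qed
    have tr: "tr ((g, \<psi>), (b, g, b')) = fo_arr (Fa b g b') (F\<theta> \<psi> b g b') (\<mu> b) (\<mu> b') (Ga b g b') (G\<theta> \<psi> b g b')
        (pb2 C (pf q b) t) (pb2 C (pf q b') t) (pf p (pb2 C b s)) (pf p (pb2 C b' s))"
      if e: "(b, g, b') \<in> Arr (slice C (Dom C q))" for g \<psi> b b'
      unfolding tr_def Let_def snd_conv E[OF e] FG_ob[OF e] fo_arr_def by (simp add: arrow_func_def)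
    have nat: "nat_trans ?A ?B ?F ?G tr"
      unfolding nat_trans_def
    proof (intro conjI ballI)
      fix w assume "w \<in> Obj ?A"
      then obtain g \<psi> b b' where w: "w = ((g, \<psi>), (b, g, b'))" "fib g \<psi>" "(b, g, b') \<in> Arr (slice C (Dom C q))"
        by (rule fo_obj_cases)
      show "tr w \<in> hom ?B (fob ?F w) (fob ?G w)"
        unfolding w(1) tr[OF w(3)] FG_ob[OF w(3)] hom_def mem_Collect_eq fo_simps using tgt[OF w(2,3)] by blast
    next
      fix T assume T: "T \<in> Arr ?A"
      obtain f \<psi>1 a a' g \<psi>2 b b' d d' where t: "T = fo_arr f \<psi>1 a a' g \<psi>2 b b' d d'" using T by (rule fo_arr_cases)
      note T' = T[unfolded t]
      have r: "fib_mor f \<psi>1 a a' g \<psi>2" "(b, f, b') \<in> Arr (slice C (Dom C q))" "(d, g, d') \<in> Arr (slice C (Dom C q))"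
        "(b, a, d) \<in> Arr (slice C (Dom C q))" "(b', a', d') \<in> Arr (slice C (Dom C q))"
        using T' unfolding fo_arr_iff by blast+
      have FT: "far ?F T = fo_arr (Fa b f b') (F\<theta> \<psi>1 b f b') (Fa b a d) (Fa b' a' d') (Fa d g d') (F\<theta> \<psi>2 d g d')
        (pb2 C (pf q b) t) (pb2 C (pf q b') t) (pb2 C (pf q d) t) (pb2 C (pf q d') t)"
        unfolding t comp_func_simps PL_def fst_conv snd_conv over_lift_arr[OF fp(2) r(2-5)] Fib_pull_over_lift
          over_lift_arr[OF fp(3) qs(1)[OF r(2)] qs(1)[OF r(3)] qs(1)[OF r(4)] qs(1)[OF r(5)]]
          pull_func_simps(1) Fa_def F\<theta>_def ..
      have GT: "far ?G T = fo_arr (Ga b f b') (G\<theta> \<psi>1 b f b') (Ga b a d) (Ga b' a' d') (Ga d g d') (G\<theta> \<psi>2 d g d')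
        (pf p (pb2 C b s)) (pf p (pb2 C b' s)) (pf p (pb2 C d s)) (pf p (pb2 C d' s))"
        unfolding t comp_func_simps PL_def fst_conv snd_conv over_lift_arr[OF fp(4) r(2-5)] Fib_pull_over_lift
          pull_func_simps(1) over_lift_arr[OF fp(1) qs(2)[OF r(2)] qs(2)[OF r(3)] qs(2)[OF r(4)] qs(2)[OF r(5)]]
          Ga_def G\<theta>_def ..
      have "\<mu> d \<cdot> Fa b a d = Ga b a d \<cdot> \<mu> b" "\<mu> d' \<cdot> Fa b' a' d' = Ga b' a' d' \<cdot> \<mu> b'"
        unfolding \<mu>_def Fa_def Ga_def by (rule exch_mate_natural[OF sq r(4)], rule exch_mate_natural[OF sq r(5)])
      then show "tr (Cod ?A T) \<cdot>\<^bsub>?B\<^esub> far ?F T = far ?G T \<cdot>\<^bsub>?B\<^esub> tr (Dom ?A T)"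
        unfolding FT GT unfolding t fo_simps tr[OF r(2)] tr[OF r(3)] by simp
    qed
    have over: "snd (tr w) = exch_mate_arrow C p q s t (snd w)" for w
      by (simp add: tr_def Let_def)
    have "nat_iso ?A ?B ?F ?G tr" if pull: "is_pullback C t q p s"
      unfolding nat_iso_def
    proof (intro conjI ballI)
      fix w assume "w \<in> Obj ?A"
      then obtain g \<psi> b b' where w: "w = ((g, \<psi>), (b, g, b'))" "fib g \<psi>" "(b, g, b') \<in> Arr (slice C (Dom C q))"
        by (rule fo_obj_cases)
      note eD = sliceD[OF w(3)]
      have "is_iso (slice C (Cod C p)) (pb2 C (pf q c) t, \<mu> c, pf p (pb2 C c s))" if "c \<in> Arr C" "Cod C c = Dom C q" for c
        using exch_mate(3)[OF sq that pull] exch_mate(2)[OF sq that] unfolding \<mu>_def by metis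
      then show "is_iso ?B (tr w)"
        unfolding w(1) tr[OF w(3)] using eD by (intro is_iso_fo_arr tgt w(2,3)) simp_all
    qed (rule nat)
    then show ?thesis using nat over by blast
  qed
  note exch = this
  show ?thesis
  proof (rule exI[of _ PL], intro conjI ballI, goal_cases)
    case (1 x)
    then have "fib (fst x) (snd x)" by (simp add: Fib_def)
    from lift[OF this] show ?case by (simp add: Let_def)
  next
    case (2 z)
    obtain x p s t q y where e: "z = (x, (p, s, t, q), y)" by (cases z) auto
    obtain p' \<phi> q' \<chi> where xy: "x = (p', \<phi>)" "y = (q', \<chi>)" by (cases x; cases y)
    have pq: "p = p'" "q = q'"
      using 2 unfolding Fib_def e xy right_maps_arr by blast+
    have mor: "fib_mor p \<phi> s t q \<chi>"
      using 2 unfolding Fib_def e xy pq .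
    have xy': "x = (p, \<phi>)" "y = (q, \<chi>)" using xy pq by simp_all
    show ?case
      using exch[OF mor] unfolding e xy' prod.case Let_def snd_func_simps .
  qed
qed

end


section \<open>Uniform fibrations are closed under pushforward along uniform fibrations\<close>

lemma infinite_universe:
  fixes \<kappa> :: "'u rel"
  assumes "Card_order \<kappa>" "cinfinite \<kappa>" "\<kappa> <o |UNIV :: 'u set|"
  shows "infinite (UNIV :: 'u set)"
  using assms(2) finite_subset[of "Field \<kappa>" UNIV] by (auto simp: cinfinite_def)

theorem corollary7p9:
  fixes C :: "('o, 'm) cat"
    and K :: "('o, 'm, 'o, 'm) func"
    and \<delta> c :: "nat \<Rightarrow> 'o \<Rightarrow> 'm"
    and \<epsilon> :: "'o \<Rightarrow> 'm"
    and W :: "('o, 'm) awfs_data"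
    and I :: "('i, 'j) cat"
    and u :: "('i, 'j, 'm, 'm sq) func"
  assumes "locally_presentable TYPE('u) C"
    and "locally_cartesian_closed C"
    and "functorial_cylinder C K \<delta>"
    and "has_contractions C K \<delta> \<epsilon>"
    and "has_connections C K \<delta> \<epsilon> c"
    and "has_right_adjoint C C K"
    and "awfs C W"
    and "suitable TYPE('u) C K \<delta> W"
    and "cofibrantly_generated_by TYPE('u) C W I u"
  shows "\<exists>push_lift.
    (\<forall>x \<in> Obj (Fib C K \<delta> I u). let p = fst x in
       lifts_functor (Fib_over C K \<delta> I u (Dom C p)) (Fib_over C K \<delta> I u (Cod C p))
         snd_func snd_func (arrow_func (push_func C p)) (push_lift x)) \<and>
    (\<forall>(x, (p, s, t, q), y) \<in> Arr (Fib C K \<delta> I u).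
       \<exists>\<psi>. let A = Fib_over C K \<delta> I u (Dom C q); B = Fib_over C K \<delta> I u (Cod C p);
               F = Fib_pull C K \<delta> I u t \<circ>\<^sub>F push_lift y;
               G = push_lift x \<circ>\<^sub>F Fib_pull C K \<delta> I u s in
         nat_trans A B F G \<psi> \<and>
         (\<forall>w \<in> Obj A. far snd_func (\<psi> w) = exch_mate_arrow C p q s t (fob snd_func w)) \<and>
         (is_pullback C t q p s \<longrightarrow> nat_iso A B F G \<psi>))"
proof -
  have C: "category C" and coc: "cocomplete TYPE('u) C"
    using assms(1) by (auto simp: locally_presentable_def)
  interpret C: category C by (rule C)
  have inf: "infinite (UNIV :: 'u set)"
    using assms(1) infinite_universe by (auto simp: locally_presentable_def)
  obtain \<Lambda> where \<Lambda>: "adjunction C C \<Lambda>" and K: "K = ladj \<Lambda>"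
    using assms(6) by (auto simp: has_right_adjoint_def)
  have I: "category I" and u: "is_functor I (arrow_cat C) u"
    and iso: "iso_over (RMap C W) (right_maps C I u) forget forget"
    using assms(9) by (auto simp: cofibrantly_generated_by_def small_category_def)
  interpret I: category I by (rule I)
  interpret aw: awfs_category C W
    using assms(7) by unfold_locales
  obtain U where U: "is_functor I (Lmap C W) U" "eq_func I (forget \<circ>\<^sub>F U) (u \<circ>\<^sub>F id_func)"
    using aw.generators_coalgebras[OF I u iso] by (auto simp: lifts_functor_def)
  obtain R G where R: "is_functor (RMap C W) (right_maps C I u) R" "is_functor (right_maps C I u) (RMap C W) G"
      "eq_func (right_maps C I u) (R \<circ>\<^sub>F G) id_func" "eq_func (RMap C W) (forget \<circ>\<^sub>F R) forget"
    using iso by (auto simp: iso_over_def)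
  have G: "eq_func (right_maps C I u) (forget \<circ>\<^sub>F G) forget"
  proof -
    have "fst (fob G x) = fst x" if x: "x \<in> Obj (right_maps C I u)" for x
    proof -
      have "fob R (fob G x) = x"
        using R(3) x by (simp add: eq_func_def)
      moreover have "fst (fob R (fob G x)) = fst (fob G x)"
        using R(4) functorD(1)[OF R(2) x] by (simp add: eq_func_def)
      ultimately show ?thesis by simp
    qed
    moreover have "far forget (far G x) = far forget x" if x: "x \<in> Arr (right_maps C I u)" for x
    proof -
      have "far R (far G x) = x"
        using R(3) x by (simp add: eq_func_def)
      moreover have "far forget (far R (far G x)) = far forget (far G x)"
        using R(4) functorD(2)[OF R(2) x] by (simp add: eq_func_def)
      ultimately show ?thesis by simp
    qed
    ultimately show ?thesis by (simp add: eq_func_def)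
  qed
  obtain Z where Z: "lifts_functor C (Lmap C W) id_func forget (init_func C) Z"
    using assms(8) by (auto simp: suitable_def)
  obtain P where P: "lifts_functor (fibre_prod (Lmap C W) (arrow_cat C) (cod_func C \<circ>\<^sub>F forget) (cod_func C)) (Lmap C W)
      (prod_func forget id_func) forget (pull_bifunc C) P"
    using assms(8) by (auto simp: suitable_def)
  have "\<forall>k. \<exists>L. endpoint k \<longrightarrow> lifts_functor (Lmap C W) (Lmap C W) forget forget (leibniz C K (\<delta> k)) L"
    using assms(8) by (auto simp: suitable_def endpoint_def)
  then obtain L where L: "\<And>k. endpoint k \<Longrightarrow> lifts_functor (Lmap C W) (Lmap C W) forget forget (leibniz C K (\<delta> k)) (L k)"
    by metis
  have M: "lifts_functor I (Lmap C W) id_func forget (leibniz C K (\<delta> k) \<circ>\<^sub>F u) (L k \<circ>\<^sub>F U)" if "endpoint k" for k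
    using L[OF that] U functorD(1,2)[OF U(1)] is_functor_comp[OF U(1), of "Lmap C W" "L k"]
    by (simp add: lifts_functor_def eq_func_def)
  interpret frobenius_category C \<Lambda> \<delta> I u W G \<epsilon> c "\<lambda>k. L k \<circ>\<^sub>F U" Z P
  proof
    show "\<exists>p q. is_pullback C f g p q" if "f \<in> Arr C" "g \<in> Arr C" "Cod C f = Cod C g" for f g
      using assms(2) that by (auto simp: locally_cartesian_closed_def)
    show "is_push_adj C p (push_adj C p)" if "p \<in> Arr C" for p
      using assms(2) that unfolding push_adj_def locally_cartesian_closed_def by (metis someI_ex)
    show "\<exists>p q. is_pushout C f g p q" if "f \<in> Arr C" "g \<in> Arr C" "Dom C f = Dom C g" for f g
      using C.pushout_from_cocomplete[OF coc inf that] .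
    show "\<exists>z. initial C z" using C.initial_from_cocomplete[OF coc inf] .
    show "adjunction C C \<Lambda>" by (fact \<Lambda>)
    show "is_functor I (arrow_cat C) u" by (fact u)
    show "is_functor (right_maps C I u) (RMap C W) G" by (fact R(2))
    show "eq_func (right_maps C I u) (forget \<circ>\<^sub>F G) forget" by (fact G)
    show "lifts_functor C (Lmap C W) id_func forget (init_func C) Z"
      "lifts_functor (fibre_prod (Lmap C W) (arrow_cat C) (cod_func C \<circ>\<^sub>F forget) (cod_func C)) (Lmap C W)
        (prod_func forget id_func) forget (pull_bifunc C) P"
      by (fact Z P)+
    show "nat_trans C C (ladj \<Lambda>) id_func \<epsilon>"
      using assms(4) unfolding K has_contractions_def by blast
    fix k assume k: "endpoint k"
    show "nat_trans C C id_func (ladj \<Lambda>) (\<delta> k)"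
      using assms(3) k unfolding K functorial_cylinder_def endpoint_def by blast
    show "lifts_functor I (Lmap C W) id_func forget (leibniz C (ladj \<Lambda>) (\<delta> k) \<circ>\<^sub>F u) (L k \<circ>\<^sub>F U)"
      using M[OF k] unfolding K .
    show "nat_trans C C (ladj \<Lambda> \<circ>\<^sub>F ladj \<Lambda>) (ladj \<Lambda>) (c k)"
      using assms(5) k unfolding K has_connections_def endpoint_def by blast
    fix X assume X: "X \<in> Obj C"
    show "\<epsilon> X \<cdot>\<^bsub>C\<^esub> \<delta> k X = Id C X"
      using assms(4) k X unfolding K has_contractions_def endpoint_def by blast
    show "c k X \<cdot>\<^bsub>C\<^esub> \<delta> k (fob (ladj \<Lambda>) X) = \<delta> k X \<cdot>\<^bsub>C\<^esub> \<epsilon> X"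
      "c k X \<cdot>\<^bsub>C\<^esub> far (ladj \<Lambda>) (\<delta> k X) = \<delta> k X \<cdot>\<^bsub>C\<^esub> \<epsilon> X"
      "c k X \<cdot>\<^bsub>C\<^esub> \<delta> (opp k) (fob (ladj \<Lambda>) X) = Id C (fob (ladj \<Lambda>) X)"
      using assms(5) k X unfolding K has_connections_def endpoint_def opp_def by blast+
  qed
  show ?thesis
    using pushforward_lifts unfolding K .
qed


end
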